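(* Let $\gamma\in(0,1)$. Let $u:[0,\infty)\to(0,\infty)$ be strictly positive, non-increasing and continuous, such that $\phi(x)=x\,u(x)$ is non-decreasing and bounded. Assume further that: (i) $\phi_\infty:=\lim_{x\to\infty}\phi(x)>1$; (ii) there is a unique $d_0$ such that $\phi(d_0)=1$ (that is, $\phi$ is strictly increasing at $\phi^{-1}(1):=d_0$), and moreover the inverse map $\phi^{-1}$ is locally Lipschitz at $1$; (iii) $u$ is locally Lipschitz at $\phi^{-1}(1)$. Then there are constants $c,C,\epsilon_0>0$, depending on the distribution of $Y$ (in the sense of the context) and on $\gamma$, such that the following holds for all $n,p$ with $p/n=\gamma$, every strictly positive definite $\Sigma_p\in\mathbb{R}^{p\times p}$ and every $0<\epsilon<\epsilon_0$. Let $\mathbf{x}_i=\Sigma_p^{1/2}\mathbf{y}_i$, $1\le i\le n$, with $\mathbf{y}_1,\dots,\mathbf{y}_n$ i.i.d. copies of $Y$, and let $\mathcal{E}_{ME}(\epsilon)$ be the event that the equation $$\hat\Sigma=\frac1n\sum_{i=1}^n w_i\,\mathbf{x}_i\mathbf{x}_i^\top,\qquad w_i=u\Big(\frac1p\mathbf{x}_i^\top\hat\Sigma^{-1}\mathbf{x}_i\Big)$$ has a unique solution $\hat\Sigma$ and that its weights satisfy $\max_{1\le i\le n}|w_i-1/\phi^{-1}(1)|\le\epsilon$. - If $Y$ satisfies (LC), then $\Pr(\mathcal{E}_{ME}(\epsilon)^c)\le Cn^2e^{-c(\Psi_p\sqrt n)\epsilon}$. - If $Y$ satisfies either (IND) or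 (CCP-SBP), then $\Pr(\mathcal{E}_{ME}(\epsilon)^c)\le Cn^2e^{-cn\epsilon^2}$.
   Context: $Y$ is a random vector in $\mathbb{R}^p$ having a density, with $\mathbb{E}[Y]=0$ and $\mathbb{E}[YY^\top]=I_{p}$ (isotropic). $\|\cdot\|$ is the Euclidean norm. (IND): the coordinates $Y_1,\dots,Y_p$ are independent, each sub-Gaussian with constant $K>0$, i.e. $\Pr(|Y_j-\mathbb{E}Y_j|\ge t)\le 2\exp(-(t/(2K))^2)$ for $t\ge 0$, and each has a density bounded by $C_0>0$. (CCP-SBP): $Y$ satisfies the convex concentration property with constant $K>0$: for every $1$-Lipschitz convex $f:\mathbb{R}^p\to\mathbb{R}$ and $t\ge0$, $\Pr(|f(Y)-\mathbb{E}f(Y)|\ge t)\le 2\exp(-(t/(2K))^2)$; and the small ball property with constant $C_0>0$: for every $v\in\mathbb{R}^p$ with $\|v\|=1$, $a\in\mathbb{R}$ and $t\ge0$, $\Pr(|v^\top Y-a|\le t)\le C_0t$. (LC): $Y$ is log-concave, i.e. has a density $e^{-V}$ with $V:\mathbb{R}^p\to\mathbb{R}\cup\{\infty\}$ convex. A constant "depends on the distribution of $Y$" means that it may depend on the parameters $K,C_0$ when $Y$ satisfies (IND) or (CCP-SBP) (and is otherwise independent of $Y$); such constants do not depend on $n,p,\Sigma_p$. $\Psi_p$ denotes, up to a universal constant, the Cheeger constant of the family of isotropic log-concave distributions on $\mathbb{R}^p$. Concretely, $(\Psi_p)$ is a fixed sequence in $(0,1]$, with $\Psi_p\ge(\log p)^{-5}$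 for $p\ge3$, such that for a universal $c_0>0$, every isotropic log-concave $Z$ in $\mathbb{R}^p$, every $1$-Lipschitz $f:\mathbb{R}^p\to\mathbb{R}$ and every $t\ge0$, $\Pr(|f(Z)-\mathbb{E}f(Z)|\ge t)\le\exp(-c_0\Psi_pt)$. Solutions $\hat\Sigma$ are positive definite $p\times p$ matrices (Maronna's M-estimator).
   Formalization: The concentration inequality characterizing Ψ_p is taken as Pr(|f(Z)-E f(Z)| ≥ t) ≤ 2exp(-c_0 Ψ_p t); with prefactor 1 instead of 2 no such sequence exists (it fails for a Gaussian Z and f(z)=max(0,z_1-a) with a large). *)

theory Defs
  imports
    "HOL-Probability.Probability"
    "Jordan_Normal_Form.Gauss_Jordan_Elimination"
begin

hide_const (open) Finite_Cartesian_Product.vec Finite_Cartesian_Product.mat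
no_notation Finite_Cartesian_Product.vec_nth (infixl \<open>$\<close> 90)

text \<open>
  The dimension has to vary inside the statement (the constants are uniform in it), so the space
  of \<open>p\<close>-dimensional vectors is \<open>carrier_vec p\<close>, on which Lebesgue measure is transported from the
  product measure on extensional functions.
\<close>

definition lborel_vec :: "nat \<Rightarrow> real vec measure" where
  "lborel_vec p = embed_measure (\<Pi>\<^sub>M j\<in>{..<p}. (lborel :: real measure)) (Matrix.vec p)"

lemma inj_on_vec_PiE: "inj_on (Matrix.vec p) (\<Pi>\<^sub>E j\<in>{..<p}. A j)"
proof (rule inj_onI)
  fix x y assume x: "x \<in> (\<Pi>\<^sub>E j\<in>{..<p}. A j)" and y: "y \<in> (\<Pi>\<^sub>E j\<in>{..<p}. A j)"
    and eq: "Matrix.vec p x = Matrix.vec p y"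
  have "x j = y j" if "j < p" for j
    using arg_cong[OF eq, of "\<lambda>v. vec_index v j"] that by simp
  with x y show "x = y" by (intro PiE_ext) auto
qed

lemma space_lborel_vec: "space (lborel_vec p) = carrier_vec p"
proof -
  have "v \<in> Matrix.vec p ` (\<Pi>\<^sub>E j\<in>{..<p}. UNIV)" if "v \<in> carrier_vec p" for v :: "real vec"
    using that by (intro image_eqI[where x = "\<lambda>j\<in>{..<p}. vec_index v j"] eq_vecI) auto
  then show ?thesis
    by (auto simp: lborel_vec_def space_embed_measure space_PiM)
qed

definition eucl_norm :: "real vec \<Rightarrow> real" where
  "eucl_norm v = sqrt (v \<bullet> v)"

definition lipschitz1_vec :: "nat \<Rightarrow> (real vec \<Rightarrow> real) \<Rightarrow> bool" where
  "lipschitz1_vec p f \<longleftrightarrow>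
     (\<forall>x \<in> carrier_vec p. \<forall>y \<in> carrier_vec p. \<bar>f x - f y\<bar> \<le> eucl_norm (x - y))"

definition convex_vec :: "nat \<Rightarrow> (real vec \<Rightarrow> real) \<Rightarrow> bool" where
  "convex_vec p f \<longleftrightarrow>
     (\<forall>x \<in> carrier_vec p. \<forall>y \<in> carrier_vec p. \<forall>s \<in> {0..1}.
        f (s \<cdot>\<^sub>v x + (1 - s) \<cdot>\<^sub>v y) \<le> s * f x + (1 - s) * f y)"


text \<open>
  All assumptions on the random vector concern its law \<open>\<mu>\<close> only; the vector itself is then the
  identity on the probability space \<open>\<mu>\<close>, with coordinates \<open>\<lambda>y. vec_index y j\<close>.
\<close>

definition law_with_density :: "nat \<Rightarrow> real vec measure \<Rightarrow> bool" where
  "law_with_density p \<mu> \<longleftrightarrow> prob_space \<mu> \<and>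
     (\<exists>f \<in> borel_measurable (lborel_vec p). \<mu> = density (lborel_vec p) f)"

definition isotropic :: "nat \<Rightarrow> real vec measure \<Rightarrow> bool" where
  "isotropic p \<mu> \<longleftrightarrow>
     (\<forall>j<p. integrable \<mu> (\<lambda>y. vec_index y j) \<and> (\<integral>y. vec_index y j \<partial>\<mu>) = 0) \<and>
     (\<forall>j<p. \<forall>k<p. integrable \<mu> (\<lambda>y. vec_index y j * vec_index y k) \<and>
        (\<integral>y. vec_index y j * vec_index y k \<partial>\<mu>) = (if j = k then 1 else 0))"

definition IND :: "nat \<Rightarrow> real \<Rightarrow> real \<Rightarrow> real vec measure \<Rightarrow> bool" where
  "IND p K C\<^sub>0 \<mu> \<longleftrightarrow>
     prob_space.indep_vars \<mu> (\<lambda>_. borel) (\<lambda>j y. vec_index y j) {..<p} \<and>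
     (\<forall>j<p. \<forall>t\<ge>0.
        measure \<mu> {y \<in> space \<mu>. \<bar>vec_index y j - (\<integral>z. vec_index z j \<partial>\<mu>)\<bar> \<ge> t}
          \<le> 2 * exp (- (t / (2 * K))\<^sup>2)) \<and>
     (\<forall>j<p. \<exists>f. distributed \<mu> lborel (\<lambda>y. vec_index y j) f \<and> (\<forall>x. f x \<le> ennreal C\<^sub>0))"

definition CCP :: "nat \<Rightarrow> real \<Rightarrow> real vec measure \<Rightarrow> bool" where
  "CCP p K \<mu> \<longleftrightarrow>
     (\<forall>f t. lipschitz1_vec p f \<longrightarrow> convex_vec p f \<longrightarrow> t \<ge> 0 \<longrightarrow>
        measure \<mu> {y \<in> space \<mu>. \<bar>f y - (\<integral>z. f z \<partial>\<mu>)\<bar> \<ge> t} \<le> 2 * exp (- (t / (2 * K))\<^sup>2))"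

definition SBP :: "nat \<Rightarrow> real \<Rightarrow> real vec measure \<Rightarrow> bool" where
  "SBP p C\<^sub>0 \<mu> \<longleftrightarrow>
     (\<forall>v \<in> carrier_vec p. \<forall>a t. eucl_norm v = 1 \<longrightarrow> t \<ge> 0 \<longrightarrow>
        measure \<mu> {y \<in> space \<mu>. \<bar>v \<bullet> y - a\<bar> \<le> t} \<le> C\<^sub>0 * t)"

text \<open>
  The value \<open>-\<infinity>\<close> is excluded, so the extended-real arithmetic below is the usual one
  (with \<open>0 * \<infinity> = 0\<close> the cases \<open>s = 0\<close> and \<open>s = 1\<close> are harmless). Measurability of the density is
  explicit because a convex \<open>V\<close> may fail to be Borel on the boundary of its effective domain;
  this excludes no distribution, since that boundary is a null set.
\<close>

definition exp_minus :: "ereal \<Rightarrow> ennreal" where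
  "exp_minus v = (if v = \<infinity> then 0 else ennreal (exp (- real_of_ereal v)))"

definition log_concave :: "nat \<Rightarrow> real vec measure \<Rightarrow> bool" where
  "log_concave p \<mu> \<longleftrightarrow>
     (\<exists>V :: real vec \<Rightarrow> ereal.
        (\<forall>x \<in> carrier_vec p. V x \<noteq> -\<infinity>) \<and>
        (\<forall>x \<in> carrier_vec p. \<forall>y \<in> carrier_vec p. \<forall>s \<in> {0..1}.
           V (s \<cdot>\<^sub>v x + (1 - s) \<cdot>\<^sub>v y) \<le> ereal s * V x + ereal (1 - s) * V y) \<and>
        (\<lambda>x. exp_minus (V x)) \<in> borel_measurable (lborel_vec p) \<and>
        \<mu> = density (lborel_vec p) (\<lambda>x. exp_minus (V x)))"

text \<open>
  The factor \<open>2\<close> in the concentration inequality is essential: with prefactor \<open>1\<close> no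
  \<open>\<Psi> p > 0\<close> would do, as shown by a standard Gaussian \<open>Z\<close>, \<open>f z = max 0 (z\<^sub>1 - a)\<close>,
  \<open>t = E f(Z)\<close> and \<open>a \<rightarrow> \<infinity>\<close>. As an assumption, the version with \<open>2\<close> is the weaker one.
\<close>

definition lc_concentration :: "real \<Rightarrow> (nat \<Rightarrow> real) \<Rightarrow> bool" where
  "lc_concentration c\<^sub>0 \<Psi> \<longleftrightarrow>
     c\<^sub>0 > 0 \<and> (\<forall>p\<ge>1. 0 < \<Psi> p \<and> \<Psi> p \<le> 1) \<and> (\<forall>p\<ge>3. \<Psi> p \<ge> ln (real p) powr (-5)) \<and>
     (\<forall>p \<mu> f t. p \<ge> 1 \<longrightarrow> law_with_density p \<mu> \<longrightarrow> isotropic p \<mu> \<longrightarrow> log_concave p \<mu> \<longrightarrow>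
        lipschitz1_vec p f \<longrightarrow> t \<ge> 0 \<longrightarrow>
        measure \<mu> {y \<in> space \<mu>. \<bar>f y - (\<integral>z. f z \<partial>\<mu>)\<bar> \<ge> t} \<le> 2 * exp (- c\<^sub>0 * \<Psi> p * t))"


definition pos_def_mat :: "nat \<Rightarrow> real mat \<Rightarrow> bool" where
  "pos_def_mat p A \<longleftrightarrow> A \<in> carrier_mat p p \<and> A\<^sup>T = A \<and>
     (\<forall>v \<in> carrier_vec p. v \<noteq> 0\<^sub>v p \<longrightarrow> v \<bullet> (A *\<^sub>v v) > 0)"

definition mat_sqrt :: "nat \<Rightarrow> real mat \<Rightarrow> real mat" where
  "mat_sqrt p A = (THE B. pos_def_mat p B \<and> B * B = A)"

definition maronna_weight ::
    "(real \<Rightarrow> real) \<Rightarrow> nat \<Rightarrow> (nat \<Rightarrow> real vec) \<Rightarrow> real mat \<Rightarrow> nat \<Rightarrow> real" where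
  "maronna_weight u p x S i = u (1 / real p * (x i \<bullet> (the (mat_inverse S) *\<^sub>v x i)))"

definition maronna_solution ::
    "(real \<Rightarrow> real) \<Rightarrow> nat \<Rightarrow> nat \<Rightarrow> (nat \<Rightarrow> real vec) \<Rightarrow> real mat \<Rightarrow> bool" where
  "maronna_solution u n p x S \<longleftrightarrow> pos_def_mat p S \<and>
     S = (1 / real n) \<cdot>\<^sub>m Matrix.mat p p (\<lambda>(j, k).
           \<Sum>i<n. maronna_weight u p x S i * (vec_index (x i) j * vec_index (x i) k))"

text \<open>Samples are points of the \<open>n\<close>-fold product of the law, \<open>w\<close> is the target weight.\<close>

definition E_ME :: "(real \<Rightarrow> real) \<Rightarrow> real \<Rightarrow> nat \<Rightarrow> nat \<Rightarrow> real vec measure \<Rightarrow> real mat \<Rightarrow> real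
    \<Rightarrow> (nat \<Rightarrow> real vec) set" where
  "E_ME u w n p \<mu> \<Sigma> \<epsilon> =
     {y \<in> space (\<Pi>\<^sub>M i\<in>{..<n}. \<mu>).
        let x = (\<lambda>i. mat_sqrt p \<Sigma> *\<^sub>v y i) in
        (\<exists>!S. maronna_solution u n p x S) \<and>
        (\<forall>S. maronna_solution u n p x S \<longrightarrow> (\<forall>i<n. \<bar>maronna_weight u p x S i - w\<bar> \<le> \<epsilon>))}"

text \<open>
  The failure probability is an outer probability, which for measurable events is the
  probability itself. (Plain \<open>measure\<close> would be \<open>0\<close> on non-measurable sets.)
\<close>

definition prob_not_E_ME :: "(real \<Rightarrow> real) \<Rightarrow> real \<Rightarrow> nat \<Rightarrow> nat \<Rightarrow> real vec measure \<Rightarrow> real mat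
    \<Rightarrow> real \<Rightarrow> ennreal" where
  "prob_not_E_ME u w n p \<mu> \<Sigma> \<epsilon> =
     outer_measure_of (\<Pi>\<^sub>M i\<in>{..<n}. \<mu>) (space (\<Pi>\<^sub>M i\<in>{..<n}. \<mu>) - E_ME u w n p \<mu> \<Sigma> \<epsilon>)"

end

theory Submission
  imports Defs "Jordan_Normal_Form.Determinant" "HOL-Real_Asymp.Real_Asymp"
begin

text \<open>
  Substituting \<open>x\<^sub>i = \<Sigma>\<^sup>1\<^sup>/\<^sup>2 y\<^sub>i\<close>, everything depends on the leverages
  \<open>h\<^sub>i = y\<^sub>i\<^sup>T (\<Sum>\<^sub>j y\<^sub>j y\<^sub>j\<^sup>T)\<^sup>-\<^sup>1 y\<^sub>i\<close>, which do not see \<open>\<Sigma>\<close>. If all of them lie in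
  \<open>\<gamma> (1 \<plusminus> \<eta>)\<close> and \<open>\<phi> r\<^sub>1 = 1 - \<eta>\<close>, \<open>\<phi> r\<^sub>2 = 1 + \<eta>\<close>, the monotone map on weights given by the
  equation preserves the box \<open>[u r\<^sub>2, u r\<^sub>1]\<^sup>n\<close> and so has a fixed point there; comparing two
  solutions through the largest ratio of their weights gives uniqueness, and the Lipschitz
  hypothesis turns \<open>\<eta>\<close> into a multiple of \<open>\<epsilon>\<close>.

  By Sherman--Morrison \<open>h\<^sub>i = q\<^sub>i / (1 + q\<^sub>i)\<close>, where \<open>q\<^sub>i\<close> is the quadratic form of the inverse Gram
  matrix without row \<open>i\<close>, evaluated at the independent vector \<open>y\<^sub>i\<close>. Quadratic forms concentrate at
  the trace, hence all leverages are close to one common number, which is \<open>\<gamma>\<close> because they sum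
  to \<open>p\<close>. This needs the smallest eigenvalue of the Gram matrix to be of order \<open>n\<close>; that follows
  from a barrier argument in which every row, with probability bounded below by anti-concentration
  of linear forms, allows the spectrum to be shifted by a fixed amount without increasing the trace
  of the inverse.

  Concentration of quadratic forms comes from concentration of the convex Lipschitz function
  \<open>y \<mapsto> (y\<^sup>T M y)\<^sup>1\<^sup>/\<^sup>2\<close> or, for independent coordinates, from decoupling and exponential moments.
\<close>

text \<open>The ratio \<gamma> is only assumed to be below 1, so a crude net argument for the
  smallest eigenvalue, which wants many more rows than columns, does not suffice. The trace of the
  inverse is the potential instead: it controls the smallest eigenvalue, it is the number around
  which the quadratic forms concentrate, and adding a row changes it by an explicit amount. A ridge
  term of order n makes a trace bound available before any eigenvalue bound is known; the rows held
  back for the barrier argument repay the ridge. Leave-one-out is applied for every row and again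
  inside the subsample belonging to it, and these two union bounds produce the factor
  \<open>n\<^sup>2\<close>.

  A form of size p is the square of a variable of size \<open>sqrt p\<close>, so relative accuracy
  \<epsilon> of the form means accuracy of order \<epsilon> times \<open>sqrt p\<close> for the
  root. A Gaussian tail of the root then gives the exponent \<open>n * \<epsilon>\<^sup>2\<close>,
  an exponential tail with rate \<open>\<Psi> p\<close> gives
  \<open>\<Psi> p * sqrt n * \<epsilon>\<close>. Where n or \<epsilon> is too small for the
  estimates to work, C is large enough to make the claimed bound exceed 1.\<close>

no_notation inner (infix \<open>\<bullet>\<close> 70)

section \<open>Positive definite matrices\<close>

definition psd_mat :: "nat \<Rightarrow> real mat \<Rightarrow> bool" where
  "psd_mat p A \<longleftrightarrow> A \<in> carrier_mat p p \<and> A\<^sup>T = A \<and> (\<forall>v \<in> carrier_vec p. 0 \<le> v \<bullet> (A *\<^sub>v v))"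

definition mtrace :: "real mat \<Rightarrow> real" where
  "mtrace A = (\<Sum>j<dim_row A. A $$ (j, j))"

text \<open>For symmetric \<open>A\<close> this is the trace of the square of \<open>A\<close>. When
  \<open>A\<close> is the inverse of some \<open>D\<close>, it is the rate at which the trace of the
  inverse grows as the spectrum of \<open>D\<close> is shifted down, hence the cost of a barrier
  step.\<close>

definition frob2 :: "real mat \<Rightarrow> real" where
  "frob2 A = (\<Sum>j<dim_row A. row A j \<bullet> row A j)"

text \<open>The adjugate formula is total and rational in the entries, so the inverse of a random
  matrix is measurable entry by entry. Agreement with \<open>mat_inverse\<close> is shown below for
  positive definite matrices.\<close>

definition inv_mat :: "real mat \<Rightarrow> real mat" where
  "inv_mat A = (1 / det A) \<cdot>\<^sub>m adj_mat A"

definition outer :: "real vec \<Rightarrow> real mat" where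
  "outer y = Matrix.mat (dim_vec y) (dim_vec y) (\<lambda>(j, k). y $ j * y $ k)"

section \<open>Quadratic forms and Cauchy--Schwarz\<close>

lemma pos_def_matD:
  assumes "pos_def_mat p A"
  shows "A \<in> carrier_mat p p" "A\<^sup>T = A"
    and "\<And>v. v \<in> carrier_vec p \<Longrightarrow> v \<noteq> 0\<^sub>v p \<Longrightarrow> 0 < v \<bullet> (A *\<^sub>v v)"
  using assms by (auto simp: pos_def_mat_def)

lemma psd_matD:
  assumes "psd_mat p A"
  shows "A \<in> carrier_mat p p" "A\<^sup>T = A"
    and "\<And>v. v \<in> carrier_vec p \<Longrightarrow> 0 \<le> v \<bullet> (A *\<^sub>v v)"
  using assms by (auto simp: psd_mat_def)

lemma scalar_prod_sum: "v \<in> carrier_vec p \<Longrightarrow> w \<in> carrier_vec p \<Longrightarrow> v \<bullet> w = (\<Sum>j<p. v $ j * w $ j)"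
  by (simp add: scalar_prod_def lessThan_atLeast0)

lemma scalar_prod_self_ge_0: "0 \<le> (v :: real vec) \<bullet> v"
  by (auto simp: scalar_prod_def intro!: sum_nonneg)

lemma scalar_prod_self_eq_0_iff:
  assumes "v \<in> carrier_vec p" shows "(v :: real vec) \<bullet> v = 0 \<longleftrightarrow> v = 0\<^sub>v p"
proof
  assume "v \<bullet> v = 0"
  then have "(\<Sum>j<p. v $ j * v $ j) = 0" using assms by (simp add: scalar_prod_sum)
  then have "\<forall>j\<in>{..<p}. v $ j * v $ j = 0"
    by (subst (asm) sum_nonneg_eq_0_iff) auto
  then show "v = 0\<^sub>v p" using assms by (intro eq_vecI) auto
qed (use assms in auto)

lemma pos_def_psd: "pos_def_mat p A \<Longrightarrow> psd_mat p A"
  unfolding psd_mat_def pos_def_mat_def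
  by (metis less_eq_real_def mult_mat_vec_carrier scalar_prod_left_zero)

lemma sym_mat_swap:
  fixes A :: "real mat"
  assumes "A \<in> carrier_mat p p" "A\<^sup>T = A" "v \<in> carrier_vec p" "w \<in> carrier_vec p"
  shows "(A *\<^sub>v v) \<bullet> w = v \<bullet> (A *\<^sub>v w)"
  using transpose_vec_mult_scalar[OF assms(1,4,3)] assms
  by (metis comm_scalar_prod mult_mat_vec_carrier)

lemma mat_vec_scalar_sum:
  fixes A :: "real mat"
  assumes "A \<in> carrier_mat p p" "v \<in> carrier_vec p" "w \<in> carrier_vec p"
  shows "v \<bullet> (A *\<^sub>v w) = (\<Sum>j<p. \<Sum>k<p. v $ j * A $$ (j, k) * w $ k)"
proof -
  have "v \<bullet> (A *\<^sub>v w) = (\<Sum>j<p. v $ j * (\<Sum>k<p. A $$ (j, k) * w $ k))"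
    using assms by (subst scalar_prod_sum[of _ p]) (auto simp: scalar_prod_def lessThan_atLeast0)
  then show ?thesis by (simp add: sum_distrib_left mult.assoc)
qed

lemma sym_mat_entry: "A \<in> carrier_mat p p \<Longrightarrow> A\<^sup>T = A \<Longrightarrow> j < p \<Longrightarrow> k < p \<Longrightarrow> A $$ (j, k) = A $$ (k, j)"
  by (metis carrier_matD index_transpose_mat(1))

lemma quad_expand:
  fixes A :: "real mat"
  assumes "A \<in> carrier_mat p p" "A\<^sup>T = A" "v \<in> carrier_vec p" "w \<in> carrier_vec p"
  shows "(v + t \<cdot>\<^sub>v w) \<bullet> (A *\<^sub>v (v + t \<cdot>\<^sub>v w)) =
    v \<bullet> (A *\<^sub>v v) + 2 * t * (v \<bullet> (A *\<^sub>v w)) + t\<^sup>2 * (w \<bullet> (A *\<^sub>v w))"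
proof -
  have Av: "A *\<^sub>v v \<in> carrier_vec p" "A *\<^sub>v w \<in> carrier_vec p" using assms by auto
  have eq: "w \<bullet> (A *\<^sub>v v) = v \<bullet> (A *\<^sub>v w)"
    using sym_mat_swap[OF assms] Av assms by (metis comm_scalar_prod)
  have "A *\<^sub>v (v + t \<cdot>\<^sub>v w) = A *\<^sub>v v + t \<cdot>\<^sub>v (A *\<^sub>v w)"
    using assms by (simp add: mult_add_distrib_mat_vec[of _ p p] mult_mat_vec[of _ p p])
  then show ?thesis using Av assms eq
    by (simp add: add_scalar_prod_distrib[of _ p] scalar_prod_add_distrib[of _ p] power2_eq_square algebra_simps)
qed

text \<open>Evaluate at the minimiser \<open>-b / c\<close>. If \<open>c = 0\<close> the function is
  affine in \<open>t\<close>, and unless \<open>b = 0\<close> it takes the value -1 at the point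
  chosen below.\<close>

lemma discriminant_le:
  fixes a b c :: real
  assumes "\<And>t. 0 \<le> a + 2 * t * b + t\<^sup>2 * c" and "0 \<le> c"
  shows "b\<^sup>2 \<le> a * c"
proof (cases "c = 0")
  case True
  show ?thesis
  proof (cases "b = 0")
    case False
    have "0 \<le> a + 2 * (-(a+1)/(2*b)) * b" using assms(1)[of "-(a+1)/(2*b)"] True by simp
    then show ?thesis using False by (simp add: field_simps)
  qed (use True in simp)
next
  case False
  then have c: "c > 0" using assms(2) by simp
  have "0 \<le> a + 2 * (-b/c) * b + (-b/c)\<^sup>2 * c" by (rule assms(1))
  also have "\<dots> = a - b\<^sup>2/c" using c by (simp add: field_simps power2_eq_square)
  finally show ?thesis using c by (simp add: field_simps)
qed

text \<open>The form is nonnegative along the line \<open>v + t w\<close>, so its discriminant in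
  \<open>t\<close> cannot be positive. Applied to a matrix or to its inverse, this takes the place
  of diagonalisation in most of what follows.\<close>

lemma psd_cauchy_schwarz:
  assumes "psd_mat p A" "v \<in> carrier_vec p" "w \<in> carrier_vec p"
  shows "(v \<bullet> (A *\<^sub>v w))\<^sup>2 \<le> (v \<bullet> (A *\<^sub>v v)) * (w \<bullet> (A *\<^sub>v w))"
proof (rule discriminant_le)
  note A = psd_matD[OF assms(1)]
  fix t
  show "0 \<le> v \<bullet> (A *\<^sub>v v) + 2 * t * (v \<bullet> (A *\<^sub>v w)) + t\<^sup>2 * (w \<bullet> (A *\<^sub>v w))"
    using A(3)[of "v + t \<cdot>\<^sub>v w"] assms quad_expand[OF A(1,2) assms(2,3), of t] by simp
  show "0 \<le> w \<bullet> (A *\<^sub>v w)" using A assms by simp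
qed

lemma psd_one: "psd_mat p (1\<^sub>m p)"
  by (auto simp: psd_mat_def intro: scalar_prod_self_ge_0)

lemma cauchy_schwarz_vec:
  assumes "v \<in> carrier_vec p" "w \<in> carrier_vec p"
  shows "((v :: real vec) \<bullet> w)\<^sup>2 \<le> (v \<bullet> v) * (w \<bullet> w)"
  using psd_cauchy_schwarz[OF psd_one assms] assms by simp

lemma unit_vec_mat:
  fixes A :: "real mat"
  assumes "A \<in> carrier_mat p p" "j < p" "k < p"
  shows "unit_vec p j \<bullet> (A *\<^sub>v unit_vec p k) = A $$ (j, k)"
  using assms by (simp add: scalar_prod_left_unit)

text \<open>Cauchy--Schwarz on unit vectors bounds every entry by the geometric mean of two diagonal
  entries, so the form is at most the square of a single sum; Cauchy--Schwarz for that sum produces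
  the trace.\<close>

lemma psd_le_trace:
  assumes "psd_mat p A" "v \<in> carrier_vec p"
  shows "v \<bullet> (A *\<^sub>v v) \<le> mtrace A * (v \<bullet> v)"
proof -
  note A = psd_matD[OF assms(1)]
  define d where "d j = sqrt (A $$ (j, j))" for j
  have d0: "0 \<le> A $$ (j, j)" if "j < p" for j
    using A(3)[of "unit_vec p j"] unit_vec_mat[OF A(1) that that] by simp
  have ent: "\<bar>A $$ (j, k)\<bar> \<le> d j * d k" if "j < p" "k < p" for j k
  proof -
    have "(A $$ (j, k))\<^sup>2 \<le> A $$ (j, j) * A $$ (k, k)"
      using psd_cauchy_schwarz[OF assms(1), of "unit_vec p j" "unit_vec p k"] unit_vec_mat[OF A(1)] that
      by simp
    then show ?thesis unfolding d_def by (metis real_sqrt_abs real_sqrt_le_iff real_sqrt_mult)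
  qed
  have "v \<bullet> (A *\<^sub>v v) \<le> (\<Sum>j<p. \<Sum>k<p. (\<bar>v $ j\<bar> * d j) * (\<bar>v $ k\<bar> * d k))"
    unfolding mat_vec_scalar_sum[OF A(1) assms(2,2)]
  proof (intro sum_mono)
    fix j k assume jk: "j \<in> {..<p}" "k \<in> {..<p}"
    have "v $ j * A $$ (j, k) * v $ k \<le> \<bar>v $ j\<bar> * \<bar>A $$ (j, k)\<bar> * \<bar>v $ k\<bar>"
      by (metis abs_ge_self abs_mult)
    also have "\<dots> \<le> \<bar>v $ j\<bar> * (d j * d k) * \<bar>v $ k\<bar>"
      using ent[of j k] jk by (intro mult_right_mono mult_left_mono) auto
    finally show "v $ j * A $$ (j, k) * v $ k \<le> (\<bar>v $ j\<bar> * d j) * (\<bar>v $ k\<bar> * d k)" by (simp add: algebra_simps)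
  qed
  also have "\<dots> = (\<Sum>j<p. \<bar>v $ j\<bar> * d j)\<^sup>2" by (simp add: power2_eq_square sum_product)
  also have "\<dots> \<le> (\<Sum>j<p. (d j)\<^sup>2) * (\<Sum>j<p. \<bar>v $ j\<bar>\<^sup>2)"
    using Cauchy_Schwarz_ineq_sum[of d "\<lambda>j. \<bar>v $ j\<bar>" "{..<p}"] by (simp add: mult.commute)
  also have "(\<Sum>j<p. (d j)\<^sup>2) = mtrace A" using d0 A(1) by (auto simp: mtrace_def d_def intro!: sum.cong)
  also have "(\<Sum>j<p. \<bar>v $ j\<bar>\<^sup>2) = v \<bullet> v" using assms(2) by (simp add: scalar_prod_sum power2_eq_square)
  finally show ?thesis .
qed

lemma psd_trace_ge_0: assumes "psd_mat p A" shows "0 \<le> mtrace A"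
proof -
  note A = psd_matD[OF assms(1)]
  have "0 \<le> A $$ (j, j)" if "j < p" for j
    using A(3)[of "unit_vec p j"] unit_vec_mat[OF A(1) that that] by simp
  then show ?thesis using A(1) by (auto simp: mtrace_def intro!: sum_nonneg)
qed

section \<open>Inverses and the order of quadratic forms\<close>

lemma pos_def_det: assumes "pos_def_mat p A" shows "det A \<noteq> 0"
proof
  note A = pos_def_matD[OF assms]
  assume "det A = 0"
  then obtain v where v: "v \<in> carrier_vec p" "v \<noteq> 0\<^sub>v p" "A *\<^sub>v v = 0\<^sub>v p"
    using det_0_iff_vec_prod_zero[OF A(1)] by auto
  then show False using A(3)[OF v(1,2)] by simp
qed

lemma inv_mat_carrier[simp]: "A \<in> carrier_mat p p \<Longrightarrow> inv_mat A \<in> carrier_mat p p"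
  by (auto simp: inv_mat_def adj_mat)

lemma inv_mat_vec_carrier[simp]:
  "A \<in> carrier_mat p p \<Longrightarrow> x \<in> carrier_vec p \<Longrightarrow> inv_mat A *\<^sub>v x \<in> carrier_vec p"
  using inv_mat_carrier mult_mat_vec_carrier by blast

lemma inv_mat_inverse:
  assumes "pos_def_mat p A"
  shows "A * inv_mat A = 1\<^sub>m p" "inv_mat A * A = 1\<^sub>m p"
proof -
  note A = pos_def_matD[OF assms]
  have "A * inv_mat A = (1 / det A) \<cdot>\<^sub>m (A * adj_mat A)" "inv_mat A * A = (1 / det A) \<cdot>\<^sub>m (adj_mat A * A)"
    unfolding inv_mat_def using A(1) adj_mat(1)[OF A(1)]
    by (auto simp: mult_smult_distrib[of _ p p _ p] mult_smult_assoc_mat[of _ p p _ p])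
  then show "A * inv_mat A = 1\<^sub>m p" "inv_mat A * A = 1\<^sub>m p"
    using pos_def_det[OF assms] adj_mat[OF A(1)] by (auto intro!: eq_matI)
qed

lemma inv_mat_unique:
  assumes "pos_def_mat p A" "B \<in> carrier_mat p p" "A * B = 1\<^sub>m p"
  shows "inv_mat A = B"
proof -
  note A = pos_def_matD[OF assms(1)]
  have "inv_mat A = inv_mat A * (A * B)" using assms A inv_mat_carrier by (metis right_mult_one_mat)
  also have "\<dots> = B" using assms A inv_mat_inverse[OF assms(1)]
    by (metis assoc_mult_mat inv_mat_carrier left_mult_one_mat)
  finally show ?thesis .
qed

lemma mat_inverse_pos_def:
  assumes "pos_def_mat p A" shows "the (mat_inverse A) = inv_mat A"
proof -
  note A = pos_def_matD[OF assms]
  have "A \<in> Units (ring_mat TYPE(real) p ())"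
    using inv_mat_inverse[OF assms] A(1) inv_mat_carrier[OF A(1)] unfolding Units_def ring_mat_def by force
  then obtain B where "mat_inverse A = Some B" using mat_inverse(1)[OF A(1)] by (metis option.exhaust)
  then show ?thesis using mat_inverse(2)[OF A(1)] inv_mat_unique[OF assms] by auto
qed

lemma inv_mat_vec:
  assumes "pos_def_mat p A" "x \<in> carrier_vec p"
  shows "A *\<^sub>v (inv_mat A *\<^sub>v x) = x" "inv_mat A *\<^sub>v (A *\<^sub>v x) = x"
  using inv_mat_inverse[OF assms(1)] pos_def_matD[OF assms(1)] assms(2)
  by (metis assoc_mult_mat_vec inv_mat_carrier one_mult_mat_vec)+

lemma inv_mat_sym: assumes "pos_def_mat p A" shows "(inv_mat A)\<^sup>T = inv_mat A"
proof -
  note A = pos_def_matD[OF assms]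
  have "(inv_mat A * A)\<^sup>T = 1\<^sub>m p" using inv_mat_inverse[OF assms] by simp
  then have "A * (inv_mat A)\<^sup>T = 1\<^sub>m p" using A by (metis inv_mat_carrier transpose_mult)
  then show ?thesis using inv_mat_unique[OF assms, of "(inv_mat A)\<^sup>T"] A by simp
qed

lemma inv_mat_pos_def: assumes "pos_def_mat p A" shows "pos_def_mat p (inv_mat A)"
proof -
  note A = pos_def_matD[OF assms]
  have "0 < v \<bullet> (inv_mat A *\<^sub>v v)" if v: "v \<in> carrier_vec p" "v \<noteq> 0\<^sub>v p" for v
  proof -
    define w where "w = inv_mat A *\<^sub>v v"
    have w: "w \<in> carrier_vec p" "A *\<^sub>v w = v" using A v inv_mat_vec[OF assms] by (auto simp: w_def)
    have "w \<noteq> 0\<^sub>v p" using w v A(1) by auto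
    then have "0 < w \<bullet> (A *\<^sub>v w)" using A w by auto
    then show ?thesis using w v by (metis comm_scalar_prod w_def)
  qed
  then show ?thesis using A inv_mat_sym[OF assms] by (auto simp: pos_def_mat_def)
qed

text \<open>With \<open>a\<close> and \<open>b\<close> the images of \<open>x\<close> under the two
  inverses, Cauchy--Schwarz in the form of \<open>A\<close> bounds the square of
  \<open>b \<bullet> x\<close> by \<open>c * (b \<bullet> x) * (a \<bullet> x)\<close>, and one
  factor cancels. The constant \<open>c\<close> allows matrices to be compared up to a ratio, which
  the uniqueness argument for the weights relies on.\<close>

lemma inv_mat_antimono:
  assumes "pos_def_mat p A" "pos_def_mat p B" "0 < c" "x \<in> carrier_vec p"
    and le: "\<And>v. v \<in> carrier_vec p \<Longrightarrow> v \<bullet> (A *\<^sub>v v) \<le> c * (v \<bullet> (B *\<^sub>v v))"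
  shows "x \<bullet> (inv_mat B *\<^sub>v x) \<le> c * (x \<bullet> (inv_mat A *\<^sub>v x))"
proof -
  note A = pos_def_matD[OF assms(1)] and B = pos_def_matD[OF assms(2)]
  define a where "a = inv_mat A *\<^sub>v x"
  define b where "b = inv_mat B *\<^sub>v x"
  have ab: "a \<in> carrier_vec p" "b \<in> carrier_vec p" "A *\<^sub>v a = x" "B *\<^sub>v b = x"
    using assms A B inv_mat_vec by (auto simp: a_def b_def)
  have "(b \<bullet> (A *\<^sub>v a))\<^sup>2 \<le> (b \<bullet> (A *\<^sub>v b)) * (a \<bullet> (A *\<^sub>v a))"
    by (rule psd_cauchy_schwarz[OF pos_def_psd[OF assms(1)] ab(2,1)])
  also have "\<dots> \<le> (c * (b \<bullet> (B *\<^sub>v b))) * (a \<bullet> (A *\<^sub>v a))"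
    using le[OF ab(2)] psd_matD(3)[OF pos_def_psd[OF assms(1)] ab(1)] by (rule mult_right_mono)
  finally have 1: "(b \<bullet> x)\<^sup>2 \<le> c * (b \<bullet> x) * (a \<bullet> x)" using ab by simp
  have pos: "0 \<le> b \<bullet> x" "0 \<le> a \<bullet> x" using psd_matD(3)[OF pos_def_psd[OF assms(2)] ab(2)] 
      psd_matD(3)[OF pos_def_psd[OF assms(1)] ab(1)] ab by auto
  have "b \<bullet> x \<le> c * (a \<bullet> x)"
  proof (cases "b \<bullet> x = 0")
    case False
    then show ?thesis using 1 pos by (simp add: power2_eq_square mult.assoc mult.left_commute[of c])
  qed (use pos assms in simp)
  then show ?thesis using ab assms(4) by (metis a_def b_def comm_scalar_prod)
qed

text \<open>Inserting the vector \<open>inv_mat A *\<^sub>v x\<close> into the lower bound gives the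
  first estimate; Euclidean Cauchy--Schwarz then turns it into the second.\<close>

lemma inv_mat_bounds:
  assumes "pos_def_mat p A" "0 < \<beta>" "x \<in> carrier_vec p"
    and ge: "\<And>v. v \<in> carrier_vec p \<Longrightarrow> \<beta> * (v \<bullet> v) \<le> v \<bullet> (A *\<^sub>v v)"
  shows "(inv_mat A *\<^sub>v x) \<bullet> (inv_mat A *\<^sub>v x) \<le> (x \<bullet> (inv_mat A *\<^sub>v x)) / \<beta>"
    and "x \<bullet> (inv_mat A *\<^sub>v x) \<le> (x \<bullet> x) / \<beta>"
proof -
  note A = pos_def_matD[OF assms(1)]
  define w where "w = inv_mat A *\<^sub>v x"
  have w: "w \<in> carrier_vec p" "A *\<^sub>v w = x" using A assms inv_mat_vec[OF assms(1)] by (auto simp: w_def)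
  have 1: "w \<bullet> w \<le> (x \<bullet> w) / \<beta>"
    using ge[OF w(1)] w assms comm_scalar_prod[of w p x] by (simp add: field_simps)
  then show "(inv_mat A *\<^sub>v x) \<bullet> (inv_mat A *\<^sub>v x) \<le> (x \<bullet> (inv_mat A *\<^sub>v x)) / \<beta>" by (simp add: w_def)
  have "(x \<bullet> w)\<^sup>2 \<le> (x \<bullet> x) * (w \<bullet> w)" by (rule cauchy_schwarz_vec[OF assms(3) w(1)])
  also have "\<dots> \<le> (x \<bullet> x) * ((x \<bullet> w) / \<beta>)" using 1 by (intro mult_left_mono scalar_prod_self_ge_0)
  finally have 2: "(x \<bullet> w)\<^sup>2 \<le> (x \<bullet> x) / \<beta> * (x \<bullet> w)" by simp
  have "0 \<le> x \<bullet> w" using psd_matD(3)[OF pos_def_psd[OF assms(1)] w(1)] w assms comm_scalar_prod[of w p x] by simp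
  moreover have "0 \<le> (x \<bullet> x) / \<beta>" using assms scalar_prod_self_ge_0[of x] by simp
  ultimately have "x \<bullet> w \<le> (x \<bullet> x) / \<beta>" using 2 mult_right_le_imp_le[of "x \<bullet> w" "x \<bullet> w" "(x \<bullet> x) / \<beta>"]
    by (cases "x \<bullet> w = 0") (auto simp: power2_eq_square)
  then show "x \<bullet> (inv_mat A *\<^sub>v x) \<le> (x \<bullet> x) / \<beta>" by (simp add: w_def)
qed

text \<open>Write \<open>v \<bullet> v\<close> as the product of \<open>v\<close> with the inverse
  applied to \<open>A *\<^sub>v v\<close> and use Cauchy--Schwarz in the form of the inverse, whose
  value at \<open>v\<close> the trace controls. This is how a bound on the potential becomes an
  eigenvalue bound.\<close>

lemma pos_def_ge_inv_trace:
  assumes "pos_def_mat p A" "mtrace (inv_mat A) \<le> \<phi>" "0 < \<phi>" "v \<in> carrier_vec p"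
  shows "(v \<bullet> v) / \<phi> \<le> v \<bullet> (A *\<^sub>v v)"
proof -
  note A = pos_def_matD[OF assms(1)]
  let ?M = "inv_mat A"
  have M: "psd_mat p ?M" by (intro pos_def_psd inv_mat_pos_def assms)
  have Av: "A *\<^sub>v v \<in> carrier_vec p" using A assms by auto
  have "(v \<bullet> v)\<^sup>2 = (v \<bullet> (?M *\<^sub>v (A *\<^sub>v v)))\<^sup>2" using inv_mat_vec[OF assms(1,4)] by simp
  also have "\<dots> \<le> (v \<bullet> (?M *\<^sub>v v)) * ((A *\<^sub>v v) \<bullet> (?M *\<^sub>v (A *\<^sub>v v)))"
    by (rule psd_cauchy_schwarz[OF M assms(4) Av])
  also have "(A *\<^sub>v v) \<bullet> (?M *\<^sub>v (A *\<^sub>v v)) = v \<bullet> (A *\<^sub>v v)"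
    using inv_mat_vec[OF assms(1,4)] comm_scalar_prod[OF Av assms(4)] by simp
  also have "(v \<bullet> (?M *\<^sub>v v)) * (v \<bullet> (A *\<^sub>v v)) \<le> (\<phi> * (v \<bullet> v)) * (v \<bullet> (A *\<^sub>v v))"
  proof (rule mult_right_mono)
    show "v \<bullet> (?M *\<^sub>v v) \<le> \<phi> * (v \<bullet> v)"
      using psd_le_trace[OF M assms(4)] assms(2) scalar_prod_self_ge_0[of v] by (meson mult_right_mono order_trans)
    show "0 \<le> v \<bullet> (A *\<^sub>v v)" using psd_matD(3)[OF pos_def_psd[OF assms(1)] assms(4)] .
  qed
  finally have "(v \<bullet> v)\<^sup>2 \<le> (v \<bullet> v) * (\<phi> * (v \<bullet> (A *\<^sub>v v)))" by (simp add: algebra_simps)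
  then have "v \<bullet> v \<le> \<phi> * (v \<bullet> (A *\<^sub>v v))"
    using scalar_prod_self_ge_0[of v] psd_matD(3)[OF pos_def_psd[OF assms(1)] assms(4)] assms(3)
      mult_left_le_imp_le[of "v \<bullet> v" "v \<bullet> v" "\<phi> * (v \<bullet> (A *\<^sub>v v))"]
    by (cases "v \<bullet> v = 0") (auto simp: power2_eq_square)
  then show ?thesis using assms(3) by (simp add: field_simps)
qed

section \<open>Rank-one updates and the barrier step\<close>

lemma sym_matrix_add: "A \<in> carrier_mat p p \<Longrightarrow> B \<in> carrier_mat p p \<Longrightarrow> A\<^sup>T = A \<Longrightarrow> B\<^sup>T = B
    \<Longrightarrow> (A + B)\<^sup>T = (A + B :: real mat)"
  by (simp add: transpose_add)

lemma outer_carrier[simp]: "y \<in> carrier_vec p \<Longrightarrow> outer y \<in> carrier_mat p p"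
  by (auto simp: outer_def)

lemma outer_sym: "(outer y)\<^sup>T = outer y"
  by (rule eq_matI) (auto simp: outer_def)

lemma outer_vec: "y \<in> carrier_vec p \<Longrightarrow> v \<in> carrier_vec p \<Longrightarrow> outer y *\<^sub>v v = (y \<bullet> v) \<cdot>\<^sub>v y"
  by (rule eq_vecI) (auto simp: outer_def scalar_prod_def sum_distrib_left sum_distrib_right mult_ac)

lemma quad_add_outer:
  assumes "A \<in> carrier_mat p p" "y \<in> carrier_vec p" "v \<in> carrier_vec p"
  shows "v \<bullet> ((A + outer y) *\<^sub>v v) = v \<bullet> (A *\<^sub>v v) + (y \<bullet> v)\<^sup>2"
proof -
  have "(A + outer y) *\<^sub>v v = A *\<^sub>v v + (y \<bullet> v) \<cdot>\<^sub>v y"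
    using assms by (simp add: add_mult_distrib_mat_vec[of _ p p] outer_vec)
  moreover have "A *\<^sub>v v \<in> carrier_vec p" using assms by auto
  ultimately show ?thesis using assms comm_scalar_prod[of v p y]
    by (simp add: scalar_prod_add_distrib[of _ p] power2_eq_square)
qed

lemma pos_def_add_outer:
  assumes "pos_def_mat p A" "y \<in> carrier_vec p" shows "pos_def_mat p (A + outer y)"
  using assms pos_def_matD[OF assms(1)] unfolding pos_def_mat_def
  by (auto simp: quad_add_outer sym_matrix_add outer_sym intro: add_pos_nonneg)

lemma mat_eqI_vec:
  fixes A B :: "real mat"
  assumes "A \<in> carrier_mat p p" "B \<in> carrier_mat p p" "\<And>v. v \<in> carrier_vec p \<Longrightarrow> A *\<^sub>v v = B *\<^sub>v v"
  shows "A = B"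
proof (rule eq_matI)
  fix i j assume "i < dim_row B" "j < dim_col B"
  then have ij: "i < p" "j < p" using assms by auto
  have "(A *\<^sub>v unit_vec p j) $ i = (B *\<^sub>v unit_vec p j) $ i" using assms(3)[of "unit_vec p j"] by simp
  then show "A $$ (i, j) = B $$ (i, j)" using assms(1,2) ij by simp
qed (use assms in auto)

lemma smult_mat_mult_vec:
  fixes A :: "real mat"
  assumes "A \<in> carrier_mat p p" "v \<in> carrier_vec p"
  shows "(k \<cdot>\<^sub>m A) *\<^sub>v v = k \<cdot>\<^sub>v (A *\<^sub>v v)"
  using assms by (intro eq_vecI) auto

text \<open>\<open>B\<close> is the explicit rank-one correction of \<open>inv_mat A\<close>. It is
  recognised as the inverse by its action on vectors, after which leverage and trace are read off
  from it. The trace identity is exact, which is what makes the trace of the inverse a usable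
  potential.\<close>

lemma sherman_morrison:
  assumes A: "pos_def_mat p A" and y: "y \<in> carrier_vec p"
  defines "s \<equiv> y \<bullet> (inv_mat A *\<^sub>v y)"
  shows "0 \<le> s"
    and "y \<bullet> (inv_mat (A + outer y) *\<^sub>v y) = s / (1 + s)"
    and "mtrace (inv_mat (A + outer y)) =
      mtrace (inv_mat A) - ((inv_mat A *\<^sub>v y) \<bullet> (inv_mat A *\<^sub>v y)) / (1 + s)"
proof -
  note Ad = pos_def_matD[OF A]
  let ?R = "inv_mat A"
  define z where "z = ?R *\<^sub>v y"
  define B where "B = ?R + (-(1 / (1 + s))) \<cdot>\<^sub>m outer z"
  have R: "?R \<in> carrier_mat p p" using Ad by simp
  have z: "z \<in> carrier_vec p" using Ad y by (simp add: z_def)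
  have Az: "A *\<^sub>v z = y" using inv_mat_vec[OF A y] by (simp add: z_def)
  have s_eq: "s = y \<bullet> z" by (simp add: s_def z_def)
  show s0: "0 \<le> s" unfolding s_def using psd_matD(3)[OF pos_def_psd[OF inv_mat_pos_def[OF A]] y] .
  have B: "B \<in> carrier_mat p p" using R z by (simp add: B_def)
  have Bv: "B *\<^sub>v x = ?R *\<^sub>v x + (-(z \<bullet> x) / (1 + s)) \<cdot>\<^sub>v z" if x: "x \<in> carrier_vec p" for x
    unfolding B_def using R z x
    by (simp add: add_mult_distrib_mat_vec[of _ p p] outer_vec smult_mat_mult_vec[of _ p] smult_smult_assoc)
  have "(A + outer y) * B = 1\<^sub>m p"
  proof (rule mat_eqI_vec[of _ p])
    fix x :: "real vec" assume x: "x \<in> carrier_vec p"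
    have Rx: "?R *\<^sub>v x \<in> carrier_vec p" using Ad x by simp
    have c: "y \<bullet> (?R *\<^sub>v x) = z \<bullet> x"
      unfolding z_def using sym_mat_swap[OF R inv_mat_sym[OF A] y x] by simp
    have Bx: "B *\<^sub>v x \<in> carrier_vec p" using B x by simp
    have "((A + outer y) * B) *\<^sub>v x = (A + outer y) *\<^sub>v (B *\<^sub>v x)"
      using Ad y B x by (simp add: assoc_mult_mat_vec[of _ p p _ p])
    also have "\<dots> = A *\<^sub>v (B *\<^sub>v x) + (y \<bullet> (B *\<^sub>v x)) \<cdot>\<^sub>v y"
      using Ad y Bx by (simp add: add_mult_distrib_mat_vec[of _ p p] outer_vec)
    also have "A *\<^sub>v (B *\<^sub>v x) = x + (-(z \<bullet> x) / (1 + s)) \<cdot>\<^sub>v y"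
      unfolding Bv[OF x] using Ad Rx z Az inv_mat_vec[OF A x]
      by (simp add: mult_add_distrib_mat_vec[of _ p p] mult_mat_vec[of _ p p])
    also have "y \<bullet> (B *\<^sub>v x) = z \<bullet> x + (-(z \<bullet> x) / (1 + s)) * s"
      unfolding Bv[OF x] using y Rx z c s_eq by (simp add: scalar_prod_add_distrib[of _ p])
    also have "\<dots> = (z \<bullet> x) / (1 + s)" using s0 by (simp add: field_simps)
    also have "x + (-(z \<bullet> x) / (1 + s)) \<cdot>\<^sub>v y + ((z \<bullet> x) / (1 + s)) \<cdot>\<^sub>v y = x"
      using x y by (intro eq_vecI) auto
    finally show "((A + outer y) * B) *\<^sub>v x = 1\<^sub>m p *\<^sub>v x" using x by simp
  qed (use Ad B y in \<open>auto intro!: mult_carrier_mat add_carrier_mat\<close>)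
  then have inv: "inv_mat (A + outer y) = B" by (rule inv_mat_unique[OF pos_def_add_outer[OF A y] B])
  show "y \<bullet> (inv_mat (A + outer y) *\<^sub>v y) = s / (1 + s)"
  proof -
    have "y \<bullet> (B *\<^sub>v y) = s + (-(z \<bullet> y) / (1 + s)) * s"
      unfolding Bv[OF y] using y R z s_eq by (simp add: scalar_prod_add_distrib[of _ p] z_def[symmetric])
    also have "\<dots> = s / (1 + s)" using s0 s_eq comm_scalar_prod[OF z y] by (simp add: field_simps)
    finally show ?thesis by (simp add: inv)
  qed
  have "mtrace B = mtrace ?R + (-(1 / (1 + s))) * (z \<bullet> z)"
    using R z by (simp add: B_def mtrace_def outer_def scalar_prod_sum[OF z z] sum.distrib sum_negf sum_divide_distrib sum_subtractf)
  then show "mtrace (inv_mat (A + outer y)) =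
      mtrace (inv_mat A) - ((inv_mat A *\<^sub>v y) \<bullet> (inv_mat A *\<^sub>v y)) / (1 + s)"
    by (simp add: inv z_def)
qed

text \<open>By symmetry rows are images of unit vectors, so trace and Frobenius norm can be compared
  one unit vector at a time.\<close>

lemma frob2_sym:
  fixes M :: "real mat"
  assumes "M \<in> carrier_mat p p" "M\<^sup>T = M"
  shows "frob2 M = (\<Sum>k<p. (M *\<^sub>v unit_vec p k) \<bullet> (M *\<^sub>v unit_vec p k))"
proof -
  have "M *\<^sub>v unit_vec p k = row M k" if "k < p" for k
    using assms that by (intro eq_vecI) (auto simp: sym_mat_entry[OF assms])
  then show ?thesis using assms by (simp add: frob2_def)
qed

lemma mtrace_unit: "M \<in> carrier_mat p p \<Longrightarrow> mtrace M = (\<Sum>k<p. unit_vec p k \<bullet> (M *\<^sub>v unit_vec p k))"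
  by (simp add: mtrace_def)

text \<open>Lowering the spectrum by \<delta> raises the trace of the inverse by at most
  \<open>2 * \<delta> * frob2 (inv_mat D)\<close>; adding \<open>outer y\<close> lowers it by the
  Sherman--Morrison term of the shifted matrix. The conditions on \<open>y\<close> make the gain at
  least the cost. The trace bound keeps \<open>D\<close> above \<open>1 / \<phi>\<close>, so a shift
  by at most half of that leaves at least half of \<open>D\<close>.\<close>

lemma barrier_step:
  assumes D: "pos_def_mat p D" and tr: "mtrace (inv_mat D) \<le> \<phi>" and \<phi>: "0 < \<phi>"
    and \<delta>: "0 \<le> \<delta>" "\<delta> \<le> 1 / (2 * \<phi>)" and y: "y \<in> carrier_vec p"
    and s: "y \<bullet> (inv_mat D *\<^sub>v y) \<le> \<kappa>\<^sub>1"
    and z: "\<kappa>\<^sub>2 * frob2 (inv_mat D) \<le> (inv_mat D *\<^sub>v y) \<bullet> (inv_mat D *\<^sub>v y)"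
    and \<kappa>: "2 * \<delta> * (1 + 2 * \<kappa>\<^sub>1) \<le> \<kappa>\<^sub>2"
  shows "pos_def_mat p (D + (-\<delta>) \<cdot>\<^sub>m 1\<^sub>m p + outer y)"
    and "mtrace (inv_mat (D + (-\<delta>) \<cdot>\<^sub>m 1\<^sub>m p + outer y)) \<le> \<phi>"
proof -
  note Dd = pos_def_matD[OF D]
  define E where "E = D + (-\<delta>) \<cdot>\<^sub>m 1\<^sub>m p"
  have Ev: "E *\<^sub>v v = D *\<^sub>v v + (-\<delta>) \<cdot>\<^sub>v v" if "v \<in> carrier_vec p" for v
    unfolding E_def using Dd that by (simp add: add_mult_distrib_mat_vec[of _ p p] smult_mat_mult_vec[of _ p])
  have qE: "v \<bullet> (E *\<^sub>v v) = v \<bullet> (D *\<^sub>v v) - \<delta> * (v \<bullet> v)" if "v \<in> carrier_vec p" for v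
    unfolding Ev[OF that] using Dd that by (simp add: scalar_prod_add_distrib[of _ p])
  have Dge: "(v \<bullet> v) / \<phi> \<le> v \<bullet> (D *\<^sub>v v)" if "v \<in> carrier_vec p" for v
    by (rule pos_def_ge_inv_trace[OF D tr \<phi> that])
  have Ege: "v \<bullet> (D *\<^sub>v v) / 2 \<le> v \<bullet> (E *\<^sub>v v)" if "v \<in> carrier_vec p" for v
  proof -
    have "\<delta> * (v \<bullet> v) \<le> 1 / (2 * \<phi>) * (v \<bullet> v)" using \<delta> by (intro mult_right_mono scalar_prod_self_ge_0)
    also have "\<dots> \<le> v \<bullet> (D *\<^sub>v v) / 2" using Dge[OF that] by simp
    finally show ?thesis using qE[OF that] by simp
  qed
  have E: "pos_def_mat p E"
    unfolding pos_def_mat_def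
  proof (intro conjI ballI impI)
    show "E \<in> carrier_mat p p" using Dd by (simp add: E_def)
    have "(D + (-\<delta>) \<cdot>\<^sub>m 1\<^sub>m p)\<^sup>T = D + (-\<delta>) \<cdot>\<^sub>m 1\<^sub>m p"
      using Dd by (intro eq_matI) (auto simp: sym_mat_entry[OF Dd(1,2)])
    then show "E\<^sup>T = E" by (simp add: E_def)
    fix v :: "real vec" assume v: "v \<in> carrier_vec p" "v \<noteq> 0\<^sub>v p"
    show "0 < v \<bullet> (E *\<^sub>v v)" using Ege[OF v(1)] Dd(3)[OF v] by simp
  qed
  note Ed = pos_def_matD[OF E]
  let ?M = "inv_mat D" and ?N = "inv_mat E"
  note M = pos_def_matD[OF inv_mat_pos_def[OF D]] and N = pos_def_matD[OF inv_mat_pos_def[OF E]]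
  show pd: "pos_def_mat p (D + (-\<delta>) \<cdot>\<^sub>m 1\<^sub>m p + outer y)"
    using pos_def_add_outer[OF E y] by (simp add: E_def)
  \<comment> \<open>Resolvent identity for the shift: apply the new inverse to
    \<open>v = E *\<^sub>v w + \<delta> \<cdot>\<^sub>v w\<close>.\<close>
  have NM: "?N *\<^sub>v v = ?M *\<^sub>v v + \<delta> \<cdot>\<^sub>v (?N *\<^sub>v (?M *\<^sub>v v))" if v: "v \<in> carrier_vec p" for v
  proof -
    define w where "w = ?M *\<^sub>v v"
    have w: "w \<in> carrier_vec p" "D *\<^sub>v w = v" using v Dd inv_mat_vec[OF D v] by (auto simp: w_def)
    have "v = E *\<^sub>v w + \<delta> \<cdot>\<^sub>v w" unfolding Ev[OF w(1)] w(2) using v w by (intro eq_vecI) auto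
    then have "?N *\<^sub>v v = ?N *\<^sub>v (E *\<^sub>v w + \<delta> \<cdot>\<^sub>v w)" by simp
    also have "\<dots> = w + \<delta> \<cdot>\<^sub>v (?N *\<^sub>v w)"
      using Ed N w inv_mat_vec(2)[OF E w(1)] by (simp add: mult_add_distrib_mat_vec[of _ p p] mult_mat_vec[of _ p p])
    finally show ?thesis by (simp add: w_def)
  qed
  have Nle: "v \<bullet> (?N *\<^sub>v v) \<le> 2 * \<phi> * (v \<bullet> v)" if v: "v \<in> carrier_vec p" for v
  proof -
    have "v \<bullet> (?N *\<^sub>v v) \<le> (v \<bullet> v) / (1 / (2 * \<phi>))"
    proof (rule inv_mat_bounds(2)[OF E _ v])
      fix u :: "real vec" assume u: "u \<in> carrier_vec p"
      show "1 / (2 * \<phi>) * (u \<bullet> u) \<le> u \<bullet> (E *\<^sub>v u)" using Ege[OF u] Dge[OF u] by simp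
    qed (use \<phi> in simp)
    then show ?thesis by (simp add: mult.commute)
  qed
  have N0: "0 \<le> v \<bullet> (?N *\<^sub>v v)" if "v \<in> carrier_vec p" for v
    using psd_matD(3)[OF pos_def_psd[OF inv_mat_pos_def[OF E]] that] .
  \<comment> \<open>Two uses of the resolvent identity expand the new inverse into
    \<open>?M\<close>, \<delta> times the square of \<open>?M\<close>, and a remainder. By
    \<open>Nle\<close> and the upper bound on \<delta> the remainder is at most another copy of the
    second term, hence the factor 2.\<close>
  have trN: "mtrace ?N \<le> mtrace ?M + 2 * \<delta> * frob2 ?M"
  proof -
    have "unit_vec p k \<bullet> (?N *\<^sub>v unit_vec p k) \<le> unit_vec p k \<bullet> (?M *\<^sub>v unit_vec p k)
        + 2 * \<delta> * ((?M *\<^sub>v unit_vec p k) \<bullet> (?M *\<^sub>v unit_vec p k))" if "k < p" for k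
    proof -
      let ?e = "unit_vec p k :: real vec"
      define w where "w = ?M *\<^sub>v ?e"
      have w: "w \<in> carrier_vec p" "?N *\<^sub>v w \<in> carrier_vec p" "?N *\<^sub>v ?e \<in> carrier_vec p" using Dd Ed by (auto simp: w_def)
      have "?e \<bullet> (?N *\<^sub>v ?e) = ?e \<bullet> w + \<delta> * (?e \<bullet> (?N *\<^sub>v w))"
        using NM[of ?e] w by (simp add: w_def[symmetric] scalar_prod_add_distrib[of _ p] scalar_prod_smult_distrib[of _ p])
      also have "?e \<bullet> (?N *\<^sub>v w) = w \<bullet> (?N *\<^sub>v ?e)"
        using sym_mat_swap[OF N(1,2), of ?e w] comm_scalar_prod[OF w(3,1)] w by simp
      also have "\<dots> = w \<bullet> w + \<delta> * (w \<bullet> (?N *\<^sub>v w))"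
        using NM[of ?e] w by (simp add: w_def[symmetric] scalar_prod_add_distrib[of _ p])
      also have "\<delta> * (w \<bullet> (?N *\<^sub>v w)) \<le> 1 / (2 * \<phi>) * (2 * \<phi> * (w \<bullet> w))"
        using \<delta> Nle[OF w(1)] N0[OF w(1)] \<phi> by (intro mult_mono) auto
      also have "\<dots> = w \<bullet> w" using \<phi> by simp
      finally have "?e \<bullet> (?N *\<^sub>v ?e) \<le> ?e \<bullet> w + \<delta> * (2 * (w \<bullet> w))"
        using \<delta>(1) by (simp add: mult_left_mono)
      then show ?thesis by (simp add: w_def)
    qed
    then have "(\<Sum>k<p. unit_vec p k \<bullet> (?N *\<^sub>v unit_vec p k)) \<le> (\<Sum>k<p. unit_vec p k \<bullet> (?M *\<^sub>v unit_vec p k)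
        + 2 * \<delta> * ((?M *\<^sub>v unit_vec p k) \<bullet> (?M *\<^sub>v unit_vec p k)))" by (intro sum_mono) auto
    then show ?thesis unfolding mtrace_unit[OF N(1)] mtrace_unit[OF M(1)] frob2_sym[OF M(1,2)]
      by (simp only: sum.distrib sum_distrib_left)
  qed
  define s' where "s' = y \<bullet> (?N *\<^sub>v y)"
  have s'0: "0 \<le> s'" using N0[OF y] by (simp add: s'_def)
  \<comment> \<open>\<open>E\<close> retains at least half of \<open>D\<close>, so its inverse is at
    most twice that of \<open>D\<close>.\<close>
  have s'le: "s' \<le> 2 * \<kappa>\<^sub>1"
  proof -
    have "s' \<le> 2 * (y \<bullet> (?M *\<^sub>v y))" unfolding s'_def
      by (rule inv_mat_antimono[OF D E _ y]) (use Ege in \<open>auto simp: field_simps\<close>)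
    then show ?thesis using s by simp
  qed
  define w where "w = ?M *\<^sub>v y"
  have w: "w \<in> carrier_vec p" "?N *\<^sub>v w \<in> carrier_vec p" using Dd Ed y by (auto simp: w_def)
  \<comment> \<open>By the resolvent identity the new image of \<open>y\<close> is \<open>w\<close>
    plus \<delta> times \<open>?N *\<^sub>v w\<close>. The cross term is nonnegative, so the shift
    can only increase the norm.\<close>
  have "w \<bullet> w \<le> (?N *\<^sub>v y) \<bullet> (?N *\<^sub>v y)"
  proof -
    have "(w + \<delta> \<cdot>\<^sub>v (?N *\<^sub>v w)) \<bullet> (w + \<delta> \<cdot>\<^sub>v (?N *\<^sub>v w)) =
      w \<bullet> w + 2 * \<delta> * (w \<bullet> (?N *\<^sub>v w)) + \<delta>\<^sup>2 * ((?N *\<^sub>v w) \<bullet> (?N *\<^sub>v w))"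
      using quad_expand[of "1\<^sub>m p" p w "?N *\<^sub>v w" \<delta>] w by simp
    then show ?thesis unfolding NM[OF y] w_def[symmetric]
      using \<delta>(1) N0[OF w(1)] scalar_prod_self_ge_0[of "?N *\<^sub>v w"] by simp
  qed
  then have z': "\<kappa>\<^sub>2 * frob2 ?M \<le> (?N *\<^sub>v y) \<bullet> (?N *\<^sub>v y)" using z by (simp add: w_def)
  have f0: "0 \<le> frob2 ?M" unfolding frob2_def by (intro sum_nonneg scalar_prod_self_ge_0)
  have "2 * \<delta> * frob2 ?M * (1 + s') \<le> 2 * \<delta> * frob2 ?M * (1 + 2 * \<kappa>\<^sub>1)"
    using s'le f0 \<delta> by (intro mult_left_mono) auto
  also have "\<dots> = (2 * \<delta> * (1 + 2 * \<kappa>\<^sub>1)) * frob2 ?M" by simp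
  also have "\<dots> \<le> \<kappa>\<^sub>2 * frob2 ?M" using \<kappa> f0 by (rule mult_right_mono)
  also note z'
  finally have "2 * \<delta> * frob2 ?M \<le> ((?N *\<^sub>v y) \<bullet> (?N *\<^sub>v y)) / (1 + s')" using s'0 by (simp add: field_simps)
  then show "mtrace (inv_mat (D + (-\<delta>) \<cdot>\<^sub>m 1\<^sub>m p + outer y)) \<le> \<phi>"
    using sherman_morrison(3)[OF E y] trN tr by (simp add: E_def[symmetric] s'_def)
qed

section \<open>Ridge-regularised Gram matrices and leverages\<close>

definition gram :: "nat \<Rightarrow> real \<Rightarrow> nat set \<Rightarrow> (nat \<Rightarrow> real vec) \<Rightarrow> real mat" where
  "gram p \<zeta> J y = Matrix.mat p p (\<lambda>(j, k). (if j = k then \<zeta> else 0) + (\<Sum>i\<in>J. y i $ j * y i $ k))"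

lemma gram_carrier[simp]: "gram p \<zeta> J y \<in> carrier_mat p p"
  by (simp add: gram_def)

lemma gram_sym[simp]: "(gram p \<zeta> J y)\<^sup>T = gram p \<zeta> J y"
  by (rule eq_matI) (auto simp: gram_def mult.commute)

lemma gram_empty: "gram p \<zeta> {} y = \<zeta> \<cdot>\<^sub>m 1\<^sub>m p"
  by (rule eq_matI) (auto simp: gram_def)

lemma gram_insert:
  "finite J \<Longrightarrow> i \<notin> J \<Longrightarrow> y i \<in> carrier_vec p \<Longrightarrow> gram p \<zeta> (insert i J) y = gram p \<zeta> J y + outer (y i)"
  by (rule eq_matI) (auto simp: gram_def outer_def)

lemma quad_gram:
  assumes "finite J" "\<And>i. i \<in> J \<Longrightarrow> y i \<in> carrier_vec p" "v \<in> carrier_vec p"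
  shows "v \<bullet> (gram p \<zeta> J y *\<^sub>v v) = \<zeta> * (v \<bullet> v) + (\<Sum>i\<in>J. (y i \<bullet> v)\<^sup>2)"
  using assms
proof (induction J rule: finite_induct)
  case empty
  then show ?case by (simp add: gram_empty smult_mat_mult_vec[of _ p])
next
  case (insert i J)
  then show ?case by (simp add: gram_insert quad_add_outer[of _ p])
qed

lemma gram_pos_defI:
  assumes "0 < \<beta>" "\<And>v. v \<in> carrier_vec p \<Longrightarrow> \<beta> * (v \<bullet> v) \<le> v \<bullet> (gram p \<zeta> J y *\<^sub>v v)"
  shows "pos_def_mat p (gram p \<zeta> J y)"
proof -
  have "0 < v \<bullet> (gram p \<zeta> J y *\<^sub>v v)" if "v \<in> carrier_vec p" "v \<noteq> 0\<^sub>v p" for v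
  proof -
    have "0 < v \<bullet> v" using scalar_prod_self_ge_0[of v] scalar_prod_self_eq_0_iff[OF that(1)] that(2) by simp
    then have "0 < \<beta> * (v \<bullet> v)" using assms(1) by simp
    then show ?thesis using assms(2)[OF that(1)] by simp
  qed
  then show ?thesis by (simp add: pos_def_mat_def)
qed

lemma quad_gram_ge:
  assumes "finite J" "\<And>i. i \<in> J \<Longrightarrow> y i \<in> carrier_vec p" "v \<in> carrier_vec p"
  shows "\<zeta> * (v \<bullet> v) \<le> v \<bullet> (gram p \<zeta> J y *\<^sub>v v)"
  using quad_gram[OF assms, where \<zeta> = \<zeta>] by (simp add: sum_nonneg)

text \<open>The sum is the trace of \<open>R\<close> times the Gram matrix without its ridge. Since
  \<open>R\<close> inverts the ridged matrix, the identity contributes \<open>p\<close> and the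
  ridge has to be taken off. For \<open>\<zeta> = 0\<close> the leverages add up to \<open>p\<close>
  exactly.\<close>

lemma sum_leverage:
  assumes "finite J" "\<And>i. i \<in> J \<Longrightarrow> y i \<in> carrier_vec p" "pos_def_mat p (gram p \<zeta> J y)"
  defines "R \<equiv> inv_mat (gram p \<zeta> J y)"
  shows "(\<Sum>l\<in>J. y l \<bullet> (R *\<^sub>v y l)) = real p - \<zeta> * mtrace R"
proof -
  have R: "R \<in> carrier_mat p p" "R\<^sup>T = R" using inv_mat_sym[OF assms(3)] by (auto simp: R_def)
  have "(\<Sum>l\<in>J. y l \<bullet> (R *\<^sub>v y l)) = (\<Sum>l\<in>J. \<Sum>j<p. \<Sum>k<p. R $$ (j, k) * (y l $ j * y l $ k))"
    using assms(2) by (intro sum.cong refl, subst mat_vec_scalar_sum[OF R(1)]) (auto intro!: sum.cong)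
  also have "\<dots> = (\<Sum>j<p. \<Sum>l\<in>J. \<Sum>k<p. R $$ (j, k) * (y l $ j * y l $ k))"
    by (rule sum.swap)
  also have "\<dots> = (\<Sum>j<p. \<Sum>k<p. \<Sum>l\<in>J. R $$ (j, k) * (y l $ j * y l $ k))"
    by (intro sum.cong refl sum.swap)
  also have "\<dots> = (\<Sum>j<p. \<Sum>k<p. R $$ (j, k) * (\<Sum>l\<in>J. y l $ j * y l $ k))"
    by (simp only: sum_distrib_left)
  also have "\<dots> = (\<Sum>j<p. \<Sum>k<p. R $$ (j, k) * gram p \<zeta> J y $$ (k, j) - (if j = k then \<zeta> * R $$ (j, j) else 0))"
    by (intro sum.cong refl) (auto simp: gram_def algebra_simps)
  also have "\<dots> = (\<Sum>j<p. (R * gram p \<zeta> J y) $$ (j, j)) - \<zeta> * mtrace R"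
    using R(1) by (simp add: sum_subtractf mtrace_def sum_distrib_left scalar_prod_def lessThan_atLeast0
        carrier_matD[OF gram_carrier[of p \<zeta> J y]])
  also have "R * gram p \<zeta> J y = 1\<^sub>m p" unfolding R_def by (rule inv_mat_inverse(2)[OF assms(3)])
  finally show ?thesis by simp
qed

text \<open>By Sherman--Morrison the leverage is \<open>s / (1 + s)\<close>, where \<open>s\<close>
  is the form of the left-out inverse at the left-out row. Removing one row changes the trace by at
  most \<open>1 / \<beta>\<close>, so \<open>s\<close> is close to \<tau>, and
  \<open>x / (1 + x)\<close> is a contraction on nonnegative reals. The target no longer depends on
  \<open>l\<close>.\<close>

lemma leverage_deviation:
  assumes J: "finite J" "\<And>i. i \<in> J \<Longrightarrow> y i \<in> carrier_vec p" and l: "l \<in> J" and \<beta>: "0 < \<beta>"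
    and ge: "\<And>v. v \<in> carrier_vec p \<Longrightarrow> \<beta> * (v \<bullet> v) \<le> v \<bullet> (gram p \<zeta> (J - {l}) y *\<^sub>v v)"
    and dev: "\<bar>y l \<bullet> (inv_mat (gram p \<zeta> (J - {l}) y) *\<^sub>v y l) - mtrace (inv_mat (gram p \<zeta> (J - {l}) y))\<bar> \<le> e"
  defines "\<tau> \<equiv> mtrace (inv_mat (gram p \<zeta> J y))"
  shows "pos_def_mat p (gram p \<zeta> J y)"
    and "0 \<le> \<tau>" and "\<bar>y l \<bullet> (inv_mat (gram p \<zeta> J y) *\<^sub>v y l) - \<tau> / (1 + \<tau>)\<bar> \<le> e + 1 / \<beta>"
proof -
  define A where "A = gram p \<zeta> (J - {l}) y"
  have A: "pos_def_mat p A" unfolding A_def by (rule gram_pos_defI[OF \<beta> ge])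
  have yl: "y l \<in> carrier_vec p" using J l by simp
  have eq: "gram p \<zeta> J y = A + outer (y l)"
    using gram_insert[of "J - {l}" l y p \<zeta>] J l by (simp add: A_def insert_absorb)
  show pd: "pos_def_mat p (gram p \<zeta> J y)" unfolding eq by (rule pos_def_add_outer[OF A yl])
  show \<tau>0: "0 \<le> \<tau>" unfolding \<tau>_def by (rule psd_trace_ge_0[OF pos_def_psd[OF inv_mat_pos_def[OF pd]]])
  define s where "s = y l \<bullet> (inv_mat A *\<^sub>v y l)"
  define w where "w = inv_mat A *\<^sub>v y l"
  note sm = sherman_morrison[OF A yl, folded s_def w_def eq]
  have "w \<bullet> w \<le> s / \<beta>" unfolding w_def s_def
    by (rule inv_mat_bounds(1)[OF A \<beta> yl]) (use ge in \<open>simp add: A_def\<close>)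
  then have "(w \<bullet> w) / (1 + s) \<le> (s / \<beta>) / (1 + s)" using sm(1) by (intro divide_right_mono) auto
  also have "\<dots> = (s / (1 + s)) / \<beta>" by (simp add: mult.commute)
  also have "\<dots> \<le> 1 / \<beta>" using sm(1) \<beta> by (intro divide_right_mono) auto
  finally have 1: "(w \<bullet> w) / (1 + s) \<le> 1 / \<beta>" .
  have 2: "0 \<le> (w \<bullet> w) / (1 + s)" using sm(1) scalar_prod_self_ge_0[of w] by simp
  have dev': "\<bar>s - mtrace (inv_mat A)\<bar> \<le> e" using dev by (simp add: A_def s_def)
  have s\<tau>: "\<bar>s - \<tau>\<bar> \<le> e + 1 / \<beta>" using sm(3) 1 2 dev' unfolding \<tau>_def by linarith
  have "s / (1 + s) - \<tau> / (1 + \<tau>) = (s - \<tau>) / ((1 + s) * (1 + \<tau>))"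
    using sm(1) \<tau>0 by (simp add: field_simps)
  also have "\<bar>\<dots>\<bar> = \<bar>s - \<tau>\<bar> / ((1 + s) * (1 + \<tau>))" using sm(1) \<tau>0 by (simp add: abs_divide)
  also have "\<dots> \<le> \<bar>s - \<tau>\<bar> / 1"
    using sm(1) \<tau>0 by (intro divide_left_mono) (auto simp: algebra_simps add_pos_nonneg)
  finally show "\<bar>y l \<bullet> (inv_mat (gram p \<zeta> J y) *\<^sub>v y l) - \<tau> / (1 + \<tau>)\<bar> \<le> e + 1 / \<beta>"
    using s\<tau> sm(2) by simp
qed

section \<open>The positive definite square root\<close>

lemma mtrace_mult_comm:
  assumes "A \<in> carrier_mat p p" "B \<in> carrier_mat p p"
  shows "mtrace (A * B) = mtrace (B * A)"
proof -
  have "mtrace (A * B) = (\<Sum>j<p. \<Sum>k<p. A $$ (j, k) * B $$ (k, j))"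
    using assms by (simp add: mtrace_def scalar_prod_def lessThan_atLeast0)
  also have "\<dots> = (\<Sum>k<p. \<Sum>j<p. A $$ (j, k) * B $$ (k, j))" by (rule sum.swap)
  also have "\<dots> = mtrace (B * A)"
    using assms by (simp add: mtrace_def scalar_prod_def lessThan_atLeast0 mult.commute)
  finally show ?thesis .
qed

lemma mtrace_add: "A \<in> carrier_mat p p \<Longrightarrow> B \<in> carrier_mat p p \<Longrightarrow> mtrace (A + B) = mtrace A + mtrace B"
  by (simp add: mtrace_def sum.distrib)

text \<open>The difference \<open>X\<close> satisfies \<open>X * B + C * X = 0\<close>. Multiplying
  by \<open>X\<close> and taking the trace gives two nonnegative sums, of the forms of
  \<open>B\<close> and \<open>C\<close> at the columns of \<open>X\<close>, with total zero;
  definiteness of \<open>B\<close> then annihilates every column.\<close>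

lemma pos_def_sqrt_unique:
  assumes B: "pos_def_mat p B" and C: "pos_def_mat p C" and eq: "B * B = C * C"
  shows "B = C"
proof -
  note Bd = pos_def_matD[OF B] and Cd = pos_def_matD[OF C]
  define X where "X = B - C"
  have X: "X \<in> carrier_mat p p" unfolding X_def using Cd(1) by (rule minus_carrier_mat)
  have Xsym: "X\<^sup>T = X" using Bd Cd by (simp add: X_def transpose_minus)
  have "X * B + C * X = (B * B - C * B) + (C * B - C * C)"
    unfolding X_def using Bd Cd
    by (simp add: minus_mult_distrib_mat[of _ p p] mult_minus_distrib_mat[of _ p p])
  also have "\<dots> = 0\<^sub>m p p" using Bd(1) Cd(1) eq by (intro eq_matI) auto
  finally have zero: "X * B + C * X = 0\<^sub>m p p" .
  have tr_quad: "mtrace (X * (D * X)) = (\<Sum>k<p. (X *\<^sub>v unit_vec p k) \<bullet> (D *\<^sub>v (X *\<^sub>v unit_vec p k)))"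
    if "D \<in> carrier_mat p p" for D
  proof -
    have "unit_vec p k \<bullet> ((X * (D * X)) *\<^sub>v unit_vec p k) = (X *\<^sub>v unit_vec p k) \<bullet> (D *\<^sub>v (X *\<^sub>v unit_vec p k))"
      if k: "k < p" for k
    proof -
      let ?e = "unit_vec p k :: real vec"
      have c: "X *\<^sub>v ?e \<in> carrier_vec p" "D *\<^sub>v (X *\<^sub>v ?e) \<in> carrier_vec p" using X \<open>D \<in> carrier_mat p p\<close> by auto
      have "(X * (D * X)) *\<^sub>v ?e = X *\<^sub>v (D *\<^sub>v (X *\<^sub>v ?e))"
        using X \<open>D \<in> carrier_mat p p\<close> by (simp add: assoc_mult_mat_vec[of _ p p _ p])
      then show ?thesis using sym_mat_swap[OF X Xsym, of ?e "D *\<^sub>v (X *\<^sub>v ?e)"] c by simp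
    qed
    then show ?thesis using X that by (subst mtrace_unit[of _ p]) (auto intro!: sum.cong)
  qed
  have "0 = mtrace (X * (X * B + C * X))" using X by (simp add: zero mtrace_def)
  also have "\<dots> = mtrace (X * (X * B)) + mtrace (X * (C * X))"
  proof -
    have "X * (X * B + C * X) = X * (X * B) + X * (C * X)"
      using X Bd(1) Cd(1) by (intro mult_add_distrib_mat[of _ p p]) auto
    moreover have "X * (X * B) \<in> carrier_mat p p" "X * (C * X) \<in> carrier_mat p p" using X Bd(1) Cd(1) by auto
    ultimately show ?thesis by (simp add: mtrace_add[of _ p])
  qed
  also have "mtrace (X * (X * B)) = mtrace (X * (B * X))"
    using X Bd mtrace_mult_comm[of X p "X * B"] by (simp add: assoc_mult_mat[of _ p p _ p _ p])
  finally have sum0: "(\<Sum>k<p. (X *\<^sub>v unit_vec p k) \<bullet> (B *\<^sub>v (X *\<^sub>v unit_vec p k)))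
      + (\<Sum>k<p. (X *\<^sub>v unit_vec p k) \<bullet> (C *\<^sub>v (X *\<^sub>v unit_vec p k))) = 0"
    using tr_quad Bd Cd by simp
  have Bnn: "0 \<le> (X *\<^sub>v unit_vec p k) \<bullet> (B *\<^sub>v (X *\<^sub>v unit_vec p k))" for k
    using psd_matD(3)[OF pos_def_psd[OF B]] X by simp
  have Cnn: "0 \<le> (X *\<^sub>v unit_vec p k) \<bullet> (C *\<^sub>v (X *\<^sub>v unit_vec p k))" for k
    using psd_matD(3)[OF pos_def_psd[OF C]] X by simp
  have "(\<Sum>k<p. (X *\<^sub>v unit_vec p k) \<bullet> (B *\<^sub>v (X *\<^sub>v unit_vec p k))) = 0"
    using sum0 
      sum_nonneg[of "{..<p}" "\<lambda>k. (X *\<^sub>v unit_vec p k) \<bullet> (B *\<^sub>v (X *\<^sub>v unit_vec p k))", OF Bnn]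
      sum_nonneg[of "{..<p}" "\<lambda>k. (X *\<^sub>v unit_vec p k) \<bullet> (C *\<^sub>v (X *\<^sub>v unit_vec p k))", OF Cnn] by linarith
  then have "\<forall>k\<in>{..<p}. (X *\<^sub>v unit_vec p k) \<bullet> (B *\<^sub>v (X *\<^sub>v unit_vec p k)) = 0"
    by (subst (asm) sum_nonneg_eq_0_iff) (auto intro: Bnn)
  then have B0: "(X *\<^sub>v unit_vec p k) \<bullet> (B *\<^sub>v (X *\<^sub>v unit_vec p k)) = 0" if "k < p" for k
    using that by simp
  have Xe: "X *\<^sub>v unit_vec p k = 0\<^sub>v p" if k: "k < p" for k
  proof (rule ccontr)
    assume "X *\<^sub>v unit_vec p k \<noteq> 0\<^sub>v p"
    then have "0 < (X *\<^sub>v unit_vec p k) \<bullet> (B *\<^sub>v (X *\<^sub>v unit_vec p k))"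
      using X by (intro Bd(3)) auto
    then show False using B0[OF k] by simp
  qed
  have "X $$ (i, k) = 0" if "i < p" "k < p" for i k
    using Xe[OF that(2)] unit_vec_mat[OF X that] that by simp
  then have "B $$ (i, k) = C $$ (i, k)" if "i < p" "k < p" for i k
    using that Bd Cd by (auto simp: X_def)
  then show "B = C" using Bd Cd by (intro eq_matI) auto
qed

text \<open>Operator norm at most \<open>c\<close>, phrased for the bilinear form: unit vectors then
  bound the entries, and such bounds add and multiply.\<close>

definition op_bound :: "nat \<Rightarrow> real \<Rightarrow> real mat \<Rightarrow> bool" where
  "op_bound p c Y \<longleftrightarrow> Y \<in> carrier_mat p p \<and>
    (\<forall>v \<in> carrier_vec p. \<forall>w \<in> carrier_vec p. \<bar>v \<bullet> (Y *\<^sub>v w)\<bar> \<le> c * (eucl_norm v * eucl_norm w))"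

lemma eucl_norm_ge_0[simp]: "0 \<le> eucl_norm v"
  by (simp add: eucl_norm_def scalar_prod_self_ge_0)

lemma eucl_norm_sq: "(eucl_norm v)\<^sup>2 = v \<bullet> v"
  by (simp add: eucl_norm_def scalar_prod_self_ge_0)

text \<open>Test the bilinear form at \<open>Y *\<^sub>v w\<close> itself and cancel one factor of
  its norm.\<close>

lemma op_bound_vec:
  assumes "op_bound p c Y" "0 \<le> c" "w \<in> carrier_vec p"
  shows "eucl_norm (Y *\<^sub>v w) \<le> c * eucl_norm w"
proof -
  have Yw: "Y *\<^sub>v w \<in> carrier_vec p" using assms by (auto simp: op_bound_def)
  have "(eucl_norm (Y *\<^sub>v w))\<^sup>2 \<le> c * (eucl_norm (Y *\<^sub>v w) * eucl_norm w)"
    using assms Yw abs_ge_self order_trans unfolding eucl_norm_sq op_bound_def by blast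
  then show ?thesis using assms(2) mult_left_le_imp_le[of "eucl_norm (Y *\<^sub>v w)" "eucl_norm (Y *\<^sub>v w)" "c * eucl_norm w"]
    by (cases "eucl_norm (Y *\<^sub>v w) = 0") (auto simp: power2_eq_square algebra_simps less_le)
qed

lemma op_bound_mult:
  assumes "op_bound p a Y" "op_bound p b Z" "0 \<le> a" "0 \<le> b"
  shows "op_bound p (a * b) (Y * Z)"
  unfolding op_bound_def
proof (intro conjI ballI)
  have c: "Y \<in> carrier_mat p p" "Z \<in> carrier_mat p p" using assms by (auto simp: op_bound_def)
  then show "Y * Z \<in> carrier_mat p p" by simp
  fix v w :: "real vec" assume vw: "v \<in> carrier_vec p" "w \<in> carrier_vec p"
  have Zw: "Z *\<^sub>v w \<in> carrier_vec p" using c vw by auto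
  have "\<bar>v \<bullet> ((Y * Z) *\<^sub>v w)\<bar> = \<bar>v \<bullet> (Y *\<^sub>v (Z *\<^sub>v w))\<bar>" using c vw by (simp add: assoc_mult_mat_vec[of _ p p _ p])
  also have "\<dots> \<le> a * (eucl_norm v * eucl_norm (Z *\<^sub>v w))" using assms vw Zw by (auto simp: op_bound_def)
  also have "\<dots> \<le> a * (eucl_norm v * (b * eucl_norm w))"
    using assms op_bound_vec[OF assms(2,4) vw(2)] by (intro mult_left_mono) auto
  finally show "\<bar>v \<bullet> ((Y * Z) *\<^sub>v w)\<bar> \<le> a * b * (eucl_norm v * eucl_norm w)" by (simp add: algebra_simps)
qed

lemma op_bound_add:
  assumes "op_bound p a Y" "op_bound p b Z"
  shows "op_bound p (a + b) (Y + Z)"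
  unfolding op_bound_def
proof (intro conjI ballI)
  have c: "Y \<in> carrier_mat p p" "Z \<in> carrier_mat p p" using assms by (auto simp: op_bound_def)
  then show "Y + Z \<in> carrier_mat p p" by simp
  fix v w :: "real vec" assume vw: "v \<in> carrier_vec p" "w \<in> carrier_vec p"
  have Zw: "Z *\<^sub>v w \<in> carrier_vec p" "Y *\<^sub>v w \<in> carrier_vec p" using c vw by auto
  have "v \<bullet> ((Y + Z) *\<^sub>v w) = v \<bullet> (Y *\<^sub>v w) + v \<bullet> (Z *\<^sub>v w)"
    using c vw Zw by (simp add: add_mult_distrib_mat_vec[of _ p p] scalar_prod_add_distrib[of _ p])
  moreover have "\<bar>v \<bullet> (Y *\<^sub>v w)\<bar> \<le> a * (eucl_norm v * eucl_norm w)" "\<bar>v \<bullet> (Z *\<^sub>v w)\<bar> \<le> b * (eucl_norm v * eucl_norm w)"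
    using assms vw by (auto simp: op_bound_def)
  ultimately show "\<bar>v \<bullet> ((Y + Z) *\<^sub>v w)\<bar> \<le> (a + b) * (eucl_norm v * eucl_norm w)"
    by (simp add: distrib_right)
qed

lemma op_bound_smult:
  assumes "op_bound p a Y" shows "op_bound p (\<bar>k\<bar> * a) (k \<cdot>\<^sub>m Y)"
  unfolding op_bound_def
proof (intro conjI ballI)
  have c: "Y \<in> carrier_mat p p" using assms by (auto simp: op_bound_def)
  then show "k \<cdot>\<^sub>m Y \<in> carrier_mat p p" by simp
  fix v w :: "real vec" assume vw: "v \<in> carrier_vec p" "w \<in> carrier_vec p"
  have "Y *\<^sub>v w \<in> carrier_vec p" using c vw by auto
  then have "v \<bullet> ((k \<cdot>\<^sub>m Y) *\<^sub>v w) = k * (v \<bullet> (Y *\<^sub>v w))"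
    using c vw by (simp add: smult_mat_mult_vec[of _ p])
  moreover have "\<bar>k\<bar> * \<bar>v \<bullet> (Y *\<^sub>v w)\<bar> \<le> \<bar>k\<bar> * (a * (eucl_norm v * eucl_norm w))"
    using assms vw by (intro mult_left_mono) (auto simp: op_bound_def)
  ultimately show "\<bar>v \<bullet> ((k \<cdot>\<^sub>m Y) *\<^sub>v w)\<bar> \<le> \<bar>k\<bar> * a * (eucl_norm v * eucl_norm w)"
    by (simp add: abs_mult algebra_simps)
qed

lemma op_bound_mono: "op_bound p a Y \<Longrightarrow> a \<le> b \<Longrightarrow> op_bound p b Y"
  unfolding op_bound_def
proof (intro conjI ballI; elim conjE)
  fix v w :: "real vec" assume "a \<le> b" "v \<in> carrier_vec p" "w \<in> carrier_vec p"
    "\<forall>v \<in> carrier_vec p. \<forall>w \<in> carrier_vec p. \<bar>v \<bullet> (Y *\<^sub>v w)\<bar> \<le> a * (eucl_norm v * eucl_norm w)"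
  then have "\<bar>v \<bullet> (Y *\<^sub>v w)\<bar> \<le> a * (eucl_norm v * eucl_norm w)" by blast
  also have "\<dots> \<le> b * (eucl_norm v * eucl_norm w)"
    using \<open>a \<le> b\<close> by (intro mult_right_mono) auto
  finally show "\<bar>v \<bullet> (Y *\<^sub>v w)\<bar> \<le> b * (eucl_norm v * eucl_norm w)" .
qed

lemma sym_mat_smult: assumes "A\<^sup>T = A" shows "(k \<cdot>\<^sub>m A)\<^sup>T = k \<cdot>\<^sub>m (A :: real mat)"
proof -
  have "(k \<cdot>\<^sub>m A)\<^sup>T = k \<cdot>\<^sub>m A\<^sup>T" by (intro eq_matI) auto
  then show ?thesis unfolding assms .
qed

text \<open>For semidefinite matrices the values on the diagonal \<open>v = w\<close> control the
  whole bilinear form, by Cauchy--Schwarz in the form of \<open>X\<close>.\<close>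

lemma psd_op_bound:
  assumes "psd_mat p X" "0 \<le> c" "\<And>v. v \<in> carrier_vec p \<Longrightarrow> v \<bullet> (X *\<^sub>v v) \<le> c * (v \<bullet> v)"
  shows "op_bound p c X"
  unfolding op_bound_def
proof (intro conjI ballI)
  show "X \<in> carrier_mat p p" by (rule psd_matD(1)[OF assms(1)])
  fix v w :: "real vec" assume vw: "v \<in> carrier_vec p" "w \<in> carrier_vec p"
  have vnn: "0 \<le> v \<bullet> v" "0 \<le> w \<bullet> (X *\<^sub>v w)"
    by (rule scalar_prod_self_ge_0, rule psd_matD(3)[OF assms(1) vw(2)])
  have "(v \<bullet> (X *\<^sub>v w))\<^sup>2 \<le> (v \<bullet> (X *\<^sub>v v)) * (w \<bullet> (X *\<^sub>v w))" by (rule psd_cauchy_schwarz[OF assms(1) vw])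
  also have "\<dots> \<le> (c * (v \<bullet> v)) * (c * (w \<bullet> w))"
    by (rule mult_mono[OF assms(3)[OF vw(1)] assms(3)[OF vw(2)] mult_nonneg_nonneg[OF assms(2) vnn(1)] vnn(2)])
  also have "\<dots> = (c * (eucl_norm v * eucl_norm w))\<^sup>2"
    by (simp only: power_mult_distrib eucl_norm_sq power2_eq_square[of c] mult_ac)
  finally have sq: "(v \<bullet> (X *\<^sub>v w))\<^sup>2 \<le> (c * (eucl_norm v * eucl_norm w))\<^sup>2" .
  have "0 \<le> c * (eucl_norm v * eucl_norm w)" using assms(2) by simp
  then show "\<bar>v \<bullet> (X *\<^sub>v w)\<bar> \<le> c * (eucl_norm v * eucl_norm w)"
    using sq abs_le_square_iff[of "v \<bullet> (X *\<^sub>v w)" "c * (eucl_norm v * eucl_norm w)"] by linarith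
qed

lemma op_bound_entry:
  assumes "op_bound p c Y" "i < p" "j < p" shows "\<bar>Y $$ (i, j)\<bar> \<le> c"
proof -
  have "\<bar>unit_vec p i \<bullet> (Y *\<^sub>v unit_vec p j)\<bar> \<le> c * (eucl_norm (unit_vec p i) * eucl_norm (unit_vec p j))"
    using assms by (auto simp: op_bound_def)
  then show ?thesis using assms unit_vec_mat[of Y p i j] by (simp add: op_bound_def eucl_norm_def)
qed

lemma quad_one_add_smult:
  fixes A :: "real mat"
  assumes "A \<in> carrier_mat p p" "v \<in> carrier_vec p"
  shows "v \<bullet> ((1\<^sub>m p + k \<cdot>\<^sub>m A) *\<^sub>v v) = v \<bullet> v + k * (v \<bullet> (A *\<^sub>v v))"
proof -
  have "(1\<^sub>m p + k \<cdot>\<^sub>m A) *\<^sub>v v = v + k \<cdot>\<^sub>v (A *\<^sub>v v)"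
    using assms by (simp add: add_mult_distrib_mat_vec[of _ p p] smult_mat_mult_vec[of _ p])
  then show ?thesis using assms by (simp add: scalar_prod_add_distrib[of _ p] scalar_prod_smult_distrib[of _ p])
qed

text \<open>\<open>1 - A\<^sup>1\<^sup>/\<^sup>2\<close> is the fixed point of the contraction \<open>Y \<mapsto> (1 - A + Y\<^sup>2) / 2\<close>.\<close>

lemma pos_def_sqrt_contraction:
  assumes A: "A \<in> carrier_mat p p" "A\<^sup>T = A" and \<epsilon>: "0 < \<epsilon>" "\<epsilon> \<le> 1"
    and lo: "\<And>v. v \<in> carrier_vec p \<Longrightarrow> \<epsilon> * (v \<bullet> v) \<le> v \<bullet> (A *\<^sub>v v)"
    and hi: "\<And>v. v \<in> carrier_vec p \<Longrightarrow> v \<bullet> (A *\<^sub>v v) \<le> v \<bullet> v"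
  shows "\<exists>B. pos_def_mat p B \<and> B * B = A"
proof -
  define X where "X = 1\<^sub>m p + (-1) \<cdot>\<^sub>m A"
  define \<rho> where "\<rho> = 1 - \<epsilon>"
  have \<rho>: "0 \<le> \<rho>" "\<rho> < 1" using \<epsilon> by (auto simp: \<rho>_def)
  have X: "X \<in> carrier_mat p p" using A(1) by (simp add: X_def)
  have Xsym: "X\<^sup>T = X" unfolding X_def
    by (rule sym_matrix_add[of _ p], use A in simp, use A in simp, simp, rule sym_mat_smult, rule A(2))
  have Xv: "v \<bullet> (X *\<^sub>v v) = v \<bullet> v - v \<bullet> (A *\<^sub>v v)" if "v \<in> carrier_vec p" for v
    unfolding X_def quad_one_add_smult[OF A(1) that] by simp
  have Xb: "op_bound p \<rho> X"
  proof (rule psd_op_bound[OF _ \<rho>(1)])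
    show "psd_mat p X" unfolding psd_mat_def
    proof (intro conjI ballI)
      show "0 \<le> v \<bullet> (X *\<^sub>v v)" if "v \<in> carrier_vec p" for v unfolding Xv[OF that] using hi[OF that] by linarith
    qed (rule X Xsym)+
    show "v \<bullet> (X *\<^sub>v v) \<le> \<rho> * (v \<bullet> v)" if "v \<in> carrier_vec p" for v
      unfolding Xv[OF that] \<rho>_def left_diff_distrib using lo[OF that] by linarith
  qed
  define Y where "Y = rec_nat (0\<^sub>m p p) (\<lambda>_ Z. (1/2) \<cdot>\<^sub>m (X + Z * Z))"
  have Y0: "Y 0 = 0\<^sub>m p p" and YS: "Y (Suc k) = (1/2) \<cdot>\<^sub>m (X + Y k * Y k)" for k by (auto simp: Y_def)
  have Yb: "op_bound p \<rho> (Y k)" for k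
  proof (induction k)
    case 0
    have "(0\<^sub>m p p :: real mat) *\<^sub>v w = 0\<^sub>v p" if "w \<in> carrier_vec p" for w
      using that by (intro eq_vecI) auto
    then show ?case using \<rho> by (auto simp: Y0 op_bound_def)
  next
    case (Suc k)
    have "op_bound p (\<bar>1/2\<bar> * (\<rho> + \<rho> * \<rho>)) (Y (Suc k))"
      unfolding YS by (intro op_bound_smult op_bound_add op_bound_mult Xb Suc \<rho>)
    \<comment> \<open>The ball of radius \<rho> is invariant under the iteration because \<rho> is
      below 1.\<close>
    moreover have "\<bar>1/2\<bar> * (\<rho> + \<rho> * \<rho>) \<le> \<rho>" using \<rho> by (simp add: mult_left_le)
    ultimately show ?case by (rule op_bound_mono)
  qed
  have Yc: "Y k \<in> carrier_mat p p" for k using Yb by (auto simp: op_bound_def)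
  have Ysym: "(Y k)\<^sup>T = Y k" for k
  proof (induction k)
    case 0
    show ?case by (simp add: Y0)
  next
    case (Suc k)
    have YY: "Y k * Y k \<in> carrier_mat p p" using Yc[of k] by simp
    have "(Y k * Y k)\<^sup>T = Y k * Y k" using transpose_mult[OF Yc[of k] Yc[of k]] Suc by simp
    then have "(X + Y k * Y k)\<^sup>T = X + Y k * Y k" using sym_matrix_add[OF X YY Xsym] by simp
    then show ?case unfolding YS by (rule sym_mat_smult)
  qed
  have Yd: "op_bound p (\<rho> ^ Suc k) (Y (Suc k) + (-1) \<cdot>\<^sub>m Y k)" for k
  proof (induction k)
    case 0
    have "Y (Suc 0) + (-1) \<cdot>\<^sub>m Y 0 = (1/2) \<cdot>\<^sub>m X" unfolding YS Y0 using X by (intro eq_matI) auto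
    then have "op_bound p (\<bar>1/2\<bar> * \<rho>) (Y (Suc 0) + (-1) \<cdot>\<^sub>m Y 0)" using op_bound_smult[OF Xb, of "1/2"] by simp
    moreover have "\<bar>1/2\<bar> * \<rho> \<le> \<rho>" using \<rho> by simp
    ultimately have "op_bound p \<rho> (Y (Suc 0) + (-1) \<cdot>\<^sub>m Y 0)" by (rule op_bound_mono)
    then show ?case by simp
  next
    case (Suc k)
    let ?D = "Y (Suc k) + (-1) \<cdot>\<^sub>m Y k"
    have c: "Y k \<in> carrier_mat p p" "Y (Suc k) \<in> carrier_mat p p" by (rule Yc)+
    have D: "?D \<in> carrier_mat p p" using c by simp
    have e1: "Y (Suc k) * ?D = Y (Suc k) * Y (Suc k) + (-1) \<cdot>\<^sub>m (Y (Suc k) * Y k)"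
      using c by (simp add: mult_add_distrib_mat[of _ p p _ p] mult_smult_distrib[of _ p p _ p])
    have e2: "?D * Y k = Y (Suc k) * Y k + (-1) \<cdot>\<^sub>m (Y k * Y k)"
      using c by (simp add: add_mult_distrib_mat[of _ p p] mult_smult_assoc_mat[of _ p p _ p])
    \<comment> \<open>The difference of two squares is split as
      \<open>Y (Suc k) * ?D + ?D * Y k\<close>, an identity that holds whether or not the iterates
      commute. Both terms have norm at most \<rho> times that of \<open>?D\<close>.\<close>
    have "Y (Suc (Suc k)) + (-1) \<cdot>\<^sub>m Y (Suc k) = (1/2) \<cdot>\<^sub>m (Y (Suc k) * ?D + ?D * Y k)"
    proof -
      define a b d where "a = Y (Suc k) * Y (Suc k)" and "b = Y (Suc k) * Y k" and "d = Y k * Y k"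
      have abc: "a \<in> carrier_mat p p" "b \<in> carrier_mat p p" "d \<in> carrier_mat p p"
        using c by (auto simp: a_def b_def d_def)
      have "Y (Suc (Suc k)) + (-1) \<cdot>\<^sub>m Y (Suc k) = (1/2) \<cdot>\<^sub>m (X + a) + (-1) \<cdot>\<^sub>m ((1/2) \<cdot>\<^sub>m (X + d))"
        by (simp only: YS a_def d_def)
      also have "\<dots> = (1/2) \<cdot>\<^sub>m ((a + (-1) \<cdot>\<^sub>m b) + (b + (-1) \<cdot>\<^sub>m d))"
        using abc X by (intro eq_matI) (auto simp: add_divide_distrib diff_divide_distrib)
      finally show ?thesis unfolding e1 e2 a_def b_def d_def .
    qed
    moreover have "op_bound p (\<bar>1/2\<bar> * (\<rho> * \<rho> ^ Suc k + \<rho> ^ Suc k * \<rho>)) ((1/2) \<cdot>\<^sub>m (Y (Suc k) * ?D + ?D * Y k))"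
      by (intro op_bound_smult op_bound_add op_bound_mult Yb Suc \<rho> zero_le_power)
    moreover have "\<bar>1/2\<bar> * (\<rho> * \<rho> ^ Suc k + \<rho> ^ Suc k * \<rho>) = \<rho> ^ Suc (Suc k)" by simp
    ultimately show ?case by (simp only:)
  qed
  have conv: "convergent (\<lambda>k. Y k $$ (i, j))" if ij: "i < p" "j < p" for i j
  proof -
    have "summable (\<lambda>k. Y (Suc k) $$ (i, j) - Y k $$ (i, j))"
    proof (rule summable_comparison_test')
      show "summable (\<lambda>k. \<rho> ^ Suc k)" using \<rho> by (subst summable_Suc_iff) (simp add: summable_geometric)
      show "norm (Y (Suc k) $$ (i, j) - Y k $$ (i, j)) \<le> \<rho> ^ Suc k" if "0 \<le> k" for k
        using op_bound_entry[OF Yd ij, of k] Yc[of k] Yc[of "Suc k"] ij by simp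
    qed
    then have "convergent (\<lambda>n. \<Sum>k<n. Y (Suc k) $$ (i, j) - Y k $$ (i, j))" by (simp add: summable_iff_convergent)
    then have "convergent (\<lambda>n. Y n $$ (i, j) - Y 0 $$ (i, j))"
      by (simp add: sum_lessThan_telescope[of "\<lambda>k. Y k $$ (i, j)"])
    then show ?thesis by (simp add: convergent_diff_const_right_iff)
  qed
  define Z where "Z = Matrix.mat p p (\<lambda>(i, j). lim (\<lambda>k. Y k $$ (i, j)))"
  have Zc: "Z \<in> carrier_mat p p" by (simp add: Z_def)
  have lim: "(\<lambda>k. Y k $$ (i, j)) \<longlonglongrightarrow> Z $$ (i, j)" if "i < p" "j < p" for i j
    using conv[OF that] that by (simp add: Z_def convergent_LIMSEQ_iff)
  have Zsym: "Z\<^sup>T = Z"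
    using sym_mat_entry[OF Yc Ysym] by (intro eq_matI) (auto simp: Z_def)
  have ZZ: "2 \<cdot>\<^sub>m Z = X + Z * Z"
  proof (rule eq_matI)
    fix i j assume "i < dim_row (X + Z * Z)" "j < dim_col (X + Z * Z)"
    then have ij: "i < p" "j < p" using X Zc by auto
    have "(\<lambda>k. (1/2) * (X $$ (i, j) + (\<Sum>l<p. Y k $$ (i, l) * Y k $$ (l, j)))) \<longlonglongrightarrow>
        (1/2) * (X $$ (i, j) + (\<Sum>l<p. Z $$ (i, l) * Z $$ (l, j)))"
      using lim ij by (intro tendsto_intros) auto
    moreover have "(1/2) * (X $$ (i, j) + (\<Sum>l<p. Y k $$ (i, l) * Y k $$ (l, j))) = Y (Suc k) $$ (i, j)" for k
      unfolding YS using Yc[of k] X ij by (simp add: scalar_prod_def lessThan_atLeast0)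
    ultimately have "(\<lambda>k. Y (Suc k) $$ (i, j)) \<longlonglongrightarrow> (1/2) * (X $$ (i, j) + (\<Sum>l<p. Z $$ (i, l) * Z $$ (l, j)))" by simp
    moreover have "(\<lambda>k. Y (Suc k) $$ (i, j)) \<longlonglongrightarrow> Z $$ (i, j)" using lim[OF ij] by (rule LIMSEQ_Suc)
    ultimately have "Z $$ (i, j) = (1/2) * (X $$ (i, j) + (\<Sum>l<p. Z $$ (i, l) * Z $$ (l, j)))"
      by (rule LIMSEQ_unique[symmetric])
    then show "(2 \<cdot>\<^sub>m Z) $$ (i, j) = (X + Z * Z) $$ (i, j)"
      using Zc X ij by (simp add: scalar_prod_def lessThan_atLeast0)
  qed (use X Zc in auto)
  \<comment> \<open>The forms of the iterates stay below \<rho>, and this survives the limit. Hence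
    the form of \<open>1 - Z\<close> is at least \<open>1 - \<rho> = \<epsilon>\<close>, which makes
    the root positive definite.\<close>
  have Zle: "v \<bullet> (Z *\<^sub>v v) \<le> \<rho> * (v \<bullet> v)" if v: "v \<in> carrier_vec p" for v
  proof (rule LIMSEQ_le_const2)
    show "(\<lambda>k. v \<bullet> (Y k *\<^sub>v v)) \<longlonglongrightarrow> v \<bullet> (Z *\<^sub>v v)"
      unfolding mat_vec_scalar_sum[OF Yc v v] mat_vec_scalar_sum[OF Zc v v]
      using lim by (intro tendsto_intros) auto
    show "\<exists>N. \<forall>k\<ge>N. v \<bullet> (Y k *\<^sub>v v) \<le> \<rho> * (v \<bullet> v)"
    proof (intro exI allI impI)
      fix k
      have "\<bar>v \<bullet> (Y k *\<^sub>v v)\<bar> \<le> \<rho> * (eucl_norm v * eucl_norm v)" using Yb v by (auto simp: op_bound_def)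
      then show "v \<bullet> (Y k *\<^sub>v v) \<le> \<rho> * (v \<bullet> v)" by (simp add: eucl_norm_sq[symmetric] power2_eq_square)
    qed
  qed
  define B where "B = 1\<^sub>m p + (-1) \<cdot>\<^sub>m Z"
  have Bc: "B \<in> carrier_mat p p" using Zc by (simp add: B_def)
  have "pos_def_mat p B"
    unfolding pos_def_mat_def
  proof (intro conjI ballI impI)
    show "B\<^sup>T = B" unfolding B_def
      by (rule sym_matrix_add[of _ p], use Zc in simp, use Zc in simp, simp, rule sym_mat_smult, rule Zsym)
    fix v :: "real vec" assume v: "v \<in> carrier_vec p" "v \<noteq> 0\<^sub>v p"
    have "v \<bullet> (B *\<^sub>v v) = v \<bullet> v - v \<bullet> (Z *\<^sub>v v)"
      unfolding B_def quad_one_add_smult[OF Zc v(1)] by simp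
    then have 1: "(1 - \<rho>) * (v \<bullet> v) \<le> v \<bullet> (B *\<^sub>v v)" using Zle[OF v(1)] by (simp add: left_diff_distrib)
    have "0 < v \<bullet> v" using scalar_prod_self_ge_0[of v] scalar_prod_self_eq_0_iff[OF v(1)] v(2) by simp
    then have "0 < (1 - \<rho>) * (v \<bullet> v)" using \<rho> by simp
    then show "0 < v \<bullet> (B *\<^sub>v v)" using 1 by linarith
  qed (rule Bc)
  moreover have "B * B = A"
  proof -
    have ZZc: "Z * Z \<in> carrier_mat p p" using Zc by simp
    have "B * B = B + (-1) \<cdot>\<^sub>m (Z * B)"
    proof -
      have "B * B = (1\<^sub>m p + (-1) \<cdot>\<^sub>m Z) * B" by (simp add: B_def)
      also have "\<dots> = 1\<^sub>m p * B + ((-1) \<cdot>\<^sub>m Z) * B" using Bc Zc by (intro add_mult_distrib_mat) auto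
      finally show ?thesis using Bc Zc by (simp add: mult_smult_assoc_mat[of _ p p _ p])
    qed
    also have "Z * B = Z + (-1) \<cdot>\<^sub>m (Z * Z)"
    proof -
      have "Z * B = Z * 1\<^sub>m p + Z * ((-1) \<cdot>\<^sub>m Z)" unfolding B_def using Zc by (intro mult_add_distrib_mat) auto
      then show ?thesis using Zc by (simp add: mult_smult_distrib[of _ p p _ p])
    qed
    also have "Z * Z = 2 \<cdot>\<^sub>m Z + (-1) \<cdot>\<^sub>m X" unfolding ZZ using X ZZc by (intro eq_matI) auto
    also have "B + (-1) \<cdot>\<^sub>m (Z + (-1) \<cdot>\<^sub>m (2 \<cdot>\<^sub>m Z + (-1) \<cdot>\<^sub>m X)) = A"
      unfolding B_def X_def using Zc A by (intro eq_matI) auto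
    finally show ?thesis .
  qed
  ultimately show ?thesis by blast
qed

text \<open>Dividing by a number above the trace puts the form below 1, and the trace of the inverse
  supplies the lower end required by the contraction; the root is then rescaled by
  \<open>sqrt t\<close>. The summands 1 make \<open>t\<close> and \<open>f\<close> at least 1, also
  for \<open>p = 0\<close>.\<close>

lemma pos_def_sqrt_exists:
  assumes "pos_def_mat p A"
  shows "\<exists>B. pos_def_mat p B \<and> B * B = A"
proof -
  note A = pos_def_matD[OF assms]
  define t where "t = mtrace A + 1"
  define f where "f = mtrace (inv_mat A) + 1"
  have t: "1 \<le> t" and f: "1 \<le> f"
    using psd_trace_ge_0[OF pos_def_psd[OF assms]] psd_trace_ge_0[OF pos_def_psd[OF inv_mat_pos_def[OF assms]]]
    by (auto simp: t_def f_def)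
  have q: "v \<bullet> (((1 / t) \<cdot>\<^sub>m A) *\<^sub>v v) = (v \<bullet> (A *\<^sub>v v)) / t" if "v \<in> carrier_vec p" for v
    using A that by (simp add: smult_mat_mult_vec[of _ p])
  have "\<exists>B. pos_def_mat p B \<and> B * B = (1 / t) \<cdot>\<^sub>m A"
  proof (rule pos_def_sqrt_contraction[where \<epsilon> = "1 / (f * t)"])
    show "(1 / t) \<cdot>\<^sub>m A \<in> carrier_mat p p" using A by simp
    show "((1 / t) \<cdot>\<^sub>m A)\<^sup>T = (1 / t) \<cdot>\<^sub>m A" using A(2) by (rule sym_mat_smult)
    have "1 * 1 \<le> f * t" using f t by (intro mult_mono) auto
    then show "0 < 1 / (f * t)" "1 / (f * t) \<le> 1" using f t by (auto intro: mult_pos_pos)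
    fix v :: "real vec" assume v: "v \<in> carrier_vec p"
    have "(v \<bullet> v) / f \<le> v \<bullet> (A *\<^sub>v v)"
      by (rule pos_def_ge_inv_trace[OF assms _ _ v]) (use f in \<open>auto simp: f_def\<close>)
    then have "(v \<bullet> v) / f / t \<le> v \<bullet> (A *\<^sub>v v) / t" using t by (intro divide_right_mono) auto
    then show "1 / (f * t) * (v \<bullet> v) \<le> v \<bullet> (((1 / t) \<cdot>\<^sub>m A) *\<^sub>v v)" unfolding q[OF v] by simp
    have "v \<bullet> (A *\<^sub>v v) \<le> t * (v \<bullet> v)"
      using psd_le_trace[OF pos_def_psd[OF assms] v] scalar_prod_self_ge_0[of v] by (simp add: t_def distrib_right)
    then show "v \<bullet> (((1 / t) \<cdot>\<^sub>m A) *\<^sub>v v) \<le> v \<bullet> v" unfolding q[OF v] using t by (simp add: field_simps)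
  qed
  then obtain B where B: "pos_def_mat p B" "B * B = (1 / t) \<cdot>\<^sub>m A" by blast
  note Bd = pos_def_matD[OF B(1)]
  let ?C = "sqrt t \<cdot>\<^sub>m B"
  have "pos_def_mat p ?C"
    unfolding pos_def_mat_def
  proof (intro conjI ballI impI)
    show "?C \<in> carrier_mat p p" using Bd by simp
    show "?C\<^sup>T = ?C" using Bd(2) by (rule sym_mat_smult)
    fix v :: "real vec" assume v: "v \<in> carrier_vec p" "v \<noteq> 0\<^sub>v p"
    have "v \<bullet> (?C *\<^sub>v v) = sqrt t * (v \<bullet> (B *\<^sub>v v))" using Bd v(1) by (simp add: smult_mat_mult_vec[of _ p])
    then show "0 < v \<bullet> (?C *\<^sub>v v)" using Bd(3)[OF v] t by simp
  qed
  moreover have "?C * ?C = A"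
  proof -
    have "?C * ?C = sqrt t \<cdot>\<^sub>m (sqrt t \<cdot>\<^sub>m (B * B))"
      using Bd by (simp add: mult_smult_assoc_mat[of _ p p _ p] mult_smult_distrib[of _ p p _ p])
    also have "\<dots> = (sqrt t * sqrt t * (1 / t)) \<cdot>\<^sub>m A" unfolding B(2) by (intro eq_matI) auto
    also have "sqrt t * sqrt t * (1 / t) = 1" using t by simp
    finally show ?thesis using A by (intro eq_matI) auto
  qed
  ultimately show ?thesis by blast
qed

lemma mat_sqrt_pos_def:
  assumes "pos_def_mat p A" shows "pos_def_mat p (mat_sqrt p A)"
proof -
  have "\<exists>!B. pos_def_mat p B \<and> B * B = A"
    using pos_def_sqrt_exists[OF assms] pos_def_sqrt_unique by metis
  from theI'[OF this] show ?thesis by (simp add: mat_sqrt_def)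
qed

section \<open>Maronna's equation with given leverages\<close>

text \<open>Right-hand side of the equation with the weights frozen. The equation becomes a fixed
  point problem for weight vectors rather than for matrices.\<close>

definition wgram :: "nat \<Rightarrow> nat \<Rightarrow> (nat \<Rightarrow> real) \<Rightarrow> (nat \<Rightarrow> real vec) \<Rightarrow> real mat" where
  "wgram p n w x = (1 / real n) \<cdot>\<^sub>m Matrix.mat p p (\<lambda>(j, k). \<Sum>i<n. w i * (x i $ j * x i $ k))"

lemma wgram_carrier[simp]: "wgram p n w x \<in> carrier_mat p p"
  by (simp add: wgram_def)

lemma wgram_sym: "(wgram p n w x)\<^sup>T = wgram p n w x"
  unfolding wgram_def by (rule sym_mat_smult, rule eq_matI) (auto simp: mult.commute)

lemma wgram_cong: "(\<And>i. i < n \<Longrightarrow> w i = w' i) \<Longrightarrow> wgram p n w x = wgram p n w' x"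
  unfolding wgram_def by (intro arg_cong[where f = "\<lambda>M. (1 / real n) \<cdot>\<^sub>m M"] eq_matI) auto

lemma quad_wgram:
  assumes x: "\<And>i. i < n \<Longrightarrow> x i \<in> carrier_vec p" and v: "v \<in> carrier_vec p"
  shows "v \<bullet> (wgram p n w x *\<^sub>v v) = (\<Sum>i<n. w i * (x i \<bullet> v)\<^sup>2) / real n"
proof -
  have "v \<bullet> (wgram p n w x *\<^sub>v v) = (\<Sum>j<p. \<Sum>k<p. v $ j * ((1 / real n) * (\<Sum>i<n. w i * (x i $ j * x i $ k))) * v $ k)"
    unfolding mat_vec_scalar_sum[OF wgram_carrier v v] by (intro sum.cong refl) (simp add: wgram_def)
  also have "\<dots> = (\<Sum>j<p. \<Sum>k<p. \<Sum>i<n. w i * ((x i $ j * v $ j) * (x i $ k * v $ k)) / real n)"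
  proof (intro sum.cong refl)
    fix j k
    have "v $ j * ((1 / real n) * (\<Sum>i<n. w i * (x i $ j * x i $ k))) * v $ k =
        (v $ j * v $ k / real n) * (\<Sum>i<n. w i * (x i $ j * x i $ k))" by simp
    also have "\<dots> = (\<Sum>i<n. (v $ j * v $ k / real n) * (w i * (x i $ j * x i $ k)))" by (rule sum_distrib_left)
    also have "\<dots> = (\<Sum>i<n. w i * ((x i $ j * v $ j) * (x i $ k * v $ k)) / real n)"
      by (intro sum.cong refl) simp
    finally show "v $ j * ((1 / real n) * (\<Sum>i<n. w i * (x i $ j * x i $ k))) * v $ k =
        (\<Sum>i<n. w i * ((x i $ j * v $ j) * (x i $ k * v $ k)) / real n)" .
  qed
  also have "\<dots> = (\<Sum>j<p. \<Sum>i<n. \<Sum>k<p. w i * ((x i $ j * v $ j) * (x i $ k * v $ k)) / real n)"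
    by (intro sum.cong refl sum.swap)
  also have "\<dots> = (\<Sum>i<n. \<Sum>j<p. \<Sum>k<p. w i * ((x i $ j * v $ j) * (x i $ k * v $ k)) / real n)"
    by (rule sum.swap)
  also have "\<dots> = (\<Sum>i<n. w i * (x i \<bullet> v)\<^sup>2 / real n)"
  proof (intro sum.cong refl)
    fix i assume "i \<in> {..<n}"
    then have i: "i < n" by simp
    have xv: "x i \<bullet> v = (\<Sum>j<p. x i $ j * v $ j)" by (rule scalar_prod_sum[OF x[OF i] v])
    show "(\<Sum>j<p. \<Sum>k<p. w i * ((x i $ j * v $ j) * (x i $ k * v $ k)) / real n) = w i * (x i \<bullet> v)\<^sup>2 / real n"
    proof -
      have "w i * (x i \<bullet> v)\<^sup>2 / real n = (w i / real n) * ((\<Sum>j<p. x i $ j * v $ j) * (\<Sum>k<p. x i $ k * v $ k))"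
        unfolding xv[symmetric] power2_eq_square by simp
      also have "\<dots> = (\<Sum>j<p. \<Sum>k<p. (w i / real n) * ((x i $ j * v $ j) * (x i $ k * v $ k)))"
        unfolding sum_product by (simp only: sum_distrib_left)
      finally show ?thesis by simp
    qed
  qed
  also have "\<dots> = (\<Sum>i<n. w i * (x i \<bullet> v)\<^sup>2) / real n" by (rule sum_divide_distrib[symmetric])
  finally show ?thesis .
qed

lemma wgram_mono:
  assumes x: "\<And>i. i < n \<Longrightarrow> x i \<in> carrier_vec p" and v: "v \<in> carrier_vec p"
    and le: "\<And>i. i < n \<Longrightarrow> w i \<le> c * w' i"
  shows "v \<bullet> (wgram p n w x *\<^sub>v v) \<le> c * (v \<bullet> (wgram p n w' x *\<^sub>v v))"
proof -
  have "(\<Sum>i<n. w i * (x i \<bullet> v)\<^sup>2) \<le> (\<Sum>i<n. (c * w' i) * (x i \<bullet> v)\<^sup>2)"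
    using le by (intro sum_mono mult_right_mono) auto
  also have "\<dots> = c * (\<Sum>i<n. w' i * (x i \<bullet> v)\<^sup>2)" by (simp add: sum_distrib_left mult.assoc)
  finally have "(\<Sum>i<n. w i * (x i \<bullet> v)\<^sup>2) / real n \<le> c * (\<Sum>i<n. w' i * (x i \<bullet> v)\<^sup>2) / real n"
    by (rule divide_right_mono) simp
  moreover have "v \<bullet> (wgram p n w x *\<^sub>v v) = (\<Sum>i<n. w i * (x i \<bullet> v)\<^sup>2) / real n" for w
    by (rule quad_wgram[OF x v])
  ultimately show ?thesis by simp
qed

lemma quad_gram_wgram:
  assumes x: "\<And>i. i < n \<Longrightarrow> x i \<in> carrier_vec p" and v: "v \<in> carrier_vec p" and n: "0 < n"
  shows "v \<bullet> (gram p 0 {..<n} x *\<^sub>v v) = real n * (v \<bullet> (wgram p n (\<lambda>_. 1) x *\<^sub>v v))"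
proof -
  have "v \<bullet> (wgram p n (\<lambda>_. 1) x *\<^sub>v v) = (\<Sum>i<n. 1 * (x i \<bullet> v)\<^sup>2) / real n"
    by (rule quad_wgram[OF x v])
  moreover have "v \<bullet> (gram p 0 {..<n} x *\<^sub>v v) = 0 * (v \<bullet> v) + (\<Sum>i<n. (x i \<bullet> v)\<^sup>2)"
    by (rule quad_gram[OF finite_lessThan x v]) simp
  ultimately show ?thesis using n by simp
qed

text \<open>
  Knaster--Tarski in the box \<open>[a, b]\<^sup>n\<close> of weights: the map sending a weight vector to the weights
  of the associated matrix is monotone, so no continuity or compactness is needed.
\<close>

lemma box_fixed_point:
  fixes F :: "(nat \<Rightarrow> real) \<Rightarrow> nat \<Rightarrow> real"
  assumes ab: "a \<le> b"
    and mono: "\<And>w w'. (\<And>i. i < n \<Longrightarrow> a \<le> w i \<and> w i \<le> w' i \<and> w' i \<le> b) \<Longrightarrow> (\<And>i. i < n \<Longrightarrow> F w i \<le> F w' i)"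
    and box: "\<And>w i. (\<And>i. i < n \<Longrightarrow> a \<le> w i \<and> w i \<le> b) \<Longrightarrow> i < n \<Longrightarrow> a \<le> F w i \<and> F w i \<le> b"
  shows "\<exists>w. \<forall>i<n. a \<le> w i \<and> w i \<le> b \<and> F w i = w i"
proof -
  define P where "P = {w. \<forall>i<n. a \<le> w i \<and> w i \<le> b \<and> w i \<le> F w i}"
  define W where "W i = (SUP w\<in>P. w i)" for i
  have aP: "(\<lambda>_. a) \<in> P" using box[of "\<lambda>_. a"] ab by (auto simp: P_def)
  have bdd: "bdd_above ((\<lambda>w. w i) ` P)" if "i < n" for i
    using that by (intro bdd_aboveI[of _ b]) (auto simp: P_def)
  have upper: "w i \<le> W i" if "w \<in> P" "i < n" for w i
    unfolding W_def by (rule cSUP_upper[OF that(1) bdd[OF that(2)]])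
  have least: "W i \<le> c" if "\<And>w. w \<in> P \<Longrightarrow> w i \<le> c" for i c
    unfolding W_def using aP that by (intro cSUP_least) auto
  have Wbox: "a \<le> W i \<and> W i \<le> b" if "i < n" for i
    using upper[OF aP that] least[of i b] that by (auto simp: P_def)
  have WF: "W i \<le> F W i" if i: "i < n" for i
  proof (rule least)
    fix w assume w: "w \<in> P"
    then have "w i \<le> F w i" using i by (simp add: P_def)
    also have "F w i \<le> F W i"
      using w upper[OF w] Wbox by (intro mono i) (auto simp: P_def)
    finally show "w i \<le> F W i" .
  qed
  have "F W \<in> P"
    unfolding P_def mem_Collect_eq
  proof (intro allI impI)
    fix i assume i: "i < n"
    have "F W i \<le> F (F W) i" using Wbox WF box[of W] by (intro mono i) auto
    then show "a \<le> F W i \<and> F W i \<le> b \<and> F W i \<le> F (F W) i" using box[of W i] Wbox i by blast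
  qed
  then have "F W i = W i" if "i < n" for i using upper[of "F W" i] WF[OF that] that by simp
  then show ?thesis using Wbox by blast
qed

text \<open>If some ratio exceeded 1, the largest ratio \<open>c\<close> would dominate all others,
  so \<open>strict\<close> would apply at an index where it is attained and contradict the equality
  \<open>f i = c * g i\<close> there.\<close>

lemma weights_le:
  fixes f g :: "nat \<Rightarrow> real"
  assumes pos: "\<And>i. i < n \<Longrightarrow> 0 < f i" "\<And>i. i < n \<Longrightarrow> 0 < g i"
    and strict: "\<And>c i. 1 < c \<Longrightarrow> (\<And>j. j < n \<Longrightarrow> f j \<le> c * g j) \<Longrightarrow> i < n \<Longrightarrow> f i < c * g i"
  shows "\<forall>i<n. f i \<le> g i"
proof (rule ccontr)
  assume "\<not> (\<forall>i<n. f i \<le> g i)"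
  then obtain k where k: "k < n" "g k < f k" by (auto simp: not_le)
  define c where "c = Max ((\<lambda>i. f i / g i) ` {..<n})"
  have ne: "(\<lambda>i. f i / g i) ` {..<n} \<noteq> {}" using k by auto
  obtain i where i: "i < n" "c = f i / g i" using Max_in[OF _ ne] by (auto simp: c_def)
  have le: "f j / g j \<le> c" if "j < n" for j unfolding c_def using that by (intro Max_ge) auto
  have "1 < f k / g k" using k pos(2)[OF k(1)] by simp
  then have "1 < c" using le[OF k(1)] by simp
  then have "f i < c * g i"
  proof (rule strict)
    fix j assume "j < n"
    then show "f j \<le> c * g j" using le[of j] pos(2)[of j] by (simp add: field_simps)
  qed (rule i(1))
  then show False using i pos(2)[OF i(1)] by simp
qed

text \<open>\<open>Q S i\<close> is the argument at which \<open>u\<close> is evaluated. Larger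
  weights give a larger matrix and a smaller \<open>Q\<close>, so the map on weights is monotone.
  The bounds \<open>lo\<close> and \<open>hi\<close> place \<open>Q\<close> for unit weights between
  \<open>u r1 * r1\<close> and \<open>u r2 * r2\<close>, which is exactly what makes the box between
  \<open>u r2\<close> and \<open>u r1\<close> invariant.\<close>

lemma maronna_unique_solution:
  fixes u :: "real \<Rightarrow> real"
  assumes u_pos: "\<And>r. 0 \<le> r \<Longrightarrow> 0 < u r" and u_anti: "\<And>r s. 0 \<le> r \<Longrightarrow> r \<le> s \<Longrightarrow> u s \<le> u r"
    and n: "0 < n" and p: "0 < p"
    and x: "\<And>i. i < n \<Longrightarrow> x i \<in> carrier_vec p" and G: "pos_def_mat p (gram p 0 {..<n} x)"
    and lo: "\<And>i. i < n \<Longrightarrow> u r1 * r1 \<le> real n / real p * (x i \<bullet> (inv_mat (gram p 0 {..<n} x) *\<^sub>v x i))"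
    and hi: "\<And>i. i < n \<Longrightarrow> real n / real p * (x i \<bullet> (inv_mat (gram p 0 {..<n} x) *\<^sub>v x i)) \<le> u r2 * r2"
    and r: "0 < r1" "r1 \<le> r2"
    and strict: "\<And>s c. r1 \<le> s \<Longrightarrow> s \<le> r2 \<Longrightarrow> 1 < c \<Longrightarrow> u (s / c) < c * u s \<and> u s < c * u (c * s)"
  shows "\<exists>!S. maronna_solution u n p x S"
    and "\<And>S i. maronna_solution u n p x S \<Longrightarrow> i < n \<Longrightarrow> u r2 \<le> maronna_weight u p x S i \<and> maronna_weight u p x S i \<le> u r1"
proof -
  define a b where "a = u r2" and "b = u r1"
  have ab: "0 < a" "a \<le> b" using u_pos u_anti r by (auto simp: a_def b_def)
  have b: "0 < b" using ab by simp
  let ?G = "gram p 0 {..<n} x"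
  define h where "h i = x i \<bullet> (inv_mat ?G *\<^sub>v x i)" for i
  define Q where "Q S i = 1 / real p * (x i \<bullet> (inv_mat S *\<^sub>v x i))" for S i
  have rn: "0 < real n" "0 < real p" using n p by auto
  have xc: "x i \<in> carrier_vec p" if "i \<in> {..<n}" for i using x that by simp
  have pd: "pos_def_mat p (wgram p n w x)" if w: "\<And>i. i < n \<Longrightarrow> 0 < w i" for w
    unfolding pos_def_mat_def
  proof (intro conjI ballI impI)
    fix v :: "real vec" assume v: "v \<in> carrier_vec p" "v \<noteq> 0\<^sub>v p"
    have "0 < v \<bullet> (?G *\<^sub>v v)" by (rule pos_def_matD(3)[OF G v])
    moreover have "v \<bullet> (?G *\<^sub>v v) = 0 * (v \<bullet> v) + (\<Sum>i<n. (x i \<bullet> v)\<^sup>2)"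
      by (rule quad_gram[OF finite_lessThan xc v(1)])
    ultimately have "0 < (\<Sum>i<n. (x i \<bullet> v)\<^sup>2)" by simp
    then obtain i where i: "i < n" "(x i \<bullet> v)\<^sup>2 \<noteq> 0"
      by (metis (no_types, lifting) lessThan_iff less_irrefl sum.neutral)
    have "0 < w i * (x i \<bullet> v)\<^sup>2" using w[OF i(1)] i(2) by simp
    also have "\<dots> \<le> (\<Sum>i<n. w i * (x i \<bullet> v)\<^sup>2)"
      using i(1) w by (intro member_le_sum mult_nonneg_nonneg) (auto intro: less_imp_le)
    finally have "0 < (\<Sum>i<n. w i * (x i \<bullet> v)\<^sup>2) / real n" using rn by simp
    moreover have "v \<bullet> (wgram p n w x *\<^sub>v v) = (\<Sum>i<n. w i * (x i \<bullet> v)\<^sup>2) / real n"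
      by (rule quad_wgram[OF x v(1)])
    ultimately show "0 < v \<bullet> (wgram p n w x *\<^sub>v v)" by simp
  qed (simp_all add: wgram_sym)
  have qG: "v \<bullet> (?G *\<^sub>v v) = real n * (v \<bullet> (wgram p n (\<lambda>_. 1) x *\<^sub>v v))" if "v \<in> carrier_vec p" for v
    by (rule quad_gram_wgram[OF x that n])
  have pdp: "0 \<le> Q S i" if "pos_def_mat p S" "i < n" for S i
    unfolding Q_def using psd_matD(3)[OF pos_def_psd[OF inv_mat_pos_def[OF that(1)]] x[OF that(2)]] by simp
  have Qmono: "Q (wgram p n w' x) i \<le> c * Q (wgram p n w x) i"
    if w: "\<And>i. i < n \<Longrightarrow> 0 < w i" "\<And>i. i < n \<Longrightarrow> 0 < w' i" and c: "0 < c"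
      and le: "\<And>i. i < n \<Longrightarrow> w i \<le> c * w' i" and i: "i < n" for w w' c i
  proof -
    have "x i \<bullet> (inv_mat (wgram p n w' x) *\<^sub>v x i) \<le> c * (x i \<bullet> (inv_mat (wgram p n w x) *\<^sub>v x i))"
      by (rule inv_mat_antimono[OF pd pd c x[OF i] wgram_mono[OF x _ le]]) (use w in auto)
    then have "1 / real p * (x i \<bullet> (inv_mat (wgram p n w' x) *\<^sub>v x i)) \<le>
        1 / real p * (c * (x i \<bullet> (inv_mat (wgram p n w x) *\<^sub>v x i)))"
      using rn by (intro mult_left_mono) auto
    then show ?thesis by (simp add: Q_def)
  qed
  \<comment> \<open>Unit weights give the Gram matrix divided by \<open>n\<close>, hence the factor
    \<open>n / p\<close> in front of the leverage. Equality comes from order reversal in both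
    directions.\<close>
  have Qone: "Q (wgram p n (\<lambda>_. 1) x) i = real n / real p * h i" if i: "i < n" for i
  proof -
    have "x i \<bullet> (inv_mat (wgram p n (\<lambda>_. 1) x) *\<^sub>v x i) \<le> real n * h i"
      unfolding h_def
      by (rule inv_mat_antimono[OF G pd rn(1) x[OF i]]) (auto simp: qG)
    moreover have "h i \<le> (1 / real n) * (x i \<bullet> (inv_mat (wgram p n (\<lambda>_. 1) x) *\<^sub>v x i))"
      unfolding h_def
      by (rule inv_mat_antimono[OF pd G _ x[OF i]]) (use rn in \<open>auto simp: qG\<close>)
    then have "real n * h i \<le> x i \<bullet> (inv_mat (wgram p n (\<lambda>_. 1) x) *\<^sub>v x i)" using rn by (simp add: field_simps)
    ultimately have "x i \<bullet> (inv_mat (wgram p n (\<lambda>_. 1) x) *\<^sub>v x i) = real n * h i" by (rule antisym)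
    then show ?thesis by (simp add: Q_def)
  qed
  \<comment> \<open>Weights at most \<open>b = u r1\<close> make \<open>Q\<close> at least its value
    for unit weights divided by \<open>b\<close>, which is at least \<open>r1\<close> by
    \<open>lo\<close>; symmetrically with \<open>a = u r2\<close> and \<open>hi\<close>.\<close>
  have Qbox: "r1 \<le> Q (wgram p n w x) i \<and> Q (wgram p n w x) i \<le> r2"
    if w: "\<And>i. i < n \<Longrightarrow> a \<le> w i \<and> w i \<le> b" and i: "i < n" for w i
  proof -
    have w0: "0 < w i" if "i < n" for i using w[OF that] ab by linarith
    have "Q (wgram p n (\<lambda>_. 1) x) i \<le> b * Q (wgram p n w x) i"
      by (rule Qmono[OF _ _ b _ i]) (use w w0 in auto)
    then have "b * r1 \<le> b * Q (wgram p n w x) i"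
      using lo[OF i] unfolding Qone[OF i] h_def b_def by linarith
    moreover have "Q (wgram p n w x) i \<le> (1 / a) * Q (wgram p n (\<lambda>_. 1) x) i"
    proof (rule Qmono[OF _ _ _ _ i])
      show "1 \<le> 1 / a * w i" if "i < n" for i using w[OF that] ab by (simp add: field_simps)
    qed (use ab w0 in auto)
    then have "a * Q (wgram p n w x) i \<le> Q (wgram p n (\<lambda>_. 1) x) i" using ab by (simp add: field_simps)
    then have "a * Q (wgram p n w x) i \<le> a * r2"
      using hi[OF i] unfolding Qone[OF i] h_def a_def by linarith
    ultimately show ?thesis using ab b by simp
  qed
  define F where "F w i = u (Q (wgram p n w x) i)" for w i
  have "\<exists>w. \<forall>i<n. a \<le> w i \<and> w i \<le> b \<and> F w i = w i"
  proof (rule box_fixed_point[OF ab(2)])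
    fix w w' :: "nat \<Rightarrow> real" and i
    assume w: "\<And>i. i < n \<Longrightarrow> a \<le> w i \<and> w i \<le> w' i \<and> w' i \<le> b" and i: "i < n"
    have w0: "0 < w i \<and> 0 < w' i" if "i < n" for i using w[OF that] ab by linarith
    have "Q (wgram p n w' x) i \<le> 1 * Q (wgram p n w x) i"
      by (rule Qmono[OF _ _ _ _ i]) (use w w0 in auto)
    moreover have "0 \<le> Q (wgram p n w' x) i" by (rule pdp[OF pd i]) (use w0 in auto)
    ultimately show "F w i \<le> F w' i" unfolding F_def by (intro u_anti) auto
  next
    fix w :: "nat \<Rightarrow> real" and i
    assume w: "\<And>i. i < n \<Longrightarrow> a \<le> w i \<and> w i \<le> b" and i: "i < n"
    have "r1 \<le> Q (wgram p n w x) i \<and> Q (wgram p n w x) i \<le> r2" by (rule Qbox[OF _ i]) (rule w)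
    then show "a \<le> F w i \<and> F w i \<le> b" using r unfolding F_def a_def b_def by (auto intro!: u_anti)
  qed
  then obtain w where w: "\<And>i. i < n \<Longrightarrow> a \<le> w i \<and> w i \<le> b" "\<And>i. i < n \<Longrightarrow> F w i = w i" by blast
  have w0: "0 < w i" if "i < n" for i using w(1)[OF that] ab by linarith
  define S where "S = wgram p n w x"
  have S: "pos_def_mat p S" unfolding S_def by (rule pd[OF w0])
  have weight: "maronna_weight u p x T i = u (Q T i)" if "pos_def_mat p T" for T i
    by (simp add: maronna_weight_def Q_def mat_inverse_pos_def[OF that])
  have sol_iff: "maronna_solution u n p x T \<longleftrightarrow> pos_def_mat p T \<and> T = wgram p n (\<lambda>i. u (Q T i)) x" for T
    using weight[of T] by (auto simp: maronna_solution_def wgram_def)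
  have solS: "maronna_solution u n p x S"
    unfolding sol_iff using S w(2) by (auto simp: S_def F_def intro!: wgram_cong)
  \<comment> \<open>\<open>T\<close> is an arbitrary solution, not known to lie in the box.
    Therefore \<open>strict\<close> is invoked only at the values of \<open>Q S\<close>: with
    \<open>Q S i / c\<close> to bound \<open>t\<close> by \<open>w\<close>, and with
    \<open>c * Q S i\<close> for the converse.\<close>
  have uniq: "T = S" if T: "maronna_solution u n p x T" for T
  proof -
    define t where "t i = u (Q T i)" for i
    have Tpd: "pos_def_mat p T" and Teq: "T = wgram p n t x" using T unfolding sol_iff t_def by auto
    have QT0: "0 \<le> Q T i" if "i < n" for i by (rule pdp[OF Tpd that])
    have t0: "0 < t i" if "i < n" for i unfolding t_def by (rule u_pos[OF QT0[OF that]])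
    have wu: "w i = u (Q S i)" if "i < n" for i using w(2)[OF that] by (simp add: F_def S_def)
    have QS: "r1 \<le> Q S i \<and> Q S i \<le> r2" if "i < n" for i unfolding S_def by (rule Qbox[OF w(1) that])
    have "\<forall>i<n. t i \<le> w i"
    proof (rule weights_le[OF t0 w0])
      fix c i assume c: "1 < (c::real)" and le: "\<And>j. j < n \<Longrightarrow> t j \<le> c * w j" and i: "i < n"
      have "Q S i \<le> c * Q T i" unfolding S_def Teq by (rule Qmono[OF t0 w0 _ le i]) (use c in auto)
      then have "Q S i / c \<le> Q T i" using c by (simp add: field_simps)
      moreover have "0 \<le> Q S i / c" using QS[OF i] r c by simp
      ultimately have "t i \<le> u (Q S i / c)" unfolding t_def by (intro u_anti)
      also have "\<dots> < c * w i" unfolding wu[OF i] using strict[of "Q S i" c] QS[OF i] c by blast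
      finally show "t i < c * w i" .
    qed auto
    moreover have "\<forall>i<n. w i \<le> t i"
    proof (rule weights_le[OF w0 t0])
      fix c i assume c: "1 < (c::real)" and le: "\<And>j. j < n \<Longrightarrow> w j \<le> c * t j" and i: "i < n"
      have "Q T i \<le> c * Q S i" unfolding S_def Teq by (rule Qmono[OF w0 t0 _ le i]) (use c in auto)
      then have "u (c * Q S i) \<le> t i" unfolding t_def by (rule u_anti[OF QT0[OF i]])
      then have "c * u (c * Q S i) \<le> c * t i" using c by simp
      moreover have "w i < c * u (c * Q S i)" unfolding wu[OF i] using strict[of "Q S i" c] QS[OF i] c by blast
      ultimately show "w i < c * t i" by linarith
    qed auto
    ultimately have "\<And>i. i < n \<Longrightarrow> t i = w i" by (simp add: antisym)
    then show "T = S" unfolding Teq S_def by (rule wgram_cong)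
  qed
  show "\<exists>!S. maronna_solution u n p x S" using solS uniq by blast
  show "u r2 \<le> maronna_weight u p x T i \<and> maronna_weight u p x T i \<le> u r1"
    if "maronna_solution u n p x T" "i < n" for T i
    using uniq[OF that(1)] weight[OF S] w[OF that(2)] by (simp add: F_def S_def a_def b_def)
qed

text \<open>The intermediate value theorem supplies \<open>r1\<close> and \<open>r2\<close>, the
  Lipschitz inverse puts them within \<open>L * \<eta>\<close> of \<open>d\<^sub>0\<close>, and
  \<open>u r = \<phi> r / r\<close> transfers this to the weights. Strictness comes from injectivity
  of \<phi> near the level 1: \<open>\<phi> (s / c) < \<phi> s < \<phi> (c * s)\<close>, divided by
  \<open>s\<close>.\<close>

lemma maronna_scalar_choice:
  fixes d\<^sub>0 \<phi>_lim :: real and u \<phi> :: "real \<Rightarrow> real"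
  assumes u_pos: "\<And>x. x \<ge> 0 \<Longrightarrow> u x > 0" and u_cont: "continuous_on {0..} u"
    and \<phi>: "\<And>x. \<phi> x = x * u x" and \<phi>_mono: "mono_on {0..} \<phi>"
    and lim: "(\<phi> \<longlongrightarrow> \<phi>_lim) at_top" "\<phi>_lim > 1"
    and d0: "d\<^sub>0 \<ge> 0" "\<phi> d\<^sub>0 = 1"
    and inv: "\<exists>\<delta>>0. \<exists>L. \<exists>\<phi>_inv. (\<forall>x\<ge>0. \<bar>\<phi> x - 1\<bar> < \<delta> \<longrightarrow> \<phi>_inv (\<phi> x) = x) \<and>
           L-lipschitz_on {1 - \<delta><..<1 + \<delta>} \<phi>_inv"
  shows "\<exists>K>0. \<exists>\<eta>\<^sub>0>0. \<forall>\<eta>. 0 < \<eta> \<and> \<eta> < \<eta>\<^sub>0 \<longrightarrow> (\<exists>r1 r2. 0 < r1 \<and> r1 \<le> r2 \<and> \<phi> r1 = 1 - \<eta> \<and> \<phi> r2 = 1 + \<eta> \<and>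
      \<bar>u r1 - 1 / d\<^sub>0\<bar> \<le> K * \<eta> \<and> \<bar>u r2 - 1 / d\<^sub>0\<bar> \<le> K * \<eta> \<and>
      (\<forall>s c. r1 \<le> s \<longrightarrow> s \<le> r2 \<longrightarrow> 1 < c \<longrightarrow> u (s / c) < c * u s \<and> u s < c * u (c * s)))"
proof -
  obtain \<delta> L \<phi>_inv where \<delta>: "\<delta> > 0" and inv1: "\<And>x. x \<ge> 0 \<Longrightarrow> \<bar>\<phi> x - 1\<bar> < \<delta> \<Longrightarrow> \<phi>_inv (\<phi> x) = x"
    and lip: "L-lipschitz_on {1 - \<delta><..<1 + \<delta>} \<phi>_inv" using inv by blast
  have L: "0 \<le> L" using lip by (rule lipschitz_on_nonneg)
  have d0pos: "0 < d\<^sub>0" using d0 \<phi>[of 0] by (cases "d\<^sub>0 = 0") auto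
  have cont: "continuous_on {0..b} \<phi>" for b
  proof -
    have "continuous_on {0..b} u" by (rule continuous_on_subset[OF u_cont]) auto
    then have "continuous_on {0..b} (\<lambda>x. x * u x)" by (intro continuous_intros)
    then show ?thesis by (simp add: \<phi>[abs_def] cong: continuous_on_cong)
  qed
  \<comment> \<open>The deviation of the weight is a quotient with numerator at most
    \<open>(d\<^sub>0 + L) * \<eta>\<close> and denominator \<open>d\<^sub>0 * r\<close>, where
    \<open>r\<close> is at least \<open>d\<^sub>0 / 2\<close>.\<close>
  define K where "K = (d\<^sub>0 + L) / (d\<^sub>0 * (d\<^sub>0 / 2)) + 1"
  \<comment> \<open>The four entries keep \<open>1 - \<eta>\<close> positive, stay in the window
    where \<phi> is inverted, make \<open>1 + \<eta>\<close> an attained value, and force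
    \<open>L * \<eta> \<le> d\<^sub>0 / 2\<close>.\<close>
  define \<eta>\<^sub>0 where "\<eta>\<^sub>0 = min (min 1 \<delta>) (min (\<phi>_lim - 1) (d\<^sub>0 / (2 * (L + 1))))"
  have K: "0 < K" unfolding K_def using L d0pos by (intro add_nonneg_pos divide_nonneg_nonneg) auto
  have \<eta>0: "0 < \<eta>\<^sub>0" unfolding \<eta>\<^sub>0_def using \<delta> lim(2) L d0pos by simp
  show ?thesis
  proof (rule exI[of _ K], rule conjI, rule K, rule exI[of _ \<eta>\<^sub>0], rule conjI, rule \<eta>0, intro allI impI)
    fix \<eta> assume "0 < \<eta> \<and> \<eta> < \<eta>\<^sub>0"
    then have \<eta>: "0 < \<eta>" "\<eta> < 1" "\<eta> < \<delta>" "1 + \<eta> < \<phi>_lim" "\<eta> < d\<^sub>0 / (2 * (L + 1))" by (auto simp: \<eta>\<^sub>0_def)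
    have L\<eta>: "L * \<eta> \<le> d\<^sub>0 / 2"
    proof -
      have "\<eta> * (2 * (L + 1)) < d\<^sub>0" using \<eta>(5) L by (simp add: pos_less_divide_eq)
      then have "2 * (L * \<eta>) + 2 * \<eta> < d\<^sub>0" by (simp add: algebra_simps)
      then show ?thesis using \<eta>(1) by linarith
    qed
    have ev: "eventually (\<lambda>x. 1 + \<eta> < \<phi> x \<and> x \<ge> 0) at_top"
      using order_tendstoD(1)[OF lim(1) \<eta>(4)] eventually_ge_at_top[of 0] by eventually_elim simp
    then obtain b where b: "1 + \<eta> < \<phi> b" "0 \<le> b" by (metis (mono_tags, lifting) eventually_at_top_linorder order_refl)
    have ivt: "\<exists>r. 0 \<le> r \<and> \<phi> r = c" if "0 \<le> c" "c \<le> 1 + \<eta>" for c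
      using IVT'[of \<phi> 0 c b] cont[of b] b that \<phi>[of 0] by auto
    obtain r1 where r1: "0 \<le> r1" "\<phi> r1 = 1 - \<eta>" using ivt[of "1 - \<eta>"] \<eta> by auto
    obtain r2 where r2: "0 \<le> r2" "\<phi> r2 = 1 + \<eta>" using ivt[of "1 + \<eta>"] \<eta> by auto
    have r12: "r1 \<le> r2"
    proof (rule ccontr)
      assume "\<not> r1 \<le> r2"
      then have "\<phi> r2 \<le> \<phi> r1" using mono_onD[OF \<phi>_mono, of r2 r1] r1 r2 by auto
      then show False using r1 r2 \<eta> by simp
    qed
    have close: "\<bar>u r - 1 / d\<^sub>0\<bar> \<le> K * \<eta> \<and> 0 < r" if r: "0 \<le> r" "\<phi> r = 1 + \<sigma>" "\<bar>\<sigma>\<bar> = \<eta>" for r \<sigma>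
    proof -
      have \<sigma>: "1 + \<sigma> \<in> {1 - \<delta><..<1 + \<delta>}" "1 \<in> {1 - \<delta><..<1 + \<delta>}" using r(3) \<eta> \<delta> by auto
      have "\<phi>_inv (\<phi> r) = r" by (rule inv1[OF r(1)]) (use r \<eta> in simp)
      moreover have "\<phi>_inv (\<phi> d\<^sub>0) = d\<^sub>0" by (rule inv1[OF d0(1)]) (use d0 \<delta> in simp)
      ultimately have "\<bar>r - d\<^sub>0\<bar> \<le> L * \<bar>\<sigma>\<bar>" using lipschitz_onD[OF lip \<sigma>] r(2) d0(2) by (simp add: dist_real_def)
      then have rd: "\<bar>r - d\<^sub>0\<bar> \<le> L * \<eta>" using r(3) by simp
      then have rpos: "d\<^sub>0 / 2 \<le> r" using L\<eta> by linarith
      then have r0: "0 < r" using d0pos by linarith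
      have ur: "u r = (1 + \<sigma>) / r" using r(2) \<phi>[of r] r0 by (simp add: field_simps)
      have "\<bar>d\<^sub>0 - r + \<sigma> * d\<^sub>0\<bar> \<le> \<bar>d\<^sub>0 - r\<bar> + \<bar>\<sigma>\<bar> * d\<^sub>0" using d0pos abs_triangle_ineq[of "d\<^sub>0 - r" "\<sigma> * d\<^sub>0"] by (simp add: abs_mult)
      also have "\<dots> \<le> (d\<^sub>0 + L) * \<eta>" using rd r(3) by (simp add: algebra_simps abs_minus_commute)
      finally have num: "\<bar>d\<^sub>0 - r + \<sigma> * d\<^sub>0\<bar> \<le> (d\<^sub>0 + L) * \<eta>" .
      have "u r - 1 / d\<^sub>0 = (d\<^sub>0 - r + \<sigma> * d\<^sub>0) / (d\<^sub>0 * r)" unfolding ur using r0 d0pos by (simp add: field_simps)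
      then have "\<bar>u r - 1 / d\<^sub>0\<bar> = \<bar>d\<^sub>0 - r + \<sigma> * d\<^sub>0\<bar> / (d\<^sub>0 * r)" using r0 d0pos by (simp add: abs_divide abs_mult)
      also have "\<dots> \<le> ((d\<^sub>0 + L) * \<eta>) / (d\<^sub>0 * (d\<^sub>0 / 2))"
        using num rpos d0pos by (intro frac_le mult_left_mono) auto
      also have "\<dots> \<le> (d\<^sub>0 + L) / (d\<^sub>0 * (d\<^sub>0 / 2)) * \<eta> + 1 * \<eta>"
        unfolding times_divide_eq_left using \<eta>(1) by linarith
      also have "\<dots> = K * \<eta>" unfolding K_def by (rule distrib_right[symmetric])
      finally show ?thesis using r0 by simp
    qed
    have c1: "\<bar>u r1 - 1 / d\<^sub>0\<bar> \<le> K * \<eta> \<and> 0 < r1" using close[of r1 "- \<eta>"] r1 \<eta>(1) by simp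
    have c2: "\<bar>u r2 - 1 / d\<^sub>0\<bar> \<le> K * \<eta> \<and> 0 < r2" using close[of r2 "\<eta>"] r2 \<eta>(1) by simp
    have strict: "u (s / c) < c * u s \<and> u s < c * u (c * s)" if s: "r1 \<le> s" "s \<le> r2" and c: "1 < c" for s c
    proof -
      have s0: "0 < s" using s c1 by linarith
      have "1 - \<eta> \<le> \<phi> s" "\<phi> s \<le> 1 + \<eta>"
        using mono_onD[OF \<phi>_mono, of r1 s] mono_onD[OF \<phi>_mono, of s r2] s r1 r2 s0 by auto
      then have near: "\<bar>\<phi> s - 1\<bar> < \<delta>" using \<eta>(3) by linarith
      \<comment> \<open>The local inverse recovers a point from its value under \<phi>, so a second
        point with the value \<open>\<phi> s\<close> would coincide with \<open>s\<close>.\<close>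
      have ne: "\<phi> s' \<noteq> \<phi> s" if "0 \<le> s'" "s' \<noteq> s" for s'
        using inv1[of s'] inv1[of s] near s0 that by (metis less_imp_le)
      have sc: "s / c < s" "s < c * s" using s0 c by (auto simp: field_simps)
      have "\<phi> (s / c) \<le> \<phi> s" using mono_onD[OF \<phi>_mono, of "s / c" s] sc s0 c by auto
      then have 1: "\<phi> (s / c) < \<phi> s" using ne[of "s / c"] sc s0 c by fastforce
      have "\<phi> s \<le> \<phi> (c * s)" using mono_onD[OF \<phi>_mono, of s "c * s"] sc s0 c by auto
      then have 2: "\<phi> s < \<phi> (c * s)" using ne[of "c * s"] sc s0 c by fastforce
      have "s * u (s / c) < s * (c * u s)" using 1 c unfolding \<phi> by (simp add: field_simps)
      moreover have "s * u s < s * (c * u (c * s))" using 2 unfolding \<phi> by (simp add: mult_ac)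
      ultimately show ?thesis using s0 by simp
    qed
    show "\<exists>r1 r2. 0 < r1 \<and> r1 \<le> r2 \<and> \<phi> r1 = 1 - \<eta> \<and> \<phi> r2 = 1 + \<eta> \<and>
      \<bar>u r1 - 1 / d\<^sub>0\<bar> \<le> K * \<eta> \<and> \<bar>u r2 - 1 / d\<^sub>0\<bar> \<le> K * \<eta> \<and>
      (\<forall>s c. r1 \<le> s \<longrightarrow> s \<le> r2 \<longrightarrow> 1 < c \<longrightarrow> u (s / c) < c * u s \<and> u s < c * u (c * s))"
      by (intro exI[of _ r1] exI[of _ r2] conjI allI impI) (use c1 c2 r12 r1(2) r2(2) strict in simp_all)
  qed
qed

section \<open>Invariance of leverages under linear maps\<close>

lemma gram_transform:
  assumes J: "finite J" "\<And>i. i \<in> J \<Longrightarrow> y i \<in> carrier_vec p" and B: "B \<in> carrier_mat p p" "B\<^sup>T = B" and v: "v \<in> carrier_vec p"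
  shows "gram p 0 J (\<lambda>i. B *\<^sub>v y i) *\<^sub>v v = B *\<^sub>v (gram p 0 J y *\<^sub>v (B *\<^sub>v v))"
  using J
proof (induction J rule: finite_induct)
  case empty
  have "(0 \<cdot>\<^sub>m 1\<^sub>m p) *\<^sub>v w = 0\<^sub>v p" if "w \<in> carrier_vec p" for w :: "real vec"
    using that by (intro eq_vecI) auto
  moreover have "B *\<^sub>v 0\<^sub>v p = 0\<^sub>v p" using B by (intro eq_vecI) auto
  ultimately show ?case using B v by (simp add: gram_empty)
next
  case (insert i J)
  have yi: "y i \<in> carrier_vec p" using insert.prems by simp
  have Byi: "B *\<^sub>v y i \<in> carrier_vec p" and Bv: "B *\<^sub>v v \<in> carrier_vec p" using B yi v by auto
  let ?g = "gram p 0 J (\<lambda>i. B *\<^sub>v y i)" and ?h = "gram p 0 J y"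
  have h: "?h *\<^sub>v (B *\<^sub>v v) \<in> carrier_vec p" by (rule mult_mat_vec_carrier[OF gram_carrier Bv])
  have "gram p 0 (insert i J) (\<lambda>i. B *\<^sub>v y i) *\<^sub>v v = ?g *\<^sub>v v + ((B *\<^sub>v y i) \<bullet> v) \<cdot>\<^sub>v (B *\<^sub>v y i)"
    using insert.hyps Byi v by (simp add: gram_insert add_mult_distrib_mat_vec[of _ p p] outer_vec)
  also have "(B *\<^sub>v y i) \<bullet> v = y i \<bullet> (B *\<^sub>v v)" by (rule sym_mat_swap[OF B yi v])
  also have "?g *\<^sub>v v = B *\<^sub>v (?h *\<^sub>v (B *\<^sub>v v))" using insert by simp
  also have "B *\<^sub>v (?h *\<^sub>v (B *\<^sub>v v)) + (y i \<bullet> (B *\<^sub>v v)) \<cdot>\<^sub>v (B *\<^sub>v y i)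
      = B *\<^sub>v (?h *\<^sub>v (B *\<^sub>v v) + (y i \<bullet> (B *\<^sub>v v)) \<cdot>\<^sub>v y i)"
    using B yi h by (simp add: mult_add_distrib_mat_vec[of _ p p] mult_mat_vec[of _ p p])
  also have "?h *\<^sub>v (B *\<^sub>v v) + (y i \<bullet> (B *\<^sub>v v)) \<cdot>\<^sub>v y i = gram p 0 (insert i J) y *\<^sub>v (B *\<^sub>v v)"
    using insert.hyps yi Bv by (simp add: gram_insert add_mult_distrib_mat_vec[of _ p p] outer_vec)
  finally show ?case .
qed

text \<open>The transformed Gram matrix is the original one between two factors \<open>B\<close>,
  which cancel against those in the rows. Concretely, the vector \<open>v\<close> below solves the
  linear system with right-hand side \<open>x i\<close>. Used with \<open>B\<close> the root of the
  scatter matrix, this removes the scatter matrix from the problem.\<close>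

lemma leverage_transform:
  assumes y: "\<And>i. i < n \<Longrightarrow> y i \<in> carrier_vec p" and B: "pos_def_mat p B"
    and G: "pos_def_mat p (gram p 0 {..<n} y)"
  defines "x \<equiv> \<lambda>i. B *\<^sub>v y i"
  shows "pos_def_mat p (gram p 0 {..<n} x)"
    and "i < n \<Longrightarrow> x i \<bullet> (inv_mat (gram p 0 {..<n} x) *\<^sub>v x i) = y i \<bullet> (inv_mat (gram p 0 {..<n} y) *\<^sub>v y i)"
proof -
  note Bd = pos_def_matD[OF B]
  let ?g = "gram p 0 {..<n} x" and ?h = "gram p 0 {..<n} y"
  have gv: "?g *\<^sub>v v = B *\<^sub>v (?h *\<^sub>v (B *\<^sub>v v))" if "v \<in> carrier_vec p" for v
    unfolding x_def by (rule gram_transform[OF _ _ Bd(1,2) that]) (use y in auto)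
  show pd: "pos_def_mat p ?g"
    unfolding pos_def_mat_def
  proof (intro conjI ballI impI)
    fix v :: "real vec" assume v: "v \<in> carrier_vec p" "v \<noteq> 0\<^sub>v p"
    have Bv: "B *\<^sub>v v \<in> carrier_vec p" using Bd(1) v(1) by simp
    have hBv: "?h *\<^sub>v (B *\<^sub>v v) \<in> carrier_vec p" by (rule mult_mat_vec_carrier[OF gram_carrier Bv])
    have "B *\<^sub>v v \<noteq> 0\<^sub>v p" using Bd(3)[OF v] v(1) by auto
    then have "0 < (B *\<^sub>v v) \<bullet> (?h *\<^sub>v (B *\<^sub>v v))" by (rule pos_def_matD(3)[OF G Bv])
    then show "0 < v \<bullet> (?g *\<^sub>v v)" unfolding gv[OF v(1)] sym_mat_swap[OF Bd(1,2) v(1) hBv] .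
  qed simp_all
  assume i: "i < n"
  define z where "z = inv_mat ?h *\<^sub>v y i"
  define v where "v = inv_mat B *\<^sub>v z"
  have z: "z \<in> carrier_vec p" unfolding z_def by (rule inv_mat_vec_carrier[OF gram_carrier y[OF i]])
  have v: "v \<in> carrier_vec p" unfolding v_def by (rule inv_mat_vec_carrier[OF Bd(1) z])
  have Bv: "B *\<^sub>v v = z" unfolding v_def by (rule inv_mat_vec(1)[OF B z])
  have hz: "?h *\<^sub>v z = y i" unfolding z_def by (rule inv_mat_vec(1)[OF G y[OF i]])
  have "?g *\<^sub>v v = x i" unfolding gv[OF v] Bv hz by (simp add: x_def)
  then have "inv_mat ?g *\<^sub>v x i = v" using inv_mat_vec(2)[OF pd v] by simp
  then have "x i \<bullet> (inv_mat ?g *\<^sub>v x i) = x i \<bullet> v" by simp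
  also have "\<dots> = y i \<bullet> z" unfolding x_def sym_mat_swap[OF Bd(1,2) y[OF i] v] Bv ..
  finally show "x i \<bullet> (inv_mat ?g *\<^sub>v x i) = y i \<bullet> (inv_mat ?h *\<^sub>v y i)" by (simp add: z_def)
qed

section \<open>Measurability, and sampling one row at a time\<close>

definition vec_law :: "nat \<Rightarrow> real vec measure \<Rightarrow> bool" where
  "vec_law p \<mu> \<longleftrightarrow> prob_space \<mu> \<and> sets \<mu> = sets (lborel_vec p)"

lemma vec_law_prob: "vec_law p \<mu> \<Longrightarrow> prob_space \<mu>"
  by (simp add: vec_law_def)

lemma vec_law_space: "vec_law p \<mu> \<Longrightarrow> space \<mu> = carrier_vec p"
  unfolding vec_law_def using sets_eq_imp_space_eq space_lborel_vec by metis

lemma measurable_vec_index: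
  assumes "vec_law p \<mu>" "j < p" shows "(\<lambda>y. y $ j) \<in> borel_measurable \<mu>"
proof -
  have "(\<lambda>x. vec_index (Matrix.vec p x) j) \<in> borel_measurable (\<Pi>\<^sub>M j\<in>{..<p}. (lborel :: real measure))"
    using assms(2) measurable_component_singleton[of j "{..<p}" "\<lambda>_. lborel :: real measure"] by simp
  then have "(\<lambda>y. y $ j) \<in> borel_measurable (lborel_vec p)"
    unfolding lborel_vec_def by (rule measurable_embed_measure1)
  moreover have "borel_measurable \<mu> = (borel_measurable (lborel_vec p) :: (real vec \<Rightarrow> real) set)"
    using assms(1) by (intro measurable_cong_sets) (auto simp: vec_law_def)
  ultimately show ?thesis by simp
qed

lemma borel_measurable_bilinear:
  fixes A :: "'a \<Rightarrow> real mat"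
  assumes A: "\<And>\<omega>. \<omega> \<in> space M \<Longrightarrow> A \<omega> \<in> carrier_mat p p"
    and Am: "\<And>j k. j < p \<Longrightarrow> k < p \<Longrightarrow> (\<lambda>\<omega>. A \<omega> $$ (j, k)) \<in> borel_measurable M"
    and v: "\<And>\<omega>. \<omega> \<in> space M \<Longrightarrow> v \<omega> \<in> carrier_vec p" "\<And>\<omega>. \<omega> \<in> space M \<Longrightarrow> w \<omega> \<in> carrier_vec p"
    and vm: "\<And>j. j < p \<Longrightarrow> (\<lambda>\<omega>. v \<omega> $ j) \<in> borel_measurable M" "\<And>j. j < p \<Longrightarrow> (\<lambda>\<omega>. w \<omega> $ j) \<in> borel_measurable M"
  shows "(\<lambda>\<omega>. v \<omega> \<bullet> (A \<omega> *\<^sub>v w \<omega>)) \<in> borel_measurable M"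
proof -
  have "(\<lambda>\<omega>. \<Sum>j<p. \<Sum>k<p. v \<omega> $ j * A \<omega> $$ (j, k) * w \<omega> $ k) \<in> borel_measurable M"
    using Am vm by (intro borel_measurable_sum borel_measurable_times) auto
  also have "?this \<longleftrightarrow> ?thesis"
    by (rule measurable_cong) (rule mat_vec_scalar_sum[symmetric, OF A v])
  finally show ?thesis .
qed

lemma borel_measurable_scalar_prod:
  fixes v w :: "'a \<Rightarrow> real vec"
  assumes v: "\<And>\<omega>. \<omega> \<in> space M \<Longrightarrow> v \<omega> \<in> carrier_vec p" "\<And>\<omega>. \<omega> \<in> space M \<Longrightarrow> w \<omega> \<in> carrier_vec p"
    and vm: "\<And>j. j < p \<Longrightarrow> (\<lambda>\<omega>. v \<omega> $ j) \<in> borel_measurable M" "\<And>j. j < p \<Longrightarrow> (\<lambda>\<omega>. w \<omega> $ j) \<in> borel_measurable M"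
  shows "(\<lambda>\<omega>. v \<omega> \<bullet> w \<omega>) \<in> borel_measurable M"
proof -
  have "(\<lambda>\<omega>. \<Sum>j<p. v \<omega> $ j * w \<omega> $ j) \<in> borel_measurable M"
    using vm by (intro borel_measurable_sum borel_measurable_times) auto
  also have "?this \<longleftrightarrow> ?thesis"
    by (rule measurable_cong) (rule scalar_prod_sum[symmetric, OF v])
  finally show ?thesis .
qed

lemma borel_measurable_det:
  fixes A :: "'a \<Rightarrow> real mat"
  assumes A: "\<And>\<omega>. A \<omega> \<in> carrier_mat n n"
    and Am: "\<And>j k. j < n \<Longrightarrow> k < n \<Longrightarrow> (\<lambda>\<omega>. A \<omega> $$ (j, k)) \<in> borel_measurable M"
  shows "(\<lambda>\<omega>. det (A \<omega>)) \<in> borel_measurable M"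
  unfolding det_def'[OF A]
  by (intro borel_measurable_sum borel_measurable_times borel_measurable_prod borel_measurable_const Am)
    (auto simp: permutes_in_image)

text \<open>Entries are cofactors over the determinant. Where the determinant vanishes the quotient
  is 0 by convention, so no case distinction on invertibility arises.\<close>

lemma borel_measurable_inv_mat:
  fixes A :: "'a \<Rightarrow> real mat"
  assumes A: "\<And>\<omega>. A \<omega> \<in> carrier_mat p p"
    and Am: "\<And>j k. j < p \<Longrightarrow> k < p \<Longrightarrow> (\<lambda>\<omega>. A \<omega> $$ (j, k)) \<in> borel_measurable M"
    and jk: "j < p" "k < p"
  shows "(\<lambda>\<omega>. inv_mat (A \<omega>) $$ (j, k)) \<in> borel_measurable M"
proof -
  have dims: "dim_row (A \<omega>) = p" "dim_col (A \<omega>) = p" for \<omega> using A[of \<omega>] by auto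
  have "(\<lambda>\<omega>. det (mat_delete (A \<omega>) k j)) \<in> borel_measurable M"
  proof (rule borel_measurable_det[of _ "p - 1"])
    show "mat_delete (A \<omega>) k j \<in> carrier_mat (p - 1) (p - 1)" for \<omega>
      using A[of \<omega>] by (simp add: mat_delete_def)
    fix a b assume "a < p - 1" "b < p - 1"
    then show "(\<lambda>\<omega>. mat_delete (A \<omega>) k j $$ (a, b)) \<in> borel_measurable M"
      by (auto simp: mat_delete_def dims intro!: Am)
  qed
  moreover have "inv_mat (A \<omega>) $$ (j, k) = 1 / det (A \<omega>) * ((-1) ^ (k + j) * det (mat_delete (A \<omega>) k j))" for \<omega>
    using jk by (simp add: inv_mat_def adj_mat_def cofactor_def dims)
  ultimately show ?thesis
    using borel_measurable_det[OF A Am] by simp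
qed

text \<open>The vectors coded by the countable type \<open>rat list\<close> are dense, and both
  sides are continuous in \<open>v\<close>. An eigenvalue bound, which is an uncountable family of
  inequalities, thereby becomes a countable one and defines an event.\<close>

lemma quad_ge_dense:
  fixes A :: "real mat"
  assumes A: "A \<in> carrier_mat p p"
    and rat: "\<And>l :: rat list. c * (Matrix.vec p (\<lambda>j. of_rat (l ! j)) \<bullet> Matrix.vec p (\<lambda>j. of_rat (l ! j)))
        \<le> Matrix.vec p (\<lambda>j. of_rat (l ! j)) \<bullet> (A *\<^sub>v Matrix.vec p (\<lambda>j. of_rat (l ! j)))"
    and v: "v \<in> carrier_vec p"
  shows "c * (v \<bullet> v) \<le> v \<bullet> (A *\<^sub>v v)"
proof -
  have "\<exists>r :: rat. \<bar>of_rat r - v $ j\<bar> < 1 / real (Suc n)" for j n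
  proof -
    obtain q where "q \<in> \<rat>" "v $ j < q" "q < v $ j + 1 / real (Suc n)"
      using Rats_dense_in_real[of "v $ j" "v $ j + 1 / real (Suc n)"] by auto
    moreover from this(1) obtain r where "q = of_rat r" by (rule Rats_cases)
    ultimately have "\<bar>of_rat r - v $ j\<bar> < 1 / real (Suc n)" by auto
    then show ?thesis by blast
  qed
  then obtain r :: "nat \<Rightarrow> nat \<Rightarrow> rat" where r: "\<And>j n. \<bar>of_rat (r j n) - v $ j\<bar> < 1 / real (Suc n)" by metis
  define w :: "nat \<Rightarrow> real vec" where "w n = Matrix.vec p (\<lambda>j. of_rat (map (\<lambda>j. r j n) [0..<p] ! j))" for n
  have w: "w n \<in> carrier_vec p" for n by (simp add: w_def)
  have wj: "w n $ j = of_rat (r j n)" if "j < p" for n j using that by (simp add: w_def)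
  have lim: "(\<lambda>n. w n $ j) \<longlonglongrightarrow> v $ j" if "j < p" for j
  proof (rule LIM_zero_cancel, rule Lim_null_comparison[OF _ LIMSEQ_inverse_real_of_nat])
    show "\<forall>\<^sub>F n in sequentially. norm (w n $ j - v $ j) \<le> inverse (real (Suc n))"
      using r[of j] that by (intro always_eventually allI) (simp add: wj inverse_eq_divide less_imp_le)
  qed
  show ?thesis
  proof (rule LIMSEQ_le)
    show "(\<lambda>n. c * (w n \<bullet> w n)) \<longlonglongrightarrow> c * (v \<bullet> v)"
      unfolding scalar_prod_sum[OF w w] scalar_prod_sum[OF v v] using lim by (intro tendsto_intros) auto
    show "(\<lambda>n. w n \<bullet> (A *\<^sub>v w n)) \<longlonglongrightarrow> v \<bullet> (A *\<^sub>v v)"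
      unfolding mat_vec_scalar_sum[OF A w w] mat_vec_scalar_sum[OF A v v] using lim by (intro tendsto_intros) auto
    show "\<exists>N. \<forall>n\<ge>N. c * (w n \<bullet> w n) \<le> w n \<bullet> (A *\<^sub>v w n)"
      unfolding w_def using rat by blast
  qed
qed

lemma sets_quad_ge:
  fixes A :: "'a \<Rightarrow> real mat"
  assumes A: "\<And>\<omega>. A \<omega> \<in> carrier_mat p p"
    and Am: "\<And>j k. j < p \<Longrightarrow> k < p \<Longrightarrow> (\<lambda>\<omega>. A \<omega> $$ (j, k)) \<in> borel_measurable M"
  shows "{\<omega> \<in> space M. \<forall>v \<in> carrier_vec p. c * (v \<bullet> v) \<le> v \<bullet> (A \<omega> *\<^sub>v v)} \<in> sets M"
proof -
  define V where "V l = (Matrix.vec p (\<lambda>j. of_rat (l ! j)) :: real vec)" for l :: "rat list"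
  have V: "V l \<in> carrier_vec p" for l by (simp add: V_def)
  have "{\<omega> \<in> space M. \<forall>v \<in> carrier_vec p. c * (v \<bullet> v) \<le> v \<bullet> (A \<omega> *\<^sub>v v)} =
      {\<omega> \<in> space M. \<forall>l. c * (V l \<bullet> V l) \<le> V l \<bullet> (A \<omega> *\<^sub>v V l)}"
    using V quad_ge_dense[OF A] by (auto simp: V_def)
  also have "\<dots> \<in> sets M"
  proof (rule sets.sets_Collect_countable_All)
    fix l
    have "(\<lambda>\<omega>. V l \<bullet> (A \<omega> *\<^sub>v V l)) \<in> borel_measurable M"
      by (rule borel_measurable_bilinear[where p = p]) (use A Am V in auto)
    then show "{\<omega> \<in> space M. c * (V l \<bullet> V l) \<le> V l \<bullet> (A \<omega> *\<^sub>v V l)} \<in> sets M" by measurable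
  qed
  finally show ?thesis .
qed

section \<open>Conditioning on all rows but one, or on all outside a block\<close>

lemma sample_carrier:
  assumes "vec_law p \<mu>" "\<omega> \<in> space (\<Pi>\<^sub>M i\<in>I. \<mu>)" "i \<in> I"
  shows "\<omega> i \<in> carrier_vec p"
  using assms vec_law_space[OF assms(1)] by (auto simp: space_PiM)

lemma measurable_sample_index:
  assumes "vec_law p \<mu>" "i \<in> I" "j < p"
  shows "(\<lambda>\<omega>. \<omega> i $ j) \<in> borel_measurable (\<Pi>\<^sub>M i\<in>I. \<mu>)"
  using measurable_compose[OF measurable_component_singleton[OF assms(2)] measurable_vec_index[OF assms(1,3)]] by simp

lemma measurable_gram:
  assumes "vec_law p \<mu>" "J \<subseteq> I" "j < p" "k < p"
  shows "(\<lambda>\<omega>. gram p \<zeta> J \<omega> $$ (j, k)) \<in> borel_measurable (\<Pi>\<^sub>M i\<in>I. \<mu>)"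
proof -
  have "gram p \<zeta> J \<omega> $$ (j, k) = (if j = k then \<zeta> else 0) + (\<Sum>i\<in>J. \<omega> i $ j * \<omega> i $ k)" for \<omega>
    using assms(3,4) by (simp add: gram_def)
  moreover have "(\<lambda>\<omega>. (if j = k then \<zeta> else 0) + (\<Sum>i\<in>J. \<omega> i $ j * \<omega> i $ k)) \<in> borel_measurable (\<Pi>\<^sub>M i\<in>I. \<mu>)"
    by (intro borel_measurable_add borel_measurable_const borel_measurable_sum borel_measurable_times
        measurable_sample_index[OF assms(1)]) (use assms in auto)
  ultimately show ?thesis by (simp only:)
qed

text \<open>Fubini with the other rows frozen: row \<open>i\<close> is then a fresh sample from
  \<mu>, and a bound that holds for every section survives integration.\<close>

lemma PiM_emeasure_section_le:
  fixes \<mu> :: "'a measure"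
  assumes \<mu>: "prob_space \<mu>" and I: "finite I" "i \<in> I" and E: "E \<in> sets (\<Pi>\<^sub>M i\<in>I. \<mu>)"
    and sec: "\<And>\<omega>. \<omega> \<in> space (\<Pi>\<^sub>M i\<in>I - {i}. \<mu>) \<Longrightarrow> emeasure \<mu> {y \<in> space \<mu>. fun_upd \<omega> i y \<in> E} \<le> b"
  shows "emeasure (\<Pi>\<^sub>M i\<in>I. \<mu>) E \<le> b"
proof -
  interpret prob_space \<mu> by (rule \<mu>)
  interpret product_prob_space "\<lambda>_. \<mu>" I by unfold_locales
  let ?K = "I - {i}"
  have ins: "insert i ?K = I" using I by auto
  interpret K: prob_space "\<Pi>\<^sub>M i\<in>?K. \<mu>" by (rule prob_space_PiM) (rule \<mu>)
  have "emeasure (\<Pi>\<^sub>M i\<in>I. \<mu>) E = (\<integral>\<^sup>+\<omega>. indicator E \<omega> \<partial>(\<Pi>\<^sub>M i\<in>I. \<mu>))" using E by simp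
  also have "\<dots> = (\<integral>\<^sup>+\<omega>. (\<integral>\<^sup>+y. indicator E (fun_upd \<omega> i y) \<partial>\<mu>) \<partial>(\<Pi>\<^sub>M i\<in>?K. \<mu>))"
    using product_nn_integral_insert[of ?K i "indicator E"] I E ins by simp
  also have "\<dots> \<le> (\<integral>\<^sup>+\<omega>. b \<partial>(\<Pi>\<^sub>M i\<in>?K. \<mu>))"
  proof (rule nn_integral_mono)
    fix \<omega> assume \<omega>: "\<omega> \<in> space (\<Pi>\<^sub>M i\<in>?K. \<mu>)"
    have m: "(\<lambda>y. fun_upd \<omega> i y) \<in> measurable \<mu> (\<Pi>\<^sub>M i\<in>I. \<mu>)"
      using measurable_component_update[OF \<omega>, of i] ins by simp
    have set: "{y \<in> space \<mu>. fun_upd \<omega> i y \<in> E} \<in> sets \<mu>"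
      using measurable_sets[OF m E] by (simp add: vimage_def Int_def conj_commute)
    have "(\<integral>\<^sup>+y. indicator E (fun_upd \<omega> i y) \<partial>\<mu>) = (\<integral>\<^sup>+y. indicator {y \<in> space \<mu>. fun_upd \<omega> i y \<in> E} y \<partial>\<mu>)"
      by (intro nn_integral_cong) (auto simp: indicator_def)
    also have "\<dots> = emeasure \<mu> {y \<in> space \<mu>. fun_upd \<omega> i y \<in> E}" using set by simp
    finally show "(\<integral>\<^sup>+y. indicator E (fun_upd \<omega> i y) \<partial>\<mu>) \<le> b" using sec[OF \<omega>] by simp
  qed
  also have "\<dots> = b" by (simp add: K.emeasure_space_1)
  finally show ?thesis .
qed

lemma PiM_emeasure_fold_le:
  fixes \<mu> :: "'a measure"
  assumes \<mu>: "prob_space \<mu>" and I: "finite I" "J \<subseteq> I" and E: "E \<in> sets (\<Pi>\<^sub>M i\<in>I. \<mu>)"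
    and sec: "\<And>\<omega>. \<omega> \<in> space (\<Pi>\<^sub>M i\<in>I - J. \<mu>) \<Longrightarrow>
      emeasure (\<Pi>\<^sub>M i\<in>J. \<mu>) {y \<in> space (\<Pi>\<^sub>M i\<in>J. \<mu>). merge (I - J) J (\<omega>, y) \<in> E} \<le> b"
  shows "emeasure (\<Pi>\<^sub>M i\<in>I. \<mu>) E \<le> b"
proof -
  interpret prob_space \<mu> by (rule \<mu>)
  interpret product_prob_space "\<lambda>_. \<mu>" I by unfold_locales
  have un: "I - J \<union> J = I" using I by auto
  interpret K: prob_space "\<Pi>\<^sub>M i\<in>I - J. \<mu>" by (rule prob_space_PiM) (rule \<mu>)
  have "emeasure (\<Pi>\<^sub>M i\<in>I. \<mu>) E = (\<integral>\<^sup>+\<omega>. emeasure (\<Pi>\<^sub>M i\<in>J. \<mu>)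
      ((\<lambda>y. merge (I - J) J (\<omega>, y)) -` E \<inter> space (\<Pi>\<^sub>M i\<in>J. \<mu>)) \<partial>(\<Pi>\<^sub>M i\<in>I - J. \<mu>))"
    using emeasure_fold_integral[of "I - J" J E] I E un finite_subset[of J I] by auto
  also have "\<dots> \<le> (\<integral>\<^sup>+\<omega>. b \<partial>(\<Pi>\<^sub>M i\<in>I - J. \<mu>))"
    using sec by (intro nn_integral_mono) (simp add: vimage_def Int_def conj_commute)
  also have "\<dots> = b" by (simp add: K.emeasure_space_1)
  finally show ?thesis .
qed

section \<open>Isotropic laws and the success of one barrier step\<close>

lemma isotropic_second_moment:
  assumes law: "vec_law p \<mu>" and iso: "isotropic p \<mu>" and M: "M \<in> carrier_mat p p"
  shows "integrable \<mu> (\<lambda>y. y \<bullet> (M *\<^sub>v y))" and "(\<integral>y. y \<bullet> (M *\<^sub>v y) \<partial>\<mu>) = mtrace M"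
proof -
  have i: "integrable \<mu> (\<lambda>y. y $ j * y $ k)" "(\<integral>y. y $ j * y $ k \<partial>\<mu>) = (if j = k then 1 else 0)"
    if "j < p" "k < p" for j k using iso that by (auto simp: isotropic_def)
  have eq: "y \<bullet> (M *\<^sub>v y) = (\<Sum>j<p. \<Sum>k<p. M $$ (j, k) * (y $ j * y $ k))" if "y \<in> space \<mu>" for y
    using that vec_law_space[OF law] mat_vec_scalar_sum[OF M, of y y] by (simp add: mult_ac)
  have "integrable \<mu> (\<lambda>y. \<Sum>j<p. \<Sum>k<p. M $$ (j, k) * (y $ j * y $ k))"
    using i(1) by (intro Bochner_Integration.integrable_sum integrable_mult_right) auto
  moreover have "integrable \<mu> (\<lambda>y. y \<bullet> (M *\<^sub>v y)) \<longleftrightarrow> integrable \<mu> (\<lambda>y. \<Sum>j<p. \<Sum>k<p. M $$ (j, k) * (y $ j * y $ k))"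
    by (rule Bochner_Integration.integrable_cong[OF refl]) (rule eq)
  ultimately show "integrable \<mu> (\<lambda>y. y \<bullet> (M *\<^sub>v y))" by blast
  have "(\<integral>y. y \<bullet> (M *\<^sub>v y) \<partial>\<mu>) = (\<integral>y. (\<Sum>j<p. \<Sum>k<p. M $$ (j, k) * (y $ j * y $ k)) \<partial>\<mu>)"
    by (rule Bochner_Integration.integral_cong[OF refl]) (rule eq)
  also have "\<dots> = (\<Sum>j<p. \<Sum>k<p. M $$ (j, k) * (if j = k then 1 else 0))"
  proof (subst Bochner_Integration.integral_sum)
    show "integrable \<mu> (\<lambda>y. \<Sum>k<p. M $$ (j, k) * (y $ j * y $ k))" if "j \<in> {..<p}" for j
      using i(1) that by (intro Bochner_Integration.integrable_sum integrable_mult_right) auto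
    show "(\<Sum>j<p. \<integral>y. (\<Sum>k<p. M $$ (j, k) * (y $ j * y $ k)) \<partial>\<mu>) =
        (\<Sum>j<p. \<Sum>k<p. M $$ (j, k) * (if j = k then 1 else 0))"
    proof (intro sum.cong refl)
      fix j assume j: "j \<in> {..<p}"
      have "(\<integral>y. (\<Sum>k<p. M $$ (j, k) * (y $ j * y $ k)) \<partial>\<mu>) = (\<Sum>k<p. \<integral>y. M $$ (j, k) * (y $ j * y $ k) \<partial>\<mu>)"
        using i(1) j by (intro Bochner_Integration.integral_sum integrable_mult_right) auto
      also have "\<dots> = (\<Sum>k<p. M $$ (j, k) * (if j = k then 1 else 0))"
      proof (intro sum.cong refl)
        fix k assume "k \<in> {..<p}"
        then show "(\<integral>y. M $$ (j, k) * (y $ j * y $ k) \<partial>\<mu>) = M $$ (j, k) * (if j = k then 1 else 0)"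
          using i(2)[of j k] j by (simp only: integral_mult_right_zero lessThan_iff)
      qed
      finally show "(\<integral>y. (\<Sum>k<p. M $$ (j, k) * (y $ j * y $ k)) \<partial>\<mu>) = (\<Sum>k<p. M $$ (j, k) * (if j = k then 1 else 0))" .
    qed
  qed
  also have "\<dots> = (\<Sum>j<p. \<Sum>k<p. if j = k then M $$ (j, j) else 0)"
    by (intro sum.cong refl) auto
  also have "\<dots> = mtrace M" using M by (simp add: mtrace_def)
  finally show "(\<integral>y. y \<bullet> (M *\<^sub>v y) \<partial>\<mu>) = mtrace M" .
qed

text \<open>The weak lower bound that lets a new row move the barrier with positive probability. It
  is derived separately for each class of laws, with \<open>t\<close> and \<open>q\<close>
  independent of \<open>p\<close>.\<close>

definition anti_conc :: "nat \<Rightarrow> real \<Rightarrow> real \<Rightarrow> real vec measure \<Rightarrow> bool" where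
  "anti_conc p t q \<mu> \<longleftrightarrow> (\<forall>v \<in> carrier_vec p. q \<le> measure \<mu> {y \<in> space \<mu>. t * eucl_norm v \<le> \<bar>v \<bullet> y\<bar>})"

text \<open>Matrices are normalised to contractions, whose trace is at most \<open>p\<close>, so
  \<open>t\<close> is a relative deviation and \<open>r\<close> the failure probability. It is
  applied to \<beta> times the inverse of a matrix that dominates \<beta>.\<close>

definition quad_conc :: "nat \<Rightarrow> real \<Rightarrow> real \<Rightarrow> real vec measure \<Rightarrow> bool" where
  "quad_conc p t r \<mu> \<longleftrightarrow> (\<forall>M. psd_mat p M \<longrightarrow> (\<forall>v \<in> carrier_vec p. v \<bullet> (M *\<^sub>v v) \<le> v \<bullet> v) \<longrightarrow>
     measure \<mu> {y \<in> space \<mu>. t * real p < \<bar>y \<bullet> (M *\<^sub>v y) - mtrace M\<bar>} \<le> r)"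

lemma measurable_quad:
  assumes "vec_law p \<mu>" "M \<in> carrier_mat p p"
  shows "(\<lambda>y. y \<bullet> (M *\<^sub>v y)) \<in> borel_measurable \<mu>"
  by (rule borel_measurable_bilinear[where p = p])
    (use assms vec_law_space[OF assms(1)] measurable_vec_index[OF assms(1)] in auto)

lemma measurable_scalar_prod:
  assumes "vec_law p \<mu>" "v \<in> carrier_vec p"
  shows "(\<lambda>y. v \<bullet> y) \<in> borel_measurable \<mu>"
  by (rule borel_measurable_scalar_prod[where p = p])
    (use assms vec_law_space[OF assms(1)] measurable_vec_index[OF assms(1)] in auto)

lemma mat_vec_norm_rows:
  fixes M :: "real mat"
  assumes "M \<in> carrier_mat p p" "y \<in> carrier_vec p"
  shows "(M *\<^sub>v y) \<bullet> (M *\<^sub>v y) = (\<Sum>k<p. (row M k \<bullet> y)\<^sup>2)"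
proof -
  have c: "M *\<^sub>v y \<in> carrier_vec p" using assms by simp
  show ?thesis unfolding scalar_prod_sum[OF c c] using assms
    by (intro sum.cong refl) (simp add: power2_eq_square)
qed

text \<open>The two random requirements of \<open>barrier_step\<close>, as an event in the new row
  alone.\<close>

definition barrier_success :: "real \<Rightarrow> real \<Rightarrow> real vec measure \<Rightarrow> real mat \<Rightarrow> real vec set" where
  "barrier_success \<kappa>\<^sub>1 \<kappa>\<^sub>2 \<mu> M =
     {y \<in> space \<mu>. y \<bullet> (M *\<^sub>v y) \<le> \<kappa>\<^sub>1 \<and> \<kappa>\<^sub>2 * frob2 M \<le> (M *\<^sub>v y) \<bullet> (M *\<^sub>v y)}"

lemma barrier_success_sets:
  assumes law: "vec_law p \<mu>" and M: "M \<in> carrier_mat p p"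
  shows "barrier_success \<kappa>\<^sub>1 \<kappa>\<^sub>2 \<mu> M \<in> sets \<mu>"
proof -
  have [measurable]: "(\<lambda>y. y \<bullet> (M *\<^sub>v y)) \<in> borel_measurable \<mu>" by (rule measurable_quad[OF law M])
  have [measurable]: "(\<lambda>y. \<Sum>k<p. (row M k \<bullet> y)\<^sup>2) \<in> borel_measurable \<mu>"
    using M by (intro borel_measurable_sum borel_measurable_power measurable_scalar_prod[OF law]) auto
  have "barrier_success \<kappa>\<^sub>1 \<kappa>\<^sub>2 \<mu> M = {y \<in> space \<mu>. y \<bullet> (M *\<^sub>v y) \<le> \<kappa>\<^sub>1 \<and> \<kappa>\<^sub>2 * frob2 M \<le> (\<Sum>k<p. (row M k \<bullet> y)\<^sup>2)}"
    unfolding barrier_success_def using vec_law_space[OF law] mat_vec_norm_rows[OF M] by auto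
  also have "\<dots> \<in> sets \<mu>" by measurable
  finally show ?thesis .
qed

text \<open>Markov at level \<open>4 * \<phi> / q\<close> spends \<open>q / 4\<close> on the first
  requirement. For the second, the squared norm is a sum over the rows of \<open>M\<close>, each
  large with probability at least \<open>q\<close>. These events are dependent, so the weight of the
  failing rows is bounded in mean; it exceeds \<open>(1 - q / 2) * W\<close> with probability at
  most \<open>1 - q / 2\<close>. What remains is \<open>q / 2 - q / 4\<close>.\<close>

lemma barrier_success_prob:
  assumes law: "vec_law p \<mu>" and iso: "isotropic p \<mu>" and ac: "anti_conc p t q \<mu>" and t: "0 < t" and q: "0 < q" "q \<le> 1"
    and M: "psd_mat p M" and tr: "mtrace M \<le> \<phi>" and \<phi>: "0 < \<phi>"
  shows "q / 4 \<le> measure \<mu> (barrier_success (4 * \<phi> / q) (t\<^sup>2 * q / 2) \<mu> M)"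
proof -
  interpret prob_space \<mu> by (rule vec_law_prob[OF law])
  note Md = psd_matD[OF M]
  define X where "X y = y \<bullet> (M *\<^sub>v y)" for y
  have Xm[measurable]: "X \<in> borel_measurable \<mu>" unfolding X_def by (rule measurable_quad[OF law Md(1)])
  have X0: "0 \<le> X y" if "y \<in> space \<mu>" for y using Md(3) that vec_law_space[OF law] by (simp add: X_def)
  have "measure \<mu> {y \<in> space \<mu>. 4 * \<phi> / q \<le> X y} \<le> (\<integral>y. X y \<partial>\<mu>) / (4 * \<phi> / q)"
    using isotropic_second_moment(1)[OF law iso Md(1)] X0 \<phi> q
    by (intro integral_Markov_inequality_measure[where A = "{}"]) (auto simp: X_def)
  also have "\<dots> \<le> \<phi> / (4 * \<phi> / q)"
    using isotropic_second_moment(2)[OF law iso Md(1)] tr \<phi> q by (intro divide_right_mono) (auto simp: X_def)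
  also have "\<dots> = q / 4" using \<phi> by simp
  finally have markov: "measure \<mu> {y \<in> space \<mu>. 4 * \<phi> / q \<le> X y} \<le> q / 4" .
  define w where "w k = row M k \<bullet> row M k" for k
  define W where "W = frob2 M"
  have W: "W = (\<Sum>k<p. w k)" using Md(1) by (simp add: W_def frob2_def w_def)
  have w0: "0 \<le> w k" for k by (simp add: w_def scalar_prod_self_ge_0)
  have W0: "0 \<le> W" unfolding W by (intro sum_nonneg w0)
  have rc: "row M k \<in> carrier_vec p" if "k < p" for k using Md(1) that by auto
  define A where "A k = {y \<in> space \<mu>. t * eucl_norm (row M k) \<le> \<bar>row M k \<bullet> y\<bar>}" for k
  have As: "A k \<in> sets \<mu>" if "k < p" for k
  proof -
    have [measurable]: "(\<lambda>y. row M k \<bullet> y) \<in> borel_measurable \<mu>" by (rule measurable_scalar_prod[OF law rc[OF that]])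
    show ?thesis unfolding A_def by measurable
  qed
  have Aq: "q \<le> measure \<mu> (A k)" if "k < p" for k using ac rc[OF that] by (simp add: anti_conc_def A_def)
  \<comment> \<open>The part of the squared Frobenius norm carried by rows of \<open>M\<close> whose
    linear form is too small at \<open>y\<close>.\<close>
  define Z where "Z y = W - (\<Sum>k<p. w k * indicator (A k) y)" for y
  have Zm[measurable]: "Z \<in> borel_measurable \<mu>" unfolding Z_def using As by (intro borel_measurable_diff borel_measurable_sum) auto
  have Z0: "0 \<le> Z y" for y
  proof -
    have "(\<Sum>k<p. w k * indicator (A k) y) \<le> (\<Sum>k<p. w k)"
    proof (rule sum_mono)
      show "w k * indicator (A k) y \<le> w k" for k
        by (rule mult_left_le[OF indicator_le_1 w0])
    qed
    then show ?thesis by (simp only: Z_def W diff_ge_0_iff_ge)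
  qed
  have Ai: "integrable \<mu> (\<lambda>y. w k * indicator (A k) y)" if "k < p" for k
    using As[OF that] by (intro integrable_mult_right integrable_real_indicator) (auto simp: emeasure_eq_measure)
  have Zi: "integrable \<mu> Z" unfolding Z_def
    by (rule Bochner_Integration.integrable_diff, simp, rule Bochner_Integration.integrable_sum, rule Ai, simp)
  have EZ: "(\<integral>y. Z y \<partial>\<mu>) \<le> (1 - q) * W"
  proof -
    have "(\<integral>y. Z y \<partial>\<mu>) = W - (\<Sum>k<p. w k * measure \<mu> (A k))"
    proof -
      have "(\<integral>y. Z y \<partial>\<mu>) = (\<integral>y. W \<partial>\<mu>) - (\<integral>y. (\<Sum>k<p. w k * indicator (A k) y) \<partial>\<mu>)" unfolding Z_def
        by (rule Bochner_Integration.integral_diff, simp, rule Bochner_Integration.integrable_sum, rule Ai, simp)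
      also have "(\<integral>y. (\<Sum>k<p. w k * indicator (A k) y) \<partial>\<mu>) = (\<Sum>k<p. \<integral>y. w k * indicator (A k) y \<partial>\<mu>)"
        by (rule Bochner_Integration.integral_sum, rule Ai, simp)
      also have "\<dots> = (\<Sum>k<p. w k * measure \<mu> (A k))"
        using As by (intro sum.cong refl) simp
      finally show ?thesis by (simp add: prob_space)
    qed
    also have "\<dots> \<le> W - (\<Sum>k<p. w k * q)"
      using Aq w0 by (intro diff_left_mono sum_mono mult_left_mono) auto
    also have "\<dots> = (1 - q) * W" unfolding W sum_distrib_right[symmetric] left_diff_distrib by simp
    finally show ?thesis .
  qed
  let ?B = "{y \<in> space \<mu>. W - q / 2 * W < Z y}"
  have Bp: "measure \<mu> ?B \<le> 1 - q / 2"
  \<comment> \<open>At \<open>W = 0\<close> the threshold for Markov would be zero, but then the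
    event is empty.\<close>
  proof (cases "W = 0")
    case True
    have "0 \<le> (\<Sum>k<p. w k * indicator (A k) y)" for y by (intro sum_nonneg mult_nonneg_nonneg w0) simp
    then have "\<not> W - q / 2 * W < Z y" for y unfolding True Z_def by (simp add: not_less)
    then have B: "?B = {}" by blast
    show ?thesis unfolding B using q by simp
  next
    case False
    then have Wp: "0 < W" using W0 by simp
    have c: "0 < W - q / 2 * W" using Wp q by (simp add: field_simps)
    have "measure \<mu> ?B \<le> measure \<mu> {y \<in> space \<mu>. W - q / 2 * W \<le> Z y}"
      by (intro finite_measure_mono) auto
    also have "\<dots> \<le> (\<integral>y. Z y \<partial>\<mu>) / (W - q / 2 * W)"
      using Zi Z0 c by (intro integral_Markov_inequality_measure[where A = "{}"]) auto
    also have "\<dots> \<le> ((1 - q) * W) / (W - q / 2 * W)" using EZ c by (intro divide_right_mono) auto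
    also have "\<dots> \<le> 1 - q / 2"
    proof -
      \<comment> \<open>This is \<open>1 - q \<le> (1 - q / 2)\<^sup>2\<close>, multiplied by
        \<open>W\<close>.\<close>
      have "(1 - q) * W \<le> (1 - q / 2) * (W - q / 2 * W)"
      proof -
        have "(1 - q / 2) * (W - q / 2 * W) - (1 - q) * W = (q / 2)\<^sup>2 * W" by (simp add: field_simps power2_eq_square)
        moreover have "0 \<le> (q / 2)\<^sup>2 * W" using W0 by simp
        ultimately show ?thesis by linarith
      qed
      then show ?thesis using c by (simp add: pos_divide_le_eq)
    qed
    finally show ?thesis .
  qed
  let ?S = "barrier_success (4 * \<phi> / q) (t\<^sup>2 * q / 2) \<mu> M"
  have S: "?S \<in> sets \<mu>" by (rule barrier_success_sets[OF law Md(1)])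
  have "space \<mu> \<subseteq> ?S \<union> {y \<in> space \<mu>. 4 * \<phi> / q \<le> X y} \<union> ?B"
  proof
    fix y assume y: "y \<in> space \<mu>"
    show "y \<in> ?S \<union> {y \<in> space \<mu>. 4 * \<phi> / q \<le> X y} \<union> ?B"
    proof (cases "4 * \<phi> / q \<le> X y \<or> W - q / 2 * W < Z y")
      case True
      then show ?thesis using y by auto
    next
      case False
      then have X: "X y \<le> 4 * \<phi> / q" and Z: "q / 2 * W \<le> (\<Sum>k<p. w k * indicator (A k) y)" by (auto simp: Z_def)
      have yc: "y \<in> carrier_vec p" using y vec_law_space[OF law] by simp
      have "t\<^sup>2 * (q / 2 * W) \<le> t\<^sup>2 * (\<Sum>k<p. w k * indicator (A k) y)" using Z by (intro mult_left_mono) auto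
      also have "\<dots> \<le> (\<Sum>k<p. (row M k \<bullet> y)\<^sup>2)"
        unfolding sum_distrib_left
      proof (intro sum_mono)
        fix k assume "k \<in> {..<p}"
        show "t\<^sup>2 * (w k * indicator (A k) y) \<le> (row M k \<bullet> y)\<^sup>2"
        proof (cases "y \<in> A k")
          case True
          then have "(t * eucl_norm (row M k))\<^sup>2 \<le> \<bar>row M k \<bullet> y\<bar>\<^sup>2"
            using t by (intro power_mono) (auto simp: A_def)
          then show ?thesis using True by (simp add: power_mult_distrib eucl_norm_sq w_def)
        qed simp
      qed
      also have "\<dots> = (M *\<^sub>v y) \<bullet> (M *\<^sub>v y)" by (rule mat_vec_norm_rows[symmetric, OF Md(1) yc])
      finally show ?thesis using y X by (simp add: barrier_success_def X_def W_def)
    qed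
  qed
  then have "1 \<le> measure \<mu> (?S \<union> {y \<in> space \<mu>. 4 * \<phi> / q \<le> X y} \<union> ?B)"
    using S finite_measure_mono[of "space \<mu>" "?S \<union> {y \<in> space \<mu>. 4 * \<phi> / q \<le> X y} \<union> ?B"] prob_space by simp
  also have "\<dots> \<le> measure \<mu> (?S \<union> {y \<in> space \<mu>. 4 * \<phi> / q \<le> X y}) + measure \<mu> ?B"
    using S by (intro measure_Un_le) auto
  also have "measure \<mu> (?S \<union> {y \<in> space \<mu>. 4 * \<phi> / q \<le> X y}) \<le> measure \<mu> ?S + measure \<mu> {y \<in> space \<mu>. 4 * \<phi> / q \<le> X y}"
    using S by (intro measure_Un_le) auto
  finally show ?thesis using markov Bp by linarith
qed

section \<open>The smallest eigenvalue of the Gram matrix\<close>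

lemma dim_gram[simp]: "dim_row (gram p \<zeta> J y) = p" "dim_col (gram p \<zeta> J y) = p"
  by (simp_all add: gram_def)

lemma dim_inv_mat[simp]: "dim_row (inv_mat A) = dim_row A" "dim_col (inv_mat A) = dim_col A"
  by (simp_all add: inv_mat_def adj_mat_def)

lemma gram_cong: "(\<And>i. i \<in> J \<Longrightarrow> y i = z i) \<Longrightarrow> gram p \<zeta> J y = gram p \<zeta> J z"
  unfolding gram_def by (intro arg_cong[where f = "Matrix.mat p p"] ext) (auto intro!: sum.cong split: prod.splits)

lemma quad_add:
  assumes "A \<in> carrier_mat p p" "B \<in> carrier_mat p p" "v \<in> carrier_vec p"
  shows "v \<bullet> ((A + B) *\<^sub>v v) = v \<bullet> (A *\<^sub>v v) + v \<bullet> (B *\<^sub>v v :: real vec)"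
proof -
  have "A *\<^sub>v v \<in> carrier_vec p" "B *\<^sub>v v \<in> carrier_vec p" using assms by auto
  then show ?thesis using assms by (simp add: add_mult_distrib_mat_vec[of _ p p] scalar_prod_add_distrib[of _ p])
qed

lemma quad_scaled_one:
  assumes "v \<in> carrier_vec p"
  shows "v \<bullet> ((k \<cdot>\<^sub>m 1\<^sub>m p) *\<^sub>v v) = k * (v \<bullet> (v :: real vec))"
  using assms by (simp add: smult_mat_mult_vec[of _ p])

text \<open>Given the rows already read, the next one succeeds with probability at least
  \<open>q / 4\<close>. A success ticks off one of the \<open>k\<close> shifts still to be made, a
  failure only adds a semidefinite matrix. The bound is Chernoff's inequality with parameter 1 for
  too few successes: every row contributes a factor \<open>1 - q / 4 * (1 - exp (-1))\<close>.
  \<open>D\<close> is general because the updated matrix is the start for the remaining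
  rows.\<close>

lemma barrier_tail:
  fixes D :: "real mat" and k :: nat
  assumes law: "vec_law p \<mu>" and iso: "isotropic p \<mu>" and ac: "anti_conc p t q \<mu>" and t: "0 < t" and q: "0 < q" "q \<le> 1"
    and \<phi>: "0 < \<phi>" and \<delta>: "0 \<le> \<delta>" "\<delta> \<le> 1 / (2 * \<phi>)" "2 * \<delta> * (1 + 2 * (4 * \<phi> / q)) \<le> t\<^sup>2 * q / 2"
    and J: "finite J" and D: "pos_def_mat p D" "mtrace (inv_mat D) \<le> \<phi>"
  shows "emeasure (\<Pi>\<^sub>M i\<in>J. \<mu>) {\<omega> \<in> space (\<Pi>\<^sub>M i\<in>J. \<mu>). \<not> (\<forall>v \<in> carrier_vec p.
      real k * \<delta> * (v \<bullet> v) \<le> v \<bullet> ((D + gram p 0 J \<omega>) *\<^sub>v v))}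
    \<le> ennreal (exp (real k) * (1 - q / 4 * (1 - exp (-1))) ^ card J)"
  using J D
proof (induction J arbitrary: D k rule: finite_induct)
  case empty
  interpret P: prob_space "\<Pi>\<^sub>M i\<in>{}. \<mu>" by (rule prob_space_PiM) (rule vec_law_prob[OF law])
  show ?case
  proof (cases k)
    case 0
    have "0 \<le> v \<bullet> ((D + gram p 0 {} \<omega>) *\<^sub>v v)" if v: "v \<in> carrier_vec p" for v and \<omega> :: "nat \<Rightarrow> real vec"
      using psd_matD(3)[OF pos_def_psd[OF empty(1)] v] pos_def_matD(1)[OF empty(1)] v
      by (simp add: quad_add[of _ p] gram_empty quad_scaled_one)
    then show ?thesis by (simp add: 0)
  next
    \<comment> \<open>No row is left while shifts remain to be made; the claimed bound is then at
      least 1.\<close>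
    case (Suc k')
    have "emeasure (\<Pi>\<^sub>M i\<in>{}. \<mu>) A \<le> 1" for A by (rule P.measure_le_1)
    also have "(1 :: ennreal) \<le> ennreal (exp (real k))" by (simp add: ennreal_1[symmetric] del: ennreal_1)
    finally show ?thesis by simp
  qed
next
  case (insert i J)
  interpret prob_space \<mu> by (rule vec_law_prob[OF law])
  interpret product_sigma_finite "\<lambda>_. \<mu>" by unfold_locales
  define \<rho> where "\<rho> = 1 - q / 4 * (1 - exp (-1 :: real))"
  note Dd = pos_def_matD[OF insert.prems(1)]
  define Bad where "Bad J D k = {\<omega> \<in> space (\<Pi>\<^sub>M i\<in>J. \<mu>). \<not> (\<forall>v \<in> carrier_vec p.
      real k * \<delta> * (v \<bullet> v) \<le> v \<bullet> ((D + gram p 0 J \<omega>) *\<^sub>v v))}" for J :: "nat set" and D and k :: nat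
  have Bad_sets: "Bad J D k \<in> sets (\<Pi>\<^sub>M i\<in>J. \<mu>)" if D: "D \<in> carrier_mat p p" for J :: "nat set" and D and k :: nat
  proof -
    have "{\<omega> \<in> space (\<Pi>\<^sub>M i\<in>J. \<mu>). \<forall>v \<in> carrier_vec p.
      real k * \<delta> * (v \<bullet> v) \<le> v \<bullet> ((D + gram p 0 J \<omega>) *\<^sub>v v)} \<in> sets (\<Pi>\<^sub>M i\<in>J. \<mu>)"
    proof (rule sets_quad_ge)
      show "D + gram p 0 J \<omega> \<in> carrier_mat p p" for \<omega> using gram_carrier by (rule add_carrier_mat)
      fix a b assume ab: "a < p" "b < p"
      have "(D + gram p 0 J \<omega>) $$ (a, b) = D $$ (a, b) + gram p 0 J \<omega> $$ (a, b)" for \<omega>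
        by (rule index_add_mat(1)) (use ab in simp_all)
      moreover have "(\<lambda>\<omega>. D $$ (a, b) + gram p 0 J \<omega> $$ (a, b)) \<in> borel_measurable (\<Pi>\<^sub>M i\<in>J. \<mu>)"
        by (intro borel_measurable_add borel_measurable_const measurable_gram[OF law _ ab]) simp
      ultimately show "(\<lambda>\<omega>. (D + gram p 0 J \<omega>) $$ (a, b)) \<in> borel_measurable (\<Pi>\<^sub>M i\<in>J. \<mu>)" by (simp only:)
    qed
    then have "space (\<Pi>\<^sub>M i\<in>J. \<mu>) - {\<omega> \<in> space (\<Pi>\<^sub>M i\<in>J. \<mu>). \<forall>v \<in> carrier_vec p.
      real k * \<delta> * (v \<bullet> v) \<le> v \<bullet> ((D + gram p 0 J \<omega>) *\<^sub>v v)} \<in> sets (\<Pi>\<^sub>M i\<in>J. \<mu>)" by (rule sets.compl_sets)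
    also have "space (\<Pi>\<^sub>M i\<in>J. \<mu>) - {\<omega> \<in> space (\<Pi>\<^sub>M i\<in>J. \<mu>). \<forall>v \<in> carrier_vec p.
      real k * \<delta> * (v \<bullet> v) \<le> v \<bullet> ((D + gram p 0 J \<omega>) *\<^sub>v v)} = Bad J D k" unfolding Bad_def by blast
    finally show ?thesis .
  qed
  have IH: "emeasure (\<Pi>\<^sub>M i\<in>J. \<mu>) (Bad J D' k') \<le> ennreal (exp (real k') * \<rho> ^ card J)"
    if "pos_def_mat p D'" "mtrace (inv_mat D') \<le> \<phi>" for D' and k' :: nat
    unfolding Bad_def \<rho>_def by (rule insert.IH[OF that])
  have \<rho>: "0 \<le> \<rho>"
  proof -
    have "q / 4 * (1 - exp (-1)) \<le> 1 * 1" using q by (intro mult_mono) auto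
    then show ?thesis by (simp add: \<rho>_def)
  qed
  show ?case
  proof (cases k)
    case 0
    have "\<not> (\<exists>\<omega>\<in>space (\<Pi>\<^sub>M i\<in>insert i J. \<mu>). \<not> (\<forall>v \<in> carrier_vec p.
      real k * \<delta> * (v \<bullet> v) \<le> v \<bullet> ((D + gram p 0 (insert i J) \<omega>) *\<^sub>v v)))"
    proof (intro notI, elim bexE notE, intro ballI)
      fix \<omega> and v :: "real vec" assume \<omega>: "\<omega> \<in> space (\<Pi>\<^sub>M i\<in>insert i J. \<mu>)" and v: "v \<in> carrier_vec p"
      have "0 * (v \<bullet> v) \<le> v \<bullet> (gram p 0 (insert i J) \<omega> *\<^sub>v v)"
        by (rule quad_gram_ge[OF _ sample_carrier[OF law \<omega>] v]) (use insert.hyps in simp_all)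
      then show "real k * \<delta> * (v \<bullet> v) \<le> v \<bullet> ((D + gram p 0 (insert i J) \<omega>) *\<^sub>v v)"
        unfolding 0 quad_add[OF Dd(1) gram_carrier v] using psd_matD(3)[OF pos_def_psd[OF insert.prems(1)] v] by simp
    qed
    then have "{\<omega> \<in> space (\<Pi>\<^sub>M i\<in>insert i J. \<mu>). \<not> (\<forall>v \<in> carrier_vec p.
      real k * \<delta> * (v \<bullet> v) \<le> v \<bullet> ((D + gram p 0 (insert i J) \<omega>) *\<^sub>v v))} = {}" by blast
    then show ?thesis by (simp only: emeasure_empty zero_le)
  next
    case (Suc k')
    define S where "S = barrier_success (4 * \<phi> / q) (t\<^sup>2 * q / 2) \<mu> (inv_mat D)"
    have Ss: "S \<in> sets \<mu>" unfolding S_def by (rule barrier_success_sets[OF law inv_mat_carrier[OF Dd(1)]])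
    have Sq: "q / 4 \<le> measure \<mu> S" unfolding S_def
      by (rule barrier_success_prob[OF law iso ac t q pos_def_psd[OF inv_mat_pos_def[OF insert.prems(1)]] insert.prems(2) \<phi>])
    define c where "c = exp (real k) * \<rho> ^ card J"
    have c: "0 \<le> c" using \<rho> by (simp add: c_def)
    \<comment> \<open>The bound that remains after reading row \<open>y\<close>: a success removes
      one shift and with it a factor e. Averaging over \<open>y\<close> multiplies \<open>c\<close>
      by at most \<rho>.\<close>
    define g where "g y = c * (1 - (1 - exp (-1)) * indicator S y)" for y :: "real vec"
    have g0: "0 \<le> g y" for y unfolding g_def using c by (intro mult_nonneg_nonneg) (auto simp: indicator_def)
    have inner: "(\<integral>\<^sup>+\<omega>. indicator (Bad (insert i J) D k) (fun_upd \<omega> i y) \<partial>(\<Pi>\<^sub>M i\<in>J. \<mu>)) \<le> ennreal (g y)"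
      if y: "y \<in> space \<mu>" for y
    proof -
      have yc: "y \<in> carrier_vec p" using y vec_law_space[OF law] by simp
      have gr: "D + gram p 0 (insert i J) (fun_upd \<omega> i y) = (D + outer y) + gram p 0 J \<omega>" for \<omega>
      proof -
        have "gram p 0 (insert i J) (fun_upd \<omega> i y) = gram p 0 J (fun_upd \<omega> i y) + outer (fun_upd \<omega> i y i)"
          by (rule gram_insert[OF insert.hyps]) (use yc in simp)
        also have "gram p 0 J (fun_upd \<omega> i y) = gram p 0 J \<omega>" using insert.hyps(2) by (intro gram_cong) auto
        also have "fun_upd \<omega> i y i = y" by simp
        also have "gram p 0 J \<omega> + outer y = outer y + gram p 0 J \<omega>" by (rule comm_add_mat[OF gram_carrier outer_carrier[OF yc]])
        finally show ?thesis
          using assoc_add_mat[OF Dd(1) outer_carrier[OF yc] gram_carrier[of p 0 J \<omega>]] by (simp only:)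
      qed
      \<comment> \<open>After a success the spectrum is shifted and one shift is ticked off; after a
        failure the row is merely added, which cannot raise the trace of the inverse.\<close>
      define D' k'' where "D' = (if y \<in> S then D + (-\<delta>) \<cdot>\<^sub>m 1\<^sub>m p + outer y else D + outer y)"
        and "k'' = (if y \<in> S then k' else k)"
      have D': "pos_def_mat p D' \<and> mtrace (inv_mat D') \<le> \<phi>"
      proof (cases "y \<in> S")
        case True
        then have "y \<bullet> (inv_mat D *\<^sub>v y) \<le> 4 * \<phi> / q"
          "t\<^sup>2 * q / 2 * frob2 (inv_mat D) \<le> (inv_mat D *\<^sub>v y) \<bullet> (inv_mat D *\<^sub>v y)"
          by (simp_all add: S_def barrier_success_def)
        from barrier_step[OF insert.prems \<phi> \<delta>(1,2) yc this \<delta>(3)] True show ?thesis by (simp add: D'_def)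
      next
        case False
        have "0 \<le> (inv_mat D *\<^sub>v y) \<bullet> (inv_mat D *\<^sub>v y) / (1 + y \<bullet> (inv_mat D *\<^sub>v y))"
          using sherman_morrison(1)[OF insert.prems(1) yc] by (intro divide_nonneg_nonneg scalar_prod_self_ge_0) simp
        then show ?thesis
          using False pos_def_add_outer[OF insert.prems(1) yc] sherman_morrison(3)[OF insert.prems(1) yc] insert.prems(2)
          by (simp add: D'_def)
      qed
      have D'c: "D' \<in> carrier_mat p p" using D' pos_def_matD(1) by blast
      have Dshift: "v \<bullet> (D' *\<^sub>v v) = v \<bullet> ((D + outer y) *\<^sub>v v) - (if y \<in> S then \<delta> else 0) * (v \<bullet> v)"
        if v: "v \<in> carrier_vec p" for v
      proof (cases "y \<in> S")
        case True
        have a: "D + (-\<delta>) \<cdot>\<^sub>m 1\<^sub>m p \<in> carrier_mat p p" using Dd(1) by simp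
        have "v \<bullet> (D' *\<^sub>v v) = v \<bullet> ((D + (-\<delta>) \<cdot>\<^sub>m 1\<^sub>m p) *\<^sub>v v) + v \<bullet> (outer y *\<^sub>v v)"
          using True quad_add[OF a outer_carrier[OF yc] v] by (simp add: D'_def)
        also have "v \<bullet> ((D + (-\<delta>) \<cdot>\<^sub>m 1\<^sub>m p) *\<^sub>v v) = v \<bullet> (D *\<^sub>v v) + (-\<delta>) * (v \<bullet> v)"
          by (subst quad_add[OF Dd(1) _ v]) (simp_all add: quad_scaled_one[OF v])
        finally show ?thesis using True quad_add[OF Dd(1) outer_carrier[OF yc] v] by simp
      qed (simp add: D'_def)
      have Dc: "D + outer y \<in> carrier_mat p p" using outer_carrier[OF yc] by (rule add_carrier_mat)
      have "(\<integral>\<^sup>+\<omega>. indicator (Bad (insert i J) D k) (fun_upd \<omega> i y) \<partial>(\<Pi>\<^sub>M i\<in>J. \<mu>))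
          \<le> (\<integral>\<^sup>+\<omega>. indicator (Bad J D' k'') \<omega> \<partial>(\<Pi>\<^sub>M i\<in>J. \<mu>))"
      proof (rule nn_integral_mono)
        fix \<omega> assume \<omega>: "\<omega> \<in> space (\<Pi>\<^sub>M i\<in>J. \<mu>)"
        have "\<omega> \<in> Bad J D' k''" if "fun_upd \<omega> i y \<in> Bad (insert i J) D k"
        proof -
          from that have "\<not> (\<forall>v \<in> carrier_vec p. real k * \<delta> * (v \<bullet> v) \<le> v \<bullet> (((D + outer y) + gram p 0 J \<omega>) *\<^sub>v v))"
            by (simp only: Bad_def mem_Collect_eq gr simp_thms)
          then obtain v where v: "v \<in> carrier_vec p"
            and less: "\<not> real k * \<delta> * (v \<bullet> v) \<le> v \<bullet> (((D + outer y) + gram p 0 J \<omega>) *\<^sub>v v)"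
            by (auto simp only: not_all Ball_def not_imp)
          \<comment> \<open>The \<delta> missing from the form of \<open>D'\<close> after a success
            is exactly the \<delta> by which \<open>k' * \<delta>\<close> falls short of
            \<open>k * \<delta>\<close>.\<close>
          have "\<not> real k'' * \<delta> * (v \<bullet> v) \<le> v \<bullet> ((D' + gram p 0 J \<omega>) *\<^sub>v v)"
            using less unfolding quad_add[OF D'c gram_carrier v] quad_add[OF Dc gram_carrier v] Dshift[OF v] k''_def Suc
            by (cases "y \<in> S") (simp_all add: distrib_right)
          then have "\<not> (\<forall>v \<in> carrier_vec p. real k'' * \<delta> * (v \<bullet> v) \<le> v \<bullet> ((D' + gram p 0 J \<omega>) *\<^sub>v v))"
            using bspec[OF _ v] by (rule contrapos_nn)
          then show ?thesis using \<omega> by (simp only: Bad_def mem_Collect_eq simp_thms)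
        qed
        then show "indicator (Bad (insert i J) D k) (fun_upd \<omega> i y) \<le> (indicator (Bad J D' k'') \<omega> :: ennreal)"
          by (simp add: indicator_def)
      qed
      also have "\<dots> = emeasure (\<Pi>\<^sub>M i\<in>J. \<mu>) (Bad J D' k'')" using Bad_sets[OF D'c] by simp
      also have "\<dots> \<le> ennreal (exp (real k'') * \<rho> ^ card J)" using D' by (intro IH) auto
      also have "exp (real k'') * \<rho> ^ card J = g y"
      proof (cases "y \<in> S")
        case True
        have "exp (real k') = exp (real k) * exp (-1)" by (simp add: Suc exp_add[symmetric])
        then show ?thesis using True by (simp add: g_def c_def k''_def)
      qed (simp add: g_def c_def k''_def)
      finally show ?thesis .
    qed
    have "emeasure (\<Pi>\<^sub>M i\<in>insert i J. \<mu>) (Bad (insert i J) D k) =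
        (\<integral>\<^sup>+\<omega>. indicator (Bad (insert i J) D k) \<omega> \<partial>(\<Pi>\<^sub>M i\<in>insert i J. \<mu>))"
      using Bad_sets[OF Dd(1), of "insert i J" k] by simp
    also have "\<dots> = (\<integral>\<^sup>+y. (\<integral>\<^sup>+\<omega>. indicator (Bad (insert i J) D k) (fun_upd \<omega> i y) \<partial>(\<Pi>\<^sub>M i\<in>J. \<mu>)) \<partial>\<mu>)"
      using Bad_sets[OF Dd(1), of "insert i J" k] by (intro product_nn_integral_insert_rev insert.hyps) simp
    also have "\<dots> \<le> (\<integral>\<^sup>+y. ennreal (g y) \<partial>\<mu>)" using inner by (rule nn_integral_mono)
    also have "\<dots> = ennreal (\<integral>y. g y \<partial>\<mu>)"
    proof (rule nn_integral_eq_integral)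
      show "integrable \<mu> g" unfolding g_def using Ss
        by (intro integrable_mult_right Bochner_Integration.integrable_diff integrable_real_indicator) (simp_all add: emeasure_eq_measure)
    qed (use g0 in simp)
    also have "(\<integral>y. g y \<partial>\<mu>) = c * (1 - (1 - exp (-1)) * measure \<mu> S)"
      unfolding g_def using Ss by (simp add: prob_space emeasure_eq_measure)
    also have "\<dots> \<le> c * \<rho>"
    proof (rule mult_left_mono[OF _ c])
      have "(1 - exp (-1)) * (q / 4) \<le> (1 - exp (-1)) * measure \<mu> S" using Sq by (intro mult_left_mono) auto
      then show "1 - (1 - exp (-1)) * measure \<mu> S \<le> \<rho>" by (simp add: \<rho>_def mult.commute)
    qed
    also have "c * \<rho> = exp (real k) * \<rho> ^ card (insert i J)" using insert.hyps by (simp add: c_def)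
    finally show ?thesis unfolding Bad_def \<rho>_def by (simp add: ennreal_leI)
  qed
qed

lemma measurable_trace_inv_gram:
  assumes law: "vec_law p \<mu>" and "J \<subseteq> I"
  shows "(\<lambda>\<omega>. mtrace (inv_mat (gram p \<zeta> J \<omega>))) \<in> borel_measurable (\<Pi>\<^sub>M i\<in>I. \<mu>)"
proof -
  have "mtrace (inv_mat (gram p \<zeta> J \<omega>)) = (\<Sum>j<p. inv_mat (gram p \<zeta> J \<omega>) $$ (j, j))" for \<omega>
    by (simp add: mtrace_def)
  moreover have "(\<lambda>\<omega>. \<Sum>j<p. inv_mat (gram p \<zeta> J \<omega>) $$ (j, j)) \<in> borel_measurable (\<Pi>\<^sub>M i\<in>I. \<mu>)"
    by (intro borel_measurable_sum borel_measurable_inv_mat[where p = p] gram_carrier measurable_gram[OF law assms(2)]) auto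
  ultimately show ?thesis by (simp only:)
qed

text \<open>Freezing all rows outside \<open>J2\<close> turns the ridged Gram matrix of
  \<open>J1\<close> into a fixed starting matrix for \<open>barrier_tail\<close>. The trace bound is
  a conjunct of the event, so only frozen rows that satisfy it contribute.\<close>

lemma gram_lower_tail:
  fixes k :: nat
  assumes law: "vec_law p \<mu>" and iso: "isotropic p \<mu>" and ac: "anti_conc p t q \<mu>" and t: "0 < t" and q: "0 < q" "q \<le> 1"
    and \<phi>: "0 < \<phi>" and \<delta>: "0 \<le> \<delta>" "\<delta> \<le> 1 / (2 * \<phi>)" "2 * \<delta> * (1 + 2 * (4 * \<phi> / q)) \<le> t\<^sup>2 * q / 2"
    and I: "finite I" "J1 \<subseteq> I - J2" "J2 \<subseteq> I" and \<zeta>: "0 < \<zeta>"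
  defines "E \<equiv> {\<omega> \<in> space (\<Pi>\<^sub>M i\<in>I. \<mu>). mtrace (inv_mat (gram p \<zeta> J1 \<omega>)) \<le> \<phi> \<and>
      \<not> (\<forall>v \<in> carrier_vec p. real k * \<delta> * (v \<bullet> v) \<le> v \<bullet> ((gram p \<zeta> J1 \<omega> + gram p 0 J2 \<omega>) *\<^sub>v v))}"
  shows "E \<in> sets (\<Pi>\<^sub>M i\<in>I. \<mu>)"
    and "emeasure (\<Pi>\<^sub>M i\<in>I. \<mu>) E \<le> ennreal (exp (real k) * (1 - q / 4 * (1 - exp (-1))) ^ card J2)"
proof -
  have J1I: "J1 \<subseteq> I" using I by blast
  let ?G = "\<lambda>\<omega>. gram p \<zeta> J1 \<omega> + gram p 0 J2 \<omega>"
  define Q where "Q = {\<omega> \<in> space (\<Pi>\<^sub>M i\<in>I. \<mu>). \<forall>v \<in> carrier_vec p. real k * \<delta> * (v \<bullet> v) \<le> v \<bullet> (?G \<omega> *\<^sub>v v)}"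
  have Q: "Q \<in> sets (\<Pi>\<^sub>M i\<in>I. \<mu>)" unfolding Q_def
  proof (rule sets_quad_ge)
    show "?G \<omega> \<in> carrier_mat p p" for \<omega> using gram_carrier by (rule add_carrier_mat)
    fix a b assume ab: "a < p" "b < p"
    have "?G \<omega> $$ (a, b) = gram p \<zeta> J1 \<omega> $$ (a, b) + gram p 0 J2 \<omega> $$ (a, b)" for \<omega>
      by (rule index_add_mat(1)) (use ab in simp_all)
    moreover have "(\<lambda>\<omega>. gram p \<zeta> J1 \<omega> $$ (a, b) + gram p 0 J2 \<omega> $$ (a, b)) \<in> borel_measurable (\<Pi>\<^sub>M i\<in>I. \<mu>)"
      by (intro borel_measurable_add measurable_gram[OF law _ ab] J1I I(3))
    ultimately show "(\<lambda>\<omega>. ?G \<omega> $$ (a, b)) \<in> borel_measurable (\<Pi>\<^sub>M i\<in>I. \<mu>)" by (simp only:)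
  qed
  have [measurable]: "(\<lambda>\<omega>. mtrace (inv_mat (gram p \<zeta> J1 \<omega>))) \<in> borel_measurable (\<Pi>\<^sub>M i\<in>I. \<mu>)"
    by (rule measurable_trace_inv_gram[OF law J1I])
  have "E = {\<omega> \<in> space (\<Pi>\<^sub>M i\<in>I. \<mu>). mtrace (inv_mat (gram p \<zeta> J1 \<omega>)) \<le> \<phi>} - Q" unfolding E_def Q_def by blast
  also have "\<dots> \<in> sets (\<Pi>\<^sub>M i\<in>I. \<mu>)" by (intro sets.Diff Q) measurable
  finally show E: "E \<in> sets (\<Pi>\<^sub>M i\<in>I. \<mu>)" .
  show "emeasure (\<Pi>\<^sub>M i\<in>I. \<mu>) E \<le> ennreal (exp (real k) * (1 - q / 4 * (1 - exp (-1))) ^ card J2)"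
  proof (rule PiM_emeasure_fold_le[OF vec_law_prob[OF law] I(1) I(3) E])
    fix \<omega> assume \<omega>: "\<omega> \<in> space (\<Pi>\<^sub>M i\<in>I - J2. \<mu>)"
    have g1: "gram p \<zeta> J1 (merge (I - J2) J2 (\<omega>, y)) = gram p \<zeta> J1 \<omega>" for y
      using I(2) by (intro gram_cong) (auto simp: merge_def)
    have g2: "gram p 0 J2 (merge (I - J2) J2 (\<omega>, y)) = gram p 0 J2 y" for y
      by (intro gram_cong) (auto simp: merge_def)
    let ?S = "{y \<in> space (\<Pi>\<^sub>M i\<in>J2. \<mu>). merge (I - J2) J2 (\<omega>, y) \<in> E}"
    let ?T = "{y \<in> space (\<Pi>\<^sub>M i\<in>J2. \<mu>). \<not> (\<forall>v \<in> carrier_vec p.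
      real k * \<delta> * (v \<bullet> v) \<le> v \<bullet> ((gram p \<zeta> J1 \<omega> + gram p 0 J2 y) *\<^sub>v v))}"
    show "emeasure (\<Pi>\<^sub>M i\<in>J2. \<mu>) ?S \<le> ennreal (exp (real k) * (1 - q / 4 * (1 - exp (-1))) ^ card J2)"
    proof (cases "mtrace (inv_mat (gram p \<zeta> J1 \<omega>)) \<le> \<phi>")
      case False
      then have "?S = {}" unfolding E_def by (simp add: g1)
      then show ?thesis by (simp only: emeasure_empty zero_le)
    next
      case True
      have ST: "?S = ?T"
      proof (intro Collect_cong conj_cong refl)
        fix y assume y: "y \<in> space (\<Pi>\<^sub>M i\<in>J2. \<mu>)"
        have un: "I - J2 \<union> J2 = I" using I(3) by blast
        have "merge (I - J2) J2 (\<omega>, y) \<in> space (\<Pi>\<^sub>M i\<in>I. \<mu>)"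
          using measurable_space[OF measurable_merge[of "I - J2" J2 "\<lambda>_. \<mu>"], of "(\<omega>, y)"] \<omega> y un
          by (simp add: space_pair_measure)
        then show "merge (I - J2) J2 (\<omega>, y) \<in> E \<longleftrightarrow> \<not> (\<forall>v \<in> carrier_vec p.
          real k * \<delta> * (v \<bullet> v) \<le> v \<bullet> ((gram p \<zeta> J1 \<omega> + gram p 0 J2 y) *\<^sub>v v))"
          unfolding E_def using True by (simp add: g1 g2)
      qed
      have pd: "pos_def_mat p (gram p \<zeta> J1 \<omega>)"
      proof (rule gram_pos_defI[OF \<zeta>])
        show "\<zeta> * (v \<bullet> v) \<le> v \<bullet> (gram p \<zeta> J1 \<omega> *\<^sub>v v)" if "v \<in> carrier_vec p" for v
          by (rule quad_gram_ge[OF finite_subset[OF J1I I(1)] sample_carrier[OF law \<omega>] that]) (use I(2) in blast)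
      qed
      show ?thesis unfolding ST
        by (rule barrier_tail[OF law iso ac t q \<phi> \<delta> finite_subset[OF I(3,1)] pd True])
    qed
  qed
qed

lemma leave_one_out_tail:
  fixes \<zeta> :: real
  assumes law: "vec_law p \<mu>" and qc: "quad_conc p s r \<mu>"
    and I: "finite I" "l \<in> I" "J \<subseteq> I - {l}" and \<beta>: "0 < \<beta>"
  defines "E \<equiv> {\<omega> \<in> space (\<Pi>\<^sub>M i\<in>I. \<mu>). (\<forall>v \<in> carrier_vec p. \<beta> * (v \<bullet> v) \<le> v \<bullet> (gram p \<zeta> J \<omega> *\<^sub>v v)) \<and>
      s * real p / \<beta> < \<bar>\<omega> l \<bullet> (inv_mat (gram p \<zeta> J \<omega>) *\<^sub>v \<omega> l) - mtrace (inv_mat (gram p \<zeta> J \<omega>))\<bar>}"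
  shows "E \<in> sets (\<Pi>\<^sub>M i\<in>I. \<mu>)" and "emeasure (\<Pi>\<^sub>M i\<in>I. \<mu>) E \<le> ennreal r"
proof -
  interpret prob_space \<mu> by (rule vec_law_prob[OF law])
  have JI: "J \<subseteq> I" using I by blast
  have Q: "{\<omega> \<in> space (\<Pi>\<^sub>M i\<in>I. \<mu>). \<forall>v \<in> carrier_vec p. \<beta> * (v \<bullet> v) \<le> v \<bullet> (gram p \<zeta> J \<omega> *\<^sub>v v)} \<in> sets (\<Pi>\<^sub>M i\<in>I. \<mu>)"
    by (rule sets_quad_ge[OF gram_carrier measurable_gram[OF law JI]])
  have [measurable]: "(\<lambda>\<omega>. mtrace (inv_mat (gram p \<zeta> J \<omega>))) \<in> borel_measurable (\<Pi>\<^sub>M i\<in>I. \<mu>)"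
    by (rule measurable_trace_inv_gram[OF law JI])
  have [measurable]: "(\<lambda>\<omega>. \<omega> l \<bullet> (inv_mat (gram p \<zeta> J \<omega>) *\<^sub>v \<omega> l)) \<in> borel_measurable (\<Pi>\<^sub>M i\<in>I. \<mu>)"
  proof (rule borel_measurable_bilinear[where p = p])
    show "inv_mat (gram p \<zeta> J \<omega>) \<in> carrier_mat p p" for \<omega> by (rule inv_mat_carrier[OF gram_carrier])
    show "(\<lambda>\<omega>. inv_mat (gram p \<zeta> J \<omega>) $$ (j, k)) \<in> borel_measurable (\<Pi>\<^sub>M i\<in>I. \<mu>)" if "j < p" "k < p" for j k
      by (rule borel_measurable_inv_mat[OF gram_carrier measurable_gram[OF law JI] that])
  qed (rule sample_carrier[OF law _ I(2)] measurable_sample_index[OF law I(2)]; assumption)+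
  have "{\<omega> \<in> space (\<Pi>\<^sub>M i\<in>I. \<mu>). s * real p / \<beta> <
      \<bar>\<omega> l \<bullet> (inv_mat (gram p \<zeta> J \<omega>) *\<^sub>v \<omega> l) - mtrace (inv_mat (gram p \<zeta> J \<omega>))\<bar>} \<in> sets (\<Pi>\<^sub>M i\<in>I. \<mu>)"
    by measurable
  with Q have "{\<omega> \<in> space (\<Pi>\<^sub>M i\<in>I. \<mu>). \<forall>v \<in> carrier_vec p. \<beta> * (v \<bullet> v) \<le> v \<bullet> (gram p \<zeta> J \<omega> *\<^sub>v v)} \<inter>
    {\<omega> \<in> space (\<Pi>\<^sub>M i\<in>I. \<mu>). s * real p / \<beta> <
      \<bar>\<omega> l \<bullet> (inv_mat (gram p \<zeta> J \<omega>) *\<^sub>v \<omega> l) - mtrace (inv_mat (gram p \<zeta> J \<omega>))\<bar>} \<in> sets (\<Pi>\<^sub>M i\<in>I. \<mu>)"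
    by (rule sets.Int)
  also have "{\<omega> \<in> space (\<Pi>\<^sub>M i\<in>I. \<mu>). \<forall>v \<in> carrier_vec p. \<beta> * (v \<bullet> v) \<le> v \<bullet> (gram p \<zeta> J \<omega> *\<^sub>v v)} \<inter>
    {\<omega> \<in> space (\<Pi>\<^sub>M i\<in>I. \<mu>). s * real p / \<beta> <
      \<bar>\<omega> l \<bullet> (inv_mat (gram p \<zeta> J \<omega>) *\<^sub>v \<omega> l) - mtrace (inv_mat (gram p \<zeta> J \<omega>))\<bar>} = E" unfolding E_def by blast
  finally show E: "E \<in> sets (\<Pi>\<^sub>M i\<in>I. \<mu>)" .
  show "emeasure (\<Pi>\<^sub>M i\<in>I. \<mu>) E \<le> ennreal r"
  proof (rule PiM_emeasure_section_le[OF vec_law_prob[OF law] I(1,2) E])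
    fix \<omega> assume \<omega>: "\<omega> \<in> space (\<Pi>\<^sub>M i\<in>I - {l}. \<mu>)"
    let ?A = "gram p \<zeta> J \<omega>"
    have g: "gram p \<zeta> J (fun_upd \<omega> l y) = ?A" for y using I(3) by (intro gram_cong) auto
    show "emeasure \<mu> {y \<in> space \<mu>. fun_upd \<omega> l y \<in> E} \<le> ennreal r"
    proof (cases "\<forall>v \<in> carrier_vec p. \<beta> * (v \<bullet> v) \<le> v \<bullet> (?A *\<^sub>v v)")
      case False
      then have "{y \<in> space \<mu>. fun_upd \<omega> l y \<in> E} = {}" unfolding E_def mem_Collect_eq g by blast
      then show ?thesis by (simp only: emeasure_empty zero_le)
    next
      case True
      have pd: "pos_def_mat p ?A" by (rule gram_pos_defI[OF \<beta>]) (use True in blast)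
      note R = pos_def_psd[OF inv_mat_pos_def[OF pd]]
      note Rd = psd_matD[OF R]
      let ?M = "\<beta> \<cdot>\<^sub>m inv_mat ?A"
      have qM: "v \<bullet> (?M *\<^sub>v v) = \<beta> * (v \<bullet> (inv_mat ?A *\<^sub>v v))" if "v \<in> carrier_vec p" for v
        using Rd(1) that inv_mat_vec_carrier[OF gram_carrier that, of \<zeta> J \<omega>] by (simp add: smult_mat_mult_vec[of _ p])
      have tM: "mtrace ?M = \<beta> * mtrace (inv_mat ?A)" using Rd(1) by (simp add: mtrace_def sum_distrib_left)
      have Mpsd: "psd_mat p ?M" unfolding psd_mat_def
      proof (intro conjI ballI)
        show "?M \<in> carrier_mat p p" using Rd(1) by simp
        show "?M\<^sup>T = ?M" by (rule sym_mat_smult[OF Rd(2)])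
        show "0 \<le> v \<bullet> (?M *\<^sub>v v)" if "v \<in> carrier_vec p" for v unfolding qM[OF that] using Rd(3)[OF that] \<beta> by simp
      qed
      have Mle: "v \<bullet> (?M *\<^sub>v v) \<le> v \<bullet> v" if v: "v \<in> carrier_vec p" for v
      proof -
        have "v \<bullet> (inv_mat ?A *\<^sub>v v) \<le> (v \<bullet> v) / \<beta>" by (rule inv_mat_bounds(2)[OF pd \<beta> v]) (use True in blast)
        then show ?thesis unfolding qM[OF v] using \<beta> by (simp add: field_simps)
      qed
      have "{y \<in> space \<mu>. fun_upd \<omega> l y \<in> E} \<subseteq> {y \<in> space \<mu>. s * real p < \<bar>y \<bullet> (?M *\<^sub>v y) - mtrace ?M\<bar>}"
      proof
        fix y assume "y \<in> {y \<in> space \<mu>. fun_upd \<omega> l y \<in> E}"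
        then have y: "y \<in> space \<mu>" and d: "s * real p / \<beta> < \<bar>y \<bullet> (inv_mat ?A *\<^sub>v y) - mtrace (inv_mat ?A)\<bar>"
          unfolding E_def mem_Collect_eq g by auto
        have yc: "y \<in> carrier_vec p" using y vec_law_space[OF law] by simp
        have "\<bar>y \<bullet> (?M *\<^sub>v y) - mtrace ?M\<bar> = \<beta> * \<bar>y \<bullet> (inv_mat ?A *\<^sub>v y) - mtrace (inv_mat ?A)\<bar>"
          unfolding qM[OF yc] tM right_diff_distrib[symmetric] abs_mult using \<beta> by simp
        moreover have "\<beta> * (s * real p / \<beta>) < \<beta> * \<bar>y \<bullet> (inv_mat ?A *\<^sub>v y) - mtrace (inv_mat ?A)\<bar>"
          using d \<beta> by (rule mult_strict_left_mono)
        moreover have "\<beta> * (s * real p / \<beta>) = s * real p" using \<beta> by simp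
        ultimately show "y \<in> {y \<in> space \<mu>. s * real p < \<bar>y \<bullet> (?M *\<^sub>v y) - mtrace ?M\<bar>}" using y by simp
      qed
      moreover have "{y \<in> space \<mu>. s * real p < \<bar>y \<bullet> (?M *\<^sub>v y) - mtrace ?M\<bar>} \<in> sets \<mu>"
      proof -
        have [measurable]: "(\<lambda>y. y \<bullet> (?M *\<^sub>v y)) \<in> borel_measurable \<mu>" by (rule measurable_quad[OF law psd_matD(1)[OF Mpsd]])
        show ?thesis by measurable
      qed
      ultimately have "emeasure \<mu> {y \<in> space \<mu>. fun_upd \<omega> l y \<in> E} \<le>
          emeasure \<mu> {y \<in> space \<mu>. s * real p < \<bar>y \<bullet> (?M *\<^sub>v y) - mtrace ?M\<bar>}" by (rule emeasure_mono)
      also have "\<dots> \<le> ennreal r"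
        unfolding emeasure_eq_measure using qc Mpsd Mle by (intro ennreal_leI) (simp add: quad_conc_def)
      finally show ?thesis .
    qed
  qed
qed

section \<open>Concentration of the leverages\<close>

text \<open>All leverages are near \<open>\<tau> / (1 + \<tau>)\<close> and average to
  \<open>p / n\<close> exactly, so the common number is itself near \<open>p / n\<close>. This
  second comparison doubles the error.\<close>

lemma leverage_concentration:
  assumes y: "\<And>i. i < n \<Longrightarrow> y i \<in> carrier_vec p" and n: "0 < n" and \<beta>: "0 < \<beta>"
    and ge: "\<And>l v. l < n \<Longrightarrow> v \<in> carrier_vec p \<Longrightarrow> \<beta> * (v \<bullet> v) \<le> v \<bullet> (gram p 0 ({..<n} - {l}) y *\<^sub>v v)"
    and dev: "\<And>l. l < n \<Longrightarrow> \<bar>y l \<bullet> (inv_mat (gram p 0 ({..<n} - {l}) y) *\<^sub>v y l)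
        - mtrace (inv_mat (gram p 0 ({..<n} - {l}) y))\<bar> \<le> e"
  shows "pos_def_mat p (gram p 0 {..<n} y)"
    and "\<And>i. i < n \<Longrightarrow> \<bar>y i \<bullet> (inv_mat (gram p 0 {..<n} y) *\<^sub>v y i) - real p / real n\<bar> \<le> 2 * (e + 1 / \<beta>)"
proof -
  define \<tau> where "\<tau> = mtrace (inv_mat (gram p 0 {..<n} y))"
  define h where "h i = y i \<bullet> (inv_mat (gram p 0 {..<n} y) *\<^sub>v y i)" for i
  have yc: "y i \<in> carrier_vec p" if "i \<in> {..<n}" for i using y that by simp
  have lev: "pos_def_mat p (gram p 0 {..<n} y) \<and> \<bar>h l - \<tau> / (1 + \<tau>)\<bar> \<le> e + 1 / \<beta>" if l: "l < n" for l
  proof -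
    have l': "l \<in> {..<n}" using l by simp
    show ?thesis
      using leverage_deviation(1,3)[of "{..<n}" y p l \<beta> 0 e, OF finite_lessThan yc l' \<beta> ge[OF l] dev[OF l]]
      by (simp add: h_def \<tau>_def)
  qed
  show pd: "pos_def_mat p (gram p 0 {..<n} y)" using lev[OF n] by blast
  have sum: "(\<Sum>l<n. h l) = real p"
    using sum_leverage[of "{..<n}" y p 0, OF finite_lessThan yc pd] by (simp add: h_def)
  have "\<bar>real p - real n * (\<tau> / (1 + \<tau>))\<bar> = \<bar>\<Sum>l<n. h l - \<tau> / (1 + \<tau>)\<bar>"
    by (simp add: sum_subtractf sum)
  also have "\<dots> \<le> (\<Sum>l<n. \<bar>h l - \<tau> / (1 + \<tau>)\<bar>)" by (rule sum_abs)
  also have "\<dots> \<le> (\<Sum>l<n. e + 1 / \<beta>)" using lev by (intro sum_mono) simp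
  finally have "\<bar>real p - real n * (\<tau> / (1 + \<tau>))\<bar> \<le> real n * (e + 1 / \<beta>)" by simp
  moreover have "\<bar>real p - real n * (\<tau> / (1 + \<tau>))\<bar> = real n * \<bar>real p / real n - \<tau> / (1 + \<tau>)\<bar>"
  proof -
    have "real p - real n * (\<tau> / (1 + \<tau>)) = real n * (real p / real n - \<tau> / (1 + \<tau>))"
      unfolding right_diff_distrib using n by simp
    then show ?thesis by (simp add: abs_mult)
  qed
  ultimately have 1: "\<bar>real p / real n - \<tau> / (1 + \<tau>)\<bar> \<le> e + 1 / \<beta>" using n by simp
  show "\<bar>y i \<bullet> (inv_mat (gram p 0 {..<n} y) *\<^sub>v y i) - real p / real n\<bar> \<le> 2 * (e + 1 / \<beta>)" if "i < n" for i
    using lev[OF that, THEN conjunct2] 1 unfolding h_def by argo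
qed

text \<open>If \<tau> were large, every leverage would be close to 1, but the leverages sum to at
  most \<open>p\<close>, a fraction \<gamma> below 1 of the number of rows. The resulting bound
  involves \<gamma> only; the ridge merely enters the admissible error through
  \<open>1 / \<zeta>\<close>.\<close>

lemma trace_bound_of_deviations:
  assumes J: "finite J" "\<And>i. i \<in> J \<Longrightarrow> y i \<in> carrier_vec p" and \<zeta>: "0 < \<zeta>" and \<gamma>: "0 < \<gamma>" "\<gamma> < 1"
    and card: "real p \<le> \<gamma> * real (card J)" and J0: "J \<noteq> {}"
    and dev: "\<And>l. l \<in> J \<Longrightarrow> \<bar>y l \<bullet> (inv_mat (gram p \<zeta> (J - {l}) y) *\<^sub>v y l)
        - mtrace (inv_mat (gram p \<zeta> (J - {l}) y))\<bar> \<le> e"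
    and e: "e + 1 / \<zeta> \<le> (1 - \<gamma>) / 2"
  shows "mtrace (inv_mat (gram p \<zeta> J y)) \<le> (1 + \<gamma>) / (1 - \<gamma>)"
proof -
  define \<tau> where "\<tau> = mtrace (inv_mat (gram p \<zeta> J y))"
  define h where "h i = y i \<bullet> (inv_mat (gram p \<zeta> J y) *\<^sub>v y i)" for i
  have lev: "pos_def_mat p (gram p \<zeta> J y) \<and> 0 \<le> \<tau> \<and> \<bar>h l - \<tau> / (1 + \<tau>)\<bar> \<le> e + 1 / \<zeta>" if l: "l \<in> J" for l
  proof -
    have yJ: "y i \<in> carrier_vec p" if "i \<in> J - {l}" for i using J(2) that by simp
    have ge: "\<zeta> * (v \<bullet> v) \<le> v \<bullet> (gram p \<zeta> (J - {l}) y *\<^sub>v v)" if "v \<in> carrier_vec p" for v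
      by (rule quad_gram_ge[OF finite_Diff[OF J(1)] yJ that])
    show ?thesis using leverage_deviation[of J y p l \<zeta> \<zeta> e, OF J l \<zeta> ge dev[OF l]] by (simp add: h_def \<tau>_def)
  qed
  obtain l0 where l0: "l0 \<in> J" using J0 by blast
  have pd: "pos_def_mat p (gram p \<zeta> J y)" and \<tau>0: "0 \<le> \<tau>" using lev[OF l0] by auto
  have m: "0 < real (card J)" using J(1) J0 by (simp add: card_gt_0_iff)
  have "(\<Sum>l\<in>J. \<tau> / (1 + \<tau>) - (e + 1 / \<zeta>)) \<le> (\<Sum>l\<in>J. h l)"
  proof (rule sum_mono)
    fix l assume "l \<in> J"
    then show "\<tau> / (1 + \<tau>) - (e + 1 / \<zeta>) \<le> h l" using lev[of l] by linarith
  qed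
  also have "(\<Sum>l\<in>J. h l) = real p - \<zeta> * \<tau>"
    unfolding h_def \<tau>_def by (rule sum_leverage[OF J pd])
  also have "\<dots> \<le> real p" using \<zeta> \<tau>0 by simp
  also have "\<dots> \<le> \<gamma> * real (card J)" by (rule card)
  finally have "real (card J) * (\<tau> / (1 + \<tau>) - (e + 1 / \<zeta>)) \<le> real (card J) * \<gamma>" by (simp add: mult.commute)
  then have "\<tau> / (1 + \<tau>) - (e + 1 / \<zeta>) \<le> \<gamma>" using m mult_le_cancel_left_pos by blast
  then have "\<tau> / (1 + \<tau>) \<le> (1 + \<gamma>) / 2" using e by argo
  then have "\<tau> * 2 \<le> (1 + \<gamma>) * (1 + \<tau>)" using \<tau>0 by (simp add: field_simps)
  then have "\<tau> * (1 - \<gamma>) \<le> 1 + \<gamma>" by (simp add: algebra_simps)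
  then show ?thesis using \<gamma> by (simp add: \<tau>_def field_simps)
qed

text \<open>
  The smallest eigenvalue is bounded below in two steps. On a subsample \<open>J1\<close> that is still larger
  than \<open>p\<close>, the self-consistent equation for the regularised trace bounds it by a constant which does
  not depend on the regularisation \<open>z * n\<close>. The remaining \<open>J2\<close> rows then push the spectrum
  away from \<open>-z * n\<close> by a multiple of \<open>n\<close>, which exceeds \<open>2 * z * n\<close> for small \<open>z\<close>.
\<close>

lemma leverage_probability:
  assumes \<gamma>: "0 < \<gamma>" "\<gamma> < 1" and t: "0 < t" and q: "0 < q" "q \<le> 1"
  shows "\<exists>s>0. \<exists>b>0. \<exists>c>0. \<exists>N. \<forall>n p \<mu> r1 r2 s2. N \<le> n \<longrightarrow> real p / real n = \<gamma> \<longrightarrow> vec_law p \<mu> \<longrightarrow> isotropic p \<mu> \<longrightarrow>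
    anti_conc p t q \<mu> \<longrightarrow> 0 \<le> r1 \<longrightarrow> quad_conc p s r1 \<mu> \<longrightarrow> 0 \<le> r2 \<longrightarrow> quad_conc p s2 r2 \<mu> \<longrightarrow>
    (\<exists>E \<in> sets (\<Pi>\<^sub>M i\<in>{..<n}. \<mu>).
      emeasure (\<Pi>\<^sub>M i\<in>{..<n}. \<mu>) E \<le> ennreal (real n * (real n * r1 + exp (- c * real n) + r2)) \<and>
      (\<forall>\<omega> \<in> space (\<Pi>\<^sub>M i\<in>{..<n}. \<mu>) - E. pos_def_mat p (gram p 0 {..<n} \<omega>) \<and>
        (\<forall>i<n. \<bar>\<omega> i \<bullet> (inv_mat (gram p 0 {..<n} \<omega>) *\<^sub>v \<omega> i) - \<gamma>\<bar> \<le> 2 * (s2 * \<gamma> / b + 1 / (b * real n)))))"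
proof -
  \<comment> \<open>The subsample retains a fraction
    \<open>1 - \<alpha> = (1 + \<gamma>) / 2\<close> of the rows, so this is its ratio of dimension
    to size before rounding; it is still below 1.\<close>
  define \<gamma>' where "\<gamma>' = 2 * \<gamma> / (1 + \<gamma>)"
  define \<alpha> where "\<alpha> = (1 - \<gamma>) / 2"
  define \<phi> where "\<phi> = (1 + \<gamma>') / (1 - \<gamma>')"
  \<comment> \<open>The largest shift that both conditions of \<open>barrier_step\<close>
    permit.\<close>
  define \<delta> where "\<delta> = min (1 / (2 * \<phi>)) ((t\<^sup>2 * q / 2) / (2 * (1 + 2 * (4 * \<phi> / q))))"
  define \<rho> where "\<rho> = 1 - q / 4 * (1 - exp (-1 :: real))"
  \<comment> \<open>Since \<open>\<rho> ^ m = exp (- 2 * \<kappa> * m)\<close>, asking for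
    \<open>\<kappa> * m\<close> successes among \<open>m\<close> rows leaves the failure bound
    \<open>exp (- \<kappa> * m)\<close>.\<close>
  define \<kappa> where "\<kappa> = - ln \<rho> / 2"
  \<comment> \<open>With \<open>\<zeta> = z * n\<close> this makes \<open>2 * \<zeta>\<close> equal
    to \<open>\<kappa> * \<alpha> * n / 4 * \<delta>\<close>, the total shift guaranteed by the
    barrier; after subtracting the ridge, \<zeta> is left over.\<close>
  define z where "z = \<kappa> * \<alpha> * \<delta> / 8"
  \<comment> \<open>Makes the error \<open>s * p / \<zeta>\<close> equal to
    \<open>(1 - \<gamma>') / 4\<close>, half of what \<open>trace_bound_of_deviations\<close>
    tolerates; the other half is kept for \<open>1 / \<zeta>\<close>.\<close>
  define s where "s = z * (1 - \<gamma>') / (4 * \<gamma>)"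
  \<comment> \<open>The summands pay in turn for rounding the subsample size and losing row
    \<open>l\<close>, for rounding the number \<open>k\<close> of shifts, and for the term
    \<open>1 / \<zeta>\<close>.\<close>
  define N where "N = nat \<lceil>4 / \<alpha> + 4 / (\<kappa> * \<alpha>) + 4 / (z * (1 - \<gamma>')) + 1\<rceil>"
  have \<gamma>': "0 < \<gamma>'" "\<gamma>' < 1" using \<gamma> by (simp_all add: \<gamma>'_def field_simps)
  have \<alpha>: "0 < \<alpha>" "\<alpha> < 1" using \<gamma> by (simp_all add: \<alpha>_def)
  have \<phi>: "0 < \<phi>" using \<gamma>' by (simp add: \<phi>_def)
  have \<kappa>\<^sub>1: "0 < 1 + 2 * (4 * \<phi> / q)" using \<phi> q by (intro add_pos_pos) auto
  have \<delta>: "0 < \<delta>" "\<delta> \<le> 1 / (2 * \<phi>)" unfolding \<delta>_def using \<phi> t q \<kappa>\<^sub>1 by auto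
  have \<delta>3: "2 * \<delta> * (1 + 2 * (4 * \<phi> / q)) \<le> t\<^sup>2 * q / 2"
  proof -
    have "\<delta> \<le> (t\<^sup>2 * q / 2) / (2 * (1 + 2 * (4 * \<phi> / q)))" by (simp add: \<delta>_def)
    then have "\<delta> * (2 * (1 + 2 * (4 * \<phi> / q))) \<le> t\<^sup>2 * q / 2" using \<kappa>\<^sub>1 by (subst (asm) pos_le_divide_eq) auto
    then show ?thesis by (simp only: mult_ac)
  qed
  have e1: "0 < 1 - exp (-1 :: real)" "1 - exp (-1 :: real) < 1" by auto
  have \<rho>: "0 < \<rho>" "\<rho> < 1"
  proof -
    have "q / 4 * (1 - exp (-1)) < 1 * 1" using q e1 by (intro mult_strict_mono) auto
    then show "0 < \<rho>" by (simp add: \<rho>_def)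
    show "\<rho> < 1" using q e1 by (simp add: \<rho>_def)
  qed
  have \<kappa>: "0 < \<kappa>" using \<rho> by (simp add: \<kappa>_def)
  have z: "0 < z" using \<kappa> \<alpha> \<delta> by (simp add: z_def)
  have s: "0 < s" using z \<gamma>' \<gamma> by (simp add: s_def)
  have c: "0 < \<kappa> * \<alpha> / 2" using \<kappa> \<alpha> by simp
  show ?thesis
  proof (rule exI[of _ s], rule conjI, rule s, rule exI[of _ z], rule conjI, rule z,
      rule exI[of _ "\<kappa> * \<alpha> / 2"], rule conjI, rule c, rule exI[of _ N], intro allI impI)
    fix n p \<mu> r1 r2 s2
    assume nN: "N \<le> n" and pn: "real p / real n = \<gamma>" and law: "vec_law p \<mu>" and iso: "isotropic p \<mu>"
      and ac: "anti_conc p t q \<mu>" and r1: "0 \<le> r1" and qc1: "quad_conc p s r1 \<mu>" and r2: "0 \<le> r2" and qc2: "quad_conc p s2 r2 \<mu>"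
    interpret \<mu>: prob_space \<mu> by (rule vec_law_prob[OF law])
    let ?P = "\<Pi>\<^sub>M i\<in>{..<n}. \<mu>"
    have "real N \<ge> 4 / \<alpha> + 4 / (\<kappa> * \<alpha>) + 4 / (z * (1 - \<gamma>')) + 1" unfolding N_def by (rule real_nat_ceiling_ge)
    moreover have "0 \<le> 4 / \<alpha>" "0 \<le> 4 / (\<kappa> * \<alpha>)" "0 \<le> 4 / (z * (1 - \<gamma>'))" using \<alpha> \<kappa> z \<gamma>' by auto
    ultimately have n4: "4 / \<alpha> \<le> real n" "4 / (\<kappa> * \<alpha>) \<le> real n" "4 / (z * (1 - \<gamma>')) \<le> real n" "1 \<le> real n"
      using nN by linarith+
    have na: "4 \<le> \<alpha> * real n" "4 \<le> \<kappa> * \<alpha> * real n" "4 \<le> z * (1 - \<gamma>') * real n"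
      using n4 \<alpha> \<kappa> z \<gamma>' by (simp_all add: pos_divide_le_eq mult.commute)
    have n0: "0 < n" using n4(4) by simp
    have p: "real p = \<gamma> * real n" using pn n0 by (simp add: field_simps)
    define \<zeta> where "\<zeta> = z * real n"
    have \<zeta>: "0 < \<zeta>" using z n0 by (simp add: \<zeta>_def)
    \<comment> \<open>Rounding up keeps the ratio of \<open>p\<close> to the subsample size at most
      \<gamma>'.\<close>
    define m1 where "m1 = nat \<lceil>(1 - \<alpha>) * real n\<rceil>"
    have m1: "(1 - \<alpha>) * real n \<le> real m1" "real m1 \<le> (1 - \<alpha>) * real n + 1"
      using \<alpha> by (auto simp: m1_def real_nat_ceiling_ge)
    have m1n: "m1 \<le> n - 1"
    proof -
      have "real m1 \<le> real n - 3" using m1(2) na(1) by (simp add: algebra_simps)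
      then show ?thesis by linarith
    qed
    \<comment> \<open>The subsample avoids row \<open>l\<close>, so that the eigenvalue bound
      derived from it concerns the Gram matrix without row \<open>l\<close>.\<close>
    have "\<exists>J. J \<subseteq> {..<n} - {l} \<and> card J = m1" if "l < n" for l
      using obtain_subset_with_card_n[of m1 "{..<n} - {l}"] m1n that by (metis card_Diff_singleton card_lessThan lessThan_iff)
    then obtain J1 where J1: "\<And>l. l < n \<Longrightarrow> J1 l \<subseteq> {..<n} - {l} \<and> card (J1 l) = m1" by metis
    define J2 where "J2 l = {..<n} - J1 l - {l}" for l
    have J2: "J2 l \<subseteq> {..<n}" "J1 l \<subseteq> {..<n} - J2 l" "{..<n} - {l} = J1 l \<union> J2 l" "J1 l \<inter> J2 l = {}" if "l < n" for l
      using J1[OF that] by (auto simp: J2_def)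
    have finJ: "finite (J1 l)" "finite (J2 l)" if "l < n" for l
      using J1[OF that] J2(1)[OF that] by (meson finite_Diff finite_lessThan finite_subset)+
    have m1pos: "0 < m1" using m1(1) \<alpha> n0 by (metis diff_gt_0_iff_gt linorder_not_less mult_pos_pos of_nat_0 of_nat_0_less_iff order_less_le_trans)
    have cardJ2: "\<alpha> * real n / 2 \<le> real (card (J2 l))" if l: "l < n" for l
    proof -
      have "card ({..<n} - {l}) = card (J1 l) + card (J2 l)"
        unfolding J2(3)[OF l] by (rule card_Un_disjoint[OF finJ[OF l] J2(4)[OF l]])
      then have "real n - 1 = real m1 + real (card (J2 l))" using J1[OF l] l n0 by (simp add: of_nat_diff)
      then show ?thesis using m1(2) na(1) by (simp add: algebra_simps)
    qed
    \<comment> \<open>\<open>A\<close> and \<open>C\<close> are failures of leave-one-out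
      concentration, inside the subsample and for the full sample; \<open>B\<close> is a failure of
      the barrier argument.\<close>
    define A where "A l m = {\<omega> \<in> space ?P. (\<forall>v \<in> carrier_vec p. \<zeta> * (v \<bullet> v) \<le> v \<bullet> (gram p \<zeta> (J1 l - {m}) \<omega> *\<^sub>v v)) \<and>
      s * real p / \<zeta> < \<bar>\<omega> m \<bullet> (inv_mat (gram p \<zeta> (J1 l - {m}) \<omega>) *\<^sub>v \<omega> m) - mtrace (inv_mat (gram p \<zeta> (J1 l - {m}) \<omega>))\<bar>}" for l m
    define k where "k l = nat \<lfloor>\<kappa> * real (card (J2 l))\<rfloor>" for l
    define B where "B l = {\<omega> \<in> space ?P. mtrace (inv_mat (gram p \<zeta> (J1 l) \<omega>)) \<le> \<phi> \<and>
      \<not> (\<forall>v \<in> carrier_vec p. real (k l) * \<delta> * (v \<bullet> v) \<le> v \<bullet> ((gram p \<zeta> (J1 l) \<omega> + gram p 0 (J2 l) \<omega>) *\<^sub>v v))}" for l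
    define C where "C l = {\<omega> \<in> space ?P. (\<forall>v \<in> carrier_vec p. \<zeta> * (v \<bullet> v) \<le> v \<bullet> (gram p 0 ({..<n} - {l}) \<omega> *\<^sub>v v)) \<and>
      s2 * real p / \<zeta> < \<bar>\<omega> l \<bullet> (inv_mat (gram p 0 ({..<n} - {l}) \<omega>) *\<^sub>v \<omega> l) - mtrace (inv_mat (gram p 0 ({..<n} - {l}) \<omega>))\<bar>}" for l
    have Ab: "A l m \<in> sets ?P \<and> emeasure ?P (A l m) \<le> ennreal r1" if l: "l < n" and m: "m \<in> J1 l" for l m
    proof -
      have "m \<in> {..<n}" "J1 l - {m} \<subseteq> {..<n} - {m}" using J1[OF l] m by auto
      from leave_one_out_tail[OF law qc1 finite_lessThan this \<zeta>, of \<zeta>] show ?thesis unfolding A_def by blast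
    qed
    have Cb: "C l \<in> sets ?P \<and> emeasure ?P (C l) \<le> ennreal r2" if l: "l < n" for l
    proof -
      have "l \<in> {..<n}" using l by simp
      from leave_one_out_tail[OF law qc2 finite_lessThan this order_refl \<zeta>, of 0] show ?thesis unfolding C_def by blast
    qed
    have kle: "real (k l) \<le> \<kappa> * real (card (J2 l))" "\<kappa> * real (card (J2 l)) - 1 \<le> real (k l)" for l
    proof -
      have "0 \<le> \<kappa> * real (card (J2 l))" using \<kappa> by simp
      then have "real (k l) = of_int \<lfloor>\<kappa> * real (card (J2 l))\<rfloor>" unfolding k_def by simp
      then show "real (k l) \<le> \<kappa> * real (card (J2 l))" "\<kappa> * real (card (J2 l)) - 1 \<le> real (k l)" by linarith+
    qed
    have Bb: "B l \<in> sets ?P \<and> emeasure ?P (B l) \<le> ennreal (exp (- (\<kappa> * \<alpha> / 2) * real n))" if l: "l < n" for l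
    proof -
      note g = gram_lower_tail[OF law iso ac t q \<phi> less_imp_le[OF \<delta>(1)] \<delta>(2) \<delta>3 finite_lessThan J2(2)[OF l] J2(1)[OF l] \<zeta>,
          of "k l", folded B_def \<rho>_def]
      have "exp (real (k l)) * \<rho> ^ card (J2 l) = exp (real (k l) - 2 * \<kappa> * real (card (J2 l)))"
      proof -
        have "\<rho> ^ card (J2 l) = exp (ln \<rho>) ^ card (J2 l)" using \<rho> by simp
        also have "\<dots> = exp (real (card (J2 l)) * ln \<rho>)" by (rule exp_of_nat_mult[symmetric])
        finally show ?thesis by (simp add: exp_add[symmetric] \<kappa>_def mult.commute)
      qed
      also have "\<dots> \<le> exp (- (\<kappa> * \<alpha> / 2) * real n)"
      proof -
        have "\<kappa> * (\<alpha> * real n / 2) \<le> \<kappa> * real (card (J2 l))" using cardJ2[OF l] \<kappa> by (intro mult_left_mono) auto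
        then have "real (k l) - 2 * \<kappa> * real (card (J2 l)) \<le> - (\<kappa> * \<alpha> / 2) * real n" using kle(1)[of l] by simp
        then show ?thesis by simp
      qed
      finally have "ennreal (exp (real (k l)) * \<rho> ^ card (J2 l)) \<le> ennreal (exp (- (\<kappa> * \<alpha> / 2) * real n))" by (rule ennreal_leI)
      then show ?thesis using g by (meson order_trans)
    qed
    \<comment> \<open>For each of the \<open>n\<close> rows there are at most \<open>n\<close>
      events \<open>A\<close>, one \<open>B\<close> and one \<open>C\<close>, which is the shape of
      the bound.\<close>
    define E where "E = (\<Union>l<n. (\<Union>m\<in>J1 l. A l m) \<union> B l \<union> C l)"
    have UA: "(\<Union>m\<in>J1 l. A l m) \<in> sets ?P" if "l < n" for l
      using finJ(1)[OF that] Ab[OF that] by (intro sets.finite_UN) auto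
    have EA: "emeasure ?P (\<Union>m\<in>J1 l. A l m) \<le> ennreal (real n * r1)" if l: "l < n" for l
    proof -
      have "emeasure ?P (\<Union>m\<in>J1 l. A l m) \<le> (\<Sum>m\<in>J1 l. emeasure ?P (A l m))"
        using finJ(1)[OF l] Ab[OF l] by (intro emeasure_subadditive_finite) auto
      also have "\<dots> \<le> (\<Sum>m\<in>J1 l. ennreal r1)" using Ab[OF l] by (intro sum_mono) auto
      also have "\<dots> = ennreal (real m1 * r1)" using J1[OF l] r1 by (simp add: ennreal_mult ennreal_of_nat_eq_real_of_nat)
      also have "\<dots> \<le> ennreal (real n * r1)" using m1n r1 n0 by (intro ennreal_leI mult_right_mono) auto
      finally show ?thesis .
    qed
    have El: "(\<Union>m\<in>J1 l. A l m) \<union> B l \<union> C l \<in> sets ?P \<and> emeasure ?P ((\<Union>m\<in>J1 l. A l m) \<union> B l \<union> C l)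
        \<le> ennreal (real n * r1 + exp (- (\<kappa> * \<alpha> / 2) * real n) + r2)" if l: "l < n" for l
    proof
      show "(\<Union>m\<in>J1 l. A l m) \<union> B l \<union> C l \<in> sets ?P" using UA[OF l] Bb[OF l] Cb[OF l] by auto
      have "emeasure ?P ((\<Union>m\<in>J1 l. A l m) \<union> B l \<union> C l) \<le> emeasure ?P ((\<Union>m\<in>J1 l. A l m) \<union> B l) + emeasure ?P (C l)"
        using UA[OF l] Bb[OF l] Cb[OF l] by (intro emeasure_subadditive) auto
      also have "\<dots> \<le> (emeasure ?P (\<Union>m\<in>J1 l. A l m) + emeasure ?P (B l)) + emeasure ?P (C l)"
        using UA[OF l] Bb[OF l] by (intro add_right_mono emeasure_subadditive) auto
      also have "\<dots> \<le> (ennreal (real n * r1) + ennreal (exp (- (\<kappa> * \<alpha> / 2) * real n))) + ennreal r2"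
        using EA[OF l] Bb[OF l] Cb[OF l] by (intro add_mono) auto
      also have "\<dots> = ennreal (real n * r1 + exp (- (\<kappa> * \<alpha> / 2) * real n) + r2)" using r1 r2 by (simp add: ennreal_plus)
      finally show "emeasure ?P ((\<Union>m\<in>J1 l. A l m) \<union> B l \<union> C l)
        \<le> ennreal (real n * r1 + exp (- (\<kappa> * \<alpha> / 2) * real n) + r2)" .
    qed
    have E: "E \<in> sets ?P" unfolding E_def using El by (intro sets.finite_UN) auto
    have "emeasure ?P E \<le> (\<Sum>l<n. emeasure ?P ((\<Union>m\<in>J1 l. A l m) \<union> B l \<union> C l))"
      unfolding E_def using El by (intro emeasure_subadditive_finite) auto
    also have "\<dots> \<le> (\<Sum>l<n. ennreal (real n * r1 + exp (- (\<kappa> * \<alpha> / 2) * real n) + r2))" using El by (intro sum_mono) auto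
    also have "\<dots> = ennreal (real n * (real n * r1 + exp (- (\<kappa> * \<alpha> / 2) * real n) + r2))"
      using r1 r2 by (simp add: ennreal_mult ennreal_of_nat_eq_real_of_nat)
    finally have Ep: "emeasure ?P E \<le> ennreal (real n * (real n * r1 + exp (- (\<kappa> * \<alpha> / 2) * real n) + r2))" .
    have "pos_def_mat p (gram p 0 {..<n} \<omega>) \<and>
        (\<forall>i<n. \<bar>\<omega> i \<bullet> (inv_mat (gram p 0 {..<n} \<omega>) *\<^sub>v \<omega> i) - \<gamma>\<bar> \<le> 2 * (s2 * \<gamma> / z + 1 / (z * real n)))"
      if \<omega>E: "\<omega> \<in> space ?P - E" for \<omega>
    proof -
      have \<omega>: "\<omega> \<in> space ?P" using \<omega>E by blast
      have nE: "\<omega> \<notin> A l m" "\<omega> \<notin> B l" "\<omega> \<notin> C l" if "l < n" "m \<in> J1 l" for l m using \<omega>E that unfolding E_def by auto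
      have J1ne: "J1 l \<noteq> {}" if "l < n" for l using J1[OF that] m1pos by auto
      have yc: "\<omega> i \<in> carrier_vec p" if "i < n" for i using sample_carrier[OF law \<omega>] that by simp
      have tr: "mtrace (inv_mat (gram p \<zeta> (J1 l) \<omega>)) \<le> \<phi>" if l: "l < n" for l
        unfolding \<phi>_def
      proof (rule trace_bound_of_deviations[where e = "s * real p / \<zeta>", OF finJ(1)[OF l] _ \<zeta> \<gamma>' _ J1ne[OF l]])
        show c: "\<omega> i \<in> carrier_vec p" if "i \<in> J1 l" for i using yc J1[OF l] that by auto
        have "\<gamma> * real n = \<gamma>' * ((1 - \<alpha>) * real n)" using \<gamma> by (simp add: \<gamma>'_def \<alpha>_def field_simps)
        also have "\<dots> \<le> \<gamma>' * real m1" using m1(1) \<gamma>' by (intro mult_left_mono) auto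
        finally show "real p \<le> \<gamma>' * real (card (J1 l))" using p J1[OF l] by simp
        show "\<bar>\<omega> m \<bullet> (inv_mat (gram p \<zeta> (J1 l - {m}) \<omega>) *\<^sub>v \<omega> m) - mtrace (inv_mat (gram p \<zeta> (J1 l - {m}) \<omega>))\<bar> \<le> s * real p / \<zeta>"
          if m: "m \<in> J1 l" for m
        proof -
          have cm: "\<omega> i \<in> carrier_vec p" if "i \<in> J1 l - {m}" for i using c that by simp
          have "\<forall>v \<in> carrier_vec p. \<zeta> * (v \<bullet> v) \<le> v \<bullet> (gram p \<zeta> (J1 l - {m}) \<omega> *\<^sub>v v)"
            by (intro ballI quad_gram_ge finite_Diff finJ(1)[OF l] cm)
          then show ?thesis using nE(1)[OF l m] \<omega> unfolding A_def by (simp add: not_less)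
        qed
        have "s * real p / \<zeta> = s * \<gamma> / z" using n0 by (simp add: p \<zeta>_def)
        also have "\<dots> = (1 - \<gamma>') / 4" using z \<gamma> by (simp add: s_def)
        finally have e1: "s * real p / \<zeta> = (1 - \<gamma>') / 4" .
        have "1 / \<zeta> \<le> (1 - \<gamma>') / 4" 
        proof (subst pos_divide_le_eq[OF \<zeta>])
          have "(1 - \<gamma>') / 4 * \<zeta> = z * (1 - \<gamma>') * real n / 4" by (simp add: \<zeta>_def)
          then show "1 \<le> (1 - \<gamma>') / 4 * \<zeta>" using na(3) by linarith
        qed
        then show "s * real p / \<zeta> + 1 / \<zeta> \<le> (1 - \<gamma>') / 2" unfolding e1 by argo
      qed
      \<comment> \<open>The barrier gives at least \<open>2 * \<zeta>\<close> for a matrix that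
        contains the ridge \<zeta>; taking the ridge off leaves \<zeta> for the Gram matrix without
        row \<open>l\<close>.\<close>
      have ge: "\<zeta> * (v \<bullet> v) \<le> v \<bullet> (gram p 0 ({..<n} - {l}) \<omega> *\<^sub>v v)" if l: "l < n" and v: "v \<in> carrier_vec p" for l v
      proof -
        obtain m where m: "m \<in> J1 l" using J1ne[OF l] by blast
        have "\<forall>v \<in> carrier_vec p. real (k l) * \<delta> * (v \<bullet> v) \<le> v \<bullet> ((gram p \<zeta> (J1 l) \<omega> + gram p 0 (J2 l) \<omega>) *\<^sub>v v)"
          using nE(2)[OF l m] \<omega> tr[OF l] unfolding B_def by blast
        then have "real (k l) * \<delta> * (v \<bullet> v) \<le> v \<bullet> ((gram p \<zeta> (J1 l) \<omega> + gram p 0 (J2 l) \<omega>) *\<^sub>v v)" using v by (rule bspec)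
        also have "\<dots> = v \<bullet> (gram p \<zeta> (J1 l) \<omega> *\<^sub>v v) + v \<bullet> (gram p 0 (J2 l) \<omega> *\<^sub>v v)"
          by (rule quad_add[OF gram_carrier gram_carrier v])
        also have "v \<bullet> (gram p \<zeta> (J1 l) \<omega> *\<^sub>v v) = \<zeta> * (v \<bullet> v) + (\<Sum>i\<in>J1 l. (\<omega> i \<bullet> v)\<^sup>2)"
          by (rule quad_gram[OF finJ(1)[OF l] yc v]) (use J1[OF l] in auto)
        also have "v \<bullet> (gram p 0 (J2 l) \<omega> *\<^sub>v v) = 0 * (v \<bullet> v) + (\<Sum>i\<in>J2 l. (\<omega> i \<bullet> v)\<^sup>2)"
          by (rule quad_gram[OF finJ(2)[OF l] yc v]) (use J2(1)[OF l] in auto)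
        finally have 1: "real (k l) * \<delta> * (v \<bullet> v) - \<zeta> * (v \<bullet> v) \<le> (\<Sum>i\<in>J1 l. (\<omega> i \<bullet> v)\<^sup>2) + (\<Sum>i\<in>J2 l. (\<omega> i \<bullet> v)\<^sup>2)" by simp
        have "v \<bullet> (gram p 0 ({..<n} - {l}) \<omega> *\<^sub>v v) = 0 * (v \<bullet> v) + (\<Sum>i\<in>{..<n} - {l}. (\<omega> i \<bullet> v)\<^sup>2)"
          by (rule quad_gram[OF _ yc v]) auto
        also have "(\<Sum>i\<in>{..<n} - {l}. (\<omega> i \<bullet> v)\<^sup>2) = (\<Sum>i\<in>J1 l. (\<omega> i \<bullet> v)\<^sup>2) + (\<Sum>i\<in>J2 l. (\<omega> i \<bullet> v)\<^sup>2)"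
          unfolding J2(3)[OF l] by (rule sum.union_disjoint[OF finJ[OF l] J2(4)[OF l]])
        finally have 2: "v \<bullet> (gram p 0 ({..<n} - {l}) \<omega> *\<^sub>v v) = (\<Sum>i\<in>J1 l. (\<omega> i \<bullet> v)\<^sup>2) + (\<Sum>i\<in>J2 l. (\<omega> i \<bullet> v)\<^sup>2)" by simp
        have "2 * \<zeta> \<le> real (k l) * \<delta>"
        proof -
          have "\<kappa> * (\<alpha> * real n / 2) \<le> \<kappa> * real (card (J2 l))" using cardJ2[OF l] \<kappa> by (intro mult_left_mono) auto
          then have "\<kappa> * \<alpha> * real n / 4 \<le> real (k l)" using kle(2)[of l] na(2) by simp
          then have "\<kappa> * \<alpha> * real n / 4 * \<delta> \<le> real (k l) * \<delta>" using \<delta> by (intro mult_right_mono) auto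
          then show ?thesis by (simp add: \<zeta>_def z_def mult_ac)
        qed
        then have "2 * \<zeta> * (v \<bullet> v) \<le> real (k l) * \<delta> * (v \<bullet> v)" by (rule mult_right_mono[OF _ scalar_prod_self_ge_0])
        then show ?thesis using 1 2 by simp
      qed
      have dev: "\<bar>\<omega> l \<bullet> (inv_mat (gram p 0 ({..<n} - {l}) \<omega>) *\<^sub>v \<omega> l) - mtrace (inv_mat (gram p 0 ({..<n} - {l}) \<omega>))\<bar> \<le> s2 * real p / \<zeta>"
        if l: "l < n" for l
      proof -
        obtain m where m: "m \<in> J1 l" using J1ne[OF l] by blast
        have "\<forall>v \<in> carrier_vec p. \<zeta> * (v \<bullet> v) \<le> v \<bullet> (gram p 0 ({..<n} - {l}) \<omega> *\<^sub>v v)" using ge[OF l] by blast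
        then show ?thesis using nE(3)[OF l m] \<omega> unfolding C_def by (simp add: not_less)
      qed
      note lc = leverage_concentration[of n \<omega> p \<zeta> "s2 * real p / \<zeta>", OF yc n0 \<zeta> ge dev]
      have "s2 * real p / \<zeta> + 1 / \<zeta> = s2 * \<gamma> / z + 1 / (z * real n)" using n0 by (simp add: p \<zeta>_def)
      then show ?thesis using lc unfolding pn by simp
    qed
    then show "\<exists>E \<in> sets ?P. emeasure ?P E \<le> ennreal (real n * (real n * r1 + exp (- (\<kappa> * \<alpha> / 2) * real n) + r2)) \<and>
      (\<forall>\<omega> \<in> space ?P - E. pos_def_mat p (gram p 0 {..<n} \<omega>) \<and>
        (\<forall>i<n. \<bar>\<omega> i \<bullet> (inv_mat (gram p 0 {..<n} \<omega>) *\<^sub>v \<omega> i) - \<gamma>\<bar> \<le> 2 * (s2 * \<gamma> / z + 1 / (z * real n))))"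
      using E Ep by blast
  qed
qed

section \<open>Quadratic forms under convex and log-concave concentration\<close>

text \<open>Slice at multiples of \<open>b\<close>: the square of \<open>X\<close> is at most
  \<open>b\<^sup>2\<close> times the sum of \<open>2 * k + 1\<close> over
  \<open>k \<le> X / b\<close>, and slice \<open>k\<close> has probability at most
  \<open>c * exp (- k)\<close>. Half of the decay absorbs the linear factor, leaving a geometric
  series with ratio \<open>exp (-1/2)\<close>.\<close>

lemma exp_tail_second_moment:
  fixes X :: "'a \<Rightarrow> real"
  assumes M: "prob_space M" and X[measurable]: "X \<in> borel_measurable M" and X0: "\<And>x. x \<in> space M \<Longrightarrow> 0 \<le> X x"
    and b: "0 < b" and c: "0 \<le> c" and tail: "\<And>t. 0 \<le> t \<Longrightarrow> measure M {x \<in> space M. t \<le> X x} \<le> c * exp (- t / b)"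
  shows "(\<integral>\<^sup>+x. ennreal ((X x)\<^sup>2) \<partial>M) \<le> ennreal (4 / (1 - exp (-1/2)) * c * b\<^sup>2)"
proof -
  interpret prob_space M by (rule M)
  define f where "f k x = ennreal (b\<^sup>2 * (2 * real k + 1)) * indicator {x \<in> space M. real k * b \<le> X x} x" for k :: nat and x
  have f[measurable]: "f k \<in> borel_measurable M" for k unfolding f_def by measurable
  have pt: "ennreal ((X x)\<^sup>2) \<le> (\<Sum>k. f k x)" if x: "x \<in> space M" for x
  proof -
    define N where "N = nat \<lfloor>X x / b\<rfloor>"
    have Xb: "0 \<le> X x / b" using X0[OF x] b by simp
    have N: "real N \<le> X x / b" "X x / b < real N + 1" unfolding N_def using Xb by linarith+
    have sq: "(\<Sum>k\<le>n. 2 * real k + 1) = (real n + 1)\<^sup>2" for n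
      by (induction n) (simp_all add: power2_eq_square algebra_simps)
    have "X x = b * (X x / b)" using b by simp
    then have "(X x)\<^sup>2 = b\<^sup>2 * (X x / b)\<^sup>2" by (metis power_mult_distrib)
    also have "\<dots> \<le> b\<^sup>2 * (real N + 1)\<^sup>2" using N Xb by (intro mult_left_mono power_mono) auto
    finally have "ennreal ((X x)\<^sup>2) \<le> ennreal (\<Sum>k\<le>N. b\<^sup>2 * (2 * real k + 1))"
      unfolding sq[symmetric] sum_distrib_left by (rule ennreal_leI)
    also have "\<dots> = (\<Sum>k\<le>N. ennreal (b\<^sup>2 * (2 * real k + 1)))" by (rule sum_ennreal[symmetric]) simp
    also have "\<dots> = (\<Sum>k\<le>N. f k x)"
    proof (intro sum.cong refl)
      fix k assume "k \<in> {..N}"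
      then have "real k \<le> X x / b" using N(1) by simp
      then have "real k * b \<le> X x" using b by (simp add: pos_le_divide_eq)
      then show "ennreal (b\<^sup>2 * (2 * real k + 1)) = f k x" using x by (simp add: f_def)
    qed
    also have "\<dots> \<le> (\<Sum>k. f k x)" by (rule sum_le_suminf) (auto simp: f_def)
    finally show ?thesis .
  qed
  have "(\<integral>\<^sup>+x. ennreal ((X x)\<^sup>2) \<partial>M) \<le> (\<integral>\<^sup>+x. (\<Sum>k. f k x) \<partial>M)" by (rule nn_integral_mono) (rule pt)
  also have "\<dots> = (\<Sum>k. \<integral>\<^sup>+x. f k x \<partial>M)" by (rule nn_integral_suminf) simp
  also have "\<dots> \<le> (\<Sum>k. ennreal (4 * c * b\<^sup>2 * exp (-1/2) ^ k))"
  proof (intro suminf_le summableI)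
    fix k :: nat
    have "(\<integral>\<^sup>+x. f k x \<partial>M) = ennreal (b\<^sup>2 * (2 * real k + 1)) * emeasure M {x \<in> space M. real k * b \<le> X x}"
      unfolding f_def by (rule nn_integral_cmult_indicator) measurable
    also have "\<dots> = ennreal (b\<^sup>2 * (2 * real k + 1) * measure M {x \<in> space M. real k * b \<le> X x})"
      unfolding emeasure_eq_measure by (rule ennreal_mult[symmetric]) auto
    also have "\<dots> \<le> ennreal (4 * c * b\<^sup>2 * exp (-1/2) ^ k)"
    proof (rule ennreal_leI)
      have "measure M {x \<in> space M. real k * b \<le> X x} \<le> c * exp (- (real k * b) / b)" using b by (intro tail) simp
      also have "- (real k * b) / b = - real k" using b by simp
      finally have "b\<^sup>2 * (2 * real k + 1) * measure M {x \<in> space M. real k * b \<le> X x} \<le> b\<^sup>2 * (2 * real k + 1) * (c * exp (- real k))"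
        by (intro mult_left_mono) auto
      also have "\<dots> \<le> b\<^sup>2 * (4 * exp (real k / 2)) * (c * exp (- real k))"
      proof -
        have "1 + real k / 2 \<le> exp (real k / 2)" by (rule exp_ge_add_one_self)
        then have "2 * real k + 1 \<le> 4 * exp (real k / 2)" by linarith
        then show ?thesis using c by (intro mult_right_mono mult_left_mono) auto
      qed
      also have "\<dots> = 4 * c * b\<^sup>2 * (exp (real k / 2) * exp (- real k))" by simp
      also have "exp (real k / 2) * exp (- real k) = exp (-1/2) ^ k"
        by (simp add: exp_add[symmetric] exp_of_nat_mult[symmetric])
      finally show "b\<^sup>2 * (2 * real k + 1) * measure M {x \<in> space M. real k * b \<le> X x} \<le> 4 * c * b\<^sup>2 * exp (-1/2) ^ k" .
    qed
    finally show "(\<integral>\<^sup>+x. f k x \<partial>M) \<le> ennreal (4 * c * b\<^sup>2 * exp (-1/2) ^ k)" .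
  qed
  also have "\<dots> = ennreal (\<Sum>k. 4 * c * b\<^sup>2 * exp (-1/2) ^ k)"
    using c by (intro suminf_ennreal2 summable_mult summable_geometric) auto
  also have "(\<Sum>k. 4 * c * b\<^sup>2 * exp (-1/2 :: real) ^ k) = 4 * c * b\<^sup>2 * (1 / (1 - exp (-1/2)))"
    by (subst suminf_mult) (auto intro!: summable_geometric simp: suminf_geometric)
  finally show ?thesis by (simp add: mult_ac)
qed

text \<open>The quadratic form is not globally Lipschitz, but its root is a seminorm: convex, and
  1-Lipschitz when \<open>M\<close> is a contraction. The concentration hypotheses therefore apply
  to the root.\<close>

definition mat_seminorm :: "real mat \<Rightarrow> real vec \<Rightarrow> real" where
  "mat_seminorm M v = sqrt (v \<bullet> (M *\<^sub>v v))"

lemma mat_seminorm_sq: "psd_mat p M \<Longrightarrow> v \<in> carrier_vec p \<Longrightarrow> (mat_seminorm M v)\<^sup>2 = v \<bullet> (M *\<^sub>v v)"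
  using psd_matD(3) by (simp add: mat_seminorm_def)

lemma mat_seminorm_ge_0: "psd_mat p M \<Longrightarrow> v \<in> carrier_vec p \<Longrightarrow> 0 \<le> mat_seminorm M v"
  using psd_matD(3) by (simp add: mat_seminorm_def)

text \<open>Cauchy--Schwarz for the cross term of the expanded square. Having the triangle
  inequality and homogeneity in one statement gives both the Lipschitz bound and convexity.\<close>

lemma mat_seminorm_add_smult:
  assumes M: "psd_mat p M" and v: "v \<in> carrier_vec p" "w \<in> carrier_vec p"
  shows "mat_seminorm M (v + t \<cdot>\<^sub>v w) \<le> mat_seminorm M v + \<bar>t\<bar> * mat_seminorm M w"
proof (rule power2_le_imp_le)
  note Md = psd_matD[OF M]
  have vw: "v + t \<cdot>\<^sub>v w \<in> carrier_vec p" using v by simp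
  have "\<bar>v \<bullet> (M *\<^sub>v w)\<bar> \<le> mat_seminorm M v * mat_seminorm M w"
  proof -
    have "(v \<bullet> (M *\<^sub>v w))\<^sup>2 \<le> (mat_seminorm M v * mat_seminorm M w)\<^sup>2"
      unfolding power_mult_distrib mat_seminorm_sq[OF M v(1)] mat_seminorm_sq[OF M v(2)] by (rule psd_cauchy_schwarz[OF M v])
    then show ?thesis
      using mult_nonneg_nonneg[OF mat_seminorm_ge_0[OF M v(1)] mat_seminorm_ge_0[OF M v(2)]]
        abs_le_square_iff[of "v \<bullet> (M *\<^sub>v w)" "mat_seminorm M v * mat_seminorm M w"] by linarith
  qed
  then have "\<bar>t\<bar> * \<bar>v \<bullet> (M *\<^sub>v w)\<bar> \<le> \<bar>t\<bar> * (mat_seminorm M v * mat_seminorm M w)" by (intro mult_left_mono) auto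
  then have "t * (v \<bullet> (M *\<^sub>v w)) \<le> \<bar>t\<bar> * (mat_seminorm M v * mat_seminorm M w)" unfolding abs_mult[symmetric] by linarith
  moreover have "(mat_seminorm M (v + t \<cdot>\<^sub>v w))\<^sup>2 = (mat_seminorm M v)\<^sup>2 + 2 * (t * (v \<bullet> (M *\<^sub>v w))) + \<bar>t\<bar>\<^sup>2 * (mat_seminorm M w)\<^sup>2"
    unfolding mat_seminorm_sq[OF M vw] mat_seminorm_sq[OF M v(1)] mat_seminorm_sq[OF M v(2)] quad_expand[OF Md(1,2) v] by simp
  moreover have "2 * mat_seminorm M v * (\<bar>t\<bar> * mat_seminorm M w) = 2 * (\<bar>t\<bar> * (mat_seminorm M v * mat_seminorm M w))" by simp
  ultimately show "(mat_seminorm M (v + t \<cdot>\<^sub>v w))\<^sup>2 \<le> (mat_seminorm M v + \<bar>t\<bar> * mat_seminorm M w)\<^sup>2"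
    unfolding power2_sum power_mult_distrib by linarith
  show "0 \<le> mat_seminorm M v + \<bar>t\<bar> * mat_seminorm M w"
    using mat_seminorm_ge_0[OF M v(1)] mat_seminorm_ge_0[OF M v(2)] by simp
qed

lemma mat_seminorm_lipschitz:
  assumes M: "psd_mat p M" and le: "\<And>v. v \<in> carrier_vec p \<Longrightarrow> v \<bullet> (M *\<^sub>v v) \<le> v \<bullet> v"
  shows "lipschitz1_vec p (mat_seminorm M)"
  unfolding lipschitz1_vec_def
proof (intro ballI)
  have one: "mat_seminorm M x \<le> mat_seminorm M y + eucl_norm (x - y)" if "x \<in> carrier_vec p" "y \<in> carrier_vec p" for x y
  proof -
    have "x = y + 1 \<cdot>\<^sub>v (x - y)" using that by (intro eq_vecI) auto
    moreover have "mat_seminorm M (y + 1 \<cdot>\<^sub>v (x - y)) \<le> mat_seminorm M y + \<bar>1\<bar> * mat_seminorm M (x - y)"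
      using that by (intro mat_seminorm_add_smult[OF M]) auto
    moreover have "mat_seminorm M (x - y) \<le> eucl_norm (x - y)"
      unfolding mat_seminorm_def eucl_norm_def using le[of "x - y"] that by simp
    ultimately show ?thesis by simp
  qed
  fix x y :: "real vec" assume xy: "x \<in> carrier_vec p" "y \<in> carrier_vec p"
  have "eucl_norm (y - x) = eucl_norm (x - y)"
    unfolding eucl_norm_def using xy by (simp add: scalar_prod_sum[of _ p] algebra_simps)
  then show "\<bar>mat_seminorm M x - mat_seminorm M y\<bar> \<le> eucl_norm (x - y)" using one[OF xy] one[OF xy(2,1)] by linarith
qed

lemma mat_seminorm_convex:
  assumes M: "psd_mat p M" shows "convex_vec p (mat_seminorm M)"
  unfolding convex_vec_def
proof (intro ballI)
  fix x y :: "real vec" and s :: real assume xy: "x \<in> carrier_vec p" "y \<in> carrier_vec p" and s: "s \<in> {0..1}"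
  have "mat_seminorm M (s \<cdot>\<^sub>v x + (1 - s) \<cdot>\<^sub>v y) \<le> mat_seminorm M (s \<cdot>\<^sub>v x) + \<bar>1 - s\<bar> * mat_seminorm M y"
    by (rule mat_seminorm_add_smult[OF M _ xy(2)]) (use xy in simp)
  moreover have "mat_seminorm M (0\<^sub>v p + s \<cdot>\<^sub>v x) \<le> mat_seminorm M (0\<^sub>v p) + \<bar>s\<bar> * mat_seminorm M x"
    by (rule mat_seminorm_add_smult[OF M _ xy(1)]) simp
  moreover have "mat_seminorm M (0\<^sub>v p) = 0"
    unfolding mat_seminorm_def using mult_mat_vec_carrier[OF psd_matD(1)[OF M] zero_carrier_vec] by simp
  moreover have "0\<^sub>v p + s \<cdot>\<^sub>v x = s \<cdot>\<^sub>v x" using xy by simp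
  ultimately show "mat_seminorm M (s \<cdot>\<^sub>v x + (1 - s) \<cdot>\<^sub>v y) \<le> s * mat_seminorm M x + (1 - s) * mat_seminorm M y"
    using s by simp
qed

lemma psd_trace_le_dim:
  assumes M: "psd_mat p M" and le: "\<And>v. v \<in> carrier_vec p \<Longrightarrow> v \<bullet> (M *\<^sub>v v) \<le> v \<bullet> v"
  shows "mtrace M \<le> real p"
proof -
  have "mtrace M \<le> (\<Sum>k<p. 1)"
    unfolding mtrace_unit[OF psd_matD(1)[OF M]]
  proof (rule sum_mono)
    fix k assume "k \<in> {..<p}"
    then show "unit_vec p k \<bullet> (M *\<^sub>v unit_vec p k) \<le> 1" using le[of "unit_vec p k"] by simp
  qed
  then show ?thesis by simp
qed

text \<open>With \<open>m\<close> the mean of the root, the mean of the form is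
  \<open>m\<^sup>2\<close> plus the variance. The exponential tail bounds the variance by a
  constant, which \<open>V\<close> compares with \<open>7 / 16 * t * p\<close>. A deviation of the
  root below \<open>t * sqrt p / 4\<close> moves its square by at most
  \<open>9 / 16 * t * p\<close>, since \<open>m \<le> sqrt p\<close>. Thus \<open>tail\<close>
  serves the variance and \<open>r\<close> the final probability.\<close>

lemma quad_conc_of_seminorm_conc:
  assumes law: "vec_law p \<mu>" and iso: "isotropic p \<mu>" and p: "0 < p" and b: "0 < b" and c: "0 \<le> c" and t: "0 < t" "t \<le> 1"
    and tail: "\<And>M a. psd_mat p M \<Longrightarrow> (\<And>v. v \<in> carrier_vec p \<Longrightarrow> v \<bullet> (M *\<^sub>v v) \<le> v \<bullet> v) \<Longrightarrow> 0 \<le> a \<Longrightarrow>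
      measure \<mu> {y \<in> space \<mu>. a \<le> \<bar>mat_seminorm M y - (\<integral>z. mat_seminorm M z \<partial>\<mu>)\<bar>} \<le> c * exp (- a / b)"
    and r: "\<And>M. psd_mat p M \<Longrightarrow> (\<And>v. v \<in> carrier_vec p \<Longrightarrow> v \<bullet> (M *\<^sub>v v) \<le> v \<bullet> v) \<Longrightarrow>
      measure \<mu> {y \<in> space \<mu>. t * sqrt (real p) / 4 \<le> \<bar>mat_seminorm M y - (\<integral>z. mat_seminorm M z \<partial>\<mu>)\<bar>} \<le> r"
    and V: "4 / (1 - exp (-1/2)) * c * b\<^sup>2 \<le> 7 / 16 * t * real p"
  shows "quad_conc p t r \<mu>"
  unfolding quad_conc_def
proof (intro allI impI)
  fix M assume M: "psd_mat p M" and "\<forall>v \<in> carrier_vec p. v \<bullet> (M *\<^sub>v v) \<le> v \<bullet> v"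
  then have le: "v \<bullet> (M *\<^sub>v v) \<le> v \<bullet> v" if "v \<in> carrier_vec p" for v using that by blast
  interpret prob_space \<mu> by (rule vec_law_prob[OF law])
  note Md = psd_matD[OF M]
  let ?s = "mat_seminorm M"
  define m where "m = (\<integral>z. ?s z \<partial>\<mu>)"
  have sm[measurable]: "?s \<in> borel_measurable \<mu>"
    unfolding mat_seminorm_def[abs_def] using measurable_quad[OF law Md(1)] by measurable
  have sq: "(?s y)\<^sup>2 = y \<bullet> (M *\<^sub>v y)" if "y \<in> space \<mu>" for y
    using mat_seminorm_sq[OF M] that vec_law_space[OF law] by simp
  have s0: "0 \<le> ?s y" if "y \<in> space \<mu>" for y using mat_seminorm_ge_0[OF M] that vec_law_space[OF law] by simp
  have int2: "integrable \<mu> (\<lambda>y. (?s y)\<^sup>2)"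
    using isotropic_second_moment(1)[OF law iso Md(1)] Bochner_Integration.integrable_cong[OF refl, of \<mu> "\<lambda>y. (?s y)\<^sup>2" "\<lambda>y. y \<bullet> (M *\<^sub>v y)"] sq by blast
  have E2: "(\<integral>y. (?s y)\<^sup>2 \<partial>\<mu>) = mtrace M"
    using isotropic_second_moment(2)[OF law iso Md(1)] Bochner_Integration.integral_cong[OF refl, of \<mu> "\<lambda>y. (?s y)\<^sup>2" "\<lambda>y. y \<bullet> (M *\<^sub>v y)"] sq by simp
  have int1: "integrable \<mu> ?s" by (rule square_integrable_imp_integrable[OF sm int2])
  have m0: "0 \<le> m" unfolding m_def using s0 by (intro integral_nonneg_AE) auto
  have var: "(\<integral>y. (?s y - m)\<^sup>2 \<partial>\<mu>) = mtrace M - m\<^sup>2"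
  proof -
    have "(\<integral>y. (?s y - m)\<^sup>2 \<partial>\<mu>) = (\<integral>y. (?s y)\<^sup>2 - 2 * m * ?s y + m\<^sup>2 \<partial>\<mu>)"
      by (intro Bochner_Integration.integral_cong refl) (simp add: power2_diff)
    also have "\<dots> = mtrace M - 2 * m * m + m\<^sup>2" using int1 int2 by (simp add: E2 m_def prob_space)
    finally show ?thesis by (simp add: power2_eq_square)
  qed
  have intv: "integrable \<mu> (\<lambda>y. (?s y - m)\<^sup>2)"
    unfolding power2_diff using int1 int2 by (intro Bochner_Integration.integrable_add Bochner_Integration.integrable_diff) auto
  have v0: "0 \<le> mtrace M - m\<^sup>2" unfolding var[symmetric] by (intro integral_nonneg_AE) auto
  have vV: "mtrace M - m\<^sup>2 \<le> 7 / 16 * t * real p"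
  proof -
    have "ennreal (mtrace M - m\<^sup>2) = (\<integral>\<^sup>+y. ennreal ((?s y - m)\<^sup>2) \<partial>\<mu>)"
      unfolding var[symmetric] using intv by (intro nn_integral_eq_integral[symmetric]) auto
    also have "\<dots> = (\<integral>\<^sup>+y. ennreal (\<bar>?s y - m\<bar>\<^sup>2) \<partial>\<mu>)" by simp
    also have "\<dots> \<le> ennreal (4 / (1 - exp (-1/2)) * c * b\<^sup>2)"
      by (rule exp_tail_second_moment[OF vec_law_prob[OF law] _ _ b c]) (use tail[OF M le] in \<open>auto simp: m_def\<close>)
    finally have "mtrace M - m\<^sup>2 \<le> 4 / (1 - exp (-1/2)) * c * b\<^sup>2" using b c by (subst (asm) ennreal_le_iff) auto
    then show ?thesis using V by linarith
  qed
  have "m\<^sup>2 \<le> (sqrt (real p))\<^sup>2" using v0 psd_trace_le_dim[OF M le] by simp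
  then have mp: "m \<le> sqrt (real p)" by (rule power2_le_imp_le) simp
  let ?a = "t * sqrt (real p) / 4"
  have "{y \<in> space \<mu>. t * real p < \<bar>y \<bullet> (M *\<^sub>v y) - mtrace M\<bar>} \<subseteq> {y \<in> space \<mu>. ?a \<le> \<bar>?s y - m\<bar>}"
  proof
    fix y assume y: "y \<in> {y \<in> space \<mu>. t * real p < \<bar>y \<bullet> (M *\<^sub>v y) - mtrace M\<bar>}"
    have "?a \<le> \<bar>?s y - m\<bar>"
    proof (rule ccontr)
      assume "\<not> ?a \<le> \<bar>?s y - m\<bar>"
      then have d: "\<bar>?s y - m\<bar> \<le> ?a" by simp
      have "\<bar>(?s y)\<^sup>2 - m\<^sup>2\<bar> = \<bar>?s y - m\<bar> * (?s y + m)"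
      proof -
        have "(?s y)\<^sup>2 - m\<^sup>2 = (?s y - m) * (?s y + m)" by (simp add: power2_eq_square algebra_simps)
        then show ?thesis using s0 y m0 by (simp add: abs_mult)
      qed
      also have "\<dots> \<le> ?a * (?a + 2 * sqrt (real p))"
      proof (rule mult_mono[OF d])
        show "?s y + m \<le> ?a + 2 * sqrt (real p)" using d mp by linarith
        show "0 \<le> ?s y + m" using s0[of y] m0 y by simp
      qed (use t in simp)
      \<comment> \<open>For \<open>t \<le> 1\<close> the first factor is at most
        \<open>9 / 16 * t\<close>; the variance takes the remaining \<open>7 / 16\<close>.\<close>
      also have "\<dots> = (t * t / 16 + t / 2) * (sqrt (real p) * sqrt (real p))" by (simp add: field_simps)
      also have "\<dots> = (t * t / 16 + t / 2) * real p" by simp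
      also have "\<dots> \<le> (t / 16 + t / 2) * real p" using t by (intro mult_right_mono add_right_mono divide_right_mono) (auto simp: mult_left_le)
      finally have "\<bar>(?s y)\<^sup>2 - m\<^sup>2\<bar> \<le> 9 / 16 * t * real p" by (simp add: algebra_simps)
      then have "\<bar>(?s y)\<^sup>2 - mtrace M\<bar> \<le> t * real p" using v0 vV by linarith
      then show False using y sq by simp
    qed
    then show "y \<in> {y \<in> space \<mu>. ?a \<le> \<bar>?s y - m\<bar>}" using y by simp
  qed
  then have "measure \<mu> {y \<in> space \<mu>. t * real p < \<bar>y \<bullet> (M *\<^sub>v y) - mtrace M\<bar>} \<le> measure \<mu> {y \<in> space \<mu>. ?a \<le> \<bar>?s y - m\<bar>}"
    by (intro finite_measure_mono) auto
  also have "\<dots> \<le> r" unfolding m_def by (rule r[OF M le])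
  finally show "measure \<mu> {y \<in> space \<mu>. t * real p < \<bar>y \<bullet> (M *\<^sub>v y) - mtrace M\<bar>} \<le> r" .
qed

lemma CCP_quad_conc:
  assumes law: "vec_law p \<mu>" and iso: "isotropic p \<mu>" and p: "0 < p" and ccp: "CCP p K \<mu>" and K: "0 < K" and t: "0 < t" "t \<le> 1"
    and V: "4 / (1 - exp (-1/2)) * (2 * exp 1) * K\<^sup>2 \<le> 7 / 16 * t * real p"
  shows "quad_conc p t (2 * exp (- (t\<^sup>2 * real p / (64 * K\<^sup>2)))) \<mu>"
proof (rule quad_conc_of_seminorm_conc[OF law iso p K _ t _ _ V])
  fix M assume M: "psd_mat p M" "\<And>v. v \<in> carrier_vec p \<Longrightarrow> v \<bullet> (M *\<^sub>v v) \<le> v \<bullet> v"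
  have tail: "measure \<mu> {y \<in> space \<mu>. a \<le> \<bar>mat_seminorm M y - (\<integral>z. mat_seminorm M z \<partial>\<mu>)\<bar>} \<le> 2 * exp (- (a / (2 * K))\<^sup>2)" if "0 \<le> a" for a
    using ccp mat_seminorm_lipschitz[OF M] mat_seminorm_convex[OF M(1)] that unfolding CCP_def by blast
  show "measure \<mu> {y \<in> space \<mu>. a \<le> \<bar>mat_seminorm M y - (\<integral>z. mat_seminorm M z \<partial>\<mu>)\<bar>} \<le> 2 * exp 1 * exp (- a / K)" if a: "0 \<le> a" for a
  proof -
    \<comment> \<open>Completing the square trades the Gaussian tail for an exponential one at scale
      \<open>K\<close>, at the price of a factor e. This weaker tail feeds the variance
      bound.\<close>
    have "0 \<le> (a / K / 2 - 1)\<^sup>2" by simp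
    also have "(a / K / 2 - 1)\<^sup>2 = (a / (2 * K))\<^sup>2 - a / K + 1" unfolding power2_diff by (simp add: mult.commute)
    finally have "- (a / (2 * K))\<^sup>2 \<le> 1 + (- a / K)" by simp
    then have "exp (- (a / (2 * K))\<^sup>2) \<le> exp 1 * exp (- a / K)" by (simp add: exp_add[symmetric])
    then show ?thesis using tail[OF a] by linarith
  qed
  have "(t * sqrt (real p) / 4 / (2 * K))\<^sup>2 = t\<^sup>2 * real p / (64 * K\<^sup>2)" by (simp add: power_divide power_mult_distrib)
  then show "measure \<mu> {y \<in> space \<mu>. t * sqrt (real p) / 4 \<le> \<bar>mat_seminorm M y - (\<integral>z. mat_seminorm M z \<partial>\<mu>)\<bar>}
      \<le> 2 * exp (- (t\<^sup>2 * real p / (64 * K\<^sup>2)))"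
    using tail[of "t * sqrt (real p) / 4"] t by simp
qed simp

text \<open>At radius \<open>1 / (2 * C\<^sub>0)\<close> the small ball bound equals one half.
  Rescaling carries this from unit vectors to all nonzero \<open>v\<close>; for \<open>v = 0\<close>
  the event is the whole space.\<close>

lemma SBP_anti_conc:
  assumes law: "vec_law p \<mu>" and sbp: "SBP p C\<^sub>0 \<mu>" and C: "0 < C\<^sub>0"
  shows "anti_conc p (1 / (2 * C\<^sub>0)) (1 / 2) \<mu>"
  unfolding anti_conc_def
proof (intro ballI)
  fix v :: "real vec" assume v: "v \<in> carrier_vec p"
  interpret prob_space \<mu> by (rule vec_law_prob[OF law])
  have [measurable]: "(\<lambda>y. v \<bullet> y) \<in> borel_measurable \<mu>" by (rule measurable_scalar_prod[OF law v])
  define N where "N = eucl_norm v"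
  show "1 / 2 \<le> measure \<mu> {y \<in> space \<mu>. 1 / (2 * C\<^sub>0) * eucl_norm v \<le> \<bar>v \<bullet> y\<bar>}"
  proof (cases "N = 0")
    case True
    then have "{y \<in> space \<mu>. 1 / (2 * C\<^sub>0) * eucl_norm v \<le> \<bar>v \<bullet> y\<bar>} = space \<mu>" by (auto simp: N_def)
    then show ?thesis by (simp add: prob_space)
  next
    case False
    then have N: "0 < N" by (metis N_def eucl_norm_ge_0 order_le_imp_less_or_eq)
    let ?w = "(1 / N) \<cdot>\<^sub>v v"
    have "?w \<bullet> ?w = (1 / N)\<^sup>2 * N\<^sup>2" unfolding N_def eucl_norm_sq using v by (simp add: power2_eq_square)
    also have "\<dots> = 1" using N by (simp add: power_divide)
    finally have "eucl_norm ?w = 1" by (simp only: eucl_norm_def real_sqrt_one)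
    then have "measure \<mu> {y \<in> space \<mu>. \<bar>?w \<bullet> y - 0\<bar> \<le> 1 / (2 * C\<^sub>0)} \<le> C\<^sub>0 * (1 / (2 * C\<^sub>0))"
      using sbp[unfolded SBP_def, rule_format, of ?w "1 / (2 * C\<^sub>0)" 0] v C by simp
    then have sb: "measure \<mu> {y \<in> space \<mu>. \<bar>?w \<bullet> y - 0\<bar> \<le> 1 / (2 * C\<^sub>0)} \<le> 1 / 2" using C by simp
    have eq: "{y \<in> space \<mu>. \<bar>?w \<bullet> y - 0\<bar> \<le> 1 / (2 * C\<^sub>0)} = {y \<in> space \<mu>. \<bar>v \<bullet> y\<bar> \<le> 1 / (2 * C\<^sub>0) * N}"
    proof (intro Collect_cong conj_cong refl)
      fix y assume "y \<in> space \<mu>"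
      then have "?w \<bullet> y = (v \<bullet> y) / N" using v vec_law_space[OF law] by simp
      then show "\<bar>?w \<bullet> y - 0\<bar> \<le> 1 / (2 * C\<^sub>0) \<longleftrightarrow> \<bar>v \<bullet> y\<bar> \<le> 1 / (2 * C\<^sub>0) * N"
        using N by (simp only: diff_0_right abs_divide abs_of_pos pos_divide_le_eq)
    qed
    have "1 - measure \<mu> {y \<in> space \<mu>. \<bar>v \<bullet> y\<bar> \<le> 1 / (2 * C\<^sub>0) * N} = measure \<mu> (space \<mu> - {y \<in> space \<mu>. \<bar>v \<bullet> y\<bar> \<le> 1 / (2 * C\<^sub>0) * N})"
      by (rule prob_compl[symmetric]) measurable
    also have "\<dots> \<le> measure \<mu> {y \<in> space \<mu>. 1 / (2 * C\<^sub>0) * eucl_norm v \<le> \<bar>v \<bullet> y\<bar>}"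
    proof (rule finite_measure_mono)
      show "{y \<in> space \<mu>. 1 / (2 * C\<^sub>0) * eucl_norm v \<le> \<bar>v \<bullet> y\<bar>} \<in> sets \<mu>" by measurable
    qed (auto simp: N_def)
    finally show ?thesis using sb unfolding eq by linarith
  qed
qed

text \<open>The exponential tail at scale \<open>1 / (c\<^sub>0 * \<Psi> p)\<close> is used twice:
  for the variance, and at level \<open>t * sqrt p / 4\<close> for the deviation. The second use is
  where \<open>sqrt p\<close> instead of \<open>p\<close> enters the rate.\<close>

lemma log_concave_quad_conc:
  assumes lc: "lc_concentration c\<^sub>0 \<Psi>" and dens: "law_with_density p \<mu>" and law: "vec_law p \<mu>" and iso: "isotropic p \<mu>"
    and p: "0 < p" and log: "log_concave p \<mu>" and t: "0 < t" "t \<le> 1"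
    and V: "4 / (1 - exp (-1/2)) * 2 * (1 / (c\<^sub>0 * \<Psi> p))\<^sup>2 \<le> 7 / 16 * t * real p"
  shows "quad_conc p t (2 * exp (- (c\<^sub>0 * \<Psi> p * (t * sqrt (real p) / 4)))) \<mu>"
proof -
  have c0: "0 < c\<^sub>0" "0 < \<Psi> p" using lc p by (auto simp: lc_concentration_def)
  then have b: "0 < 1 / (c\<^sub>0 * \<Psi> p)" by simp
  show ?thesis
  proof (rule quad_conc_of_seminorm_conc[OF law iso p b _ t _ _ V])
    fix M assume M: "psd_mat p M" "\<And>v. v \<in> carrier_vec p \<Longrightarrow> v \<bullet> (M *\<^sub>v v) \<le> v \<bullet> v"
    have tail: "measure \<mu> {y \<in> space \<mu>. a \<le> \<bar>mat_seminorm M y - (\<integral>z. mat_seminorm M z \<partial>\<mu>)\<bar>} \<le> 2 * exp (- c\<^sub>0 * \<Psi> p * a)" if "0 \<le> a" for a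
    proof -
      have "1 \<le> p" using p by simp
      then show ?thesis
        using lc dens iso log mat_seminorm_lipschitz[OF M] that unfolding lc_concentration_def by blast
    qed
    show "measure \<mu> {y \<in> space \<mu>. a \<le> \<bar>mat_seminorm M y - (\<integral>z. mat_seminorm M z \<partial>\<mu>)\<bar>} \<le> 2 * exp (- a / (1 / (c\<^sub>0 * \<Psi> p)))" if a: "0 \<le> a" for a
      using tail[OF a] by (simp add: mult_ac)
    show "measure \<mu> {y \<in> space \<mu>. t * sqrt (real p) / 4 \<le> \<bar>mat_seminorm M y - (\<integral>z. mat_seminorm M z \<partial>\<mu>)\<bar>}
        \<le> 2 * exp (- (c\<^sub>0 * \<Psi> p * (t * sqrt (real p) / 4)))"
      using tail[of "t * sqrt (real p) / 4"] t by simp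
  qed simp
qed

section \<open>Quadratic forms in independent coordinates\<close>

lemma exp_minus_le_quadratic: "0 \<le> y \<Longrightarrow> y \<le> 1 \<Longrightarrow> exp (- y) \<le> 1 - y + (y :: real)\<^sup>2"
proof -
  assume y: "0 \<le> y" "y \<le> 1"
  \<comment> \<open>The product equals \<open>1 + y ^ 3\<close>.\<close>
  have "1 \<le> (1 - y + y\<^sup>2) * (1 + y)" using y by (simp add: algebra_simps power2_eq_square)
  also have "\<dots> \<le> (1 - y + y\<^sup>2) * exp y"
  proof (rule mult_left_mono)
    show "1 + y \<le> exp y" by (rule exp_ge_add_one_self)
    show "0 \<le> 1 - y + y\<^sup>2" using y zero_le_power2[of y] by linarith
  qed
  finally have "1 / exp y \<le> 1 - y + y\<^sup>2" by (subst pos_divide_le_eq) auto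
  then show "exp (- y) \<le> 1 - y + y\<^sup>2" by (simp add: exp_minus inverse_eq_divide)
qed

lemma exp_le_quadratic: "\<bar>x\<bar> \<le> 1 \<Longrightarrow> exp x \<le> 1 + x + (x :: real)\<^sup>2"
  using exp_bound[of x] exp_minus_le_quadratic[of "- x"] by (cases "0 \<le> x") auto

text \<open>For centred variables the linear term integrates to zero and only an exponential moment
  of the square is left. Near 0 the inequality is a second-order bound; away from 0 the square
  dominates the absolute value.\<close>

lemma exp_le_add_exp_square: "exp x \<le> x + exp ((x :: real)\<^sup>2)"
proof -
  have 1: "1 + x\<^sup>2 \<le> exp (x\<^sup>2)" by (rule exp_ge_add_one_self)
  consider "\<bar>x\<bar> \<le> 1" | "1 < x" | "x < - 1" by linarith
  then show ?thesis
  proof cases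
    case 1
    then show ?thesis using exp_le_quadratic[of x] \<open>1 + x\<^sup>2 \<le> exp (x\<^sup>2)\<close> by linarith
  next
    case 2
    then have "1 * x \<le> x * x" by (intro mult_right_mono) auto
    then have "exp x \<le> exp (x\<^sup>2)" by (simp add: power2_eq_square)
    then show ?thesis using 2 by linarith
  next
    case 3
    then have "(- 1) * x \<le> x * x" by (intro mult_right_mono_neg) auto
    then have "- x \<le> x\<^sup>2" by (simp add: power2_eq_square)
    moreover have "exp x \<le> 1" using 3 by simp
    ultimately show ?thesis using 1 by linarith
  qed
qed

text \<open>A second-order bound whose remainder retains the factor \<open>x\<^sup>2\<close>: for a
  centred variable scaled by \<open>l\<close>, the exponential moment then differs from 1 by order
  \<open>l\<^sup>2\<close>.\<close>

lemma exp_le_quadratic_exp: "exp x \<le> 1 + x + (x :: real)\<^sup>2 * exp \<bar>x\<bar>"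
proof -
  have e: "x\<^sup>2 * 1 \<le> x\<^sup>2 * exp \<bar>x\<bar>" by (intro mult_left_mono) auto
  consider "\<bar>x\<bar> \<le> 1" | "1 < x" | "x < - 1" by linarith
  then show ?thesis
  proof cases
    case 1
    then show ?thesis using exp_le_quadratic[of x] e by linarith
  next
    case 2
    then have "1 * exp x \<le> x\<^sup>2 * exp x" by (intro mult_right_mono) (auto simp: power2_eq_square intro: less_imp_le less_1_mult)
    then have "exp x \<le> x\<^sup>2 * exp \<bar>x\<bar>" using 2 by simp
    then show ?thesis using 2 by linarith
  next
    case 3
    then have "(- 1) * x \<le> x * x" by (intro mult_right_mono_neg) auto
    then have "- x \<le> x\<^sup>2" by (simp add: power2_eq_square)
    moreover have "exp x \<le> 1" using 3 by simp
    ultimately show ?thesis using e by linarith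
  qed
qed

lemma square_le_exp: "0 \<le> w \<Longrightarrow> w\<^sup>2 \<le> 2 * exp (w :: real)"
  using exp_lower_Taylor_quadratic[of w] by linarith

lemma fourth_power_le_exp: "0 \<le> w \<Longrightarrow> w ^ 4 \<le> 64 * exp (w :: real)"
proof -
  assume w: "0 \<le> w"
  have "(w / 2)\<^sup>2 \<le> 2 * exp (w / 2)" using w by (intro square_le_exp) simp
  then have "((w / 2)\<^sup>2)\<^sup>2 \<le> (2 * exp (w / 2))\<^sup>2" by (intro power_mono) auto
  also have "(2 * exp (w / 2))\<^sup>2 = 4 * exp w" by (simp add: power_mult_distrib exp_double[symmetric])
  also have "((w / 2)\<^sup>2)\<^sup>2 = w ^ 4 / 16" by (simp add: power_divide)
  finally show ?thesis by simp
qed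

text \<open>The sub-Gaussian constant \<open>K\<close> enters through \<open>a = 1 / (8 K\<^sup>2)\<close>: tails of the square at this scale are \<open>2 exp (- 2 s)\<close>.\<close>

definition sg_const :: real where "sg_const = 2 * exp 1 * (1 / (1 - exp (-1)))"

lemma sg_const_ge: "1 \<le> sg_const"
proof -
  have "(1 :: real) \<le> 1 / (1 - exp (-1))" by (subst pos_le_divide_eq) auto
  moreover have "(1 :: real) \<le> 2 * exp 1" using exp_ge_add_one_self[of "1 :: real"] by linarith
  ultimately have "1 * 1 \<le> 2 * exp 1 * (1 / (1 - exp (-1 :: real)))" by (intro mult_mono) auto
  then show ?thesis by (simp add: sg_const_def)
qed

text \<open>Split by the integer part \<open>k\<close> of the normalised square: the exponential is
  at most \<open>exp (k + 1)\<close> there, and the tail is at most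
  \<open>2 * exp (- 2 * k)\<close>. The resulting geometric series sums to
  \<open>sg_const\<close>.\<close>

lemma nn_integral_exp_square_le:
  fixes X :: "'a \<Rightarrow> real"
  assumes M: "prob_space M" and X[measurable]: "X \<in> borel_measurable M" and K: "0 < K"
    and tail: "\<And>t. 0 \<le> t \<Longrightarrow> measure M {x \<in> space M. t \<le> \<bar>X x\<bar>} \<le> 2 * exp (- (t / (2 * K))\<^sup>2)"
  shows "(\<integral>\<^sup>+x. ennreal (exp ((X x)\<^sup>2 / (8 * K\<^sup>2))) \<partial>M) \<le> ennreal sg_const"
proof -
  interpret prob_space M by (rule M)
  define Z where "Z x = (X x)\<^sup>2 / (8 * K\<^sup>2)" for x
  have [measurable]: "Z \<in> borel_measurable M" unfolding Z_def by measurable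
  have Z0: "0 \<le> Z x" for x by (simp add: Z_def)
  have Zt: "measure M {x \<in> space M. s \<le> Z x} \<le> 2 * exp (- 2 * s)" if s: "0 \<le> s" for s
  proof -
    have "{x \<in> space M. s \<le> Z x} \<subseteq> {x \<in> space M. sqrt (8 * K\<^sup>2 * s) \<le> \<bar>X x\<bar>}"
    proof
      fix x assume x: "x \<in> {x \<in> space M. s \<le> Z x}"
      then have "s * (8 * K\<^sup>2) \<le> (X x)\<^sup>2" using K by (simp add: Z_def pos_le_divide_eq)
      then have "8 * K\<^sup>2 * s \<le> (X x)\<^sup>2" by (simp add: mult_ac)
      then have "sqrt (8 * K\<^sup>2 * s) \<le> sqrt ((X x)\<^sup>2)" by (rule real_sqrt_le_mono)
      then show "x \<in> {x \<in> space M. sqrt (8 * K\<^sup>2 * s) \<le> \<bar>X x\<bar>}" using x by simp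
    qed
    then have "measure M {x \<in> space M. s \<le> Z x} \<le> measure M {x \<in> space M. sqrt (8 * K\<^sup>2 * s) \<le> \<bar>X x\<bar>}"
      by (intro finite_measure_mono) auto
    also have "\<dots> \<le> 2 * exp (- (sqrt (8 * K\<^sup>2 * s) / (2 * K))\<^sup>2)" using s by (intro tail) simp
    also have "(sqrt (8 * K\<^sup>2 * s) / (2 * K))\<^sup>2 = 2 * s" using s K by (simp add: power_divide power_mult_distrib)
    finally show ?thesis by simp
  qed
  define f where "f k x = ennreal (exp (real k + 1)) * indicator {x \<in> space M. real k \<le> Z x} x" for k :: nat and x
  have [measurable]: "f k \<in> borel_measurable M" for k unfolding f_def by measurable
  have pt: "ennreal (exp (Z x)) \<le> (\<Sum>k. f k x)" if x: "x \<in> space M" for x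
  proof -
    define N where "N = nat \<lfloor>Z x\<rfloor>"
    have N: "real N \<le> Z x" "Z x < real N + 1" unfolding N_def using Z0[of x] by linarith+
    have "ennreal (exp (Z x)) \<le> ennreal (exp (real N + 1))" using N by (intro ennreal_leI) simp
    also have "\<dots> = f N x" using N x by (simp add: f_def)
    also have "\<dots> = (\<Sum>k\<in>{N}. f k x)" by simp
    also have "\<dots> \<le> (\<Sum>k. f k x)" by (rule sum_le_suminf) (auto simp: f_def)
    finally show ?thesis .
  qed
  have "(\<integral>\<^sup>+x. ennreal (exp (Z x)) \<partial>M) \<le> (\<integral>\<^sup>+x. (\<Sum>k. f k x) \<partial>M)" by (rule nn_integral_mono) (rule pt)
  also have "\<dots> = (\<Sum>k. \<integral>\<^sup>+x. f k x \<partial>M)" by (rule nn_integral_suminf) simp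
  also have "\<dots> \<le> (\<Sum>k. ennreal (2 * exp 1 * exp (-1) ^ k))"
  proof (intro suminf_le summableI)
    fix k :: nat
    have "(\<integral>\<^sup>+x. f k x \<partial>M) = ennreal (exp (real k + 1)) * emeasure M {x \<in> space M. real k \<le> Z x}"
      unfolding f_def by (rule nn_integral_cmult_indicator) measurable
    also have "\<dots> = ennreal (exp (real k + 1) * measure M {x \<in> space M. real k \<le> Z x})"
      unfolding emeasure_eq_measure by (rule ennreal_mult[symmetric]) auto
    also have "\<dots> \<le> ennreal (2 * exp 1 * exp (-1) ^ k)"
    proof (rule ennreal_leI)
      have "exp (real k + 1) * measure M {x \<in> space M. real k \<le> Z x} \<le> exp (real k + 1) * (2 * exp (- 2 * real k))"
        using Zt[of "real k"] by (intro mult_left_mono) auto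
      also have "\<dots> = 2 * exp 1 * exp (- real k)" by (simp add: exp_add[symmetric] mult.assoc[symmetric])
      also have "exp (- real k) = exp (-1) ^ k" by (simp add: exp_of_nat_mult[symmetric])
      finally show "exp (real k + 1) * measure M {x \<in> space M. real k \<le> Z x} \<le> 2 * exp 1 * exp (-1) ^ k" .
    qed
    finally show "(\<integral>\<^sup>+x. f k x \<partial>M) \<le> ennreal (2 * exp 1 * exp (-1) ^ k)" .
  qed
  also have "\<dots> = ennreal (\<Sum>k. 2 * exp 1 * exp (-1) ^ k)"
    by (intro suminf_ennreal2 summable_mult summable_geometric) auto
  also have "(\<Sum>k. 2 * exp 1 * exp (-1 :: real) ^ k) = sg_const"
    unfolding sg_const_def by (subst suminf_mult) (auto intro!: summable_geometric simp: suminf_geometric)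
  finally show ?thesis by (simp add: Z_def)
qed

text \<open>The bound \<open>sg_const\<close> is the same for every \<open>K\<close>; the dependence
  on the law is carried by the scale \<open>a\<close> alone.\<close>

definition std_subgauss :: "real \<Rightarrow> real measure \<Rightarrow> bool" where
  "std_subgauss a \<nu> \<longleftrightarrow> prob_space \<nu> \<and> sets \<nu> = sets borel \<and> integrable \<nu> (\<lambda>x. x) \<and> (\<integral>x. x \<partial>\<nu>) = 0 \<and>
    integrable \<nu> (\<lambda>x. x\<^sup>2) \<and> (\<integral>x. x\<^sup>2 \<partial>\<nu>) = 1 \<and>
    integrable \<nu> (\<lambda>x. exp (a * x\<^sup>2)) \<and> (\<integral>x. exp (a * x\<^sup>2) \<partial>\<nu>) \<le> sg_const"

section \<open>Moments of a single sub-Gaussian coordinate\<close>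

lemma nn_integral_le_of_bound:
  fixes f g :: "real \<Rightarrow> real"
  assumes \<nu>: "std_subgauss a \<nu>" and g: "integrable \<nu> g" and le: "\<And>x. f x \<le> g x" and f0: "\<And>x. 0 \<le> f x"
    and c: "(\<integral>x. g x \<partial>\<nu>) \<le> c"
  shows "(\<integral>\<^sup>+x. ennreal (f x) \<partial>\<nu>) \<le> ennreal c"
proof -
  have "(\<integral>\<^sup>+x. ennreal (f x) \<partial>\<nu>) \<le> (\<integral>\<^sup>+x. ennreal (g x) \<partial>\<nu>)" using le by (intro nn_integral_mono ennreal_leI)
  also have "\<dots> = ennreal (\<integral>x. g x \<partial>\<nu>)"
    using f0 le by (intro nn_integral_eq_integral[OF g]) (auto intro: order_trans)
  also have "\<dots> \<le> ennreal c" by (rule ennreal_leI[OF c])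
  finally show ?thesis .
qed

text \<open>Convexity of exp between 0 and \<open>x\<close>. It passes from the exponential moment
  at scale \<open>a\<close> to smaller scales with a loss that is linear in the parameter.\<close>

lemma exp_scale_le:
  fixes x :: real
  assumes "0 \<le> l" "l \<le> 1" shows "exp (l * x) \<le> (1 - l) + l * exp x"
  using convex_onD[OF exp_convex, of l 0 x] assms by simp

lemma subgauss_exp_square:
  assumes \<nu>: "std_subgauss a \<nu>" and a: "0 < a" and s: "0 \<le> s" "s \<le> a"
  shows "(\<integral>\<^sup>+x. ennreal (exp (s * x\<^sup>2)) \<partial>\<nu>) \<le> ennreal (exp (sg_const / a * s))"
proof (rule nn_integral_le_of_bound[OF \<nu>])
  interpret prob_space \<nu> using \<nu> by (simp add: std_subgauss_def)
  note n = \<nu>[unfolded std_subgauss_def]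
  show "integrable \<nu> (\<lambda>x. (1 - s / a) + s / a * exp (a * x\<^sup>2))" using n by simp
  show "exp (s * x\<^sup>2) \<le> (1 - s / a) + s / a * exp (a * x\<^sup>2)" for x
    using exp_scale_le[of "s / a" "a * x\<^sup>2"] a s by simp
  have "(\<integral>x. (1 - s / a) + s / a * exp (a * x\<^sup>2) \<partial>\<nu>) = (1 - s / a) + s / a * (\<integral>x. exp (a * x\<^sup>2) \<partial>\<nu>)"
    using n by (simp add: prob_space)
  also have "\<dots> \<le> (1 - s / a) + s / a * sg_const" using n a s by (intro add_left_mono mult_left_mono) auto
  also have "\<dots> \<le> 1 + sg_const / a * s"
  proof -
    have "0 \<le> s / a" "s / a * sg_const = sg_const / a * s" using a s by simp_all
    then show ?thesis by linarith
  qed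
  also have "\<dots> \<le> exp (sg_const / a * s)" by (rule exp_ge_add_one_self)
  finally show "(\<integral>x. (1 - s / a) + s / a * exp (a * x\<^sup>2) \<partial>\<nu>) \<le> exp (sg_const / a * s)" .
qed simp

text \<open>For \<open>\<theta>\<^sup>2 \<le> a\<close> the linear term is split off, integrates to
  zero, and the exponential of \<open>(\<theta> * x)\<^sup>2\<close> is interpolated from scale
  \<open>a\<close>. For larger \<theta> centring is irrelevant, and completing the square gives
  \<open>\<theta> * x \<le> \<theta>\<^sup>2 / (4 * a) + a * x\<^sup>2\<close>.\<close>

lemma subgauss_mgf:
  assumes \<nu>: "std_subgauss a \<nu>" and a: "0 < a"
  shows "(\<integral>\<^sup>+x. ennreal (exp (\<theta> * x)) \<partial>\<nu>) \<le> ennreal (exp (sg_const / a * \<theta>\<^sup>2))"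
proof (cases "\<theta>\<^sup>2 \<le> a")
  case True
  interpret prob_space \<nu> using \<nu> by (simp add: std_subgauss_def)
  note n = \<nu>[unfolded std_subgauss_def]
  let ?l = "\<theta>\<^sup>2 / a"
  show ?thesis
  proof (rule nn_integral_le_of_bound[OF \<nu>])
    show "integrable \<nu> (\<lambda>x. \<theta> * x + ((1 - ?l) + ?l * exp (a * x\<^sup>2)))" using n by simp
    show "exp (\<theta> * x) \<le> \<theta> * x + ((1 - ?l) + ?l * exp (a * x\<^sup>2))" for x
    proof -
      have "exp (\<theta> * x) \<le> \<theta> * x + exp ((\<theta> * x)\<^sup>2)" by (rule exp_le_add_exp_square)
      also have "(\<theta> * x)\<^sup>2 = ?l * (a * x\<^sup>2)" using a by (simp add: power_mult_distrib)
      also have "exp (?l * (a * x\<^sup>2)) \<le> (1 - ?l) + ?l * exp (a * x\<^sup>2)" using True a by (intro exp_scale_le) auto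
      finally show ?thesis by simp
    qed
    have "(\<integral>x. \<theta> * x + ((1 - ?l) + ?l * exp (a * x\<^sup>2)) \<partial>\<nu>) = (1 - ?l) + ?l * (\<integral>x. exp (a * x\<^sup>2) \<partial>\<nu>)"
      using n by (simp add: prob_space)
    also have "\<dots> \<le> (1 - ?l) + ?l * sg_const" using n a by (intro add_left_mono mult_left_mono) auto
    also have "\<dots> \<le> 1 + sg_const / a * \<theta>\<^sup>2" using a by (simp add: mult.commute)
    also have "\<dots> \<le> exp (sg_const / a * \<theta>\<^sup>2)" by (rule exp_ge_add_one_self)
    finally show "(\<integral>x. \<theta> * x + ((1 - ?l) + ?l * exp (a * x\<^sup>2)) \<partial>\<nu>) \<le> exp (sg_const / a * \<theta>\<^sup>2)" .
  qed simp
next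
  case False
  interpret prob_space \<nu> using \<nu> by (simp add: std_subgauss_def)
  note n = \<nu>[unfolded std_subgauss_def]
  show ?thesis
  proof (rule nn_integral_le_of_bound[OF \<nu>])
    show "integrable \<nu> (\<lambda>x. exp (\<theta>\<^sup>2 / (4 * a)) * exp (a * x\<^sup>2))" using n by simp
    show "exp (\<theta> * x) \<le> exp (\<theta>\<^sup>2 / (4 * a)) * exp (a * x\<^sup>2)" for x
    proof -
      have "0 \<le> a * (x - \<theta> / (2 * a))\<^sup>2" using a by simp
      also have "a * (x - \<theta> / (2 * a))\<^sup>2 = a * x\<^sup>2 - \<theta> * x + \<theta>\<^sup>2 / (4 * a)"
        using a by (simp add: power2_eq_square field_simps)
      finally show ?thesis by (simp add: exp_add[symmetric])
    qed
    have "(\<integral>x. exp (\<theta>\<^sup>2 / (4 * a)) * exp (a * x\<^sup>2) \<partial>\<nu>) = exp (\<theta>\<^sup>2 / (4 * a)) * (\<integral>x. exp (a * x\<^sup>2) \<partial>\<nu>)" by simp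
    also have "\<dots> \<le> exp (\<theta>\<^sup>2 / (4 * a)) * sg_const" using n by (intro mult_left_mono) auto
    also have "\<dots> \<le> exp (\<theta>\<^sup>2 / (4 * a)) * exp (sg_const - 1)"
      using exp_ge_add_one_self[of "sg_const - 1"] by (intro mult_left_mono) auto
    also have "\<dots> \<le> exp (sg_const / a * \<theta>\<^sup>2)"
    proof -
      define l where "l = \<theta>\<^sup>2 / a"
      have l: "1 \<le> l" unfolding l_def using False a by (subst pos_le_divide_eq) auto
      \<comment> \<open>Since \<open>l \<ge> 1\<close>, both the prefactor, bounded by
        \<open>exp (sg_const - 1)\<close>, and the term \<open>l / 4\<close> fit into the exponent
        \<open>sg_const * l\<close>.\<close>
      have "(sg_const - 1) * 1 \<le> (sg_const - 1) * l" using l sg_const_ge by (intro mult_left_mono) auto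
      then have "l / 4 + (sg_const - 1) \<le> sg_const * l" using l by (simp add: left_diff_distrib)
      moreover have "\<theta>\<^sup>2 / (4 * a) = l / 4" "sg_const / a * \<theta>\<^sup>2 = sg_const * l" by (simp_all add: l_def)
      ultimately show ?thesis by (simp add: exp_add[symmetric])
    qed
    finally show "(\<integral>x. exp (\<theta>\<^sup>2 / (4 * a)) * exp (a * x\<^sup>2) \<partial>\<nu>) \<le> exp (sg_const / a * \<theta>\<^sup>2)" .
  qed simp
qed

text \<open>The first-order term vanishes by unit variance. The second-order remainder is a multiple
  of \<open>l\<^sup>2\<close> times \<open>w\<^sup>2 * exp w\<close> with \<open>w\<close> equal to
  \<open>a / 2\<close> times the deviation of the square, and
  \<open>w\<^sup>2 \<le> 2 * exp w\<close> reduces it to the moment at scale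
  \<open>a\<close>.\<close>

lemma subgauss_diag_mgf:
  assumes \<nu>: "std_subgauss a \<nu>" and a: "0 < a" and l: "\<bar>l\<bar> \<le> a / 2"
  shows "(\<integral>\<^sup>+x. ennreal (exp (l * (x\<^sup>2 - 1))) \<partial>\<nu>) \<le> ennreal (exp (8 * exp a * sg_const / a\<^sup>2 * l\<^sup>2))"
proof (rule nn_integral_le_of_bound[OF \<nu>])
  interpret prob_space \<nu> using \<nu> by (simp add: std_subgauss_def)
  note n = \<nu>[unfolded std_subgauss_def]
  let ?c = "8 * exp a / a\<^sup>2 * l\<^sup>2"
  show "integrable \<nu> (\<lambda>x. 1 + l * (x\<^sup>2 - 1) + ?c * exp (a * x\<^sup>2))" using n by simp
  show "exp (l * (x\<^sup>2 - 1)) \<le> 1 + l * (x\<^sup>2 - 1) + ?c * exp (a * x\<^sup>2)" for x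
  proof -
    define w where "w = a / 2 * \<bar>x\<^sup>2 - 1\<bar>"
    have w0: "0 \<le> w" using a by (simp add: w_def)
    have "\<bar>l * (x\<^sup>2 - 1)\<bar> \<le> w" unfolding w_def abs_mult using l by (intro mult_right_mono) auto
    then have e: "exp \<bar>l * (x\<^sup>2 - 1)\<bar> \<le> exp w" by simp
    have sq: "(l * (x\<^sup>2 - 1))\<^sup>2 = 4 * l\<^sup>2 / a\<^sup>2 * w\<^sup>2" using a by (simp add: w_def power_mult_distrib power_divide)
    have "exp (l * (x\<^sup>2 - 1)) \<le> 1 + l * (x\<^sup>2 - 1) + (l * (x\<^sup>2 - 1))\<^sup>2 * exp \<bar>l * (x\<^sup>2 - 1)\<bar>" by (rule exp_le_quadratic_exp)
    also have "(l * (x\<^sup>2 - 1))\<^sup>2 * exp \<bar>l * (x\<^sup>2 - 1)\<bar> \<le> (4 * l\<^sup>2 / a\<^sup>2 * w\<^sup>2) * exp w"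
      unfolding sq using e by (intro mult_left_mono) auto
    also have "\<dots> \<le> (4 * l\<^sup>2 / a\<^sup>2 * (2 * exp w)) * exp w"
      using square_le_exp[OF w0] by (intro mult_right_mono mult_left_mono) auto
    also have "\<dots> = 8 * l\<^sup>2 / a\<^sup>2 * exp (2 * w)" by (simp add: exp_double power2_eq_square)
    also have "\<dots> \<le> 8 * l\<^sup>2 / a\<^sup>2 * exp (a + a * x\<^sup>2)"
    proof (intro mult_left_mono)
      have "a * \<bar>x\<^sup>2 - 1\<bar> \<le> a * (x\<^sup>2 + 1)" using a zero_le_power2[of x] by (intro mult_left_mono) linarith+
      then show "exp (2 * w) \<le> exp (a + a * x\<^sup>2)" by (simp add: w_def distrib_left)
    qed simp
    also have "\<dots> = ?c * exp (a * x\<^sup>2)" by (simp add: exp_add)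
    finally show ?thesis by simp
  qed
  have "(\<integral>x. 1 + l * (x\<^sup>2 - 1) + ?c * exp (a * x\<^sup>2) \<partial>\<nu>) = 1 + ?c * (\<integral>x. exp (a * x\<^sup>2) \<partial>\<nu>)"
    using n by (simp add: prob_space)
  also have "\<dots> \<le> 1 + ?c * sg_const" using n by (intro add_left_mono mult_left_mono) auto
  also have "\<dots> \<le> exp (?c * sg_const)" by (rule exp_ge_add_one_self)
  finally show "(\<integral>x. 1 + l * (x\<^sup>2 - 1) + ?c * exp (a * x\<^sup>2) \<partial>\<nu>) \<le> exp (8 * exp a * sg_const / a\<^sup>2 * l\<^sup>2)" by (simp add: mult_ac)
qed simp


section \<open>Independent coordinates and decoupling\<close>

lemma prod_exp_nn_integral:
  fixes \<nu> :: "nat \<Rightarrow> real measure" and g :: "nat \<Rightarrow> real \<Rightarrow> real"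
  assumes \<nu>: "\<And>j. std_subgauss a (\<nu> j)" and J: "finite J" and g: "\<And>j. g j \<in> borel_measurable borel"
    and le: "\<And>j. j \<in> J \<Longrightarrow> (\<integral>\<^sup>+x. ennreal (exp (g j x)) \<partial>\<nu> j) \<le> ennreal (exp (b j))"
  shows "(\<integral>\<^sup>+x. ennreal (exp (\<Sum>j\<in>J. g j (x j))) \<partial>(\<Pi>\<^sub>M j\<in>J. \<nu> j)) \<le> ennreal (exp (\<Sum>j\<in>J. b j))"
proof -
  interpret product_sigma_finite \<nu>
    using \<nu> by (intro product_sigma_finite.intro prob_space_imp_sigma_finite) (simp add: std_subgauss_def)
  have "(\<integral>\<^sup>+x. ennreal (exp (\<Sum>j\<in>J. g j (x j))) \<partial>(\<Pi>\<^sub>M j\<in>J. \<nu> j)) =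
      (\<integral>\<^sup>+x. (\<Prod>j\<in>J. ennreal (exp (g j (x j)))) \<partial>(\<Pi>\<^sub>M j\<in>J. \<nu> j))"
    using J by (simp add: exp_sum prod_ennreal)
  also have "\<dots> = (\<Prod>j\<in>J. \<integral>\<^sup>+x. ennreal (exp (g j x)) \<partial>\<nu> j)"
  proof (rule product_nn_integral_prod[OF J])
    fix j
    have "(\<lambda>x. ennreal (exp (g j x))) \<in> borel_measurable borel" using g[of j] by measurable
    then show "(\<lambda>x. ennreal (exp (g j x))) \<in> borel_measurable (\<nu> j)"
      using \<nu>[of j] by (simp add: std_subgauss_def cong: measurable_cong_sets)
  qed
  also have "\<dots> \<le> (\<Prod>j\<in>J. ennreal (exp (b j)))" using J le
  proof (induction J rule: finite_induct)
    case (insert j J)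
    then show ?case by (simp add: mult_mono)
  qed simp
  also have "\<dots> = ennreal (exp (\<Sum>j\<in>J. b j))" using J by (simp add: exp_sum prod_ennreal)
  finally show ?thesis .
qed

lemma measurable_PiM_component:
  fixes \<nu> :: "nat \<Rightarrow> real measure"
  assumes "\<And>j. std_subgauss a (\<nu> j)" "j \<in> J"
  shows "(\<lambda>x. x j) \<in> borel_measurable (\<Pi>\<^sub>M j\<in>J. \<nu> j)"
  using measurable_component_singleton[OF assms(2), of \<nu>] assms(1)[of j]
  by (simp add: std_subgauss_def cong: measurable_cong_sets)

text \<open>For fixed coordinates in \<open>I\<close> the sum is linear in the independent remaining
  ones, so \<open>subgauss_mgf\<close> applies coordinatewise. The exponent it leaves is quadratic
  in the fixed coordinates and, by \<open>contr\<close>, at most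
  \<open>16 * (sg_const / a) * l\<^sup>2\<close> times their squared norm; \<open>l\<close> is
  restricted so that \<open>subgauss_exp_square\<close> can integrate this.\<close>

lemma off_diagonal_block_mgf:
  fixes \<nu> :: "nat \<Rightarrow> real measure" and m :: "nat \<Rightarrow> nat \<Rightarrow> real"
  assumes \<nu>: "\<And>j. std_subgauss a (\<nu> j)" and a: "0 < a" and I: "I \<subseteq> {..<p}"
    and contr: "\<And>x :: nat \<Rightarrow> real. (\<Sum>j\<in>{..<p} - I. (\<Sum>i\<in>I. m i j * x i)\<^sup>2) \<le> (\<Sum>i\<in>I. (x i)\<^sup>2)"
    and l: "16 * (sg_const / a) * l\<^sup>2 \<le> a"
  shows "(\<integral>\<^sup>+x. ennreal (exp (4 * l * (\<Sum>i\<in>I. \<Sum>j\<in>{..<p} - I. m i j * x i * x j))) \<partial>(\<Pi>\<^sub>M j\<in>{..<p}. \<nu> j))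
    \<le> ennreal (exp (16 * (sg_const / a)\<^sup>2 * l\<^sup>2 * real p))"
proof -
  let ?J = "{..<p} - I" and ?L = "sg_const / a"
  have L0: "0 \<le> ?L" using a sg_const_ge by simp
  interpret product_sigma_finite \<nu>
    using \<nu> by (intro product_sigma_finite.intro prob_space_imp_sigma_finite) (simp add: std_subgauss_def)
  have fin: "finite I" "finite ?J" using I by (auto intro: finite_subset)
  have un: "I \<union> ?J = {..<p}" "I \<inter> ?J = {}" using I by auto
  let ?f = "\<lambda>x. ennreal (exp (4 * l * (\<Sum>i\<in>I. \<Sum>j\<in>?J. m i j * x i * x j)))"
  have fm: "?f \<in> borel_measurable (\<Pi>\<^sub>M j\<in>{..<p}. \<nu> j)"
  proof -
    have [measurable]: "(\<lambda>x. x j) \<in> borel_measurable (\<Pi>\<^sub>M j\<in>{..<p}. \<nu> j)" if "j \<in> {..<p}" for j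
      by (rule measurable_PiM_component[OF \<nu> that])
    have "(\<lambda>x. \<Sum>i\<in>I. \<Sum>j\<in>?J. m i j * x i * x j) \<in> borel_measurable (\<Pi>\<^sub>M j\<in>{..<p}. \<nu> j)"
      using I by (intro borel_measurable_sum borel_measurable_times borel_measurable_const measurable_PiM_component[OF \<nu>]) auto
    then show ?thesis by measurable
  qed
  have "(\<integral>\<^sup>+x. ?f x \<partial>(\<Pi>\<^sub>M j\<in>{..<p}. \<nu> j)) =
      (\<integral>\<^sup>+x. (\<integral>\<^sup>+y. ?f (merge I ?J (x, y)) \<partial>(\<Pi>\<^sub>M j\<in>?J. \<nu> j)) \<partial>(\<Pi>\<^sub>M j\<in>I. \<nu> j))"
    using product_nn_integral_fold[OF un(2) fin, of ?f] fm unfolding un(1) by blast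
  also have "\<dots> \<le> (\<integral>\<^sup>+x. ennreal (exp (\<Sum>i\<in>I. 16 * ?L * l\<^sup>2 * (x i)\<^sup>2)) \<partial>(\<Pi>\<^sub>M j\<in>I. \<nu> j))"
  proof (rule nn_integral_mono)
    fix x
    define c where "c j = 4 * l * (\<Sum>i\<in>I. m i j * x i)" for j
    have "(\<integral>\<^sup>+y. ?f (merge I ?J (x, y)) \<partial>(\<Pi>\<^sub>M j\<in>?J. \<nu> j)) = (\<integral>\<^sup>+y. ennreal (exp (\<Sum>j\<in>?J. c j * y j)) \<partial>(\<Pi>\<^sub>M j\<in>?J. \<nu> j))"
    proof (intro nn_integral_cong arg_cong[where f = "\<lambda>r. ennreal (exp r)"])
      fix y
      have "(\<Sum>i\<in>I. \<Sum>j\<in>?J. m i j * merge I ?J (x, y) i * merge I ?J (x, y) j) = (\<Sum>i\<in>I. \<Sum>j\<in>?J. m i j * x i * y j)"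
        by (intro sum.cong refl) (simp add: merge_def)
      also have "\<dots> = (\<Sum>j\<in>?J. (\<Sum>i\<in>I. m i j * x i) * y j)"
        by (subst sum.swap) (simp only: sum_distrib_right)
      also have "4 * l * (\<Sum>j\<in>?J. (\<Sum>i\<in>I. m i j * x i) * y j) = (\<Sum>j\<in>?J. 4 * l * ((\<Sum>i\<in>I. m i j * x i) * y j))"
        by (rule sum_distrib_left)
      also have "\<dots> = (\<Sum>j\<in>?J. c j * y j)" by (simp only: c_def mult.assoc)
      finally show "4 * l * (\<Sum>i\<in>I. \<Sum>j\<in>?J. m i j * merge I ?J (x, y) i * merge I ?J (x, y) j) = (\<Sum>j\<in>?J. c j * y j)" .
    qed
    also have "\<dots> \<le> ennreal (exp (\<Sum>j\<in>?J. ?L * (c j)\<^sup>2))"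
      by (rule prod_exp_nn_integral[OF \<nu> fin(2)]) (simp, rule subgauss_mgf[OF \<nu> a])
    also have "\<dots> \<le> ennreal (exp (\<Sum>i\<in>I. 16 * ?L * l\<^sup>2 * (x i)\<^sup>2))"
    proof (intro ennreal_leI)
      have "(\<Sum>j\<in>?J. ?L * (c j)\<^sup>2) = 16 * ?L * l\<^sup>2 * (\<Sum>j\<in>?J. (\<Sum>i\<in>I. m i j * x i)\<^sup>2)"
      proof -
        have "?L * (c j)\<^sup>2 = 16 * ?L * l\<^sup>2 * (\<Sum>i\<in>I. m i j * x i)\<^sup>2" for j
          unfolding c_def power_mult_distrib by simp
        then show ?thesis by (simp only: sum_distrib_left[symmetric])
      qed
      also have "\<dots> \<le> 16 * ?L * l\<^sup>2 * (\<Sum>i\<in>I. (x i)\<^sup>2)" 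
      proof (rule mult_left_mono[OF contr])
        show "0 \<le> 16 * ?L * l\<^sup>2" by (intro mult_nonneg_nonneg L0) simp_all
      qed
      finally show "exp (\<Sum>j\<in>?J. ?L * (c j)\<^sup>2) \<le> exp (\<Sum>i\<in>I. 16 * ?L * l\<^sup>2 * (x i)\<^sup>2)" by (simp only: exp_le_cancel_iff sum_distrib_left)
    qed
    finally show "(\<integral>\<^sup>+y. ?f (merge I ?J (x, y)) \<partial>(\<Pi>\<^sub>M j\<in>?J. \<nu> j)) \<le> ennreal (exp (\<Sum>i\<in>I. 16 * ?L * l\<^sup>2 * (x i)\<^sup>2))" .
  qed
  also have "\<dots> \<le> ennreal (exp (\<Sum>i\<in>I. ?L * (16 * ?L * l\<^sup>2)))"
  proof (rule prod_exp_nn_integral[OF \<nu> fin(1)])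
    show "(\<integral>\<^sup>+x. ennreal (exp (16 * ?L * l\<^sup>2 * x\<^sup>2)) \<partial>\<nu> j) \<le> ennreal (exp (?L * (16 * ?L * l\<^sup>2)))" for j
    proof (rule subgauss_exp_square[OF \<nu> a _ l])
      show "0 \<le> 16 * ?L * l\<^sup>2" by (intro mult_nonneg_nonneg L0) simp_all
    qed
  qed simp
  also have "\<dots> \<le> ennreal (exp (16 * ?L\<^sup>2 * l\<^sup>2 * real p))"
  proof (intro ennreal_leI)
    have "real (card I) * (?L * (16 * ?L * l\<^sup>2)) \<le> real p * (?L * (16 * ?L * l\<^sup>2))"
    proof (rule mult_right_mono)
      show "0 \<le> ?L * (16 * ?L * l\<^sup>2)" by (intro mult_nonneg_nonneg L0) simp_all
    qed (use card_mono[OF finite_lessThan I] in simp)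
    then have "(\<Sum>i\<in>I. ?L * (16 * ?L * l\<^sup>2)) \<le> 16 * ?L\<^sup>2 * l\<^sup>2 * real p" by (simp add: power2_eq_square[of ?L] mult_ac)
    then show "exp (\<Sum>i\<in>I. ?L * (16 * ?L * l\<^sup>2)) \<le> exp (16 * ?L\<^sup>2 * l\<^sup>2 * real p)" by simp
  qed
  finally show ?thesis .
qed

text \<open>Removing \<open>i\<close> identifies these sets with all subsets of the other
  \<open>p - 2\<close> points.\<close>

lemma card_separating_subsets:
  assumes "i < p" "j < p" "i \<noteq> j"
  shows "card {I \<in> Pow {..<p}. i \<in> I \<and> j \<notin> I} = 2 ^ (p - 2)"
proof -
  let ?A = "{..<p} - {i, j}"
  have "bij_betw (insert i) (Pow ?A) {I \<in> Pow {..<p}. i \<in> I \<and> j \<notin> I}"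
  proof (rule bij_betw_byWitness[where f' = "\<lambda>I. I - {i}"])
    show "insert i ` Pow ?A \<subseteq> {I \<in> Pow {..<p}. i \<in> I \<and> j \<notin> I}" using assms by auto
  qed auto
  then have "card {I \<in> Pow {..<p}. i \<in> I \<and> j \<notin> I} = card (Pow ?A)" by (rule bij_betw_same_card[symmetric])
  also have "\<dots> = 2 ^ card ?A" by (rule card_Pow) simp
  also have "card ?A = p - 2" using assms by (simp add: card_Diff_subset)
  finally show ?thesis .
qed

text \<open>An ordered pair \<open>i \<noteq> j\<close> is separated by a quarter of all subsets \<open>I\<close>.\<close>

lemma decoupling_identity:
  fixes g :: "nat \<Rightarrow> nat \<Rightarrow> real"
  shows "(\<Sum>i<p. \<Sum>j\<in>{..<p} - {i}. g i j) = (\<Sum>I\<in>Pow {..<p}. 1 / 2 ^ p * (4 * (\<Sum>i\<in>I. \<Sum>j\<in>{..<p} - I. g i j)))"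
proof -
  have "(\<Sum>i\<in>I. \<Sum>j\<in>{..<p} - I. g i j) = (\<Sum>i<p. \<Sum>j<p. if i \<in> I \<and> j \<notin> I then g i j else 0)" if "I \<in> Pow {..<p}" for I
  proof -
    have I: "I \<subseteq> {..<p}" using that by simp
    have "(\<Sum>i<p. \<Sum>j<p. if i \<in> I \<and> j \<notin> I then g i j else 0) = (\<Sum>i<p. if i \<in> I then (\<Sum>j<p. if j \<in> {..<p} - I then g i j else 0) else 0)"
      by (intro sum.cong refl) (auto intro!: sum.cong)
    also have "\<dots> = (\<Sum>i\<in>{..<p} \<inter> I. \<Sum>j<p. if j \<in> {..<p} - I then g i j else 0)"
      by (rule sum.inter_restrict[symmetric]) simp
    also have "\<dots> = (\<Sum>i\<in>I. \<Sum>j\<in>{..<p} - I. g i j)"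
    proof -
      have inner: "(\<Sum>j<p. if j \<in> {..<p} - I then g i j else 0) = (\<Sum>j\<in>{..<p} \<inter> ({..<p} - I). g i j)" for i
        by (rule sum.inter_restrict[symmetric]) simp
      have int: "{..<p} \<inter> ({..<p} - I) = {..<p} - I" "{..<p} \<inter> I = I" using I by blast+
      show ?thesis by (simp only: inner int)
    qed
    finally show ?thesis by simp
  qed
  then have "(\<Sum>I\<in>Pow {..<p}. (\<Sum>i\<in>I. \<Sum>j\<in>{..<p} - I. g i j)) = (\<Sum>I\<in>Pow {..<p}. \<Sum>i<p. \<Sum>j<p. if i \<in> I \<and> j \<notin> I then g i j else 0)"
    by (rule sum.cong[OF refl])
  also have "\<dots> = (\<Sum>i<p. \<Sum>I\<in>Pow {..<p}. \<Sum>j<p. if i \<in> I \<and> j \<notin> I then g i j else 0)" by (rule sum.swap)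
  also have "\<dots> = (\<Sum>i<p. \<Sum>j<p. \<Sum>I\<in>Pow {..<p}. if i \<in> I \<and> j \<notin> I then g i j else 0)"
    by (intro sum.cong refl, rule sum.swap)
  also have "\<dots> = (\<Sum>i<p. \<Sum>j<p. if j \<in> {..<p} - {i} then 2 ^ (p - 2) * g i j else 0)"
  proof (intro sum.cong refl)
    fix i j assume ij: "i \<in> {..<p}" "j \<in> {..<p}"
    have "(\<Sum>I\<in>Pow {..<p}. if i \<in> I \<and> j \<notin> I then g i j else 0) = (\<Sum>I\<in>{I \<in> Pow {..<p}. i \<in> I \<and> j \<notin> I}. g i j)"
      by (rule sum.inter_filter[symmetric]) simp
    also have "\<dots> = real (card {I \<in> Pow {..<p}. i \<in> I \<and> j \<notin> I}) * g i j" by (simp only: sum_constant)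
    finally show "(\<Sum>I\<in>Pow {..<p}. if i \<in> I \<and> j \<notin> I then g i j else 0) = (if j \<in> {..<p} - {i} then 2 ^ (p - 2) * g i j else 0)"
      using card_separating_subsets[of i p j] ij by (cases "i = j") auto
  qed
  also have "\<dots> = (\<Sum>i<p. \<Sum>j\<in>{..<p} - {i}. 2 ^ (p - 2) * g i j)"
  proof (rule sum.cong[OF refl])
    fix i
    have "(\<Sum>j<p. if j \<in> {..<p} - {i} then 2 ^ (p - 2) * g i j else 0) = (\<Sum>j\<in>{..<p} \<inter> ({..<p} - {i}). 2 ^ (p - 2) * g i j)"
      by (rule sum.inter_restrict[symmetric]) simp
    also have "{..<p} \<inter> ({..<p} - {i}) = {..<p} - {i}" by blast
    finally show "(\<Sum>j<p. if j \<in> {..<p} - {i} then 2 ^ (p - 2) * g i j else 0) = (\<Sum>j\<in>{..<p} - {i}. 2 ^ (p - 2) * g i j)" .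
  qed
  also have "\<dots> = 2 ^ (p - 2) * (\<Sum>i<p. \<Sum>j\<in>{..<p} - {i}. g i j)" by (simp only: sum_distrib_left)
  finally have 1: "(\<Sum>I\<in>Pow {..<p}. (\<Sum>i\<in>I. \<Sum>j\<in>{..<p} - I. g i j)) = 2 ^ (p - 2) * (\<Sum>i<p. \<Sum>j\<in>{..<p} - {i}. g i j)" .
  have "(\<Sum>I\<in>Pow {..<p}. 1 / 2 ^ p * (4 * (\<Sum>i\<in>I. \<Sum>j\<in>{..<p} - I. g i j))) =
      (1 / 2 ^ p * 4) * (\<Sum>I\<in>Pow {..<p}. (\<Sum>i\<in>I. \<Sum>j\<in>{..<p} - I. g i j))"
    by (simp only: sum_distrib_left mult.assoc)
  also have "\<dots> = (4 * 2 ^ (p - 2) / 2 ^ p) * (\<Sum>i<p. \<Sum>j\<in>{..<p} - {i}. g i j)" unfolding 1 by simp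
  finally have 2: "(\<Sum>I\<in>Pow {..<p}. 1 / 2 ^ p * (4 * (\<Sum>i\<in>I. \<Sum>j\<in>{..<p} - I. g i j))) =
      (4 * 2 ^ (p - 2) / 2 ^ p) * (\<Sum>i<p. \<Sum>j\<in>{..<p} - {i}. g i j)" .
  show ?thesis
  \<comment> \<open>For \<open>p \<le> 1\<close> the truncated subtraction \<open>p - 2\<close>
    spoils the factor, but there are no off-diagonal pairs.\<close>
  proof (cases "p \<le> 1")
    case True
    have "(\<Sum>i<p. \<Sum>j\<in>{..<p} - {i}. g i j) = 0"
    proof (rule sum.neutral, rule ballI)
      fix i assume "i \<in> {..<p}"
      then have e: "{..<p} - {i} = {}" using True by auto
      show "(\<Sum>j\<in>{..<p} - {i}. g i j) = 0" unfolding e by (rule sum.empty)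
    qed
    then show ?thesis unfolding 2 by simp
  next
    case False
    then obtain k where "p = k + 2" by (metis add.commute le_Suc_ex not_less_eq_eq numeral_2_eq_2 One_nat_def)
    then have "(4 * 2 ^ (p - 2) / 2 ^ p :: real) = 1" by (simp add: power_add)
    then show ?thesis unfolding 2 by simp
  qed
qed

text \<open>By the decoupling identity the off-diagonal sum is a uniform average over all subsets
  \<open>I\<close> of four times the block sums. Jensen's inequality moves exp inside the average,
  and each block obeys the same bound.\<close>

lemma off_diagonal_mgf:
  fixes \<nu> :: "nat \<Rightarrow> real measure" and m :: "nat \<Rightarrow> nat \<Rightarrow> real"
  assumes \<nu>: "\<And>j. std_subgauss a (\<nu> j)" and a: "0 < a"
    and contr: "\<And>I x. I \<subseteq> {..<p} \<Longrightarrow> (\<Sum>j\<in>{..<p} - I. (\<Sum>i\<in>I. m i j * x i)\<^sup>2) \<le> (\<Sum>i\<in>I. (x i)\<^sup>2)"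
    and l: "16 * (sg_const / a) * l\<^sup>2 \<le> a"
  shows "(\<integral>\<^sup>+x. ennreal (exp (l * (\<Sum>i<p. \<Sum>j\<in>{..<p} - {i}. m i j * x i * x j))) \<partial>(\<Pi>\<^sub>M j\<in>{..<p}. \<nu> j))
    \<le> ennreal (exp (16 * (sg_const / a)\<^sup>2 * l\<^sup>2 * real p))"
proof -
  define B where "B I x = 4 * l * (\<Sum>i\<in>I. \<Sum>j\<in>{..<p} - I. m i j * x i * x j)" for I and x :: "nat \<Rightarrow> real"
  let ?P = "\<Pi>\<^sub>M j\<in>{..<p}. \<nu> j"
  have Bm[measurable]: "B I \<in> borel_measurable ?P" if "I \<in> Pow {..<p}" for I
    unfolding B_def using that
    by (intro borel_measurable_times borel_measurable_const borel_measurable_sum measurable_PiM_component[OF \<nu>]) auto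
  have w1: "(\<Sum>I\<in>Pow {..<p}. 1 / 2 ^ p :: real) = 1" by (simp add: card_Pow)
  have pt: "exp (l * (\<Sum>i<p. \<Sum>j\<in>{..<p} - {i}. m i j * x i * x j)) \<le> (\<Sum>I\<in>Pow {..<p}. 1 / 2 ^ p * exp (B I x))" for x :: "nat \<Rightarrow> real"
  proof -
    have "l * (\<Sum>i<p. \<Sum>j\<in>{..<p} - {i}. m i j * x i * x j) =
        l * (\<Sum>I\<in>Pow {..<p}. 1 / 2 ^ p * (4 * (\<Sum>i\<in>I. \<Sum>j\<in>{..<p} - I. m i j * x i * x j)))"
      by (simp only: decoupling_identity)
    also have "\<dots> = (\<Sum>I\<in>Pow {..<p}. l * (1 / 2 ^ p * (4 * (\<Sum>i\<in>I. \<Sum>j\<in>{..<p} - I. m i j * x i * x j))))"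
      by (rule sum_distrib_left)
    also have "\<dots> = (\<Sum>I\<in>Pow {..<p}. (1 / 2 ^ p) *\<^sub>R B I x)"
      by (intro sum.cong refl) (simp only: B_def real_scaleR_def mult_ac)
    finally show ?thesis
      using convex_on_sum[of "Pow {..<p}" UNIV exp "\<lambda>_. 1 / 2 ^ p" "\<lambda>I. B I x"] w1 exp_convex by auto
  qed
  have "(\<integral>\<^sup>+x. ennreal (exp (l * (\<Sum>i<p. \<Sum>j\<in>{..<p} - {i}. m i j * x i * x j))) \<partial>?P)
      \<le> (\<integral>\<^sup>+x. (\<Sum>I\<in>Pow {..<p}. ennreal (1 / 2 ^ p) * ennreal (exp (B I x))) \<partial>?P)"
  proof (rule nn_integral_mono)
    fix x
    have "ennreal (exp (l * (\<Sum>i<p. \<Sum>j\<in>{..<p} - {i}. m i j * x i * x j))) \<le> ennreal (\<Sum>I\<in>Pow {..<p}. 1 / 2 ^ p * exp (B I x))"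
      by (rule ennreal_leI[OF pt])
    also have "\<dots> = (\<Sum>I\<in>Pow {..<p}. ennreal (1 / 2 ^ p * exp (B I x)))" by (rule sum_ennreal[symmetric]) simp
    also have "\<dots> = (\<Sum>I\<in>Pow {..<p}. ennreal (1 / 2 ^ p) * ennreal (exp (B I x)))"
      by (intro sum.cong refl ennreal_mult) auto
    finally show "ennreal (exp (l * (\<Sum>i<p. \<Sum>j\<in>{..<p} - {i}. m i j * x i * x j))) \<le> (\<Sum>I\<in>Pow {..<p}. ennreal (1 / 2 ^ p) * ennreal (exp (B I x)))" .
  qed
  also have "\<dots> = (\<Sum>I\<in>Pow {..<p}. \<integral>\<^sup>+x. ennreal (1 / 2 ^ p) * ennreal (exp (B I x)) \<partial>?P)"
  proof (rule nn_integral_sum)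
    fix I assume "I \<in> Pow {..<p}"
    from Bm[OF this] show "(\<lambda>x. ennreal (1 / 2 ^ p) * ennreal (exp (B I x))) \<in> borel_measurable ?P" by measurable
  qed
  also have "\<dots> = (\<Sum>I\<in>Pow {..<p}. ennreal (1 / 2 ^ p) * (\<integral>\<^sup>+x. ennreal (exp (B I x)) \<partial>?P))"
  proof (intro sum.cong refl nn_integral_cmult)
    fix I assume "I \<in> Pow {..<p}"
    from Bm[OF this] show "(\<lambda>x. ennreal (exp (B I x))) \<in> borel_measurable ?P" by measurable
  qed
  also have "\<dots> \<le> (\<Sum>I\<in>Pow {..<p}. ennreal (1 / 2 ^ p) * ennreal (exp (16 * (sg_const / a)\<^sup>2 * l\<^sup>2 * real p)))"
  proof (intro sum_mono mult_left_mono)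
    fix I assume "I \<in> Pow {..<p}"
    then have I: "I \<subseteq> {..<p}" by simp
    show "(\<integral>\<^sup>+x. ennreal (exp (B I x)) \<partial>?P) \<le> ennreal (exp (16 * (sg_const / a)\<^sup>2 * l\<^sup>2 * real p))"
      unfolding B_def by (rule off_diagonal_block_mgf[OF \<nu> a I contr[OF I] l])
  qed simp
  also have "\<dots> = ennreal (\<Sum>I\<in>Pow {..<p}. 1 / 2 ^ p) * ennreal (exp (16 * (sg_const / a)\<^sup>2 * l\<^sup>2 * real p))"
    by (subst sum_ennreal[symmetric]) (simp_all only: sum_distrib_right, simp)
  also have "\<dots> = ennreal (exp (16 * (sg_const / a)\<^sup>2 * l\<^sup>2 * real p))" unfolding w1 by simp
  finally show ?thesis .
qed


text \<open>Pad \<open>x\<close> with zeros outside \<open>I\<close>, apply the contraction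
  \<open>M\<close>, and discard the output coordinates in \<open>I\<close>.\<close>

lemma psd_block_contraction:
  fixes x :: "nat \<Rightarrow> real"
  assumes M: "psd_mat p M" and le: "\<And>v. v \<in> carrier_vec p \<Longrightarrow> v \<bullet> (M *\<^sub>v v) \<le> v \<bullet> v" and I: "I \<subseteq> {..<p}"
  shows "(\<Sum>j\<in>{..<p} - I. (\<Sum>i\<in>I. M $$ (i, j) * x i)\<^sup>2) \<le> (\<Sum>i\<in>I. (x i)\<^sup>2)"
proof -
  note Md = psd_matD[OF M]
  define v where "v = Matrix.vec p (\<lambda>i. if i \<in> I then x i else 0)"
  have v: "v \<in> carrier_vec p" by (simp add: v_def)
  have Mv: "M *\<^sub>v v \<in> carrier_vec p" using Md v by simp
  have int: "{..<p} \<inter> I = I" using I by blast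
  have entry: "(M *\<^sub>v v) $ j = (\<Sum>i\<in>I. M $$ (i, j) * x i)" if j: "j < p" for j
  proof -
    have "(M *\<^sub>v v) $ j = (\<Sum>i<p. M $$ (j, i) * v $ i)"
      using Md(1) v j by (simp add: scalar_prod_def lessThan_atLeast0)
    also have "\<dots> = (\<Sum>i<p. if i \<in> I then M $$ (i, j) * x i else 0)"
      using sym_mat_entry[OF Md(1,2) _ j] by (intro sum.cong refl) (simp add: v_def)
    also have "\<dots> = (\<Sum>i\<in>{..<p} \<inter> I. M $$ (i, j) * x i)" by (rule sum.inter_restrict[symmetric]) simp
    finally show ?thesis unfolding int .
  qed
  have "(\<Sum>j\<in>{..<p} - I. (\<Sum>i\<in>I. M $$ (i, j) * x i)\<^sup>2) = (\<Sum>j\<in>{..<p} - I. ((M *\<^sub>v v) $ j)\<^sup>2)"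
    using entry by (intro sum.cong refl) simp
  also have "\<dots> \<le> (\<Sum>j<p. ((M *\<^sub>v v) $ j)\<^sup>2)" by (intro sum_mono2) auto
  also have "\<dots> = (eucl_norm (M *\<^sub>v v))\<^sup>2" unfolding eucl_norm_sq scalar_prod_sum[OF Mv Mv] by (simp only: power2_eq_square)
  also have "\<dots> \<le> (1 * eucl_norm v)\<^sup>2"
  proof (intro power_mono)
    have "op_bound p 1 M" by (rule psd_op_bound[OF M]) (use le in simp_all)
    then show "eucl_norm (M *\<^sub>v v) \<le> 1 * eucl_norm v" by (rule op_bound_vec[OF _ _ v]) simp
  qed simp
  also have "\<dots> = (\<Sum>i<p. (v $ i)\<^sup>2)" unfolding mult_1 eucl_norm_sq scalar_prod_sum[OF v v] by (simp only: power2_eq_square)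
  also have "\<dots> = (\<Sum>i<p. if i \<in> I then (x i)\<^sup>2 else 0)" by (intro sum.cong refl) (simp add: v_def)
  also have "\<dots> = (\<Sum>i\<in>{..<p} \<inter> I. (x i)\<^sup>2)" by (rule sum.inter_restrict[symmetric]) simp
  finally show ?thesis unfolding int .
qed

text \<open>Diagonal and off-diagonal parts are dependent, so they are separated by convexity of exp
  at the midpoint. This doubles \<open>l\<close> in each part, which explains \<open>a / 4\<close>
  and the constant 64 in the hypotheses. Diagonal entries of \<open>M\<close> lie between 0 and 1
  because \<open>M\<close> is a semidefinite contraction.\<close>

lemma quad_form_mgf:
  fixes \<nu> :: "nat \<Rightarrow> real measure" and M :: "real mat"
  assumes \<nu>: "\<And>j. std_subgauss a (\<nu> j)" and a: "0 < a"
    and M: "psd_mat p M" and le: "\<And>v. v \<in> carrier_vec p \<Longrightarrow> v \<bullet> (M *\<^sub>v v) \<le> v \<bullet> v"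
    and l: "\<bar>l\<bar> \<le> a / 4" "64 * (sg_const / a) * l\<^sup>2 \<le> a"
  shows "(\<integral>\<^sup>+x. ennreal (exp (l * ((\<Sum>i<p. \<Sum>j<p. x i * M $$ (i, j) * x j) - mtrace M))) \<partial>(\<Pi>\<^sub>M j\<in>{..<p}. \<nu> j))
    \<le> ennreal (exp ((64 * (sg_const / a)\<^sup>2 + 32 * exp a * sg_const / a\<^sup>2) * l\<^sup>2 * real p))"
proof -
  note Md = psd_matD[OF M]
  let ?P = "\<Pi>\<^sub>M j\<in>{..<p}. \<nu> j"
  define H where "H = 64 * (sg_const / a)\<^sup>2 + 32 * exp a * sg_const / a\<^sup>2"
  define d where "d x = (\<Sum>j<p. 2 * l * M $$ (j, j) * ((x j)\<^sup>2 - 1))" for x :: "nat \<Rightarrow> real"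
  define off where "off x = 2 * l * (\<Sum>i<p. \<Sum>j\<in>{..<p} - {i}. M $$ (i, j) * x i * x j)" for x :: "nat \<Rightarrow> real"
  have [measurable]: "d \<in> borel_measurable ?P" unfolding d_def
    by (intro borel_measurable_sum borel_measurable_times borel_measurable_diff borel_measurable_power borel_measurable_const
        measurable_PiM_component[OF \<nu>]) simp
  have [measurable]: "off \<in> borel_measurable ?P" unfolding off_def
    by (intro borel_measurable_sum borel_measurable_times borel_measurable_const measurable_PiM_component[OF \<nu>]) auto
  have split: "2 * (l * ((\<Sum>i<p. \<Sum>j<p. x i * M $$ (i, j) * x j) - mtrace M)) = d x + off x" for x :: "nat \<Rightarrow> real"
  proof -
    have "(\<Sum>i<p. \<Sum>j<p. x i * M $$ (i, j) * x j) = (\<Sum>i<p. M $$ (i, i) * (x i)\<^sup>2 + (\<Sum>j\<in>{..<p} - {i}. M $$ (i, j) * x i * x j))"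
    proof (intro sum.cong refl)
      fix i assume i: "i \<in> {..<p}"
      have "(\<Sum>j<p. x i * M $$ (i, j) * x j) = x i * M $$ (i, i) * x i + (\<Sum>j\<in>{..<p} - {i}. x i * M $$ (i, j) * x j)"
        by (rule sum.remove[OF finite_lessThan i])
      then show "(\<Sum>j<p. x i * M $$ (i, j) * x j) = M $$ (i, i) * (x i)\<^sup>2 + (\<Sum>j\<in>{..<p} - {i}. M $$ (i, j) * x i * x j)"
        by (simp add: power2_eq_square mult_ac)
    qed
    also have "\<dots> = (\<Sum>i<p. M $$ (i, i) * (x i)\<^sup>2) + (\<Sum>i<p. \<Sum>j\<in>{..<p} - {i}. M $$ (i, j) * x i * x j)" by (rule sum.distrib)
    finally have 1: "(\<Sum>i<p. \<Sum>j<p. x i * M $$ (i, j) * x j) = (\<Sum>i<p. M $$ (i, i) * (x i)\<^sup>2) + (\<Sum>i<p. \<Sum>j\<in>{..<p} - {i}. M $$ (i, j) * x i * x j)" .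
    have "d x = 2 * l * (\<Sum>i<p. M $$ (i, i) * (x i)\<^sup>2 - M $$ (i, i))"
      unfolding d_def sum_distrib_left by (intro sum.cong refl) (simp add: right_diff_distrib mult.assoc)
    also have "\<dots> = 2 * l * ((\<Sum>i<p. M $$ (i, i) * (x i)\<^sup>2) - mtrace M)" using Md(1) by (simp add: sum_subtractf mtrace_def)
    finally show ?thesis unfolding off_def 1 by (simp add: algebra_simps)
  qed
  have pt: "exp (l * ((\<Sum>i<p. \<Sum>j<p. x i * M $$ (i, j) * x j) - mtrace M)) \<le> 1 / 2 * exp (d x) + 1 / 2 * exp (off x)" for x :: "nat \<Rightarrow> real"
  proof -
    have eq: "l * ((\<Sum>i<p. \<Sum>j<p. x i * M $$ (i, j) * x j) - mtrace M) = 1 / 2 * d x + 1 / 2 * off x"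
      using split[of x] by linarith
    show ?thesis unfolding eq using convex_onD[OF exp_convex, of "1/2" "d x" "off x"] by simp
  qed
  have diag: "(\<integral>\<^sup>+x. ennreal (exp (d x)) \<partial>?P) \<le> ennreal (exp (H * l\<^sup>2 * real p))"
  proof -
    have M01: "0 \<le> M $$ (j, j)" "M $$ (j, j) \<le> 1" if "j < p" for j
      using Md(3)[of "unit_vec p j"] le[of "unit_vec p j"] unit_vec_mat[OF Md(1) that that] that by simp_all
    have "(\<integral>\<^sup>+x. ennreal (exp (d x)) \<partial>?P) \<le> ennreal (exp (\<Sum>j<p. 8 * exp a * sg_const / a\<^sup>2 * (2 * l * M $$ (j, j))\<^sup>2))"
      unfolding d_def
    proof (rule prod_exp_nn_integral[OF \<nu> finite_lessThan])
      fix j assume "j \<in> {..<p}"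
      then have j: "j < p" by simp
      have "\<bar>2 * l * M $$ (j, j)\<bar> = 2 * \<bar>l\<bar> * M $$ (j, j)" using M01[OF j] by (simp add: abs_mult)
      also have "\<dots> \<le> 2 * \<bar>l\<bar> * 1" using M01[OF j] by (intro mult_left_mono) auto
      finally have "\<bar>2 * l * M $$ (j, j)\<bar> \<le> a / 2" using l(1) by simp
      then show "(\<integral>\<^sup>+x. ennreal (exp (2 * l * M $$ (j, j) * (x\<^sup>2 - 1))) \<partial>\<nu> j) \<le> ennreal (exp (8 * exp a * sg_const / a\<^sup>2 * (2 * l * M $$ (j, j))\<^sup>2))"
        by (rule subgauss_diag_mgf[OF \<nu> a])
    qed simp
    also have "\<dots> \<le> ennreal (exp (H * l\<^sup>2 * real p))"
    proof (intro ennreal_leI)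
      have "(\<Sum>j<p. 8 * exp a * sg_const / a\<^sup>2 * (2 * l * M $$ (j, j))\<^sup>2) \<le> (\<Sum>j<p. 8 * exp a * sg_const / a\<^sup>2 * (4 * l\<^sup>2))"
      proof (intro sum_mono mult_left_mono)
        fix j assume "j \<in> {..<p}"
        then have "(M $$ (j, j))\<^sup>2 \<le> 1" using M01[of j] by (intro power_le_one) auto
        then have "4 * l\<^sup>2 * (M $$ (j, j))\<^sup>2 \<le> 4 * l\<^sup>2 * 1" by (intro mult_left_mono) auto
        then show "(2 * l * M $$ (j, j))\<^sup>2 \<le> 4 * l\<^sup>2" by (simp add: power_mult_distrib)
      next
        show "0 \<le> 8 * exp a * sg_const / a\<^sup>2" using sg_const_ge by simp
      qed
      also have "\<dots> = 32 * exp a * sg_const / a\<^sup>2 * l\<^sup>2 * real p" by simp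
      also have "\<dots> \<le> H * l\<^sup>2 * real p" unfolding H_def by (intro mult_right_mono) auto
      finally show "exp (\<Sum>j<p. 8 * exp a * sg_const / a\<^sup>2 * (2 * l * M $$ (j, j))\<^sup>2) \<le> exp (H * l\<^sup>2 * real p)" by simp
    qed
    finally show ?thesis .
  qed
  have offd: "(\<integral>\<^sup>+x. ennreal (exp (off x)) \<partial>?P) \<le> ennreal (exp (H * l\<^sup>2 * real p))"
  proof -
    have "(\<integral>\<^sup>+x. ennreal (exp (off x)) \<partial>?P) \<le> ennreal (exp (16 * (sg_const / a)\<^sup>2 * (2 * l)\<^sup>2 * real p))"
      unfolding off_def
    proof (rule off_diagonal_mgf[OF \<nu> a])
      show "16 * (sg_const / a) * (2 * l)\<^sup>2 \<le> a" using l(2) by (simp add: power_mult_distrib)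
    qed (rule psd_block_contraction[OF M le])
    also have "\<dots> \<le> ennreal (exp (H * l\<^sup>2 * real p))"
    proof (intro ennreal_leI)
      have "16 * (sg_const / a)\<^sup>2 * (2 * l)\<^sup>2 * real p = 64 * (sg_const / a)\<^sup>2 * l\<^sup>2 * real p" by (simp add: power_mult_distrib)
      also have "\<dots> \<le> H * l\<^sup>2 * real p" unfolding H_def using sg_const_ge by (intro mult_right_mono) auto
      finally show "exp (16 * (sg_const / a)\<^sup>2 * (2 * l)\<^sup>2 * real p) \<le> exp (H * l\<^sup>2 * real p)" by simp
    qed
    finally show ?thesis .
  qed
  have "(\<integral>\<^sup>+x. ennreal (exp (l * ((\<Sum>i<p. \<Sum>j<p. x i * M $$ (i, j) * x j) - mtrace M))) \<partial>?P)
      \<le> (\<integral>\<^sup>+x. ennreal (1 / 2) * ennreal (exp (d x)) + ennreal (1 / 2) * ennreal (exp (off x)) \<partial>?P)"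
  proof (rule nn_integral_mono)
    fix x
    have "ennreal (exp (l * ((\<Sum>i<p. \<Sum>j<p. x i * M $$ (i, j) * x j) - mtrace M))) \<le> ennreal (1 / 2 * exp (d x) + 1 / 2 * exp (off x))"
      by (rule ennreal_leI[OF pt])
    also have "\<dots> = ennreal (1 / 2 * exp (d x)) + ennreal (1 / 2 * exp (off x))" by (rule ennreal_plus) auto
    also have "\<dots> = ennreal (1 / 2) * ennreal (exp (d x)) + ennreal (1 / 2) * ennreal (exp (off x))"
      by (intro arg_cong2[where f = "(+)"] ennreal_mult) auto
    finally show "ennreal (exp (l * ((\<Sum>i<p. \<Sum>j<p. x i * M $$ (i, j) * x j) - mtrace M)))
      \<le> ennreal (1 / 2) * ennreal (exp (d x)) + ennreal (1 / 2) * ennreal (exp (off x))" .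
  qed
  also have "\<dots> = ennreal (1 / 2) * (\<integral>\<^sup>+x. ennreal (exp (d x)) \<partial>?P) + ennreal (1 / 2) * (\<integral>\<^sup>+x. ennreal (exp (off x)) \<partial>?P)"
    by (subst nn_integral_add, measurable, subst (1 2) nn_integral_cmult) measurable
  also have "\<dots> \<le> ennreal (1 / 2) * ennreal (exp (H * l\<^sup>2 * real p)) + ennreal (1 / 2) * ennreal (exp (H * l\<^sup>2 * real p))"
    by (intro add_mono mult_left_mono diag offd) auto
  also have "\<dots> = ennreal (1 / 2 * exp (H * l\<^sup>2 * real p) + 1 / 2 * exp (H * l\<^sup>2 * real p))"
  proof -
    have "ennreal (1 / 2) * ennreal (exp (H * l\<^sup>2 * real p)) = ennreal (1 / 2 * exp (H * l\<^sup>2 * real p))"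
      by (rule ennreal_mult[symmetric]) auto
    moreover have "ennreal (1 / 2 * exp (H * l\<^sup>2 * real p)) + ennreal (1 / 2 * exp (H * l\<^sup>2 * real p)) =
        ennreal (1 / 2 * exp (H * l\<^sup>2 * real p) + 1 / 2 * exp (H * l\<^sup>2 * real p))"
      by (rule ennreal_plus[symmetric]) auto
    ultimately show ?thesis by (simp only:)
  qed
  also have "1 / 2 * exp (H * l\<^sup>2 * real p) + 1 / 2 * exp (H * l\<^sup>2 * real p) = exp (H * l\<^sup>2 * real p)" by simp
  finally show ?thesis by (simp only: H_def)
qed

lemma IND_product_law:
  assumes law: "vec_law p \<mu>" and iso: "isotropic p \<mu>" and p: "0 < p" and ind: "IND p K C\<^sub>0 \<mu>" and K: "0 < K"
  shows "\<exists>\<nu>. (\<forall>j. std_subgauss (1 / (8 * K\<^sup>2)) (\<nu> j)) \<and>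
    (\<forall>F \<in> borel_measurable (\<Pi>\<^sub>M j\<in>{..<p}. (borel :: real measure)).
      (\<integral>\<^sup>+y. F (\<lambda>j\<in>{..<p}. y $ j) \<partial>\<mu>) = (\<integral>\<^sup>+x. F x \<partial>(\<Pi>\<^sub>M j\<in>{..<p}. \<nu> j)))"
proof -
  interpret prob_space \<mu> by (rule vec_law_prob[OF law])
  \<comment> \<open>Indices from \<open>p\<close> on repeat coordinate 0, so that every
    \<open>\<nu> j\<close> is sub-Gaussian, as the product lemmas require. Coordinate 0 exists
    because \<open>p\<close> is positive.\<close>
  define \<nu> where "\<nu> j = distr \<mu> borel (\<lambda>y. y $ (if j < p then j else 0))" for j
  have sg: "std_subgauss (1 / (8 * K\<^sup>2)) (distr \<mu> borel (\<lambda>y. y $ j))" if j: "j < p" for j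
  proof -
    have m[measurable]: "(\<lambda>y. y $ j) \<in> borel_measurable \<mu>" by (rule measurable_vec_index[OF law j])
    have i1: "integrable \<mu> (\<lambda>y. y $ j)" "(\<integral>y. y $ j \<partial>\<mu>) = 0" using iso j by (auto simp: isotropic_def)
    have i2: "integrable \<mu> (\<lambda>y. y $ j * y $ j)" "(\<integral>y. y $ j * y $ j \<partial>\<mu>) = 1" using iso j by (auto simp: isotropic_def)
    have tail: "measure \<mu> {y \<in> space \<mu>. t \<le> \<bar>y $ j\<bar>} \<le> 2 * exp (- (t / (2 * K))\<^sup>2)" if "0 \<le> t" for t
    proof -
      have "measure \<mu> {y \<in> space \<mu>. \<bar>y $ j - (\<integral>z. z $ j \<partial>\<mu>)\<bar> \<ge> t} \<le> 2 * exp (- (t / (2 * K))\<^sup>2)"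
        using ind j that unfolding IND_def by blast
      then show ?thesis unfolding i1(2) by simp
    qed
    have nn: "(\<integral>\<^sup>+y. ennreal (exp ((y $ j)\<^sup>2 / (8 * K\<^sup>2))) \<partial>\<mu>) \<le> ennreal sg_const"
      by (rule nn_integral_exp_square_le[OF vec_law_prob[OF law] m K tail])
    have i3: "integrable \<mu> (\<lambda>y. exp ((y $ j)\<^sup>2 / (8 * K\<^sup>2)))"
      using nn by (intro integrableI_bounded) (auto intro: le_less_trans)
    have "ennreal (\<integral>y. exp ((y $ j)\<^sup>2 / (8 * K\<^sup>2)) \<partial>\<mu>) \<le> ennreal sg_const"
      using nn nn_integral_eq_integral[OF i3] by simp
    then have i4: "(\<integral>y. exp ((y $ j)\<^sup>2 / (8 * K\<^sup>2)) \<partial>\<mu>) \<le> sg_const" using sg_const_ge by (subst (asm) ennreal_le_iff) auto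
    show ?thesis unfolding std_subgauss_def
      using i1 i2 i3 i4 by (simp add: prob_space_distr integrable_distr_eq integral_distr power2_eq_square)
  qed
  have "std_subgauss (1 / (8 * K\<^sup>2)) (\<nu> j)" for j unfolding \<nu>_def using sg p by simp
  moreover have "(\<integral>\<^sup>+y. F (\<lambda>j\<in>{..<p}. y $ j) \<partial>\<mu>) = (\<integral>\<^sup>+x. F x \<partial>(\<Pi>\<^sub>M j\<in>{..<p}. \<nu> j))"
    if F: "F \<in> borel_measurable (\<Pi>\<^sub>M j\<in>{..<p}. (borel :: real measure))" for F
  proof -
    have "indep_vars (\<lambda>_. borel) (\<lambda>j y. y $ j) {..<p}" using ind by (simp add: IND_def)
    then have "distr \<mu> (\<Pi>\<^sub>M j\<in>{..<p}. borel) (\<lambda>y. \<lambda>j\<in>{..<p}. y $ j) = (\<Pi>\<^sub>M j\<in>{..<p}. distr \<mu> borel (\<lambda>y. y $ j))"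
      using indep_vars_iff_distr_eq_PiM'[where I = "{..<p}" and M' = "\<lambda>_. borel" and X = "\<lambda>j y. y $ j"] p measurable_vec_index[OF law] by auto
    also have "\<dots> = (\<Pi>\<^sub>M j\<in>{..<p}. \<nu> j)" by (intro PiM_cong) (auto simp: \<nu>_def)
    finally have d: "(\<Pi>\<^sub>M j\<in>{..<p}. \<nu> j) = distr \<mu> (\<Pi>\<^sub>M j\<in>{..<p}. borel) (\<lambda>y. \<lambda>j\<in>{..<p}. y $ j)" ..
    have "(\<lambda>y. \<lambda>j\<in>{..<p}. y $ j) \<in> measurable \<mu> (\<Pi>\<^sub>M j\<in>{..<p}. borel)"
      using measurable_vec_index[OF law] by (intro measurable_restrict) auto
    then show ?thesis unfolding d by (rule nn_integral_distr[symmetric]) (use F in simp)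
  qed
  ultimately show ?thesis by blast
qed

text \<open>Two-sided Chernoff bound, with \<open>exp (l * \<bar>X\<bar>)\<close> dominated by the
  sum of the two one-sided exponentials. The parameter \<open>l\<close> stays free and is chosen
  proportional to the deviation later.\<close>

lemma IND_quad_conc:
  assumes law: "vec_law p \<mu>" and iso: "isotropic p \<mu>" and p: "0 < p" and ind: "IND p K C\<^sub>0 \<mu>" and K: "0 < K"
  defines "a \<equiv> 1 / (8 * K\<^sup>2)"
  assumes l: "0 < l" "l \<le> a / 4" "64 * (sg_const / a) * l\<^sup>2 \<le> a"
  shows "quad_conc p t (2 * exp (- l * t * real p + (64 * (sg_const / a)\<^sup>2 + 32 * exp a * sg_const / a\<^sup>2) * l\<^sup>2 * real p)) \<mu>"
  unfolding quad_conc_def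
proof (intro allI impI)
  fix M assume M: "psd_mat p M" and "\<forall>v \<in> carrier_vec p. v \<bullet> (M *\<^sub>v v) \<le> v \<bullet> v"
  then have le: "v \<bullet> (M *\<^sub>v v) \<le> v \<bullet> v" if "v \<in> carrier_vec p" for v using that by blast
  interpret prob_space \<mu> by (rule vec_law_prob[OF law])
  note Md = psd_matD[OF M]
  have a: "0 < a" using K by (simp add: a_def)
  obtain \<nu> where \<nu>: "\<And>j. std_subgauss a (\<nu> j)" and tr: "\<And>F. F \<in> borel_measurable (\<Pi>\<^sub>M j\<in>{..<p}. (borel :: real measure)) \<Longrightarrow>
      (\<integral>\<^sup>+y. F (\<lambda>j\<in>{..<p}. y $ j) \<partial>\<mu>) = (\<integral>\<^sup>+x. F x \<partial>(\<Pi>\<^sub>M j\<in>{..<p}. \<nu> j))"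
    using IND_product_law[OF law iso p ind K] unfolding a_def by blast
  define H where "H = 64 * (sg_const / a)\<^sup>2 + 32 * exp a * sg_const / a\<^sup>2"
  define X where "X y = y \<bullet> (M *\<^sub>v y) - mtrace M" for y
  have [measurable]: "X \<in> borel_measurable \<mu>" unfolding X_def using measurable_quad[OF law Md(1)] by measurable
  have mgf: "(\<integral>\<^sup>+y. ennreal (exp (s * X y)) \<partial>\<mu>) \<le> ennreal (exp (H * l\<^sup>2 * real p))" if s: "\<bar>s\<bar> = l" for s
  proof -
    let ?F = "\<lambda>x. ennreal (exp (s * ((\<Sum>i<p. \<Sum>j<p. x i * M $$ (i, j) * x j) - mtrace M)))"
    have Fm: "?F \<in> borel_measurable (\<Pi>\<^sub>M j\<in>{..<p}. (borel :: real measure))"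
    proof -
      have "(\<lambda>x. \<Sum>i<p. \<Sum>j<p. x i * M $$ (i, j) * x j) \<in> borel_measurable (\<Pi>\<^sub>M j\<in>{..<p}. (borel :: real measure))"
        by (intro borel_measurable_sum borel_measurable_times borel_measurable_const measurable_component_singleton) auto
      then show ?thesis by measurable
    qed
    have "(\<integral>\<^sup>+y. ennreal (exp (s * X y)) \<partial>\<mu>) = (\<integral>\<^sup>+y. ?F (\<lambda>j\<in>{..<p}. y $ j) \<partial>\<mu>)"
    proof (intro nn_integral_cong)
      fix y assume "y \<in> space \<mu>"
      then have y: "y \<in> carrier_vec p" using vec_law_space[OF law] by simp
      have "(\<Sum>i<p. \<Sum>j<p. (\<lambda>j\<in>{..<p}. y $ j) i * M $$ (i, j) * (\<lambda>j\<in>{..<p}. y $ j) j) = (\<Sum>i<p. \<Sum>j<p. y $ i * M $$ (i, j) * y $ j)"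
        by (intro sum.cong refl) simp
      then show "ennreal (exp (s * X y)) = ?F (\<lambda>j\<in>{..<p}. y $ j)"
        unfolding X_def mat_vec_scalar_sum[OF Md(1) y y] by (simp only:)
    qed
    also have "\<dots> = (\<integral>\<^sup>+x. ?F x \<partial>(\<Pi>\<^sub>M j\<in>{..<p}. \<nu> j))" by (rule tr[OF Fm])
    also have "\<dots> \<le> ennreal (exp (H * s\<^sup>2 * real p))"
      unfolding H_def
    proof (rule quad_form_mgf[OF \<nu> a M le])
      show "\<bar>s\<bar> \<le> a / 4" using s l by simp
      have "s\<^sup>2 = l\<^sup>2" using s by (metis power2_abs)
      then show "64 * (sg_const / a) * s\<^sup>2 \<le> a" using l(3) by simp
    qed
    also have "s\<^sup>2 = l\<^sup>2" using s by (metis power2_abs)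
    finally show ?thesis .
  qed
  let ?E = "{y \<in> space \<mu>. t * real p < \<bar>X y\<bar>}"
  let ?c = "exp (- l * t * real p)"
  have "emeasure \<mu> ?E = (\<integral>\<^sup>+y. indicator ?E y \<partial>\<mu>)" by (rule nn_integral_indicator[symmetric]) measurable
  also have "\<dots> \<le> (\<integral>\<^sup>+y. ennreal ?c * ennreal (exp (l * X y)) + ennreal ?c * ennreal (exp ((- l) * X y)) \<partial>\<mu>)"
  proof (rule nn_integral_mono)
    fix y
    have one: "1 \<le> ?c * exp (l * X y) + ?c * exp ((- l) * X y)" if "t * real p < \<bar>X y\<bar>"
    proof -
      have "l * (t * real p) \<le> l * \<bar>X y\<bar>" using that l by (intro mult_left_mono) auto
      then have "1 \<le> exp (- l * t * real p + l * \<bar>X y\<bar>)" by simp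
      also have "\<dots> = ?c * exp (l * \<bar>X y\<bar>)" by (simp only: exp_add)
      also have "exp (l * \<bar>X y\<bar>) \<le> exp (l * X y) + exp ((- l) * X y)" by (cases "0 \<le> X y") (simp_all add: add_increasing add_increasing2)
      finally show ?thesis by (simp add: distrib_left)
    qed
    have "indicator ?E y \<le> ennreal (?c * exp (l * X y) + ?c * exp ((- l) * X y))"
    proof (cases "t * real p < \<bar>X y\<bar>")
      case True
      have "indicator ?E y \<le> (1 :: ennreal)" by (simp add: indicator_def)
      also have "(1 :: ennreal) = ennreal 1" by simp
      also have "ennreal 1 \<le> ennreal (?c * exp (l * X y) + ?c * exp ((- l) * X y))"
        by (rule ennreal_leI[OF one[OF True]])
      finally show ?thesis .
    qed simp
    also have "\<dots> = ennreal (?c * exp (l * X y)) + ennreal (?c * exp ((- l) * X y))" by (rule ennreal_plus) auto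
    also have "\<dots> = ennreal ?c * ennreal (exp (l * X y)) + ennreal ?c * ennreal (exp ((- l) * X y))"
      by (intro arg_cong2[where f = "(+)"] ennreal_mult) auto
    finally show "indicator ?E y \<le> ennreal ?c * ennreal (exp (l * X y)) + ennreal ?c * ennreal (exp ((- l) * X y))" .
  qed
  also have "\<dots> = ennreal ?c * (\<integral>\<^sup>+y. ennreal (exp (l * X y)) \<partial>\<mu>) + ennreal ?c * (\<integral>\<^sup>+y. ennreal (exp ((- l) * X y)) \<partial>\<mu>)"
    by (subst nn_integral_add, measurable, subst (1 2) nn_integral_cmult) measurable
  also have "\<dots> \<le> ennreal ?c * ennreal (exp (H * l\<^sup>2 * real p)) + ennreal ?c * ennreal (exp (H * l\<^sup>2 * real p))"
    using l by (intro add_mono mult_left_mono mgf) auto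
  also have "\<dots> = ennreal (2 * exp (- l * t * real p + H * l\<^sup>2 * real p))"
    by (simp only: ennreal_mult[symmetric] exp_ge_zero ennreal_plus[symmetric] mult_nonneg_nonneg exp_add) simp
  finally have "measure \<mu> ?E \<le> 2 * exp (- l * t * real p + H * l\<^sup>2 * real p)"
    unfolding emeasure_eq_measure by (subst (asm) ennreal_le_iff) auto
  then show "measure \<mu> {y \<in> space \<mu>. t * real p < \<bar>y \<bullet> (M *\<^sub>v y) - mtrace M\<bar>} \<le>
      2 * exp (- l * t * real p + (64 * (sg_const / a)\<^sup>2 + 32 * exp a * sg_const / a\<^sup>2) * l\<^sup>2 * real p)"
    by (simp only: X_def H_def)
qed

text \<open>The normalised linear form has second moment 1. Values below 1/2 contribute at most 1/4
  and values beyond \<open>A\<close> at most 1/2, by the exponential moments; so at least 1/4 comes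
  from the event in question, where the truncated square is at most
  \<open>A\<^sup>2\<close>.\<close>

lemma IND_anti_conc:
  assumes law: "vec_law p \<mu>" and iso: "isotropic p \<mu>" and p: "0 < p" and ind: "IND p K C\<^sub>0 \<mu>" and K: "0 < K"
  shows "anti_conc p (1 / 2) (exp (- (8 * K\<^sup>2 * sg_const)) / 1024) \<mu>"
  unfolding anti_conc_def
proof (intro ballI)
  fix v :: "real vec" assume v: "v \<in> carrier_vec p"
  interpret prob_space \<mu> by (rule vec_law_prob[OF law])
  have vm[measurable]: "(\<lambda>y. v \<bullet> y) \<in> borel_measurable \<mu>" by (rule measurable_scalar_prod[OF law v])
  define N where "N = eucl_norm v"
  define a where "a = 1 / (8 * K\<^sup>2)"
  have a: "0 < a" using K by (simp add: a_def)
  define L where "L = sg_const / a"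
  have L: "L = 8 * K\<^sup>2 * sg_const" using K by (simp add: L_def a_def)
  have L0: "0 \<le> L" using a sg_const_ge by (simp add: L_def)
  show "exp (- (8 * K\<^sup>2 * sg_const)) / 1024 \<le> measure \<mu> {y \<in> space \<mu>. 1 / 2 * eucl_norm v \<le> \<bar>v \<bullet> y\<bar>}"
  proof (cases "N = 0")
    case True
    then have E: "{y \<in> space \<mu>. 1 / 2 * eucl_norm v \<le> \<bar>v \<bullet> y\<bar>} = space \<mu>" by (auto simp: N_def)
    have "exp (- (8 * K\<^sup>2 * sg_const)) \<le> 1" using L0 unfolding L by simp
    then show ?thesis unfolding E prob_space by linarith
  next
    case False
    then have N: "0 < N" by (metis N_def eucl_norm_ge_0 order_le_imp_less_or_eq)
    define X where "X y = (v \<bullet> y) / N" for y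
    have [measurable]: "X \<in> borel_measurable \<mu>" unfolding X_def by measurable
    obtain \<nu> where \<nu>: "\<And>j. std_subgauss a (\<nu> j)" and tr: "\<And>F. F \<in> borel_measurable (\<Pi>\<^sub>M j\<in>{..<p}. (borel :: real measure)) \<Longrightarrow>
      (\<integral>\<^sup>+y. F (\<lambda>j\<in>{..<p}. y $ j) \<partial>\<mu>) = (\<integral>\<^sup>+x. F x \<partial>(\<Pi>\<^sub>M j\<in>{..<p}. \<nu> j))"
      using IND_product_law[OF law iso p ind K] unfolding a_def by blast
    have mgf: "(\<integral>\<^sup>+y. ennreal (exp (s * X y)) \<partial>\<mu>) \<le> ennreal (exp L)" if s: "s\<^sup>2 = 1" for s
    proof -
      let ?F = "\<lambda>x. ennreal (exp (\<Sum>j<p. (s * v $ j / N) * x j))"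
      have Fm: "?F \<in> borel_measurable (\<Pi>\<^sub>M j\<in>{..<p}. (borel :: real measure))"
      proof -
        have "(\<lambda>x. \<Sum>j<p. (s * v $ j / N) * x j) \<in> borel_measurable (\<Pi>\<^sub>M j\<in>{..<p}. (borel :: real measure))"
          by (intro borel_measurable_sum borel_measurable_times borel_measurable_const measurable_component_singleton) auto
        then show ?thesis by measurable
      qed
      have "(\<integral>\<^sup>+y. ennreal (exp (s * X y)) \<partial>\<mu>) = (\<integral>\<^sup>+y. ?F (\<lambda>j\<in>{..<p}. y $ j) \<partial>\<mu>)"
      proof (intro nn_integral_cong)
        fix y assume "y \<in> space \<mu>"
        then have y: "y \<in> carrier_vec p" using vec_law_space[OF law] by simp
        have "s * X y = (\<Sum>j<p. (s * v $ j / N) * y $ j)"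
          unfolding X_def scalar_prod_sum[OF v y] by (simp add: sum_distrib_left sum_divide_distrib mult_ac)
        also have "\<dots> = (\<Sum>j<p. (s * v $ j / N) * (\<lambda>j\<in>{..<p}. y $ j) j)" by (intro sum.cong refl) simp
        finally show "ennreal (exp (s * X y)) = ?F (\<lambda>j\<in>{..<p}. y $ j)" by (simp only:)
      qed
      also have "\<dots> = (\<integral>\<^sup>+x. ?F x \<partial>(\<Pi>\<^sub>M j\<in>{..<p}. \<nu> j))" by (rule tr[OF Fm])
      also have "\<dots> \<le> ennreal (exp (\<Sum>j<p. L * (s * v $ j / N)\<^sup>2))"
        unfolding L_def by (rule prod_exp_nn_integral[OF \<nu> finite_lessThan]) (simp, rule subgauss_mgf[OF \<nu> a])
      also have "(\<Sum>j<p. L * (s * v $ j / N)\<^sup>2) = (\<Sum>j<p. L / N\<^sup>2 * (v $ j * v $ j))"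
        using s by (intro sum.cong refl) (simp add: power_mult_distrib power_divide power2_eq_square[of "v $ _"])
      also have "\<dots> = L / N\<^sup>2 * (v \<bullet> v)" unfolding scalar_prod_sum[OF v v] by (rule sum_distrib_left[symmetric])
      also have "\<dots> = L" using N unfolding N_def eucl_norm_sq[symmetric] by simp
      finally show ?thesis .
    qed
    \<comment> \<open>Makes \<open>64 / A\<^sup>2 * exp L\<close> equal to 1/4, once for each sign
      of the exponent. The final constant 1024 is 4 times 256.\<close>
    define A where "A = sqrt (256 * exp L)"
    have A: "0 < A" "A\<^sup>2 = 256 * exp L" by (simp_all add: A_def)
    let ?E = "{y \<in> space \<mu>. 1 / 2 \<le> \<bar>X y\<bar>}"
    have pt: "ennreal ((X y)\<^sup>2) \<le> ennreal (1 / 4) + ennreal (A\<^sup>2) * indicator ?E y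
        + (ennreal (64 / A\<^sup>2) * ennreal (exp (1 * X y)) + ennreal (64 / A\<^sup>2) * ennreal (exp ((-1) * X y)))" if y: "y \<in> space \<mu>" for y
    proof -
      have "(X y)\<^sup>2 \<le> 1 / 4 + A\<^sup>2 * (if 1 / 2 \<le> \<bar>X y\<bar> then 1 else 0) + (64 / A\<^sup>2 * exp (1 * X y) + 64 / A\<^sup>2 * exp ((-1) * X y))"
      proof -
        consider "\<bar>X y\<bar> < 1 / 2" | "1 / 2 \<le> \<bar>X y\<bar>" "\<bar>X y\<bar> \<le> A" | "A < \<bar>X y\<bar>" by linarith
        then show ?thesis
        proof cases
          case 1
          then have "\<bar>X y\<bar>\<^sup>2 \<le> (1 / 2)\<^sup>2" by (intro power_mono) auto
          then have "(X y)\<^sup>2 \<le> 1 / 4" by (simp add: power_divide)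
          moreover have "A\<^sup>2 * (if 1 / 2 \<le> \<bar>X y\<bar> then 1 else 0) = 0" using 1 by simp
          moreover have "0 \<le> 64 / A\<^sup>2 * exp (1 * X y)" "0 \<le> 64 / A\<^sup>2 * exp ((-1) * X y)" by simp_all
          ultimately show ?thesis by linarith
        next
          case 2
          then have "\<bar>X y\<bar>\<^sup>2 \<le> A\<^sup>2" by (intro power_mono) auto
          then have "(X y)\<^sup>2 \<le> A\<^sup>2" by simp
          moreover have "A\<^sup>2 * (if 1 / 2 \<le> \<bar>X y\<bar> then 1 else 0) = A\<^sup>2" using 2 by simp
          moreover have "0 \<le> 64 / A\<^sup>2 * exp (1 * X y)" "0 \<le> 64 / A\<^sup>2 * exp ((-1) * X y)" by simp_all
          ultimately show ?thesis by linarith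
        next
          case 3
          have "A\<^sup>2 \<le> (X y)\<^sup>2" using 3 A by (metis abs_le_square_iff abs_of_pos less_imp_le)
          then have "(X y)\<^sup>2 * A\<^sup>2 \<le> (X y)\<^sup>2 * (X y)\<^sup>2" by (intro mult_left_mono) auto
          also have "\<dots> = \<bar>X y\<bar> ^ 4" by (simp add: power4_eq_xxxx power2_eq_square)
          also have "\<dots> \<le> 64 * exp \<bar>X y\<bar>" by (rule fourth_power_le_exp) simp
          also have "exp \<bar>X y\<bar> \<le> exp (1 * X y) + exp ((-1) * X y)" by (cases "0 \<le> X y") (simp_all add: add_increasing add_increasing2)
          finally have "(X y)\<^sup>2 \<le> 64 * (exp (1 * X y) + exp ((-1) * X y)) / A\<^sup>2" using A by (subst pos_le_divide_eq) auto
          also have "\<dots> = 64 / A\<^sup>2 * exp (1 * X y) + 64 / A\<^sup>2 * exp ((-1) * X y)" by (simp add: add_divide_distrib)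
          moreover have "0 \<le> A\<^sup>2 * (if 1 / 2 \<le> \<bar>X y\<bar> then 1 else 0)" by simp
          ultimately show ?thesis by linarith
        qed
      qed
      then have "ennreal ((X y)\<^sup>2) \<le> ennreal (1 / 4 + A\<^sup>2 * (if 1 / 2 \<le> \<bar>X y\<bar> then 1 else 0) + (64 / A\<^sup>2 * exp (1 * X y) + 64 / A\<^sup>2 * exp ((-1) * X y)))"
        by (rule ennreal_leI)
      also have "\<dots> = ennreal (1 / 4) + ennreal (A\<^sup>2) * indicator ?E y
        + (ennreal (64 / A\<^sup>2) * ennreal (exp (1 * X y)) + ennreal (64 / A\<^sup>2) * ennreal (exp ((-1) * X y)))"
      proof -
        have "ennreal (A\<^sup>2 * (if 1 / 2 \<le> \<bar>X y\<bar> then 1 else 0)) = ennreal (A\<^sup>2) * indicator ?E y" using y by simp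
        moreover have "ennreal (64 / A\<^sup>2 * exp (s * X y)) = ennreal (64 / A\<^sup>2) * ennreal (exp (s * X y))" for s by (rule ennreal_mult) auto
        ultimately show ?thesis by (subst ennreal_plus, simp, simp, subst ennreal_plus, simp, simp, subst ennreal_plus, simp, simp) (simp only:)
      qed
      finally show ?thesis .
    qed
    have "(\<integral>\<^sup>+y. ennreal ((X y)\<^sup>2) \<partial>\<mu>) = 1"
    proof -
      define V where "V = (1 / N\<^sup>2) \<cdot>\<^sub>m outer v"
      have V: "V \<in> carrier_mat p p" using v by (simp add: V_def)
      have eq: "(X y)\<^sup>2 = y \<bullet> (V *\<^sub>v y)" if "y \<in> space \<mu>" for y
      proof -
        have y: "y \<in> carrier_vec p" using that vec_law_space[OF law] by simp
        have "V *\<^sub>v y = (1 / N\<^sup>2) \<cdot>\<^sub>v ((v \<bullet> y) \<cdot>\<^sub>v v)"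
          unfolding V_def smult_mat_mult_vec[OF outer_carrier[OF v] y] outer_vec[OF v y] ..
        then show ?thesis using y v comm_scalar_prod[OF y v] by (simp add: X_def power_divide power2_eq_square)
      qed
      have "mtrace V = (1 / N\<^sup>2) * (v \<bullet> v)"
        using v by (simp add: V_def mtrace_def outer_def scalar_prod_sum[OF v v] sum_distrib_left sum_divide_distrib)
      then have trV: "mtrace V = 1" using N unfolding N_def eucl_norm_sq[symmetric] by simp
      have "(\<integral>\<^sup>+y. ennreal ((X y)\<^sup>2) \<partial>\<mu>) = (\<integral>\<^sup>+y. ennreal (y \<bullet> (V *\<^sub>v y)) \<partial>\<mu>)" by (intro nn_integral_cong) (simp only: eq)
      also have "\<dots> = ennreal (\<integral>y. y \<bullet> (V *\<^sub>v y) \<partial>\<mu>)"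
      proof (rule nn_integral_eq_integral[OF isotropic_second_moment(1)[OF law iso V]], rule AE_I2)
        fix y assume "y \<in> space \<mu>"
        then show "0 \<le> y \<bullet> (V *\<^sub>v y)" by (simp only: eq[symmetric] zero_le_power2)
      qed
      also have "\<dots> = 1" unfolding isotropic_second_moment(2)[OF law iso V] trV by simp
      finally show ?thesis .
    qed
    moreover have "(\<integral>\<^sup>+y. ennreal ((X y)\<^sup>2) \<partial>\<mu>) \<le> (\<integral>\<^sup>+y. ennreal (1 / 4) + ennreal (A\<^sup>2) * indicator ?E y
        + (ennreal (64 / A\<^sup>2) * ennreal (exp (1 * X y)) + ennreal (64 / A\<^sup>2) * ennreal (exp ((-1) * X y))) \<partial>\<mu>)"
      by (rule nn_integral_mono) (rule pt)
    ultimately have "1 \<le> (\<integral>\<^sup>+y. ennreal (1 / 4) + ennreal (A\<^sup>2) * indicator ?E y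
        + (ennreal (64 / A\<^sup>2) * ennreal (exp (1 * X y)) + ennreal (64 / A\<^sup>2) * ennreal (exp ((-1) * X y))) \<partial>\<mu>)"
      by (simp only:)
    also have "\<dots> = ennreal (1 / 4) + ennreal (A\<^sup>2) * emeasure \<mu> ?E
        + (ennreal (64 / A\<^sup>2) * (\<integral>\<^sup>+y. ennreal (exp (1 * X y)) \<partial>\<mu>) + ennreal (64 / A\<^sup>2) * (\<integral>\<^sup>+y. ennreal (exp ((-1) * X y)) \<partial>\<mu>))"
      by (simp add: nn_integral_add nn_integral_cmult emeasure_space_1)
    also have "\<dots> \<le> ennreal (1 / 4) + ennreal (A\<^sup>2) * emeasure \<mu> ?E
        + (ennreal (64 / A\<^sup>2) * ennreal (exp L) + ennreal (64 / A\<^sup>2) * ennreal (exp L))"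
      by (intro add_left_mono add_mono mult_left_mono mgf) auto
    also have "\<dots> = ennreal (1 / 4 + A\<^sup>2 * measure \<mu> ?E + (64 / A\<^sup>2 * exp L + 64 / A\<^sup>2 * exp L))"
      unfolding emeasure_eq_measure by (simp add: ennreal_mult[symmetric] ennreal_plus[symmetric] del: ennreal_plus)
    finally have "1 \<le> 1 / 4 + A\<^sup>2 * measure \<mu> ?E + (64 / A\<^sup>2 * exp L + 64 / A\<^sup>2 * exp L)"
      unfolding ennreal_1[symmetric] by (subst (asm) ennreal_le_iff) auto
    moreover have "64 / A\<^sup>2 * exp L = 1 / 4" unfolding A(2) by simp
    ultimately have "1 / 4 \<le> 256 * exp L * measure \<mu> ?E" unfolding A(2) by linarith
    then have "exp (- L) * (1 / 4) \<le> exp (- L) * (256 * exp L * measure \<mu> ?E)" by (intro mult_left_mono) auto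
    also have "\<dots> = 256 * measure \<mu> ?E" by (simp add: exp_minus)
    finally have "exp (- L) / 1024 \<le> measure \<mu> ?E" by simp
    moreover have "?E = {y \<in> space \<mu>. 1 / 2 * eucl_norm v \<le> \<bar>v \<bullet> y\<bar>}"
    proof (intro Collect_cong conj_cong refl)
      fix y
      show "1 / 2 \<le> \<bar>X y\<bar> \<longleftrightarrow> 1 / 2 * eucl_norm v \<le> \<bar>v \<bullet> y\<bar>"
        using N by (simp only: X_def abs_divide abs_of_pos pos_le_divide_eq N_def[symmetric])
    qed
    ultimately show ?thesis by (simp only: L)
  qed
qed

section \<open>Small balls for log-concave laws via the Prekopa--Leindler inequality\<close>

text \<open>Half-scale copies of \<open>X\<close> shifted by a lowest point of \<open>Y\<close>, and
  of \<open>Y\<close> shifted by a highest point of \<open>X\<close>, lie in \<open>Z\<close> and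
  would meet in a single point. The extrema may not be attained, so nearly extremal
  \<open>x0\<close> and \<open>y0\<close> are used and the overlap has length at most
  \<open>e / 2\<close>.\<close>

lemma brunn_minkowski_real_bounded:
  fixes X Y Z :: "real set"
  assumes s: "X \<in> sets borel" "Y \<in> sets borel" "Z \<in> sets borel" and ne: "X \<noteq> {}" "Y \<noteq> {}"
    and b: "bdd_above X" "bdd_below Y" and Z: "\<And>x y. x \<in> X \<Longrightarrow> y \<in> Y \<Longrightarrow> (x + y) / 2 \<in> Z"
  shows "emeasure lborel X + emeasure lborel Y \<le> 2 * emeasure lborel Z"
proof (rule ennreal_le_epsilon)
  fix e :: real assume e: "0 < e"
  define S where "S = Sup X"
  define T where "T = Inf Y"
  obtain x0 where x0: "x0 \<in> X" "S - e / 2 < x0" using less_cSup_iff[OF ne(1) b(1), of "S - e / 2"] e by (auto simp: S_def)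
  obtain y0 where y0: "y0 \<in> Y" "y0 < T + e / 2" using cInf_less_iff[OF ne(2) b(2), of "T + e / 2"] e by (auto simp: T_def)
  have XS: "x \<le> S" if "x \<in> X" for x unfolding S_def using that b(1) by (rule cSup_upper)
  have YT: "T \<le> y" if "y \<in> Y" for y unfolding T_def using that b(2) by (rule cInf_lower)
  define P where "P = {z. - y0 + 2 * z \<in> X}"
  define Q where "Q = {z. - x0 + 2 * z \<in> Y}"
  have PQs: "P \<in> sets borel" "Q \<in> sets borel"
  proof -
    have "(\<lambda>z :: real. - y0 + 2 * z) -` X \<inter> space borel \<in> sets borel" by (rule measurable_sets[OF _ s(1)]) measurable
    then show "P \<in> sets borel" by (simp add: P_def vimage_def)
    have "(\<lambda>z :: real. - x0 + 2 * z) -` Y \<inter> space borel \<in> sets borel" by (rule measurable_sets[OF _ s(2)]) measurable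
    then show "Q \<in> sets borel" by (simp add: Q_def vimage_def)
  qed
  have scale: "emeasure lborel W = 2 * emeasure lborel {z. t + 2 * z \<in> W}" if W: "W \<in> sets borel" and W2: "{z. t + 2 * z \<in> W} \<in> sets borel" for W :: "real set" and t :: real
  proof -
    have "emeasure lborel W = (\<integral>\<^sup>+x. indicator W x \<partial>lborel)" using W by simp
    also have "\<dots> = ennreal \<bar>2\<bar> * (\<integral>\<^sup>+x. indicator W (t + 2 * x) \<partial>lborel)"
      by (rule nn_integral_real_affine) (use W in simp_all)
    also have "(\<integral>\<^sup>+x. indicator W (t + 2 * x) \<partial>lborel) = (\<integral>\<^sup>+x. indicator {z. t + 2 * z \<in> W} x \<partial>lborel)"
      by (intro nn_integral_cong) (simp add: indicator_def)
    also have "\<dots> = emeasure lborel {z. t + 2 * z \<in> W}" using W2 by simp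
    finally show ?thesis by simp
  qed
  have XP: "emeasure lborel X = 2 * emeasure lborel P" unfolding P_def by (rule scale[OF s(1)]) (use PQs in \<open>simp add: P_def\<close>)
  have YQ: "emeasure lborel Y = 2 * emeasure lborel Q" unfolding Q_def by (rule scale[OF s(2)]) (use PQs in \<open>simp add: Q_def\<close>)
  have "P \<inter> Q \<subseteq> {(x0 + T) / 2..(S + y0) / 2}"
  proof
    fix z assume "z \<in> P \<inter> Q"
    then have "- y0 + 2 * z \<le> S" "T \<le> - x0 + 2 * z" using XS YT by (auto simp: P_def Q_def)
    then show "z \<in> {(x0 + T) / 2..(S + y0) / 2}" by simp
  qed
  then have "emeasure lborel (P \<inter> Q) \<le> emeasure lborel {(x0 + T) / 2..(S + y0) / 2}" by (intro emeasure_mono) auto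
  also have "\<dots> \<le> ennreal (e / 2)"
  proof (cases "(x0 + T) / 2 \<le> (S + y0) / 2")
    case True
    then show ?thesis using x0 y0 by (simp add: ennreal_leI field_simps)
  qed simp
  finally have int: "emeasure lborel (P \<inter> Q) \<le> ennreal (e / 2)" .
  have "P \<union> Q \<subseteq> Z"
  proof
    fix z assume "z \<in> P \<union> Q"
    then show "z \<in> Z"
    proof
      assume "z \<in> P"
      then have "- y0 + 2 * z \<in> X" by (simp only: P_def mem_Collect_eq)
      then have "((- y0 + 2 * z) + y0) / 2 \<in> Z" by (rule Z[OF _ y0(1)])
      then show ?thesis by simp
    next
      assume "z \<in> Q"
      then have "- x0 + 2 * z \<in> Y" by (simp only: Q_def mem_Collect_eq)
      then have "(x0 + (- x0 + 2 * z)) / 2 \<in> Z" by (rule Z[OF x0(1)])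
      then show ?thesis by simp
    qed
  qed
  then have un: "emeasure lborel (P \<union> Q) \<le> emeasure lborel Z" using s(3) by (intro emeasure_mono) auto
  have "emeasure lborel X + emeasure lborel Y = 2 * (emeasure lborel P + emeasure lborel Q)"
    unfolding XP YQ by (rule distrib_left[symmetric])
  also have "emeasure lborel P + emeasure lborel Q = emeasure lborel (P \<union> Q) + emeasure lborel (P \<inter> Q)"
    using PQs by (intro emeasure_Un_Int) auto
  also have "2 * \<dots> \<le> 2 * (emeasure lborel Z + ennreal (e / 2))" by (intro mult_left_mono add_mono un int) simp
  also have "\<dots> = 2 * emeasure lborel Z + 2 * ennreal (e / 2)" by (rule distrib_left)
  also have "2 * ennreal (e / 2) = ennreal e"
  proof -
    have "2 * ennreal (e / 2) = ennreal 2 * ennreal (e / 2)" by simp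
    also have "\<dots> = ennreal (2 * (e / 2))" by (rule ennreal_mult[symmetric]) (use e in auto)
    finally show ?thesis by simp
  qed
  finally show "emeasure lborel X + emeasure lborel Y \<le> 2 * emeasure lborel Z + ennreal e" .
qed

lemma brunn_minkowski_real:
  fixes X Y Z :: "real set"
  assumes s: "X \<in> sets borel" "Y \<in> sets borel" "Z \<in> sets borel" and ne: "X \<noteq> {}" "Y \<noteq> {}"
    and Z: "\<And>x y. x \<in> X \<Longrightarrow> y \<in> Y \<Longrightarrow> (x + y) / 2 \<in> Z"
  shows "emeasure lborel X + emeasure lborel Y \<le> 2 * emeasure lborel Z"
proof -
  obtain x y where xy: "x \<in> X" "y \<in> Y" using ne by blast
  \<comment> \<open>The truncation at \<open>\<bar>x\<bar>\<close> plus \<open>n\<close> keeps the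
    chosen point in every truncated set, so none of them is empty.\<close>
  define XX where "XX n = X \<inter> {- (real n + \<bar>x\<bar>)..real n + \<bar>x\<bar>}" for n :: nat
  define YY where "YY n = Y \<inter> {- (real n + \<bar>y\<bar>)..real n + \<bar>y\<bar>}" for n :: nat
  have U: "(\<Union>n. W \<inter> {- (real n + \<bar>c\<bar>)..real n + \<bar>c\<bar>}) = W" for W :: "real set" and c
  proof -
    have "w \<in> (\<Union>n. W \<inter> {- (real n + \<bar>c\<bar>)..real n + \<bar>c\<bar>})" if "w \<in> W" for w
    proof -
      obtain n :: nat where "\<bar>w\<bar> \<le> real n" using real_arch_simple by blast
      then have "w \<in> {- (real n + \<bar>c\<bar>)..real n + \<bar>c\<bar>}" by auto
      then show ?thesis using that by blast
    qed
    then show ?thesis by blast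
  qed
  have "(\<lambda>n. emeasure lborel (XX n)) \<longlonglongrightarrow> emeasure lborel (\<Union>n. XX n)"
    using s by (intro Lim_emeasure_incseq) (auto simp: XX_def incseq_def)
  moreover have "(\<lambda>n. emeasure lborel (YY n)) \<longlonglongrightarrow> emeasure lborel (\<Union>n. YY n)"
    using s by (intro Lim_emeasure_incseq) (auto simp: YY_def incseq_def)
  ultimately have "(\<lambda>n. emeasure lborel (XX n) + emeasure lborel (YY n)) \<longlonglongrightarrow> emeasure lborel X + emeasure lborel Y"
    unfolding XX_def YY_def U by (rule tendsto_add)
  then show ?thesis
  proof (rule LIMSEQ_le_const2, intro exI allI impI)
    fix n :: nat
    show "emeasure lborel (XX n) + emeasure lborel (YY n) \<le> 2 * emeasure lborel Z"
    proof (rule brunn_minkowski_real_bounded)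
      have "- (real n + \<bar>x\<bar>) \<le> x \<and> x \<le> real n + \<bar>x\<bar>" "- (real n + \<bar>y\<bar>) \<le> y \<and> y \<le> real n + \<bar>y\<bar>" by linarith+
      then have "x \<in> XX n" "y \<in> YY n" using xy unfolding XX_def YY_def by auto
      then show "XX n \<noteq> {}" "YY n \<noteq> {}" by auto
      show "bdd_above (XX n)" by (rule bdd_aboveI[of _ "real n + \<bar>x\<bar>"]) (simp add: XX_def)
      show "bdd_below (YY n)" by (rule bdd_belowI[of _ "- (real n + \<bar>y\<bar>)"]) (simp add: YY_def)
      show "(u + v) / 2 \<in> Z" if "u \<in> XX n" "v \<in> YY n" for u v using that by (intro Z) (auto simp: XX_def YY_def)
    qed (use s in \<open>auto simp: XX_def YY_def\<close>)
  qed
qed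

text \<open>Only levels below 1 are integrated, which gives the integral of the truncated function:
  the full integral for functions with supremum 1, and a lower bound for it otherwise.\<close>

lemma layer_cake_unit:
  fixes f :: "real \<Rightarrow> real"
  assumes f[measurable]: "f \<in> borel_measurable borel" and f0: "\<And>x. 0 \<le> f x"
  shows "(\<integral>\<^sup>+t. indicator {0<..<1} t * emeasure lborel {x. t < f x} \<partial>lborel) = (\<integral>\<^sup>+x. ennreal (min (f x) 1) \<partial>lborel)"
proof -
  have m: "(\<lambda>p. indicator {p. 0 < fst p \<and> fst p < 1 \<and> fst p < f (snd p)} p :: ennreal) \<in> borel_measurable (lborel \<Otimes>\<^sub>M lborel)"
    by measurable
  have "(\<integral>\<^sup>+t. indicator {0<..<1} t * emeasure lborel {x. t < f x} \<partial>lborel) =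
      (\<integral>\<^sup>+t. (\<integral>\<^sup>+x. indicator {p. 0 < fst p \<and> fst p < 1 \<and> fst p < f (snd p)} (t, x) \<partial>lborel) \<partial>lborel)"
  proof (rule nn_integral_cong)
    fix t :: real
    have s: "{x. t < f x} \<in> sets lborel" by measurable
    have "(\<integral>\<^sup>+x. indicator {p. 0 < fst p \<and> fst p < 1 \<and> fst p < f (snd p)} (t, x) \<partial>lborel) =
        (\<integral>\<^sup>+x. indicator {0<..<1} t * indicator {x. t < f x} x \<partial>lborel)"
      by (intro nn_integral_cong) (simp add: indicator_def)
    also have "\<dots> = indicator {0<..<1} t * emeasure lborel {x. t < f x}" using s by (rule nn_integral_cmult_indicator)
    finally show "indicator {0<..<1} t * emeasure lborel {x. t < f x} =
      (\<integral>\<^sup>+x. indicator {p. 0 < fst p \<and> fst p < 1 \<and> fst p < f (snd p)} (t, x) \<partial>lborel)" ..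
  qed
  also have "\<dots> = (\<integral>\<^sup>+x. (\<integral>\<^sup>+t. indicator {p. 0 < fst p \<and> fst p < 1 \<and> fst p < f (snd p)} (t, x) \<partial>lborel) \<partial>lborel)"
    by (rule lborel_pair.Fubini'[symmetric]) (use m in \<open>simp add: case_prod_beta'\<close>)
  also have "\<dots> = (\<integral>\<^sup>+x. ennreal (min (f x) 1) \<partial>lborel)"
  proof (rule nn_integral_cong)
    fix x
    have "(\<integral>\<^sup>+t. indicator {p. 0 < fst p \<and> fst p < 1 \<and> fst p < f (snd p)} (t, x) \<partial>lborel) =
        (\<integral>\<^sup>+t. indicator {0<..<min (f x) 1} t \<partial>lborel)"
      by (intro nn_integral_cong) (auto simp: indicator_def)
    also have "\<dots> = ennreal (min (f x) 1)" using f0[of x] by simp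
    finally show "(\<integral>\<^sup>+t. indicator {p. 0 < fst p \<and> fst p < 1 \<and> fst p < f (snd p)} (t, x) \<partial>lborel) = ennreal (min (f x) 1)" .
  qed
  finally show ?thesis .
qed

text \<open>Arithmetic-geometric mean; an infinite \<open>c\<close> makes it trivial, and otherwise
  all three numbers are real.\<close>

lemma ennreal_am_gm:
  assumes "a + b \<le> 2 * (c :: ennreal)" shows "a * b \<le> c\<^sup>2"
proof (cases "c = \<top>")
  case True
  then show ?thesis by (simp add: power2_eq_square ennreal_top_mult)
next
  case False
  then obtain c' where c: "c = ennreal c'" "0 \<le> c'" by (cases c) auto
  have "a + b < \<top>"
  proof -
    have "2 * c < \<top>" using c by (simp add: ennreal_mult_less_top)
    then show ?thesis using assms by (rule le_less_trans[rotated])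
  qed
  then obtain a' b' where ab: "a = ennreal a'" "0 \<le> a'" "b = ennreal b'" "0 \<le> b'" by (cases a; cases b) auto
  have "ennreal (a' + b') \<le> ennreal (2 * c')" using assms ab c by (simp add: ennreal_mult ennreal_plus)
  then have "a' + b' \<le> 2 * c'" using c by (subst (asm) ennreal_le_iff) auto
  then have "(a' + b')\<^sup>2 \<le> (2 * c')\<^sup>2" using ab by (intro power_mono) auto
  moreover have "(a' + b')\<^sup>2 = (a' - b')\<^sup>2 + 4 * (a' * b')" by (simp add: power2_eq_square algebra_simps)
  moreover have "(2 * c')\<^sup>2 = 4 * c'\<^sup>2" by (simp add: power_mult_distrib)
  ultimately have "a' * b' \<le> c'\<^sup>2" using zero_le_power2[of "a' - b'"] by linarith
  then have "ennreal (a' * b') \<le> ennreal (c'\<^sup>2)" by (rule ennreal_leI)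
  then show ?thesis using ab c by (simp add: ennreal_mult power2_eq_square)
qed

text \<open>Dividing \<open>f\<close> and \<open>g\<close> by their suprema makes all superlevel
  sets at levels in (0,1) nonempty, as Brunn--Minkowski requires; \<open>D\<close> is the matching
  normalisation of \<open>h\<close>. Integration over the level gives an additive inequality, which
  the arithmetic-geometric mean turns into the multiplicative one.\<close>

lemma prekopa_leindler_real_bounded:
  fixes f g h :: "real \<Rightarrow> real"
  assumes m[measurable]: "f \<in> borel_measurable borel" "g \<in> borel_measurable borel" "h \<in> borel_measurable borel"
    and f: "\<And>x. 0 \<le> f x" "\<And>x. f x \<le> C" and g: "\<And>x. 0 \<le> g x" "\<And>x. g x \<le> C" and h: "\<And>x. 0 \<le> h x"
    and le: "\<And>x y. f x * g y \<le> (h ((x + y) / 2))\<^sup>2"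
  shows "(\<integral>\<^sup>+x. ennreal (f x) \<partial>lborel) * (\<integral>\<^sup>+x. ennreal (g x) \<partial>lborel) \<le> (\<integral>\<^sup>+x. ennreal (h x) \<partial>lborel)\<^sup>2"
proof -
  define A where "A = Sup (range f)"
  define B where "B = Sup (range g)"
  have bd: "bdd_above (range f)" "bdd_above (range g)" by (rule bdd_aboveI2, rule f(2), rule bdd_aboveI2, rule g(2))
  have fA: "f x \<le> A" for x unfolding A_def using bd by (intro cSup_upper) auto
  have gB: "g x \<le> B" for x unfolding B_def using bd by (intro cSup_upper) auto
  have AB0: "0 \<le> A" "0 \<le> B" using f(1)[of 0] fA[of 0] g(1)[of 0] gB[of 0] by linarith+
  show ?thesis
  proof (cases "A = 0 \<or> B = 0")
    case True
    then have "(\<forall>x. f x = 0) \<or> (\<forall>x. g x = 0)" using fA gB f(1) g(1) by (metis order_antisym)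
    then show ?thesis by auto
  next
    case False
    then have AB: "0 < A" "0 < B" using AB0 by auto
    define D where "D = sqrt (A * B)"
    have D: "0 < D" "D\<^sup>2 = A * B" using AB by (simp_all add: D_def)
    have level: "emeasure lborel {x. t < f x / A} + emeasure lborel {x. t < g x / B} \<le> 2 * emeasure lborel {x. t < h x / D}"
      if t: "t \<in> {0<..<1}" for t
    proof (rule brunn_minkowski_real)
      show "{x. t < f x / A} \<in> sets borel" "{x. t < g x / B} \<in> sets borel" "{x. t < h x / D} \<in> sets borel" by measurable
      have "t * A < 1 * A" using t AB by (intro mult_strict_right_mono) auto
      then have "t * A < Sup (range f)" by (simp add: A_def)
      then obtain x where "t * A < f x" using bd(1) by (auto simp: less_cSup_iff)
      then have "t < f x / A" using AB by (simp add: pos_less_divide_eq)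
      then show "{x. t < f x / A} \<noteq> {}" by blast
      have "t * B < 1 * B" using t AB by (intro mult_strict_right_mono) auto
      then have "t * B < Sup (range g)" by (simp add: B_def)
      then obtain y where "t * B < g y" using bd(2) by (auto simp: less_cSup_iff)
      then have "t < g y / B" using AB by (simp add: pos_less_divide_eq)
      then show "{x. t < g x / B} \<noteq> {}" by blast
      fix x y assume "x \<in> {x. t < f x / A}" "y \<in> {x. t < g x / B}"
      then have "t * A < f x" "t * B < g y" using AB by (simp_all add: pos_less_divide_eq)
      then have "(t * A) * (t * B) < f x * g y" using t AB by (intro mult_strict_mono') auto
      then have "(t * D)\<^sup>2 < (h ((x + y) / 2))\<^sup>2"
        using le[of x y] D(2) by (simp add: power_mult_distrib power2_eq_square[of t] mult_ac)
      then have "t * D < h ((x + y) / 2)" using h by (rule power_less_imp_less_base)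
      then show "(x + y) / 2 \<in> {x. t < h x / D}" using D by (simp add: pos_less_divide_eq)
    qed
    let ?F = "\<integral>\<^sup>+x. ennreal (f x / A) \<partial>lborel" and ?G = "\<integral>\<^sup>+x. ennreal (g x / B) \<partial>lborel" and ?H = "\<integral>\<^sup>+x. ennreal (h x / D) \<partial>lborel"
    have mm[measurable]: "(\<lambda>t. emeasure lborel {x. t < q x}) \<in> borel_measurable borel" if [measurable]: "q \<in> borel_measurable borel" for q :: "real \<Rightarrow> real"
    proof -
      have "(\<lambda>t. \<integral>\<^sup>+x. indicator {p. fst p < q (snd p)} (t, x) \<partial>lborel) \<in> borel_measurable lborel"
        by (rule lborel.borel_measurable_nn_integral) measurable
      also have "(\<lambda>t. \<integral>\<^sup>+x. indicator {p. fst p < q (snd p)} (t, x) \<partial>lborel) = (\<lambda>t. emeasure lborel {x. t < q x})"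
      proof
        fix t :: real
        have s: "{x. t < q x} \<in> sets lborel" by measurable
        have "(\<integral>\<^sup>+x. indicator {p. fst p < q (snd p)} (t, x) \<partial>lborel) = (\<integral>\<^sup>+x. indicator {x. t < q x} x \<partial>lborel)"
          by (intro nn_integral_cong) (simp add: indicator_def)
        also have "\<dots> = emeasure lborel {x. t < q x}" using s by simp
        finally show "(\<integral>\<^sup>+x. indicator {p. fst p < q (snd p)} (t, x) \<partial>lborel) = emeasure lborel {x. t < q x}" .
      qed
      finally show ?thesis by simp
    qed
    have m1: "(\<lambda>t. indicator {0<..<1} t * emeasure lborel {x. t < f x / A}) \<in> borel_measurable lborel"
      "(\<lambda>t. indicator {0<..<1} t * emeasure lborel {x. t < g x / B}) \<in> borel_measurable lborel"
      "(\<lambda>t. indicator {0<..<1} t * emeasure lborel {x. t < h x / D}) \<in> borel_measurable lborel"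
      using mm[of "\<lambda>x. f x / A"] mm[of "\<lambda>x. g x / B"] mm[of "\<lambda>x. h x / D"] by auto
    have F: "?F = (\<integral>\<^sup>+t. indicator {0<..<1} t * emeasure lborel {x. t < f x / A} \<partial>lborel)"
    proof -
      have "min (f x / A) 1 = f x / A" for x using fA[of x] AB by (simp add: min_def)
      then show ?thesis using layer_cake_unit[of "\<lambda>x. f x / A"] f(1) AB by simp
    qed
    have G: "?G = (\<integral>\<^sup>+t. indicator {0<..<1} t * emeasure lborel {x. t < g x / B} \<partial>lborel)"
    proof -
      have "min (g x / B) 1 = g x / B" for x using gB[of x] AB by (simp add: min_def)
      then show ?thesis using layer_cake_unit[of "\<lambda>x. g x / B"] g(1) AB by simp
    qed
    have "?F + ?G = (\<integral>\<^sup>+t. indicator {0<..<1} t * emeasure lborel {x. t < f x / A} + indicator {0<..<1} t * emeasure lborel {x. t < g x / B} \<partial>lborel)"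
      unfolding F G using m1 by (intro nn_integral_add[symmetric]) auto
    also have "\<dots> \<le> (\<integral>\<^sup>+t. 2 * (indicator {0<..<1} t * emeasure lborel {x. t < h x / D}) \<partial>lborel)"
    proof (rule nn_integral_mono)
      fix t :: real
      show "indicator {0<..<1} t * emeasure lborel {x. t < f x / A} + indicator {0<..<1} t * emeasure lborel {x. t < g x / B}
        \<le> 2 * (indicator {0<..<1} t * emeasure lborel {x. t < h x / D})"
        using level[of t] by (cases "t \<in> {0<..<1}") simp_all
    qed
    also have "\<dots> = 2 * (\<integral>\<^sup>+t. indicator {0<..<1} t * emeasure lborel {x. t < h x / D} \<partial>lborel)"
      using m1(3) by (rule nn_integral_cmult)
    also have "(\<integral>\<^sup>+t. indicator {0<..<1} t * emeasure lborel {x. t < h x / D} \<partial>lborel) = (\<integral>\<^sup>+x. ennreal (min (h x / D) 1) \<partial>lborel)"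
      using h D by (intro layer_cake_unit) auto
    also have "\<dots> \<le> ?H" by (intro nn_integral_mono ennreal_leI) simp
    finally have "?F + ?G \<le> 2 * ?H" by (simp add: mult_left_mono)
    then have FG: "?F * ?G \<le> ?H\<^sup>2" by (rule ennreal_am_gm)
    have sc: "(\<integral>\<^sup>+x. ennreal (q x) \<partial>lborel) = ennreal c * (\<integral>\<^sup>+x. ennreal (q x / c) \<partial>lborel)"
      if c: "0 < c" and [measurable]: "q \<in> borel_measurable borel" and q0: "\<And>x. 0 \<le> q x" for q :: "real \<Rightarrow> real" and c
    proof -
      have "(\<integral>\<^sup>+x. ennreal (q x) \<partial>lborel) = (\<integral>\<^sup>+x. ennreal c * ennreal (q x / c) \<partial>lborel)"
        using c q0 by (intro nn_integral_cong) (simp add: ennreal_mult[symmetric])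
      also have "\<dots> = ennreal c * (\<integral>\<^sup>+x. ennreal (q x / c) \<partial>lborel)" by (rule nn_integral_cmult) measurable
      finally show ?thesis .
    qed
    have "(\<integral>\<^sup>+x. ennreal (f x) \<partial>lborel) * (\<integral>\<^sup>+x. ennreal (g x) \<partial>lborel) = (ennreal A * ?F) * (ennreal B * ?G)"
      using sc[OF AB(1) m(1) f(1)] sc[OF AB(2) m(2) g(1)] by simp
    also have "\<dots> = (ennreal A * ennreal B) * (?F * ?G)" by (simp only: mult_ac)
    also have "ennreal A * ennreal B = ennreal D * ennreal D"
      using AB D by (simp add: ennreal_mult[symmetric] power2_eq_square)
    also have "(ennreal D * ennreal D) * (?F * ?G) \<le> (ennreal D * ennreal D) * ?H\<^sup>2" by (intro mult_left_mono FG) simp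
    also have "\<dots> = (ennreal D * ?H)\<^sup>2" by (simp add: power2_eq_square mult_ac)
    also have "ennreal D * ?H = (\<integral>\<^sup>+x. ennreal (h x) \<partial>lborel)" using sc[OF D(1) m(3) h] by simp
    finally show ?thesis .
  qed
qed

text \<open>Truncating all three functions at the same \<open>n\<close> preserves the hypothesis:
  either \<open>h\<close> is not cut at the midpoint, or the right-hand side is \<open>n\<close>
  squared, which dominates the left. Monotone convergence removes the truncation.\<close>

lemma prekopa_leindler_real:
  fixes f g h :: "real \<Rightarrow> ennreal"
  assumes m[measurable]: "f \<in> borel_measurable borel" "g \<in> borel_measurable borel" "h \<in> borel_measurable borel"
    and le: "\<And>x y. f x * g y \<le> (h ((x + y) / 2))\<^sup>2"
  shows "(\<integral>\<^sup>+x. f x \<partial>lborel) * (\<integral>\<^sup>+x. g x \<partial>lborel) \<le> (\<integral>\<^sup>+x. h x \<partial>lborel)\<^sup>2"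
proof -
  define F where "F n q x = min (q x) (of_nat n)" for n :: nat and q :: "real \<Rightarrow> ennreal" and x
  have Fm[measurable]: "F n q \<in> borel_measurable borel" if [measurable]: "q \<in> borel_measurable borel" for n q
    unfolding F_def by measurable
  have Ftop: "F n q x < \<top>" for n q x unfolding F_def by (simp add: min_less_iff_disj of_nat_less_top)
  have Finc: "F i q x \<le> F j q x" if "i \<le> j" for i j q x unfolding F_def using that by (intro min.mono) auto
  have trunc: "(\<integral>\<^sup>+x. F n f x \<partial>lborel) * (\<integral>\<^sup>+x. F n g x \<partial>lborel) \<le> (\<integral>\<^sup>+x. h x \<partial>lborel)\<^sup>2" for n
  proof -
    have e: "ennreal (enn2real (F n q x)) = F n q x" for q x using Ftop by simp
    have "(\<integral>\<^sup>+x. ennreal (enn2real (F n f x)) \<partial>lborel) * (\<integral>\<^sup>+x. ennreal (enn2real (F n g x)) \<partial>lborel)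
        \<le> (\<integral>\<^sup>+x. ennreal (enn2real (F n h x)) \<partial>lborel)\<^sup>2"
    proof (rule prekopa_leindler_real_bounded[where C = "real n"])
      have b: "enn2real (F n q x) \<le> real n" for q x
      proof -
        have "F n q x \<le> ennreal (real n)" by (simp add: F_def ennreal_of_nat_eq_real_of_nat)
        then show ?thesis by (simp add: enn2real_leI)
      qed
      show "enn2real (F n f x) \<le> real n" "enn2real (F n g x) \<le> real n" for x by (rule b)+
      fix x y
      have "F n f x * F n g y \<le> (F n h ((x + y) / 2))\<^sup>2"
      proof (cases "h ((x + y) / 2) \<le> of_nat n")
        case True
        have "F n f x * F n g y \<le> f x * g y" unfolding F_def by (intro mult_mono) auto
        also have "\<dots> \<le> (h ((x + y) / 2))\<^sup>2" by (rule le)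
        finally show ?thesis using True by (simp add: F_def min_absorb1)
      next
        case False
        have "F n f x * F n g y \<le> of_nat n * of_nat n" unfolding F_def by (intro mult_mono) auto
        then show ?thesis using False by (simp add: F_def min_absorb2 power2_eq_square)
      qed
      then have "ennreal (enn2real (F n f x) * enn2real (F n g y)) \<le> ennreal ((enn2real (F n h ((x + y) / 2)))\<^sup>2)"
        by (simp add: ennreal_mult e power2_eq_square)
      then show "enn2real (F n f x) * enn2real (F n g y) \<le> (enn2real (F n h ((x + y) / 2)))\<^sup>2"
        by (subst (asm) ennreal_le_iff) auto
    qed auto
    then have "(\<integral>\<^sup>+x. F n f x \<partial>lborel) * (\<integral>\<^sup>+x. F n g x \<partial>lborel) \<le> (\<integral>\<^sup>+x. F n h x \<partial>lborel)\<^sup>2" unfolding e .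
    also have "\<dots> \<le> (\<integral>\<^sup>+x. h x \<partial>lborel)\<^sup>2" by (intro power_mono nn_integral_mono) (auto simp: F_def)
    finally show ?thesis .
  qed
  have sup: "(\<integral>\<^sup>+x. q x \<partial>lborel) = (SUP n. \<integral>\<^sup>+x. F n q x \<partial>lborel)" if [measurable]: "q \<in> borel_measurable borel" for q
  proof -
    have "(SUP n. F n q x) = q x" for x
    proof -
      have "(SUP n. F n q x) = min (q x) (SUP n. of_nat n)"
        unfolding F_def by (simp add: inf_min[symmetric] inf_SUP)
      also have "(SUP n. of_nat n :: ennreal) = \<top>" by (rule ennreal_SUP_of_nat_eq_top)
      finally show ?thesis by (simp add: min_absorb1)
    qed
    then have "(\<integral>\<^sup>+x. q x \<partial>lborel) = (\<integral>\<^sup>+x. (SUP n. F n q x) \<partial>lborel)" by simp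
    also have "\<dots> = (SUP n. \<integral>\<^sup>+x. F n q x \<partial>lborel)"
      by (rule nn_integral_monotone_convergence_SUP) (auto simp: incseq_def le_fun_def Finc)
    finally show ?thesis .
  qed
  have Iinc: "(\<integral>\<^sup>+x. F i q x \<partial>lborel) \<le> (\<integral>\<^sup>+x. F j q x \<partial>lborel)" if "i \<le> j" for i j q
    using Finc[OF that] by (intro nn_integral_mono) auto
  have "(\<integral>\<^sup>+x. f x \<partial>lborel) * (\<integral>\<^sup>+x. g x \<partial>lborel) = (SUP i. (\<integral>\<^sup>+x. F i f x \<partial>lborel) * (SUP j. \<integral>\<^sup>+x. F j g x \<partial>lborel))"
    unfolding sup[OF m(1)] sup[OF m(2)] by (simp add: SUP_mult_right_ennreal)
  also have "\<dots> = (SUP i. SUP j. (\<integral>\<^sup>+x. F i f x \<partial>lborel) * (\<integral>\<^sup>+x. F j g x \<partial>lborel))"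
    by (simp add: SUP_mult_left_ennreal)
  also have "\<dots> \<le> (\<integral>\<^sup>+x. h x \<partial>lborel)\<^sup>2"
  proof (intro SUP_least)
    fix i j :: nat
    have "(\<integral>\<^sup>+x. F i f x \<partial>lborel) * (\<integral>\<^sup>+x. F j g x \<partial>lborel) \<le> (\<integral>\<^sup>+x. F (max i j) f x \<partial>lborel) * (\<integral>\<^sup>+x. F (max i j) g x \<partial>lborel)"
      by (intro mult_mono Iinc) auto
    also note trunc
    finally show "(\<integral>\<^sup>+x. F i f x \<partial>lborel) * (\<integral>\<^sup>+x. F j g x \<partial>lborel) \<le> (\<integral>\<^sup>+x. h x \<partial>lborel)\<^sup>2" .
  qed
  finally show ?thesis .
qed

text \<open>Induction on coordinates: the hypothesis of the one-dimensional inequality for the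
  functions obtained by integrating over \<open>J\<close> is the induction hypothesis for the
  sections at \<open>s\<close>, \<open>t\<close> and their midpoint.\<close>

lemma prekopa_leindler:
  fixes f g h :: "(nat \<Rightarrow> real) \<Rightarrow> ennreal"
  assumes J: "finite J"
    and m: "f \<in> borel_measurable (\<Pi>\<^sub>M j\<in>J. lborel)" "g \<in> borel_measurable (\<Pi>\<^sub>M j\<in>J. lborel)" "h \<in> borel_measurable (\<Pi>\<^sub>M j\<in>J. lborel)"
    and le: "\<And>x y. x \<in> extensional J \<Longrightarrow> y \<in> extensional J \<Longrightarrow> f x * g y \<le> (h (\<lambda>j\<in>J. (x j + y j) / 2))\<^sup>2"
  shows "(\<integral>\<^sup>+x. f x \<partial>(\<Pi>\<^sub>M j\<in>J. lborel)) * (\<integral>\<^sup>+x. g x \<partial>(\<Pi>\<^sub>M j\<in>J. lborel)) \<le> (\<integral>\<^sup>+x. h x \<partial>(\<Pi>\<^sub>M j\<in>J. lborel))\<^sup>2"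
  using J m le
proof (induction J arbitrary: f g h rule: finite_induct)
  case empty
  interpret product_sigma_finite "\<lambda>_. lborel :: real measure" by unfold_locales
  \<comment> \<open>Over the empty index set the product space is a single point, which is its own
    midpoint.\<close>
  have "(\<lambda>j\<in>{}. (undefined + undefined) / 2 :: real) = (\<lambda>_ :: nat. undefined)" by auto
  then show ?case using empty.prems(4)[of "\<lambda>_. undefined" "\<lambda>_. undefined"] by (simp add: nn_integral_empty)
next
  case (insert i J)
  interpret product_sigma_finite "\<lambda>_. lborel :: real measure" by unfold_locales
  interpret J: sigma_finite_measure "\<Pi>\<^sub>M j\<in>J. (lborel :: real measure)" by (rule sigma_finite[OF insert.hyps(1)])
  have upd: "(\<lambda>x. fun_upd x i s) \<in> measurable (\<Pi>\<^sub>M j\<in>J. lborel) (\<Pi>\<^sub>M j\<in>insert i J. lborel)" for s :: real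
  proof -
    have "(\<lambda>x. (\<lambda>(f, y). fun_upd f i y) (x, s)) \<in> measurable (\<Pi>\<^sub>M j\<in>J. lborel) (\<Pi>\<^sub>M j\<in>insert i J. lborel)"
      by (rule measurable_compose[OF _ measurable_add_dim]) (simp add: space_lborel)
    then show ?thesis by simp
  qed
  have sec: "(\<lambda>s. \<integral>\<^sup>+x. q (fun_upd x i s) \<partial>(\<Pi>\<^sub>M j\<in>J. lborel)) \<in> borel_measurable borel"
    if q: "q \<in> borel_measurable (\<Pi>\<^sub>M j\<in>insert i J. lborel)" for q :: "(nat \<Rightarrow> real) \<Rightarrow> ennreal"
  proof -
    have "(\<lambda>(s, x). q (fun_upd x i s)) \<in> borel_measurable (lborel \<Otimes>\<^sub>M (\<Pi>\<^sub>M j\<in>J. lborel))"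
    proof -
      have "(\<lambda>p. (\<lambda>(f, y). fun_upd f i y) (snd p, fst p)) \<in> measurable (lborel \<Otimes>\<^sub>M (\<Pi>\<^sub>M j\<in>J. lborel)) (\<Pi>\<^sub>M j\<in>insert i J. (lborel :: real measure))"
        by (rule measurable_compose[OF _ measurable_add_dim]) measurable
      from measurable_compose[OF this q] show ?thesis by (simp add: case_prod_beta')
    qed
    from J.borel_measurable_nn_integral[OF this] show ?thesis by simp
  qed
  have "(\<integral>\<^sup>+s. (\<integral>\<^sup>+x. f (fun_upd x i s) \<partial>(\<Pi>\<^sub>M j\<in>J. lborel)) \<partial>lborel) * (\<integral>\<^sup>+s. (\<integral>\<^sup>+x. g (fun_upd x i s) \<partial>(\<Pi>\<^sub>M j\<in>J. lborel)) \<partial>lborel)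
      \<le> (\<integral>\<^sup>+s. (\<integral>\<^sup>+x. h (fun_upd x i s) \<partial>(\<Pi>\<^sub>M j\<in>J. lborel)) \<partial>lborel)\<^sup>2"
  proof (rule prekopa_leindler_real[OF sec[OF insert.prems(1)] sec[OF insert.prems(2)] sec[OF insert.prems(3)]])
    fix s t :: real
    show "(\<integral>\<^sup>+x. f (fun_upd x i s) \<partial>(\<Pi>\<^sub>M j\<in>J. lborel)) * (\<integral>\<^sup>+x. g (fun_upd x i t) \<partial>(\<Pi>\<^sub>M j\<in>J. lborel))
      \<le> (\<integral>\<^sup>+x. h (fun_upd x i ((s + t) / 2)) \<partial>(\<Pi>\<^sub>M j\<in>J. lborel))\<^sup>2"
    proof (rule insert.IH)
      show "(\<lambda>x. f (fun_upd x i s)) \<in> borel_measurable (\<Pi>\<^sub>M j\<in>J. lborel)" by (rule measurable_compose[OF upd insert.prems(1)])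
      show "(\<lambda>x. g (fun_upd x i t)) \<in> borel_measurable (\<Pi>\<^sub>M j\<in>J. lborel)" by (rule measurable_compose[OF upd insert.prems(2)])
      show "(\<lambda>x. h (fun_upd x i ((s + t) / 2))) \<in> borel_measurable (\<Pi>\<^sub>M j\<in>J. lborel)" by (rule measurable_compose[OF upd insert.prems(3)])
      fix x y :: "nat \<Rightarrow> real" assume xy: "x \<in> extensional J" "y \<in> extensional J"
      have ext: "fun_upd x i s \<in> extensional (insert i J)" "fun_upd y i t \<in> extensional (insert i J)"
        using xy by (auto simp: extensional_def)
      have eq: "(\<lambda>j\<in>insert i J. (fun_upd x i s j + fun_upd y i t j) / 2) = fun_upd (\<lambda>j\<in>J. (x j + y j) / 2) i ((s + t) / 2)"
        using insert.hyps(2) by (auto simp: fun_eq_iff)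
      show "f (fun_upd x i s) * g (fun_upd y i t) \<le> (h (fun_upd (\<lambda>j\<in>J. (x j + y j) / 2) i ((s + t) / 2)))\<^sup>2"
        using insert.prems(4)[OF ext] unfolding eq .
    qed
  qed
  then show ?case
    using insert.prems(1-3) by (simp add: product_nn_integral_insert_rev[OF insert.hyps])
qed


section \<open>Log-concavity of one-dimensional marginals\<close>

lemma exp_minus_midpoint:
  assumes "a \<noteq> -\<infinity>" "b \<noteq> -\<infinity>" "c \<noteq> -\<infinity>" and le: "c \<le> ereal (1 / 2) * a + ereal (1 - 1 / 2) * b"
  shows "exp_minus a * exp_minus b \<le> (exp_minus c)\<^sup>2"
proof (cases "a = \<infinity> \<or> b = \<infinity>")
  case True
  then show ?thesis by (auto simp: exp_minus_def)
next
  case False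
  then obtain a' b' where ab: "a = ereal a'" "b = ereal b'" using assms by (cases a; cases b) auto
  then obtain c' where c: "c = ereal c'" "c' \<le> a' / 2 + b' / 2" using assms by (cases c) auto
  have "exp (- a') * exp (- b') \<le> (exp (- c'))\<^sup>2"
    unfolding exp_add[symmetric] exp_double[symmetric] using c(2) by simp
  then have "ennreal (exp (- a') * exp (- b')) \<le> ennreal ((exp (- c'))\<^sup>2)" by (rule ennreal_leI)
  then show ?thesis unfolding ab c by (simp add: exp_minus_def ennreal_mult power2_eq_square)
qed

text \<open>Prekopa--Leindler for the density multiplied by the indicators of the three slabs.
  Convexity of \<open>V\<close> at the midpoint handles the densities, and linearity of the product
  with \<open>v\<close> together with \<open>mid\<close> handles the indicators.\<close>

lemma log_concave_midpoint:
  assumes law: "vec_law p \<mu>" and lc: "log_concave p \<mu>" and v: "v \<in> carrier_vec p"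
    and s: "A \<in> sets borel" "B \<in> sets borel" "C \<in> sets borel"
    and mid: "\<And>a b. a \<in> A \<Longrightarrow> b \<in> B \<Longrightarrow> (a + b) / 2 \<in> C"
  shows "emeasure \<mu> {y \<in> space \<mu>. v \<bullet> y \<in> A} * emeasure \<mu> {y \<in> space \<mu>. v \<bullet> y \<in> B} \<le> (emeasure \<mu> {y \<in> space \<mu>. v \<bullet> y \<in> C})\<^sup>2"
proof -
  obtain V :: "real vec \<Rightarrow> ereal" where V: "\<And>x. x \<in> carrier_vec p \<Longrightarrow> V x \<noteq> -\<infinity>"
    and conv: "\<And>x y s. x \<in> carrier_vec p \<Longrightarrow> y \<in> carrier_vec p \<Longrightarrow> s \<in> {0..1} \<Longrightarrow>
           V (s \<cdot>\<^sub>v x + (1 - s) \<cdot>\<^sub>v y) \<le> ereal s * V x + ereal (1 - s) * V y"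
    and Vm: "(\<lambda>x. exp_minus (V x)) \<in> borel_measurable (lborel_vec p)"
    and \<mu>: "\<mu> = density (lborel_vec p) (\<lambda>x. exp_minus (V x))"
    using lc unfolding log_concave_def by blast
  let ?P = "\<Pi>\<^sub>M j\<in>{..<p}. (lborel :: real measure)"
  let ?vec = "Matrix.vec p :: (nat \<Rightarrow> real) \<Rightarrow> real vec"
  have sp: "space ?P = (\<Pi>\<^sub>E j\<in>{..<p}. UNIV)" by (simp add: space_PiM)
  have inj: "inj_on ?vec (space ?P)" unfolding sp by (rule inj_on_vec_PiE)
  have vm: "?vec \<in> measurable ?P (lborel_vec p)" unfolding lborel_vec_def by (rule measurable_embed_measure2'[OF inj])
  \<comment> \<open>The integrand is pulled back to the product of real lines, where
    Prekopa--Leindler was proved; \<open>lborel_vec\<close> is the image of that product.\<close>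
  define q where "q S x = exp_minus (V (?vec x)) * indicator S (v \<bullet> ?vec x)" for S :: "real set" and x
  have eval: "emeasure \<mu> {y \<in> space \<mu>. v \<bullet> y \<in> S} = (\<integral>\<^sup>+x. q S x \<partial>?P) \<and> q S \<in> borel_measurable ?P" if S: "S \<in> sets borel" for S
  proof
    have lawm: "sets \<mu> = sets (lborel_vec p)" using law by (simp add: vec_law_def)
    have set: "{y \<in> space \<mu>. v \<bullet> y \<in> S} \<in> sets (lborel_vec p)"
      using measurable_sets[OF measurable_scalar_prod[OF law v] S] lawm by (simp add: vimage_def Int_def conj_commute)
    have sm: "space \<mu> = carrier_vec p" by (rule vec_law_space[OF law])
    have gm: "(\<lambda>y. exp_minus (V y) * indicator {y \<in> space \<mu>. v \<bullet> y \<in> S} y) \<in> borel_measurable (lborel_vec p)"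
      using Vm set by (intro borel_measurable_times_ennreal borel_measurable_indicator) auto
    have eq: "exp_minus (V (?vec x)) * indicator {y \<in> space \<mu>. v \<bullet> y \<in> S} (?vec x) = q S x" for x
      unfolding q_def sm by (simp add: indicator_def)
    have "emeasure \<mu> {y \<in> space \<mu>. v \<bullet> y \<in> S} = (\<integral>\<^sup>+y. exp_minus (V y) * indicator {y \<in> space \<mu>. v \<bullet> y \<in> S} y \<partial>lborel_vec p)"
      by (subst (1) \<mu>) (rule emeasure_density[OF Vm set])
    also have "\<dots> = (\<integral>\<^sup>+x. exp_minus (V (?vec x)) * indicator {y \<in> space \<mu>. v \<bullet> y \<in> S} (?vec x) \<partial>?P)"
      unfolding lborel_vec_def by (rule nn_integral_embed_measure'[OF inj gm[unfolded lborel_vec_def]])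
    finally show "emeasure \<mu> {y \<in> space \<mu>. v \<bullet> y \<in> S} = (\<integral>\<^sup>+x. q S x \<partial>?P)" unfolding eq .
    show "q S \<in> borel_measurable ?P" using measurable_compose[OF vm gm] unfolding eq .
  qed
  have "(\<integral>\<^sup>+x. q A x \<partial>?P) * (\<integral>\<^sup>+x. q B x \<partial>?P) \<le> (\<integral>\<^sup>+x. q C x \<partial>?P)\<^sup>2"
  proof (rule prekopa_leindler)
    fix x y :: "nat \<Rightarrow> real"
    let ?m = "\<lambda>j\<in>{..<p}. (x j + y j) / 2"
    have xy: "?vec x \<in> carrier_vec p" "?vec y \<in> carrier_vec p" "?vec ?m \<in> carrier_vec p" by simp_all
    have m: "?vec ?m = (1 / 2) \<cdot>\<^sub>v ?vec x + (1 - 1 / 2) \<cdot>\<^sub>v ?vec y" by (intro eq_vecI) auto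
    show "q A x * q B y \<le> (q C ?m)\<^sup>2"
    proof (cases "v \<bullet> ?vec x \<in> A \<and> v \<bullet> ?vec y \<in> B")
      case False
      then show ?thesis by (auto simp: q_def)
    next
      case True
      have "v \<bullet> ?vec ?m = (v \<bullet> ?vec x + v \<bullet> ?vec y) / 2"
        unfolding m using v by (simp add: scalar_prod_add_distrib[of _ p])
      then have "v \<bullet> ?vec ?m \<in> C" using mid[of "v \<bullet> ?vec x" "v \<bullet> ?vec y"] True by (simp only:)
      moreover have "exp_minus (V (?vec x)) * exp_minus (V (?vec y)) \<le> (exp_minus (V (?vec ?m)))\<^sup>2"
      proof (rule exp_minus_midpoint[OF V[OF xy(1)] V[OF xy(2)] V[OF xy(3)]])
        show "V (?vec ?m) \<le> ereal (1 / 2) * V (?vec x) + ereal (1 - 1 / 2) * V (?vec y)"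
          unfolding m by (rule conv[OF xy(1,2)]) simp
      qed
      ultimately show ?thesis using True by (simp add: q_def)
    qed
  qed (use eval s in auto)
  then show ?thesis using eval s by simp
qed

text \<open>
  Borell's argument: were \<open>\<bar>v \<bullet> y\<bar> \<le> t\<close> with probability above \<open>3 / 4\<close>, the tails beyond
  \<open>(3 * 2 ^ k - 1) t\<close> would square at each step and the variance could not reach \<open>1\<close>.
\<close>

lemma log_concave_tail_recursion:
  assumes law: "vec_law p \<mu>" and lc: "log_concave p \<mu>" and v: "v \<in> carrier_vec p" and t: "0 < t"
    and \<rho>: "3 / 4 \<le> measure \<mu> {y \<in> space \<mu>. \<bar>v \<bullet> y\<bar> \<le> t}"
  shows "measure \<mu> {y \<in> space \<mu>. (3 * 2 ^ k - 1) * t \<le> v \<bullet> y} \<le> 3 / 4 * (1 / 3) ^ (2 ^ k)"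
proof (induction k)
  interpret prob_space \<mu> by (rule vec_law_prob[OF law])
  have [measurable]: "(\<lambda>y. v \<bullet> y) \<in> borel_measurable \<mu>" by (rule measurable_scalar_prod[OF law v])
  \<comment> \<open>At most 1/4 of the mass lies outside the slab, and this is
    \<open>3 / 4 * (1 / 3)\<close>.\<close>
  case 0
  have "measure \<mu> {y \<in> space \<mu>. \<bar>v \<bullet> y\<bar> \<le> t} + measure \<mu> {y \<in> space \<mu>. 2 * t \<le> v \<bullet> y} =
      measure \<mu> ({y \<in> space \<mu>. \<bar>v \<bullet> y\<bar> \<le> t} \<union> {y \<in> space \<mu>. 2 * t \<le> v \<bullet> y})"
    using t by (intro finite_measure_Union[symmetric]) auto
  also have "\<dots> \<le> 1" by (rule prob_le_1)
  finally show ?case using \<rho> by simp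
next
  interpret prob_space \<mu> by (rule vec_law_prob[OF law])
  case (Suc k)
  let ?T = "\<lambda>k. measure \<mu> {y \<in> space \<mu>. (3 * 2 ^ k - 1) * t \<le> v \<bullet> y}"
  \<comment> \<open>Midpoints of the slab and the farther half-space lie in the nearer one, because
    \<open>(- 1 + (3 * 2 ^ Suc k - 1)) / 2 = 3 * 2 ^ k - 1\<close>.\<close>
  have "emeasure \<mu> {y \<in> space \<mu>. v \<bullet> y \<in> {-t..t}} * emeasure \<mu> {y \<in> space \<mu>. v \<bullet> y \<in> {(3 * 2 ^ Suc k - 1) * t..}}
      \<le> (emeasure \<mu> {y \<in> space \<mu>. v \<bullet> y \<in> {(3 * 2 ^ k - 1) * t..}})\<^sup>2"
  proof (rule log_concave_midpoint[OF law lc v])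
    fix a b assume "a \<in> {-t..t}" "b \<in> {(3 * 2 ^ Suc k - 1) * t..}"
    then have "- t \<le> a" "(3 * 2 ^ Suc k - 1) * t \<le> b" by auto
    then have "- t + (3 * 2 ^ Suc k - 1) * t \<le> a + b" by linarith
    moreover have "- t + (3 * 2 ^ Suc k - 1) * t = 2 * ((3 * 2 ^ k - 1) * t)" by (simp add: algebra_simps)
    ultimately show "(a + b) / 2 \<in> {(3 * 2 ^ k - 1) * t..}" by simp
  qed auto
  moreover have "{y \<in> space \<mu>. v \<bullet> y \<in> {-t..t}} = {y \<in> space \<mu>. \<bar>v \<bullet> y\<bar> \<le> t}" by auto
  ultimately have "ennreal (measure \<mu> {y \<in> space \<mu>. \<bar>v \<bullet> y\<bar> \<le> t} * ?T (Suc k)) \<le> ennreal ((?T k)\<^sup>2)"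
    by (simp add: emeasure_eq_measure ennreal_mult power2_eq_square)
  then have "measure \<mu> {y \<in> space \<mu>. \<bar>v \<bullet> y\<bar> \<le> t} * ?T (Suc k) \<le> (?T k)\<^sup>2" by (subst (asm) ennreal_le_iff) auto
  moreover have "3 / 4 * ?T (Suc k) \<le> measure \<mu> {y \<in> space \<mu>. \<bar>v \<bullet> y\<bar> \<le> t} * ?T (Suc k)"
    using \<rho> by (rule mult_right_mono) simp
  moreover have "(?T k)\<^sup>2 \<le> (3 / 4 * (1 / 3) ^ (2 ^ k))\<^sup>2" using Suc.IH by (intro power_mono) auto
  \<comment> \<open>Dividing 9/16 by the slab probability 3/4 restores the prefactor 3/4; this fixes
    its choice.\<close>
  moreover have "(3 / 4 * (1 / 3) ^ (2 ^ k) :: real)\<^sup>2 = 9 / 16 * (1 / 3) ^ (2 ^ Suc k)"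
    by (simp add: power_mult_distrib power_mult[symmetric] mult.commute power_divide)
  ultimately show ?case by linarith
qed

text \<open>If the form were small too often, the recursion for \<open>v\<close> and
  \<open>- v\<close> would make its tails decay so fast that slicing at the thresholds
  \<open>s k\<close> gives a second moment below the true value \<open>N\<^sup>2\<close>. Between
  consecutive thresholds the form is at most \<open>6 * 2 ^ k * t\<close>.\<close>

lemma log_concave_anti_conc:
  assumes law: "vec_law p \<mu>" and iso: "isotropic p \<mu>" and lc: "log_concave p \<mu>"
  shows "anti_conc p (1 / 12) (1 / 4) \<mu>"
  unfolding anti_conc_def
proof (intro ballI)
  fix v :: "real vec" assume v: "v \<in> carrier_vec p"
  interpret prob_space \<mu> by (rule vec_law_prob[OF law])
  have vm[measurable]: "(\<lambda>y. v \<bullet> y) \<in> borel_measurable \<mu>" by (rule measurable_scalar_prod[OF law v])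
  define N where "N = eucl_norm v"
  show "1 / 4 \<le> measure \<mu> {y \<in> space \<mu>. 1 / 12 * eucl_norm v \<le> \<bar>v \<bullet> y\<bar>}"
  proof (cases "N = 0")
    case True
    then have E: "{y \<in> space \<mu>. 1 / 12 * eucl_norm v \<le> \<bar>v \<bullet> y\<bar>} = space \<mu>" by (auto simp: N_def)
    show ?thesis unfolding E prob_space by simp
  next
    case False
    then have N: "0 < N" by (metis N_def eucl_norm_ge_0 order_le_imp_less_or_eq)
    \<comment> \<open>The slices will sum to \<open>(4 + 72 * 9 / 5) * t\<^sup>2\<close>, that is
      133.6 times \<open>t\<^sup>2\<close>, which stays below
      \<open>144 * t\<^sup>2 = N\<^sup>2\<close>.\<close>
    define t where "t = N / 12"
    have t: "0 < t" using N by (simp add: t_def)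
    show ?thesis
    proof (rule ccontr)
      assume "\<not> 1 / 4 \<le> measure \<mu> {y \<in> space \<mu>. 1 / 12 * eucl_norm v \<le> \<bar>v \<bullet> y\<bar>}"
      then have small: "measure \<mu> {y \<in> space \<mu>. t \<le> \<bar>v \<bullet> y\<bar>} < 1 / 4" by (simp add: t_def N_def)
      have "1 - measure \<mu> {y \<in> space \<mu>. t \<le> \<bar>v \<bullet> y\<bar>} = measure \<mu> (space \<mu> - {y \<in> space \<mu>. t \<le> \<bar>v \<bullet> y\<bar>})"
        by (rule prob_compl[symmetric]) measurable
      also have "\<dots> \<le> measure \<mu> {y \<in> space \<mu>. \<bar>v \<bullet> y\<bar> \<le> t}" by (intro finite_measure_mono) auto
      finally have \<rho>: "3 / 4 \<le> measure \<mu> {y \<in> space \<mu>. \<bar>v \<bullet> y\<bar> \<le> t}" using small by linarith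
      define s where "s k = (3 * 2 ^ k - 1) * t" for k :: nat
      have neg: "(- v) \<bullet> y = - (v \<bullet> y)" if "y \<in> space \<mu>" for y using that v vec_law_space[OF law] by simp
      have nv: "- v \<in> carrier_vec p" using v by simp
      have "{y \<in> space \<mu>. \<bar>(- v) \<bullet> y\<bar> \<le> t} = {y \<in> space \<mu>. \<bar>v \<bullet> y\<bar> \<le> t}" using neg by auto
      then have \<rho>': "3 / 4 \<le> measure \<mu> {y \<in> space \<mu>. \<bar>(- v) \<bullet> y\<bar> \<le> t}" using \<rho> by simp
      \<comment> \<open>The doubly exponential decay is relaxed to a geometric one, which still
        beats the growth \<open>4 ^ k\<close> of the squared thresholds.\<close>
      have tail: "measure \<mu> {y \<in> space \<mu>. s k \<le> \<bar>v \<bullet> y\<bar>} \<le> 2 * (1 / 9) ^ k" for k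
      proof -
        have sub: "{y \<in> space \<mu>. s k \<le> \<bar>v \<bullet> y\<bar>} \<subseteq> {y \<in> space \<mu>. s k \<le> v \<bullet> y} \<union> {y \<in> space \<mu>. s k \<le> (- v) \<bullet> y}"
        proof
          fix y assume "y \<in> {y \<in> space \<mu>. s k \<le> \<bar>v \<bullet> y\<bar>}"
          then show "y \<in> {y \<in> space \<mu>. s k \<le> v \<bullet> y} \<union> {y \<in> space \<mu>. s k \<le> (- v) \<bullet> y}"
            using neg[of y] by (auto simp: abs_if split: if_splits)
        qed
        have [measurable]: "(\<lambda>y. (- v) \<bullet> y) \<in> borel_measurable \<mu>" by (rule measurable_scalar_prod[OF law nv])
        have "measure \<mu> {y \<in> space \<mu>. s k \<le> \<bar>v \<bullet> y\<bar>} \<le> measure \<mu> ({y \<in> space \<mu>. s k \<le> v \<bullet> y} \<union> {y \<in> space \<mu>. s k \<le> (- v) \<bullet> y})"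
          by (rule finite_measure_mono[OF sub]) measurable
        also have "\<dots> \<le> measure \<mu> {y \<in> space \<mu>. s k \<le> v \<bullet> y} + measure \<mu> {y \<in> space \<mu>. s k \<le> (- v) \<bullet> y}"
          by (rule measure_Un_le) measurable
        also have "\<dots> \<le> 3 / 4 * (1 / 3) ^ (2 ^ k) + 3 / 4 * (1 / 3) ^ (2 ^ k)"
          unfolding s_def by (intro add_mono log_concave_tail_recursion[OF law lc _ t] v nv \<rho> \<rho>')
        also have "\<dots> \<le> 2 * (1 / 3) ^ (2 ^ k)" by simp
        also have "(1 / 3 :: real) ^ (2 ^ k) \<le> (1 / 3) ^ (2 * k)"
        proof (rule power_decreasing)
          show "2 * k \<le> 2 ^ k"
          proof (cases k)
            case (Suc m)
            have "Suc m \<le> 2 ^ m" by (induction m) auto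
            then show ?thesis by (simp add: Suc)
          qed simp
        qed auto
        also have "(1 / 3 :: real) ^ (2 * k) = (1 / 9) ^ k" by (simp add: power_mult power2_eq_square)
        finally show ?thesis by simp
      qed
      define f where "f k y = ennreal (36 * t\<^sup>2 * 4 ^ k) * indicator {y \<in> space \<mu>. s k \<le> \<bar>v \<bullet> y\<bar>} y" for k :: nat and y
      have [measurable]: "f k \<in> borel_measurable \<mu>" for k unfolding f_def by measurable
      have pt: "ennreal ((v \<bullet> y)\<^sup>2) \<le> ennreal (4 * t\<^sup>2) + (\<Sum>k. f k y)" if y: "y \<in> space \<mu>" for y
      proof (cases "\<bar>v \<bullet> y\<bar> < s 0")
        case True
        then have "\<bar>v \<bullet> y\<bar>\<^sup>2 \<le> (2 * t)\<^sup>2" by (intro power_mono) (auto simp: s_def)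
        then have "ennreal ((v \<bullet> y)\<^sup>2) \<le> ennreal (4 * t\<^sup>2)" by (intro ennreal_leI) (simp add: power_mult_distrib)
        then show ?thesis by (rule order_trans) simp
      next
        case False
        have "\<exists>k. \<bar>v \<bullet> y\<bar> < s k"
        proof -
          obtain n :: nat where n: "\<bar>v \<bullet> y\<bar> / t < real n" using reals_Archimedean2 by blast
          have "real n \<le> 3 * 2 ^ n - 1"
          proof -
            have "real n < 2 ^ n" by (rule of_nat_less_two_power)
            moreover have "(1 :: real) \<le> 2 ^ n" by simp
            ultimately show ?thesis by linarith
          qed
          then have "real n * t \<le> s n" unfolding s_def using t by (intro mult_right_mono) auto
          moreover have "\<bar>v \<bullet> y\<bar> < real n * t" using n t by (simp add: pos_divide_less_eq)
          ultimately show ?thesis by (intro exI[of _ n]) linarith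
        qed
        define k where "k = (LEAST k. \<bar>v \<bullet> y\<bar> < s k)"
        have k: "\<bar>v \<bullet> y\<bar> < s k" unfolding k_def using \<open>\<exists>k. \<bar>v \<bullet> y\<bar> < s k\<close> by (rule LeastI_ex)
        then obtain j where j: "k = Suc j" using False by (cases k) auto
        have sj: "s j \<le> \<bar>v \<bullet> y\<bar>" using not_less_Least[of j "\<lambda>k. \<bar>v \<bullet> y\<bar> < s k"] j by (simp add: k_def[symmetric] not_less)
        have "\<bar>v \<bullet> y\<bar> \<le> 6 * 2 ^ j * t"
        proof -
          have "s k \<le> (6 * 2 ^ j) * t" unfolding s_def j using t by (intro mult_right_mono) auto
          then show ?thesis using k by linarith
        qed
        then have "\<bar>v \<bullet> y\<bar>\<^sup>2 \<le> (6 * 2 ^ j * t)\<^sup>2" by (intro power_mono) auto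
        also have "(6 * 2 ^ j * t)\<^sup>2 = 36 * t\<^sup>2 * 4 ^ j"
        proof -
          have "(2 ^ j :: real)\<^sup>2 = 4 ^ j" by (simp add: power_mult[symmetric] mult.commute[of j] power_mult)
          then show ?thesis by (simp add: power_mult_distrib)
        qed
        finally have "ennreal ((v \<bullet> y)\<^sup>2) \<le> ennreal (36 * t\<^sup>2 * 4 ^ j)" by (intro ennreal_leI) simp
        also have "\<dots> = (\<Sum>k\<in>{j}. f k y)" using sj y by (simp add: f_def)
        also have "\<dots> \<le> (\<Sum>k. f k y)" by (rule sum_le_suminf) (auto simp: f_def)
        also have "\<dots> \<le> ennreal (4 * t\<^sup>2) + (\<Sum>k. f k y)" by simp
        finally show ?thesis .
      qed
      have fint: "(\<integral>\<^sup>+y. f k y \<partial>\<mu>) \<le> ennreal (72 * t\<^sup>2 * (4 / 9) ^ k)" for k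
      proof -
        have "(\<integral>\<^sup>+y. f k y \<partial>\<mu>) = ennreal (36 * t\<^sup>2 * 4 ^ k) * emeasure \<mu> {y \<in> space \<mu>. s k \<le> \<bar>v \<bullet> y\<bar>}"
          unfolding f_def by (rule nn_integral_cmult_indicator) measurable
        also have "\<dots> = ennreal (36 * t\<^sup>2 * 4 ^ k * measure \<mu> {y \<in> space \<mu>. s k \<le> \<bar>v \<bullet> y\<bar>})"
          unfolding emeasure_eq_measure by (rule ennreal_mult[symmetric]) auto
        also have "\<dots> \<le> ennreal (36 * t\<^sup>2 * 4 ^ k * (2 * (1 / 9) ^ k))"
          using tail[of k] by (intro ennreal_leI mult_left_mono) auto
        also have "36 * t\<^sup>2 * 4 ^ k * (2 * (1 / 9) ^ k) = 72 * t\<^sup>2 * (4 ^ k * (1 / 9) ^ k)" by simp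
        also have "(4 ^ k * (1 / 9) ^ k :: real) = (4 / 9) ^ k" by (simp add: power_mult_distrib[symmetric])
        finally show ?thesis .
      qed
      have "(\<integral>\<^sup>+y. ennreal ((v \<bullet> y)\<^sup>2) \<partial>\<mu>) \<le> (\<integral>\<^sup>+y. ennreal (4 * t\<^sup>2) + (\<Sum>k. f k y) \<partial>\<mu>)"
        by (rule nn_integral_mono) (rule pt)
      also have "\<dots> = ennreal (4 * t\<^sup>2) + (\<Sum>k. \<integral>\<^sup>+y. f k y \<partial>\<mu>)"
        by (subst nn_integral_add) (simp_all add: nn_integral_suminf emeasure_space_1)
      also have "\<dots> \<le> ennreal (4 * t\<^sup>2) + (\<Sum>k. ennreal (72 * t\<^sup>2 * (4 / 9) ^ k))"
        by (intro add_left_mono suminf_le summableI fint)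
      also have "(\<Sum>k. ennreal (72 * t\<^sup>2 * (4 / 9) ^ k)) = ennreal (\<Sum>k. 72 * t\<^sup>2 * (4 / 9) ^ k)"
        by (intro suminf_ennreal2 summable_mult summable_geometric) auto
      also have "(\<Sum>k. 72 * t\<^sup>2 * (4 / 9 :: real) ^ k) = 72 * t\<^sup>2 * (9 / 5)"
        by (subst suminf_mult) (auto intro!: summable_geometric simp: suminf_geometric)
      also have "ennreal (4 * t\<^sup>2) + ennreal (72 * t\<^sup>2 * (9 / 5)) = ennreal (4 * t\<^sup>2 + 72 * t\<^sup>2 * (9 / 5))"
        by (rule ennreal_plus[symmetric]) auto
      finally have up: "(\<integral>\<^sup>+y. ennreal ((v \<bullet> y)\<^sup>2) \<partial>\<mu>) \<le> ennreal (4 * t\<^sup>2 + 72 * t\<^sup>2 * (9 / 5))" .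
      have eq: "(v \<bullet> y)\<^sup>2 = y \<bullet> (outer v *\<^sub>v y)" if "y \<in> space \<mu>" for y
      proof -
        have y: "y \<in> carrier_vec p" using that vec_law_space[OF law] by simp
        show ?thesis unfolding outer_vec[OF v y] using y v comm_scalar_prod[OF y v] by (simp add: power2_eq_square)
      qed
      have tr: "mtrace (outer v) = N\<^sup>2"
        unfolding N_def eucl_norm_sq using v by (simp add: mtrace_def outer_def scalar_prod_sum[OF v v])
      have "(\<integral>\<^sup>+y. ennreal ((v \<bullet> y)\<^sup>2) \<partial>\<mu>) = (\<integral>\<^sup>+y. ennreal (y \<bullet> (outer v *\<^sub>v y)) \<partial>\<mu>)" by (intro nn_integral_cong) (simp only: eq)
      also have "\<dots> = ennreal (\<integral>y. y \<bullet> (outer v *\<^sub>v y) \<partial>\<mu>)"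
      proof (rule nn_integral_eq_integral[OF isotropic_second_moment(1)[OF law iso outer_carrier[OF v]]], rule AE_I2)
        fix y assume "y \<in> space \<mu>"
        then show "0 \<le> y \<bullet> (outer v *\<^sub>v y)" by (simp only: eq[symmetric] zero_le_power2)
      qed
      also have "\<dots> = ennreal (N\<^sup>2)" unfolding isotropic_second_moment(2)[OF law iso outer_carrier[OF v]] tr ..
      finally have "ennreal (N\<^sup>2) \<le> ennreal (4 * t\<^sup>2 + 72 * t\<^sup>2 * (9 / 5))" using up by simp
      then have "N\<^sup>2 \<le> 4 * t\<^sup>2 + 72 * t\<^sup>2 * (9 / 5)" by (subst (asm) ennreal_le_iff) auto
      moreover have "t\<^sup>2 = N\<^sup>2 / 144" by (simp add: t_def power_divide)
      moreover have "0 < N\<^sup>2" using N by simp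
      ultimately show False by linarith
    qed
  qed
qed

section \<open>Failure probabilities\<close>

lemma law_with_density_vec_law: "law_with_density p \<mu> \<Longrightarrow> vec_law p \<mu>"
  unfolding law_with_density_def vec_law_def by auto

lemma anti_conc_mono:
  assumes law: "vec_law p \<mu>" and ac: "anti_conc p t q \<mu>" and le: "t' \<le> t" "q' \<le> q"
  shows "anti_conc p t' q' \<mu>"
  unfolding anti_conc_def
proof (intro ballI)
  fix v :: "real vec" assume v: "v \<in> carrier_vec p"
  interpret prob_space \<mu> by (rule vec_law_prob[OF law])
  note m = measurable_scalar_prod[OF law v]
  have "q' \<le> measure \<mu> {y \<in> space \<mu>. t * eucl_norm v \<le> \<bar>v \<bullet> y\<bar>}" using ac v le by (force simp: anti_conc_def)
  also have "\<dots> \<le> measure \<mu> {y \<in> space \<mu>. t' * eucl_norm v \<le> \<bar>v \<bullet> y\<bar>}"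
  proof (rule finite_measure_mono)
    show "{y \<in> space \<mu>. t' * eucl_norm v \<le> \<bar>v \<bullet> y\<bar>} \<in> sets \<mu>" using m by measurable
    have "t' * eucl_norm v \<le> t * eucl_norm v" using le
      by (intro mult_right_mono) (auto simp: eucl_norm_def scalar_prod_def intro: sum_nonneg)
    then show "{y \<in> space \<mu>. t * eucl_norm v \<le> \<bar>v \<bullet> y\<bar>} \<subseteq> {y \<in> space \<mu>. t' * eucl_norm v \<le> \<bar>v \<bullet> y\<bar>}" by auto
  qed
  finally show "q' \<le> measure \<mu> {y \<in> space \<mu>. t' * eucl_norm v \<le> \<bar>v \<bullet> y\<bar>}" .
qed

lemma quad_conc_mono:
  assumes law: "vec_law p \<mu>" and qc: "quad_conc p t r \<mu>" and le: "t \<le> t'" "r \<le> r'"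
  shows "quad_conc p t' r' \<mu>"
  unfolding quad_conc_def
proof (intro allI impI)
  fix M assume M: "psd_mat p M" "\<forall>v \<in> carrier_vec p. v \<bullet> (M *\<^sub>v v) \<le> v \<bullet> v"
  interpret prob_space \<mu> by (rule vec_law_prob[OF law])
  have "M \<in> carrier_mat p p" using M by (simp add: psd_mat_def)
  note m = measurable_quad[OF law this]
  have "measure \<mu> {y \<in> space \<mu>. t' * real p < \<bar>y \<bullet> (M *\<^sub>v y) - mtrace M\<bar>}
      \<le> measure \<mu> {y \<in> space \<mu>. t * real p < \<bar>y \<bullet> (M *\<^sub>v y) - mtrace M\<bar>}"
  proof (rule finite_measure_mono)
    show "{y \<in> space \<mu>. t * real p < \<bar>y \<bullet> (M *\<^sub>v y) - mtrace M\<bar>} \<in> sets \<mu>" using m by measurable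
    have "t * real p \<le> t' * real p" using le by (intro mult_right_mono) auto
    then show "{y \<in> space \<mu>. t' * real p < \<bar>y \<bullet> (M *\<^sub>v y) - mtrace M\<bar>} \<subseteq> {y \<in> space \<mu>. t * real p < \<bar>y \<bullet> (M *\<^sub>v y) - mtrace M\<bar>}" by auto
  qed
  also have "\<dots> \<le> r" using qc M by (simp add: quad_conc_def)
  finally show "measure \<mu> {y \<in> space \<mu>. t' * real p < \<bar>y \<bullet> (M *\<^sub>v y) - mtrace M\<bar>} \<le> r'" using le by simp
qed

text \<open>The deterministic conclusion. Leverages do not see the scatter matrix, and multiplied by
  \<open>n / p\<close> they lie between the values of \<phi> at \<open>r1\<close> and
  \<open>r2\<close>, as \<open>maronna_unique_solution\<close> requires. The solution then has
  weights between \<open>u r2\<close> and \<open>u r1\<close>, both within \<epsilon> of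
  \<open>w\<close>.\<close>

lemma E_ME_of_leverage:
  fixes u :: "real \<Rightarrow> real"
  assumes u_pos: "\<And>r. 0 \<le> r \<Longrightarrow> 0 < u r" and u_anti: "antimono_on {0..} u"
    and n: "0 < n" and p: "0 < p" and \<gamma>: "real p / real n = \<gamma>"
    and law: "vec_law p \<mu>" and \<omega>: "\<omega> \<in> space (\<Pi>\<^sub>M i\<in>{..<n}. \<mu>)" and \<Sigma>: "pos_def_mat p \<Sigma>"
    and G: "pos_def_mat p (gram p 0 {..<n} \<omega>)"
    and lev: "\<And>i. i < n \<Longrightarrow> \<bar>\<omega> i \<bullet> (inv_mat (gram p 0 {..<n} \<omega>) *\<^sub>v \<omega> i) - \<gamma>\<bar> \<le> \<gamma> * \<eta>"
    and r: "0 < r1" "r1 \<le> r2" "r1 * u r1 = 1 - \<eta>" "r2 * u r2 = 1 + \<eta>"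
    and ur: "\<bar>u r1 - w\<bar> \<le> \<epsilon>" "\<bar>u r2 - w\<bar> \<le> \<epsilon>"
    and strict: "\<And>s c. r1 \<le> s \<Longrightarrow> s \<le> r2 \<Longrightarrow> 1 < c \<Longrightarrow> u (s / c) < c * u s \<and> u s < c * u (c * s)"
  shows "\<omega> \<in> E_ME u w n p \<mu> \<Sigma> \<epsilon>"
proof -
  let ?B = "mat_sqrt p \<Sigma>"
  let ?x = "\<lambda>i. ?B *\<^sub>v \<omega> i"
  have B: "pos_def_mat p ?B" by (rule mat_sqrt_pos_def[OF \<Sigma>])
  have y: "\<omega> i \<in> carrier_vec p" if "i < n" for i using sample_carrier[OF law \<omega>] that by simp
  have x: "?x i \<in> carrier_vec p" if "i < n" for i
    using B y[OF that] by (auto simp: pos_def_mat_def)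
  have Gx: "pos_def_mat p (gram p 0 {..<n} ?x)" by (rule leverage_transform(1)[OF y B G])
  have np: "real n / real p = 1 / \<gamma>" "0 < \<gamma>" using \<gamma> n p by auto
  have q: "1 - \<eta> \<le> real n / real p * (?x i \<bullet> (inv_mat (gram p 0 {..<n} ?x) *\<^sub>v ?x i))
      \<and> real n / real p * (?x i \<bullet> (inv_mat (gram p 0 {..<n} ?x) *\<^sub>v ?x i)) \<le> 1 + \<eta>" if i: "i < n" for i
  proof -
    define h where "h = \<omega> i \<bullet> (inv_mat (gram p 0 {..<n} \<omega>) *\<^sub>v \<omega> i)"
    have "?x i \<bullet> (inv_mat (gram p 0 {..<n} ?x) *\<^sub>v ?x i) = h"
      unfolding h_def by (rule leverage_transform(2)[OF y B G i])
    moreover have "\<gamma> - \<gamma> * \<eta> \<le> h" "h \<le> \<gamma> + \<gamma> * \<eta>" using lev[OF i] unfolding h_def by linarith+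
    then have "(1 - \<eta>) * \<gamma> \<le> h" "h \<le> (1 + \<eta>) * \<gamma>" by (simp_all add: algebra_simps)
    then have "1 - \<eta> \<le> h / \<gamma>" "h / \<gamma> \<le> 1 + \<eta>" using np(2) by (simp_all only: pos_le_divide_eq pos_divide_le_eq)
    ultimately show ?thesis unfolding np(1) by simp
  qed
  have anti: "u s \<le> u r" if "0 \<le> r" "r \<le> s" for r s
    using monotone_onD[OF u_anti, of r s] that by simp
  have lo: "u r1 * r1 \<le> real n / real p * (?x i \<bullet> (inv_mat (gram p 0 {..<n} ?x) *\<^sub>v ?x i))" if "i < n" for i
    using q[OF that] r(3) by (simp add: mult.commute)
  have hi: "real n / real p * (?x i \<bullet> (inv_mat (gram p 0 {..<n} ?x) *\<^sub>v ?x i)) \<le> u r2 * r2" if "i < n" for i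
    using q[OF that] r(4) by (simp add: mult.commute)
  have sol: "\<exists>!S. maronna_solution u n p ?x S"
    by (rule maronna_unique_solution(1)[where x = ?x, OF u_pos anti n p x Gx lo hi r(1,2) strict])
  have "\<bar>maronna_weight u p ?x S i - w\<bar> \<le> \<epsilon>" if S: "maronna_solution u n p ?x S" and i: "i < n" for S i
  proof -
    have "u r2 \<le> maronna_weight u p ?x S i \<and> maronna_weight u p ?x S i \<le> u r1"
      by (rule maronna_unique_solution(2)[where x = ?x, OF u_pos anti n p x Gx lo hi r(1,2) strict S i])
    then show ?thesis using ur by linarith
  qed
  then show ?thesis using sol \<omega> unfolding E_ME_def Let_def by blast
qed

lemma ratio_pos:
  assumes "real p / real n = \<gamma>" "0 < (\<gamma> :: real)"
  shows "0 < n" "0 < p" "real p = \<gamma> * real n"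
  using assms by (auto intro!: gr0I)

text \<open>Settles the range of parameters in which the claimed bound exceeds 1.\<close>

lemma prob_not_E_ME_le_1:
  assumes "vec_law p \<mu>"
  shows "prob_not_E_ME u w n p \<mu> \<Sigma> \<epsilon> \<le> 1"
proof -
  interpret product_prob_space "\<lambda>_. \<mu>" "{..<n}"
    using vec_law_prob[OF assms] by (intro product_prob_spaceI)
  have "prob_not_E_ME u w n p \<mu> \<Sigma> \<epsilon> \<le> outer_measure_of (\<Pi>\<^sub>M i\<in>{..<n}. \<mu>) (space (\<Pi>\<^sub>M i\<in>{..<n}. \<mu>))"
    unfolding prob_not_E_ME_def by (intro outer_measure_of_mono) auto
  also have "\<dots> = 1" by (simp add: outer_measure_of_eq P.emeasure_space_1)
  finally show ?thesis .
qed

text \<open>Two levels of concentration enter: the fixed level \<open>s\<close> secures the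
  eigenvalue bound, while \<open>a * \<epsilon>\<close> governs the accuracy of the weights. The
  condition \<open>1 \<le> a * \<epsilon> * n\<close> lets \<epsilon> absorb the deterministic
  leave-one-out error \<open>1 / (b * n)\<close>.\<close>

lemma maronna_failure_bound:
  fixes \<gamma> d\<^sub>0 \<phi>_lim :: real and u \<phi> :: "real \<Rightarrow> real"
  assumes \<gamma>: "0 < \<gamma>" "\<gamma> < 1"
    and u_pos: "\<And>x. x \<ge> 0 \<Longrightarrow> u x > 0" and u_anti: "antimono_on {0..} u" and u_cont: "continuous_on {0..} u"
    and \<phi>: "\<And>x. \<phi> x = x * u x" and \<phi>_mono: "mono_on {0..} \<phi>"
    and lim: "(\<phi> \<longlongrightarrow> \<phi>_lim) at_top" "\<phi>_lim > 1"
    and d0: "d\<^sub>0 \<ge> 0" "\<phi> d\<^sub>0 = 1"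
    and inv: "\<exists>\<delta>>0. \<exists>L. \<exists>\<phi>_inv. (\<forall>x\<ge>0. \<bar>\<phi> x - 1\<bar> < \<delta> \<longrightarrow> \<phi>_inv (\<phi> x) = x) \<and>
           L-lipschitz_on {1 - \<delta><..<1 + \<delta>} \<phi>_inv"
    and t: "0 < t" and q: "0 < q" "q \<le> 1"
  obtains s a c \<epsilon>\<^sub>0 N where "0 < s" "s \<le> 1" "0 < a" "0 < c" "0 < \<epsilon>\<^sub>0" "\<epsilon>\<^sub>0 \<le> 1" "a * \<epsilon>\<^sub>0 \<le> 1"
    "\<And>n p \<mu> \<Sigma> \<epsilon> r1 r2. N \<le> n \<Longrightarrow> real p / real n = \<gamma> \<Longrightarrow> vec_law p \<mu> \<Longrightarrow> isotropic p \<mu> \<Longrightarrow> anti_conc p t q \<mu> \<Longrightarrow>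
       0 \<le> r1 \<Longrightarrow> quad_conc p s r1 \<mu> \<Longrightarrow> 0 \<le> r2 \<Longrightarrow> quad_conc p (a * \<epsilon>) r2 \<mu> \<Longrightarrow>
       pos_def_mat p \<Sigma> \<Longrightarrow> 0 < \<epsilon> \<Longrightarrow> \<epsilon> < \<epsilon>\<^sub>0 \<Longrightarrow> 1 \<le> a * \<epsilon> * real n \<Longrightarrow>
       prob_not_E_ME u (1 / d\<^sub>0) n p \<mu> \<Sigma> \<epsilon> \<le> ennreal (real n * (real n * r1 + exp (- c * real n) + r2))"
proof -
  obtain K \<eta>\<^sub>0 where K: "0 < K" and \<eta>0: "0 < \<eta>\<^sub>0"
    and scalar: "\<And>\<eta>. 0 < \<eta> \<Longrightarrow> \<eta> < \<eta>\<^sub>0 \<Longrightarrow> \<exists>r1 r2. 0 < r1 \<and> r1 \<le> r2 \<and> \<phi> r1 = 1 - \<eta> \<and> \<phi> r2 = 1 + \<eta> \<and>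
      \<bar>u r1 - 1 / d\<^sub>0\<bar> \<le> K * \<eta> \<and> \<bar>u r2 - 1 / d\<^sub>0\<bar> \<le> K * \<eta> \<and>
      (\<forall>s c. r1 \<le> s \<longrightarrow> s \<le> r2 \<longrightarrow> 1 < c \<longrightarrow> u (s / c) < c * u s \<and> u s < c * u (c * s))"
    using maronna_scalar_choice[OF u_pos u_cont \<phi> \<phi>_mono lim d0 inv] by blast
  obtain s b c N where s: "0 < s" and b: "0 < b" and c: "0 < c" and prob: "\<And>n p \<mu> r1 r2 s2. N \<le> n \<Longrightarrow> real p / real n = \<gamma> \<Longrightarrow> vec_law p \<mu> \<Longrightarrow> isotropic p \<mu> \<Longrightarrow>
    anti_conc p t q \<mu> \<Longrightarrow> 0 \<le> r1 \<Longrightarrow> quad_conc p s r1 \<mu> \<Longrightarrow> 0 \<le> r2 \<Longrightarrow> quad_conc p s2 r2 \<mu> \<Longrightarrow>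
    \<exists>E \<in> sets (\<Pi>\<^sub>M i\<in>{..<n}. \<mu>).
      emeasure (\<Pi>\<^sub>M i\<in>{..<n}. \<mu>) E \<le> ennreal (real n * (real n * r1 + exp (- c * real n) + r2)) \<and>
      (\<forall>\<omega> \<in> space (\<Pi>\<^sub>M i\<in>{..<n}. \<mu>) - E. pos_def_mat p (gram p 0 {..<n} \<omega>) \<and>
        (\<forall>i<n. \<bar>\<omega> i \<bullet> (inv_mat (gram p 0 {..<n} \<omega>) *\<^sub>v \<omega> i) - \<gamma>\<bar> \<le> 2 * (s2 * \<gamma> / b + 1 / (b * real n))))"
    using leverage_probability[OF \<gamma> t q] by metis
  \<comment> \<open>With this value \<open>a * \<epsilon> / b = \<gamma> * \<eta> / 4\<close> for
    \<open>\<eta> = \<epsilon> / K\<close>. Both error terms are at most that, and together with the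
    factor 2 they fill \<open>\<gamma> * \<eta>\<close>.\<close>
  define a where "a = b * \<gamma> / (4 * K)"
  have a: "0 < a" using b \<gamma> K by (simp add: a_def)
  \<comment> \<open>The entry \<open>1 / a\<close> keeps the level \<open>a * \<epsilon>\<close> at
    most 1, where the quadratic form bounds are stated; the entry \<open>K * \<eta>\<^sub>0\<close>
    makes \<open>\<epsilon> / K\<close> admissible for the scalar choice.\<close>
  define \<epsilon>\<^sub>0 where "\<epsilon>\<^sub>0 = min 1 (min (1 / a) (K * \<eta>\<^sub>0))"
  have \<epsilon>0: "0 < \<epsilon>\<^sub>0" "\<epsilon>\<^sub>0 \<le> 1" "\<epsilon>\<^sub>0 \<le> 1 / a" "\<epsilon>\<^sub>0 \<le> K * \<eta>\<^sub>0" using a K \<eta>0 by (simp_all add: \<epsilon>\<^sub>0_def)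
  show thesis
  proof (rule that[of "min s 1" a c \<epsilon>\<^sub>0 N])
    show "a * \<epsilon>\<^sub>0 \<le> 1" using \<epsilon>0(3) a by (simp add: pos_le_divide_eq mult.commute)
    fix n p \<mu> \<Sigma> \<epsilon> r1 r2
    assume n: "N \<le> n" and np: "real p / real n = \<gamma>" and law: "vec_law p \<mu>" and iso: "isotropic p \<mu>" and ac: "anti_conc p t q \<mu>"
      and r1: "0 \<le> r1" "quad_conc p (min s 1) r1 \<mu>" and r2: "0 \<le> r2" "quad_conc p (a * \<epsilon>) r2 \<mu>"
      and \<Sigma>: "pos_def_mat p \<Sigma>" and \<epsilon>: "0 < \<epsilon>" "\<epsilon> < \<epsilon>\<^sub>0" and large: "1 \<le> a * \<epsilon> * real n"
    note pos = ratio_pos[OF np \<gamma>(1)]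
    define \<eta> where "\<eta> = \<epsilon> / K"
    have \<eta>: "0 < \<eta>" "\<eta> < \<eta>\<^sub>0" "K * \<eta> = \<epsilon>" using \<epsilon> \<epsilon>0(4) K by (simp_all add: \<eta>_def pos_divide_less_eq mult.commute)
    obtain R1 R2 where R: "0 < R1" "R1 \<le> R2" "\<phi> R1 = 1 - \<eta>" "\<phi> R2 = 1 + \<eta>"
      "\<bar>u R1 - 1 / d\<^sub>0\<bar> \<le> K * \<eta>" "\<bar>u R2 - 1 / d\<^sub>0\<bar> \<le> K * \<eta>"
      "\<And>s c. R1 \<le> s \<Longrightarrow> s \<le> R2 \<Longrightarrow> 1 < c \<Longrightarrow> u (s / c) < c * u s \<and> u s < c * u (c * s)"
      using scalar[OF \<eta>(1,2)] by blast
    have "quad_conc p s r1 \<mu>" by (rule quad_conc_mono[OF law r1(2)]) auto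
    from prob[OF n np law iso ac r1(1) this r2]
    obtain E where E: "E \<in> sets (\<Pi>\<^sub>M i\<in>{..<n}. \<mu>)"
      "emeasure (\<Pi>\<^sub>M i\<in>{..<n}. \<mu>) E \<le> ennreal (real n * (real n * r1 + exp (- c * real n) + r2))"
      and lev: "\<And>\<omega>. \<omega> \<in> space (\<Pi>\<^sub>M i\<in>{..<n}. \<mu>) - E \<Longrightarrow> pos_def_mat p (gram p 0 {..<n} \<omega>) \<and>
        (\<forall>i<n. \<bar>\<omega> i \<bullet> (inv_mat (gram p 0 {..<n} \<omega>) *\<^sub>v \<omega> i) - \<gamma>\<bar> \<le> 2 * (a * \<epsilon> * \<gamma> / b + 1 / (b * real n)))"
      by blast
    have small: "2 * (a * \<epsilon> * \<gamma> / b + 1 / (b * real n)) \<le> \<gamma> * \<eta>"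
    proof -
      have ab: "a * \<epsilon> / b = \<gamma> * \<eta> / 4" using b K by (simp add: a_def \<eta>_def)
      have "1 / (b * real n) \<le> a * \<epsilon> / b"
        using large pos(1) b by (simp add: divide_simps mult_ac)
      moreover have "a * \<epsilon> * \<gamma> / b \<le> a * \<epsilon> / b"
      proof (rule divide_right_mono)
        show "a * \<epsilon> * \<gamma> \<le> a * \<epsilon>" using a \<epsilon> \<gamma> mult_left_mono[of \<gamma> 1 "a * \<epsilon>"] by simp
      qed (use b in simp)
      ultimately show ?thesis using ab by argo
    qed
    \<comment> \<open>Inclusion in the measurable set \<open>E\<close> is all that an outer
      probability calls for.\<close>
    have "space (\<Pi>\<^sub>M i\<in>{..<n}. \<mu>) - E_ME u (1 / d\<^sub>0) n p \<mu> \<Sigma> \<epsilon> \<subseteq> E"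
    proof (rule subsetI, rule ccontr)
      fix \<omega> assume \<omega>: "\<omega> \<in> space (\<Pi>\<^sub>M i\<in>{..<n}. \<mu>) - E_ME u (1 / d\<^sub>0) n p \<mu> \<Sigma> \<epsilon>" and nE: "\<omega> \<notin> E"
      then have sp: "\<omega> \<in> space (\<Pi>\<^sub>M i\<in>{..<n}. \<mu>)" by blast
      then have "\<omega> \<in> space (\<Pi>\<^sub>M i\<in>{..<n}. \<mu>) - E" using nE by blast
      note l = lev[OF this]
      have G: "pos_def_mat p (gram p 0 {..<n} \<omega>)" using l by blast
      have lv: "\<bar>\<omega> i \<bullet> (inv_mat (gram p 0 {..<n} \<omega>) *\<^sub>v \<omega> i) - \<gamma>\<bar> \<le> \<gamma> * \<eta>" if "i < n" for i
        using l that small by fastforce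
      have "\<omega> \<in> E_ME u (1 / d\<^sub>0) n p \<mu> \<Sigma> \<epsilon>"
        by (rule E_ME_of_leverage[OF u_pos u_anti pos(1,2) np law sp \<Sigma> G lv R(1,2) R(3,4)[unfolded \<phi>] R(5,6)[unfolded \<eta>(3)] R(7)])
      then show False using \<omega> by blast
    qed
    then have "prob_not_E_ME u (1 / d\<^sub>0) n p \<mu> \<Sigma> \<epsilon> \<le> outer_measure_of (\<Pi>\<^sub>M i\<in>{..<n}. \<mu>) E"
      unfolding prob_not_E_ME_def by (rule outer_measure_of_mono)
    also have "\<dots> = emeasure (\<Pi>\<^sub>M i\<in>{..<n}. \<mu>) E" by (rule outer_measure_of_eq[OF E(1)])
    also note E(2)
    finally show "prob_not_E_ME u (1 / d\<^sub>0) n p \<mu> \<Sigma> \<epsilon> \<le> ennreal (real n * (real n * r1 + exp (- c * real n) + r2))" .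
  qed (use s a c \<epsilon>0 in auto)
qed

section \<open>Rates uniform in sample size and accuracy\<close>

lemma failure_sum_le:
  assumes n: "0 < n" and r: "0 \<le> r1" "r1 \<le> 2 * e" "r2 \<le> 2 * e" "x \<le> e" and e: "0 \<le> e" and D: "0 \<le> D"
  shows "real n * (real n * r1 + x + r2) \<le> 5 * exp D * real n ^ 2 * e"
proof -
  have n1: "1 \<le> real n" using n by simp
  have "real n * r1 \<le> real n * (2 * e)" using r by (intro mult_left_mono) auto
  moreover have "x \<le> real n * e" using mult_right_mono[OF n1 e] r by simp
  moreover have "r2 \<le> real n * (2 * e)" using mult_right_mono[OF n1, of "2 * e"] r e by simp
  ultimately have "real n * r1 + x + r2 \<le> 5 * (real n * e)" by argo
  then have "real n * (real n * r1 + x + r2) \<le> real n * (5 * (real n * e))" by (intro mult_left_mono) auto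
  also have "\<dots> = 5 * (real n ^ 2 * e) * 1" by (simp add: power2_eq_square)
  also have "\<dots> \<le> 5 * (real n ^ 2 * e) * exp D" using D e by (intro mult_left_mono) auto
  finally show ?thesis by (simp add: mult_ac)
qed

text \<open>For exponents up to \<open>D\<close> the factor \<open>exp D\<close> in the constant
  lifts the bound above 1.\<close>

lemma one_le_failure_bound:
  assumes n: "0 < n" and x: "x \<le> D"
  shows "1 \<le> ennreal (5 * exp D * real n ^ 2 * exp (- x))"
proof -
  have "1 * 1 \<le> exp (D - x) * real n ^ 2" using n x by (intro mult_mono) auto
  also have "\<dots> = exp D * real n ^ 2 * exp (- x)" by (simp add: exp_diff exp_minus field_simps)
  finally have "1 \<le> 5 * exp D * real n ^ 2 * exp (- x)" by simp
  then show ?thesis using ennreal_leI[of 1] by simp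
qed

text \<open>The condition \<open>V \<le> x * p\<close> under which quadratic forms concentrate at
  level \<open>x\<close> must hold at \<open>x = s\<close> and at \<open>x = a * \<epsilon>\<close>.
  It fails only for small \<open>n\<close> or small \<open>n * \<epsilon>\<close>, and there the
  exponent \<open>c' * n * \<epsilon>\<^sup>2\<close> is bounded, so the constant covers it.\<close>

lemma gaussian_rate:
  fixes F :: "nat \<Rightarrow> nat \<Rightarrow> real vec measure \<Rightarrow> real mat \<Rightarrow> real \<Rightarrow> ennreal"
  assumes \<gamma>: "0 < \<gamma>" and pars: "0 < s" "s \<le> 1" "0 < a" "0 < c" "0 < \<epsilon>\<^sub>0" "\<epsilon>\<^sub>0 \<le> 1" "a * \<epsilon>\<^sub>0 \<le> 1" and \<kappa>: "0 < \<kappa>" and V: "0 \<le> V"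
    and F1: "\<And>n p \<mu> \<Sigma> \<epsilon>. vec_law p \<mu> \<Longrightarrow> F n p \<mu> \<Sigma> \<epsilon> \<le> 1"
    and F: "\<And>n p \<mu> \<Sigma> \<epsilon> r1 r2. N \<le> n \<Longrightarrow> real p / real n = \<gamma> \<Longrightarrow> vec_law p \<mu> \<Longrightarrow> isotropic p \<mu> \<Longrightarrow> anti_conc p t q \<mu> \<Longrightarrow>
       0 \<le> r1 \<Longrightarrow> quad_conc p s r1 \<mu> \<Longrightarrow> 0 \<le> r2 \<Longrightarrow> quad_conc p (a * \<epsilon>) r2 \<mu> \<Longrightarrow>
       pos_def_mat p \<Sigma> \<Longrightarrow> 0 < \<epsilon> \<Longrightarrow> \<epsilon> < \<epsilon>\<^sub>0 \<Longrightarrow> 1 \<le> a * \<epsilon> * real n \<Longrightarrow>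
       F n p \<mu> \<Sigma> \<epsilon> \<le> ennreal (real n * (real n * r1 + exp (- c * real n) + r2))"
  obtains c' C where "0 < c'" "0 < C"
    "\<And>n p \<mu> \<Sigma> \<epsilon>. real p / real n = \<gamma> \<Longrightarrow> vec_law p \<mu> \<Longrightarrow> isotropic p \<mu> \<Longrightarrow> anti_conc p t q \<mu> \<Longrightarrow>
       (\<And>x. 0 < x \<Longrightarrow> x \<le> 1 \<Longrightarrow> V \<le> x * real p \<Longrightarrow> quad_conc p x (2 * exp (- \<kappa> * x\<^sup>2 * real p)) \<mu>) \<Longrightarrow>
       pos_def_mat p \<Sigma> \<Longrightarrow> 0 < \<epsilon> \<Longrightarrow> \<epsilon> < \<epsilon>\<^sub>0 \<Longrightarrow>
       F n p \<mu> \<Sigma> \<epsilon> \<le> ennreal (C * real n ^ 2 * exp (- c' * real n * \<epsilon> ^ 2))"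
proof -
  define c' where "c' = min c (min (\<kappa> * s\<^sup>2 * \<gamma>) (\<kappa> * a\<^sup>2 * \<gamma>))"
  have c': "0 < c'" "c' \<le> c" "c' \<le> \<kappa> * s\<^sup>2 * \<gamma>" "c' \<le> \<kappa> * a\<^sup>2 * \<gamma>" using pars \<kappa> \<gamma> by (simp_all add: c'_def)
  \<comment> \<open>The first two summands are thresholds for \<open>n\<close>, the last two for
    \<open>n * \<epsilon>\<close>.\<close>
  define W where "W = real N + V / (s * \<gamma>) + V / (a * \<gamma>) + 1 / a"
  define D where "D = c' * W"
  have Wp: "0 \<le> V / (s * \<gamma>)" "0 \<le> V / (a * \<gamma>)" "0 < 1 / a" using V pars \<gamma> by auto
  then have D: "0 \<le> D" using c' by (simp add: D_def W_def)
  show thesis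
  proof (rule that[of c' "5 * exp D"])
    fix n p \<mu> \<Sigma> \<epsilon>
    assume np: "real p / real n = \<gamma>" and law: "vec_law p \<mu>" and iso: "isotropic p \<mu>" and ac: "anti_conc p t q \<mu>"
      and qc: "\<And>x. 0 < x \<Longrightarrow> x \<le> 1 \<Longrightarrow> V \<le> x * real p \<Longrightarrow> quad_conc p x (2 * exp (- \<kappa> * x\<^sup>2 * real p)) \<mu>"
      and \<Sigma>: "pos_def_mat p \<Sigma>" and \<epsilon>: "0 < \<epsilon>" "\<epsilon> < \<epsilon>\<^sub>0"
    note pos = ratio_pos[OF np \<gamma>]
    have \<epsilon>2: "\<epsilon>\<^sup>2 \<le> \<epsilon>" "\<epsilon>\<^sup>2 \<le> 1" using \<epsilon> pars(6) mult_left_mono[of \<epsilon> 1 \<epsilon>] power_le_one[of \<epsilon> 2] by (simp_all add: power2_eq_square)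
    have trivial: "F n p \<mu> \<Sigma> \<epsilon> \<le> ennreal (5 * exp D * real n ^ 2 * exp (- c' * real n * \<epsilon> ^ 2))" if "real n \<le> W \<or> real n * \<epsilon> \<le> W"
    proof -
      \<comment> \<open>Since \<epsilon> is at most 1, \<open>n * \<epsilon>\<^sup>2\<close> is
        small as soon as one of \<open>n\<close> and \<open>n * \<epsilon>\<close> is.\<close>
      have "real n * \<epsilon>\<^sup>2 \<le> real n" "real n * \<epsilon>\<^sup>2 \<le> real n * \<epsilon>" using \<epsilon>2 by (simp_all add: mult_left_le mult_left_mono)
      then have "real n * \<epsilon>\<^sup>2 \<le> W" using that by linarith
      then have "c' * (real n * \<epsilon>\<^sup>2) \<le> D" unfolding D_def using c' by (intro mult_left_mono) auto
      from order_trans[OF F1[OF law] one_le_failure_bound[OF pos(1) this]] show ?thesis by (simp add: mult_ac)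
    qed
    show "F n p \<mu> \<Sigma> \<epsilon> \<le> ennreal (5 * exp D * real n ^ 2 * exp (- c' * real n * \<epsilon> ^ 2))"
    proof (cases "real n \<le> W \<or> real n * \<epsilon> \<le> W")
      case False
      then have "W < real n" "W < real n * \<epsilon>" by simp_all
      then have big: "real N \<le> real n" "V / (s * \<gamma>) \<le> real n" "V / (a * \<gamma>) \<le> real n * \<epsilon>" "1 / a \<le> real n * \<epsilon>"
        using Wp unfolding W_def by linarith+
      have 1: "V \<le> s * real p" using big(2) pars \<gamma> unfolding pos(3) by (simp add: pos_divide_le_eq mult_ac)
      have 2: "V \<le> a * \<epsilon> * real p" using big(3) pars \<gamma> unfolding pos(3) by (simp add: pos_divide_le_eq mult_ac)
      have 3: "1 \<le> a * \<epsilon> * real n" using big(4) pars by (simp add: pos_divide_le_eq mult_ac)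
      have "a * \<epsilon> \<le> a * \<epsilon>\<^sub>0" using pars \<epsilon> by (intro mult_left_mono) auto
      then have a\<epsilon>: "0 < a * \<epsilon>" "a * \<epsilon> \<le> 1" using order_trans[OF _ pars(7)] pars(3) \<epsilon>(1) by auto
      have "F n p \<mu> \<Sigma> \<epsilon> \<le> ennreal (real n * (real n * (2 * exp (- \<kappa> * s\<^sup>2 * real p)) + exp (- c * real n) + 2 * exp (- \<kappa> * (a * \<epsilon>)\<^sup>2 * real p)))"
        using big(1) by (intro F[OF _ np law iso ac _ qc[OF pars(1,2) 1] _ qc[OF a\<epsilon> 2] \<Sigma> \<epsilon> 3]) auto
      also have "\<dots> \<le> ennreal (5 * exp D * real n ^ 2 * exp (- c' * real n * \<epsilon>\<^sup>2))"
      proof (intro ennreal_leI failure_sum_le)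
        have "c' * (real n * \<epsilon>\<^sup>2) \<le> \<kappa> * s\<^sup>2 * \<gamma> * (real n * 1)" using c' \<epsilon>2 by (intro mult_mono) auto
        then show "2 * exp (- \<kappa> * s\<^sup>2 * real p) \<le> 2 * exp (- c' * real n * \<epsilon>\<^sup>2)" unfolding pos(3) by (simp add: mult_ac)
        have "c' * (real n * \<epsilon>\<^sup>2) \<le> \<kappa> * a\<^sup>2 * \<gamma> * (real n * \<epsilon>\<^sup>2)" using c' by (intro mult_right_mono) auto
        then show "2 * exp (- \<kappa> * (a * \<epsilon>)\<^sup>2 * real p) \<le> 2 * exp (- c' * real n * \<epsilon>\<^sup>2)" unfolding pos(3) by (simp add: power_mult_distrib mult_ac)
        have "c' * (real n * \<epsilon>\<^sup>2) \<le> c * (real n * 1)" using c' \<epsilon>2 by (intro mult_mono) auto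
        then show "exp (- c * real n) \<le> exp (- c' * real n * \<epsilon>\<^sup>2)" by (simp add: mult_ac)
      qed (use pos D in auto)
      finally show ?thesis .
    qed (rule trivial)
  qed (use c' in auto)
qed

text \<open>The scheme of \<open>gaussian_rate\<close> with the exponent
  \<open>X = \<Psi> p * sqrt n * \<epsilon>\<close>. The side condition now carries
  \<open>(\<Psi> p)\<^sup>2\<close>, so it has to be shown that a large \<open>X\<close> forces
  \<open>(\<Psi> p)\<^sup>2 * n * \<epsilon>\<close> to be large as well.\<close>

lemma log_concave_rate:
  fixes F :: "nat \<Rightarrow> nat \<Rightarrow> real vec measure \<Rightarrow> real mat \<Rightarrow> real \<Rightarrow> ennreal"
  assumes \<gamma>: "0 < \<gamma>" and pars: "0 < s" "s \<le> 1" "0 < a" "0 < c" "0 < \<epsilon>\<^sub>0" "\<epsilon>\<^sub>0 \<le> 1" "a * \<epsilon>\<^sub>0 \<le> 1" and \<kappa>: "0 < \<kappa>" and V: "0 \<le> V"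
    and \<Psi>: "\<And>p. 1 \<le> p \<Longrightarrow> 0 < \<Psi> p \<and> \<Psi> p \<le> 1" "\<And>p. 3 \<le> p \<Longrightarrow> ln (real p) powr (-5) \<le> \<Psi> p"
    and F1: "\<And>n p \<mu> \<Sigma> \<epsilon>. vec_law p \<mu> \<Longrightarrow> F n p \<mu> \<Sigma> \<epsilon> \<le> 1"
    and F: "\<And>n p \<mu> \<Sigma> \<epsilon> r1 r2. N \<le> n \<Longrightarrow> real p / real n = \<gamma> \<Longrightarrow> vec_law p \<mu> \<Longrightarrow> isotropic p \<mu> \<Longrightarrow> anti_conc p t q \<mu> \<Longrightarrow>
       0 \<le> r1 \<Longrightarrow> quad_conc p s r1 \<mu> \<Longrightarrow> 0 \<le> r2 \<Longrightarrow> quad_conc p (a * \<epsilon>) r2 \<mu> \<Longrightarrow>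
       pos_def_mat p \<Sigma> \<Longrightarrow> 0 < \<epsilon> \<Longrightarrow> \<epsilon> < \<epsilon>\<^sub>0 \<Longrightarrow> 1 \<le> a * \<epsilon> * real n \<Longrightarrow>
       F n p \<mu> \<Sigma> \<epsilon> \<le> ennreal (real n * (real n * r1 + exp (- c * real n) + r2))"
  obtains c' C where "0 < c'" "0 < C"
    "\<And>n p \<mu> \<Sigma> \<epsilon>. real p / real n = \<gamma> \<Longrightarrow> vec_law p \<mu> \<Longrightarrow> isotropic p \<mu> \<Longrightarrow> anti_conc p t q \<mu> \<Longrightarrow>
       (\<And>x. 0 < x \<Longrightarrow> x \<le> 1 \<Longrightarrow> V \<le> (\<Psi> p)\<^sup>2 * x * real p \<Longrightarrow> quad_conc p x (2 * exp (- \<kappa> * \<Psi> p * x * sqrt (real p))) \<mu>) \<Longrightarrow>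
       pos_def_mat p \<Sigma> \<Longrightarrow> 0 < \<epsilon> \<Longrightarrow> \<epsilon> < \<epsilon>\<^sub>0 \<Longrightarrow>
       F n p \<mu> \<Sigma> \<epsilon> \<le> ennreal (C * real n ^ 2 * exp (- c' * (\<Psi> p * sqrt (real n)) * \<epsilon>))"
proof -
  \<comment> \<open>The polylogarithmic lower bound on \<Psi> makes
    \<open>(\<Psi> p)\<^sup>2 * p\<close> eventually exceed \<open>V / s\<close>, the side condition
    at the fixed level \<open>s\<close>.\<close>
  have "\<forall>\<^sub>F p in sequentially. V / s \<le> (ln (real p) powr (-5))\<^sup>2 * real p" by real_asymp
  then obtain P where P: "\<And>p. P \<le> p \<Longrightarrow> V / s \<le> (ln (real p) powr (-5))\<^sup>2 * real p"
    unfolding eventually_sequentially by blast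
  define c' where "c' = min c (min (\<kappa> * s * sqrt \<gamma>) (\<kappa> * a * sqrt \<gamma>))"
  have c': "0 < c'" "c' \<le> c" "c' \<le> \<kappa> * s * sqrt \<gamma>" "c' \<le> \<kappa> * a * sqrt \<gamma>" using pars \<kappa> \<gamma> by (simp_all add: c'_def)
  \<comment> \<open>Each summand after the first is a threshold for \<open>n\<close>,
    \<open>n * \<epsilon>\<close> or \<open>(\<Psi> p)\<^sup>2 * n * \<epsilon>\<close>. Exceeding
    \<open>W\<close> yields all of them through the three upper bounds on \<open>X\<close>; the
    summand 1 rules out the first alternative in \<open>X\<Psi>\<close>.\<close>
  define W where "W = 1 + real N + 3 / \<gamma> + real P / \<gamma> + V / (a * \<gamma>) + 1 / a"
  define D where "D = c' * W"
  have Wp: "0 < 3 / \<gamma>" "0 \<le> real P / \<gamma>" "0 \<le> V / (a * \<gamma>)" "0 < 1 / a" using V pars \<gamma> by auto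
  then have D: "0 \<le> D" using c' by (simp add: D_def W_def)
  have W1: "1 \<le> W" using Wp by (simp add: W_def)
  show thesis
  proof (rule that[of c' "5 * exp D"])
    fix n p \<mu> \<Sigma> \<epsilon>
    assume np: "real p / real n = \<gamma>" and law: "vec_law p \<mu>" and iso: "isotropic p \<mu>" and ac: "anti_conc p t q \<mu>"
      and qc: "\<And>x. 0 < x \<Longrightarrow> x \<le> 1 \<Longrightarrow> V \<le> (\<Psi> p)\<^sup>2 * x * real p \<Longrightarrow> quad_conc p x (2 * exp (- \<kappa> * \<Psi> p * x * sqrt (real p))) \<mu>"
      and \<Sigma>: "pos_def_mat p \<Sigma>" and \<epsilon>: "0 < \<epsilon>" "\<epsilon> < \<epsilon>\<^sub>0"
    note pos = ratio_pos[OF np \<gamma>]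
    have \<Psi>1: "0 < \<Psi> p" "\<Psi> p \<le> 1" using \<Psi>(1)[of p] pos(2) by auto
    have \<epsilon>1: "\<epsilon> \<le> 1" using \<epsilon> pars by simp
    have sq: "0 \<le> sqrt (real n)" "sqrt (real n) \<le> real n" "sqrt (real n) * sqrt (real n) = real n"
      using pos(1) by (simp_all add: real_le_lsqrt self_le_power)
    define X where "X = \<Psi> p * sqrt (real n) * \<epsilon>"
    have "\<Psi> p * (sqrt (real n) * \<epsilon>) \<le> 1 * (real n * \<epsilon>)" using \<Psi>1 sq \<epsilon> by (intro mult_mono) auto
    then have Xn\<epsilon>: "X \<le> real n * \<epsilon>" by (simp add: X_def mult_ac)
    also have "\<dots> \<le> real n" using \<epsilon> \<epsilon>1 by (simp add: mult_left_le)
    finally have Xn: "X \<le> real n" .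
    \<comment> \<open>If \<open>\<Psi> p * sqrt n\<close> is at least 1, multiplying
      \<open>X\<close> by it only increases \<open>X\<close> and gives
      \<open>(\<Psi> p)\<^sup>2 * n * \<epsilon>\<close>; otherwise \<open>X\<close> is at most
      1.\<close>
    have X\<Psi>: "X \<le> max 1 ((\<Psi> p)\<^sup>2 * (real n * \<epsilon>))"
    proof (cases "\<Psi> p * sqrt (real n) \<le> 1")
      case True
      then have "X \<le> 1 * 1" unfolding X_def using \<epsilon> \<epsilon>1 by (intro mult_mono) auto
      then show ?thesis by simp
    next
      case False
      then have "1 * X \<le> (\<Psi> p * sqrt (real n)) * X" using \<Psi>1 \<epsilon> sq unfolding X_def by (intro mult_right_mono) auto
      also have "\<dots> = (\<Psi> p)\<^sup>2 * ((sqrt (real n) * sqrt (real n)) * \<epsilon>)" by (simp add: X_def power2_eq_square mult_ac)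
      finally show ?thesis unfolding sq(3) by simp
    qed
    show "F n p \<mu> \<Sigma> \<epsilon> \<le> ennreal (5 * exp D * real n ^ 2 * exp (- c' * (\<Psi> p * sqrt (real n)) * \<epsilon>))"
    proof (cases "X \<le> W")
      case True
      then have "c' * X \<le> D" unfolding D_def using c' by (intro mult_left_mono) auto
      from order_trans[OF F1[OF law] one_le_failure_bound[OF pos(1) this]] show ?thesis by (simp add: mult_ac X_def)
    next
      case False
      then have big: "real N \<le> real n" "3 / \<gamma> \<le> real n" "real P / \<gamma> \<le> real n" "V / (a * \<gamma>) \<le> (\<Psi> p)\<^sup>2 * (real n * \<epsilon>)" "1 / a \<le> real n * \<epsilon>"
        using Wp W1 Xn Xn\<epsilon> X\<Psi> unfolding W_def by linarith+
      have p: "3 \<le> p" "P \<le> p"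
      proof -
        have "3 \<le> real p" "real P \<le> real p" using big(2,3) \<gamma> unfolding pos(3) by (simp_all add: pos_divide_le_eq mult_ac)
        then show "3 \<le> p" "P \<le> p" by linarith+
      qed
      have "V / s \<le> (ln (real p) powr (-5))\<^sup>2 * real p" by (rule P[OF p(2)])
      also have "\<dots> \<le> (\<Psi> p)\<^sup>2 * real p" using \<Psi>(2)[OF p(1)] by (intro mult_right_mono power_mono) auto
      finally have 1: "V \<le> (\<Psi> p)\<^sup>2 * s * real p" using pars by (simp add: pos_divide_le_eq mult_ac)
      have 2: "V \<le> (\<Psi> p)\<^sup>2 * (a * \<epsilon>) * real p" using big(4) pars \<gamma> unfolding pos(3) by (simp add: pos_divide_le_eq mult_ac)
      have 3: "1 \<le> a * \<epsilon> * real n" using big(5) pars by (simp add: pos_divide_le_eq mult_ac)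
      have "a * \<epsilon> \<le> a * \<epsilon>\<^sub>0" using pars \<epsilon> by (intro mult_left_mono) auto
      then have a\<epsilon>: "0 < a * \<epsilon>" "a * \<epsilon> \<le> 1" using order_trans[OF _ pars(7)] pars(3) \<epsilon>(1) by auto
      have "F n p \<mu> \<Sigma> \<epsilon> \<le> ennreal (real n * (real n * (2 * exp (- \<kappa> * \<Psi> p * s * sqrt (real p))) + exp (- c * real n) + 2 * exp (- \<kappa> * \<Psi> p * (a * \<epsilon>) * sqrt (real p))))"
        using big(1) by (intro F[OF _ np law iso ac _ qc[OF pars(1,2) 1] _ qc[OF a\<epsilon> 2] \<Sigma> \<epsilon> 3]) auto
      also have "\<dots> \<le> ennreal (5 * exp D * real n ^ 2 * exp (- (c' * X)))"
      proof (intro ennreal_leI failure_sum_le)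
        have sp: "sqrt (real p) = sqrt \<gamma> * sqrt (real n)" unfolding pos(3) by (rule real_sqrt_mult)
        have "c' * X \<le> \<kappa> * s * sqrt \<gamma> * (\<Psi> p * sqrt (real n) * 1)"
          unfolding X_def using c' \<epsilon> \<epsilon>1 \<Psi>1 by (intro mult_mono mult_left_mono) auto
        then show "2 * exp (- \<kappa> * \<Psi> p * s * sqrt (real p)) \<le> 2 * exp (- (c' * X))" unfolding sp by (simp add: mult_ac)
        have "c' * X \<le> \<kappa> * a * sqrt \<gamma> * X" using c' \<epsilon> \<Psi>1 by (intro mult_right_mono) (auto simp: X_def)
        then show "2 * exp (- \<kappa> * \<Psi> p * (a * \<epsilon>) * sqrt (real p)) \<le> 2 * exp (- (c' * X))" unfolding sp X_def by (simp add: mult_ac)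
        have "c' * X \<le> c * real n" using c' Xn \<epsilon> \<Psi>1 by (intro mult_mono) (auto simp: X_def)
        then show "exp (- c * real n) \<le> exp (- (c' * X))" by simp
      qed (use pos D in auto)
      finally show ?thesis by (simp add: X_def mult_ac)
    qed
  qed (use c' in auto)
qed

text \<open>The Chernoff parameter \<open>l = \<theta> * x\<close> makes both terms of the exponent
  proportional to \<open>x\<^sup>2 * p\<close>, and \<theta> is small enough for the linear gain to
  win by a factor 2.\<close>

lemma IND_gaussian_quad_conc:
  assumes K: "0 < (K :: real)"
  obtains \<kappa> where "0 < \<kappa>" "\<And>p \<mu> C\<^sub>0 x. vec_law p \<mu> \<Longrightarrow> isotropic p \<mu> \<Longrightarrow> 0 < p \<Longrightarrow> IND p K C\<^sub>0 \<mu> \<Longrightarrow> 0 < x \<Longrightarrow> x \<le> 1 \<Longrightarrow>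
    quad_conc p x (2 * exp (- \<kappa> * x\<^sup>2 * real p)) \<mu>"
proof -
  define a where "a = 1 / (8 * K\<^sup>2)"
  define H where "H = 64 * (sg_const / a)\<^sup>2 + 32 * exp a * sg_const / a\<^sup>2"
  have a: "0 < a" using K by (simp add: a_def)
  have sg: "0 < sg_const" using sg_const_ge by linarith
  have H: "0 < H" unfolding H_def using a sg by (intro add_pos_pos mult_pos_pos divide_pos_pos) auto
  \<comment> \<open>The first entry is the range of \<open>l\<close>, the second gives
    \<open>H * \<theta> \<le> 1 / 2\<close>, and the third gives
    \<open>64 * (sg_const / a) * (\<theta> * (a / 4)) \<le> a\<close>.\<close>
  define \<theta> where "\<theta> = min (a / 4) (min (1 / (2 * H)) (a / (16 * sg_const)))"
  have \<theta>: "0 < \<theta>" "\<theta> \<le> a / 4" "\<theta> \<le> 1 / (2 * H)" "\<theta> \<le> a / (16 * sg_const)" using a sg H by (simp_all add: \<theta>_def)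
  show thesis
  proof (rule that[of "\<theta> / 2"])
    fix p \<mu> C\<^sub>0 and x :: real
    assume law: "vec_law p \<mu>" and iso: "isotropic p \<mu>" and p: "0 < p" and ind: "IND p K C\<^sub>0 \<mu>" and x: "0 < x" "x \<le> 1"
    have \<theta>x: "0 < \<theta> * x" "\<theta> * x \<le> \<theta>" using \<theta> x by (simp_all add: mult_left_le)
    have le2: "\<theta> * x \<le> a / 4" using \<theta>x(2) \<theta>(2) by linarith
    have "(\<theta> * x)\<^sup>2 \<le> \<theta> * (a / 4)" unfolding power2_eq_square using \<theta>x le2 \<theta>(1) by (intro mult_mono) (linarith | simp)+
    then have "64 * (sg_const / a) * (\<theta> * x)\<^sup>2 \<le> 64 * (sg_const / a) * (\<theta> * (a / 4))" using a sg by (intro mult_left_mono) auto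
    also have "\<dots> = 16 * sg_const * \<theta>" using a by simp
    also have "\<dots> \<le> a" using \<theta>(4) sg by (simp add: pos_le_divide_eq mult_ac)
    finally have le: "64 * (sg_const / a) * (\<theta> * x)\<^sup>2 \<le> a" .
    have qc: "quad_conc p x (2 * exp (- (\<theta> * x) * x * real p + H * (\<theta> * x)\<^sup>2 * real p)) \<mu>"
      unfolding H_def a_def by (rule IND_quad_conc[OF law iso p ind K \<theta>x(1) le2[unfolded a_def] le[unfolded a_def]])
    have "H * \<theta> \<le> 1 / 2" using \<theta>(3) H by (simp add: pos_le_divide_eq mult_ac)
    then have "(H * \<theta>) * (\<theta> * x\<^sup>2 * real p) \<le> 1 / 2 * (\<theta> * x\<^sup>2 * real p)" using \<theta> by (intro mult_right_mono) auto
    then have "- (\<theta> * x) * x * real p + H * (\<theta> * x)\<^sup>2 * real p \<le> - (\<theta> / 2) * x\<^sup>2 * real p"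
      by (simp add: power2_eq_square mult_ac)
    then show "quad_conc p x (2 * exp (- (\<theta> / 2) * x\<^sup>2 * real p)) \<mu>" by (intro quad_conc_mono[OF law qc]) auto
  qed (use \<theta> in simp)
qed

theorem theorem1:
  fixes \<gamma> d\<^sub>0 \<phi>_lim :: real and u \<phi> :: "real \<Rightarrow> real"
  assumes "0 < \<gamma>" and "\<gamma> < 1"
    and "\<And>x. x \<ge> 0 \<Longrightarrow> u x > 0"
    and "antimono_on {0..} u"
    and "continuous_on {0..} u"
    and "\<And>x. \<phi> x = x * u x"
    and "mono_on {0..} \<phi>"
    and "bounded (\<phi> ` {0..})"
    and "(\<phi> \<longlongrightarrow> \<phi>_lim) at_top" and "\<phi>_lim > 1"
    and "d\<^sub>0 \<ge> 0" and "\<phi> d\<^sub>0 = 1" and "\<And>x. x \<ge> 0 \<Longrightarrow> \<phi> x = 1 \<Longrightarrow> x = d\<^sub>0"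
    and "\<exists>\<delta>>0. \<exists>L. \<exists>\<phi>_inv. (\<forall>x\<ge>0. \<bar>\<phi> x - 1\<bar> < \<delta> \<longrightarrow> \<phi>_inv (\<phi> x) = x) \<and>
           L-lipschitz_on {1 - \<delta><..<1 + \<delta>} \<phi>_inv"
    and "\<exists>\<delta>>0. \<exists>L. L-lipschitz_on ({0..} \<inter> {d\<^sub>0 - \<delta><..<d\<^sub>0 + \<delta>}) u"
  shows
    "(\<forall>c\<^sub>0 \<Psi>. lc_concentration c\<^sub>0 \<Psi> \<longrightarrow>
       (\<exists>c>0. \<exists>C>0. \<exists>\<epsilon>\<^sub>0>0. \<forall>n p \<mu> \<Sigma> \<epsilon>.
          real p / real n = \<gamma> \<longrightarrow> law_with_density p \<mu> \<longrightarrow> isotropic p \<mu> \<longrightarrow> log_concave p \<mu> \<longrightarrow>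
          pos_def_mat p \<Sigma> \<longrightarrow> 0 < \<epsilon> \<longrightarrow> \<epsilon> < \<epsilon>\<^sub>0 \<longrightarrow>
          prob_not_E_ME u (1 / d\<^sub>0) n p \<mu> \<Sigma> \<epsilon>
            \<le> ennreal (C * real n ^ 2 * exp (- c * (\<Psi> p * sqrt (real n)) * \<epsilon>)))) \<and>
     (\<forall>K>0. \<forall>C\<^sub>0>0. \<exists>c>0. \<exists>C>0. \<exists>\<epsilon>\<^sub>0>0. \<forall>n p \<mu> \<Sigma> \<epsilon>.
          real p / real n = \<gamma> \<longrightarrow> law_with_density p \<mu> \<longrightarrow> isotropic p \<mu> \<longrightarrow>
          IND p K C\<^sub>0 \<mu> \<or> (CCP p K \<mu> \<and> SBP p C\<^sub>0 \<mu>) \<longrightarrow>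
          pos_def_mat p \<Sigma> \<longrightarrow> 0 < \<epsilon> \<longrightarrow> \<epsilon> < \<epsilon>\<^sub>0 \<longrightarrow>
          prob_not_E_ME u (1 / d\<^sub>0) n p \<mu> \<Sigma> \<epsilon>
            \<le> ennreal (C * real n ^ 2 * exp (- c * real n * \<epsilon> ^ 2)))"
proof (intro conjI allI impI)
  \<comment> \<open>The anti-concentration constants of
    \<open>log_concave_anti_conc\<close>.\<close>
  have num: "0 < (1 / 12 :: real)" "0 < (1 / 4 :: real)" "1 / 4 \<le> (1 :: real)" by simp_all
  have lam: "0 < 1 - exp (-1 / 2 :: real)" by simp
  {
    fix c\<^sub>0 \<Psi> assume lc: "lc_concentration c\<^sub>0 \<Psi>"
    have c0: "0 < c\<^sub>0" and \<Psi>: "\<And>p. 1 \<le> p \<Longrightarrow> 0 < \<Psi> p \<and> \<Psi> p \<le> 1" "\<And>p. 3 \<le> p \<Longrightarrow> ln (real p) powr (-5) \<le> \<Psi> p"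
      using lc by (auto simp: lc_concentration_def)
    define A where "A = 4 / (1 - exp (-1/2)) * (2 :: real)"
    \<comment> \<open>The factor \<open>16 / 7\<close> undoes the share \<open>7 / 16\<close> of the
      deviation that is reserved for the variance.\<close>
    define V where "V = 16 / 7 * (A * (1 / c\<^sub>0)\<^sup>2)"
    have A: "0 < A" using lam by (simp add: A_def)
    have V: "0 \<le> V" using A by (simp add: V_def)
    show "\<exists>c>0. \<exists>C>0. \<exists>\<epsilon>\<^sub>0>0. \<forall>n p \<mu> \<Sigma> \<epsilon>.
          real p / real n = \<gamma> \<longrightarrow> law_with_density p \<mu> \<longrightarrow> isotropic p \<mu> \<longrightarrow> log_concave p \<mu> \<longrightarrow>
          pos_def_mat p \<Sigma> \<longrightarrow> 0 < \<epsilon> \<longrightarrow> \<epsilon> < \<epsilon>\<^sub>0 \<longrightarrow>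
          prob_not_E_ME u (1 / d\<^sub>0) n p \<mu> \<Sigma> \<epsilon>
            \<le> ennreal (C * real n ^ 2 * exp (- c * (\<Psi> p * sqrt (real n)) * \<epsilon>))"
      (is ?G)
    proof (rule maronna_failure_bound[OF assms(1-7,9-12,14) num])
      fix s a c \<epsilon>\<^sub>0 N assume pars: "0 < s" "s \<le> 1" "0 < a" "0 < c" "0 < \<epsilon>\<^sub>0" "\<epsilon>\<^sub>0 \<le> 1" "a * \<epsilon>\<^sub>0 \<le> 1"
        and F: "\<And>n p \<mu> \<Sigma> \<epsilon> r1 r2. N \<le> n \<Longrightarrow> real p / real n = \<gamma> \<Longrightarrow> vec_law p \<mu> \<Longrightarrow> isotropic p \<mu> \<Longrightarrow> anti_conc p (1 / 12) (1 / 4) \<mu> \<Longrightarrow>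
         0 \<le> r1 \<Longrightarrow> quad_conc p s r1 \<mu> \<Longrightarrow> 0 \<le> r2 \<Longrightarrow> quad_conc p (a * \<epsilon>) r2 \<mu> \<Longrightarrow>
         pos_def_mat p \<Sigma> \<Longrightarrow> 0 < \<epsilon> \<Longrightarrow> \<epsilon> < \<epsilon>\<^sub>0 \<Longrightarrow> 1 \<le> a * \<epsilon> * real n \<Longrightarrow>
         prob_not_E_ME u (1 / d\<^sub>0) n p \<mu> \<Sigma> \<epsilon> \<le> ennreal (real n * (real n * r1 + exp (- c * real n) + r2))"
      have \<kappa>: "0 < c\<^sub>0 / 4" using c0 by simp
      show ?G
      proof (rule log_concave_rate[where F = "prob_not_E_ME u (1 / d\<^sub>0)", OF assms(1) pars \<kappa> V \<Psi> prob_not_E_ME_le_1 F])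
        fix c' C assume cC: "0 < c'" "0 < C" and R: "\<And>n p \<mu> \<Sigma> \<epsilon>. real p / real n = \<gamma> \<Longrightarrow> vec_law p \<mu> \<Longrightarrow> isotropic p \<mu> \<Longrightarrow> anti_conc p (1 / 12) (1 / 4) \<mu> \<Longrightarrow>
           (\<And>x. 0 < x \<Longrightarrow> x \<le> 1 \<Longrightarrow> V \<le> (\<Psi> p)\<^sup>2 * x * real p \<Longrightarrow> quad_conc p x (2 * exp (- (c\<^sub>0 / 4) * \<Psi> p * x * sqrt (real p))) \<mu>) \<Longrightarrow>
           pos_def_mat p \<Sigma> \<Longrightarrow> 0 < \<epsilon> \<Longrightarrow> \<epsilon> < \<epsilon>\<^sub>0 \<Longrightarrow>
           prob_not_E_ME u (1 / d\<^sub>0) n p \<mu> \<Sigma> \<epsilon> \<le> ennreal (C * real n ^ 2 * exp (- c' * (\<Psi> p * sqrt (real n)) * \<epsilon>))"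
        have "prob_not_E_ME u (1 / d\<^sub>0) n p \<mu> \<Sigma> \<epsilon> \<le> ennreal (C * real n ^ 2 * exp (- c' * (\<Psi> p * sqrt (real n)) * \<epsilon>))"
          if np: "real p / real n = \<gamma>" and dens: "law_with_density p \<mu>" and iso: "isotropic p \<mu>" and log: "log_concave p \<mu>"
            and \<Sigma>: "pos_def_mat p \<Sigma>" and \<epsilon>: "0 < \<epsilon>" "\<epsilon> < \<epsilon>\<^sub>0" for n p \<mu> \<Sigma> \<epsilon>
        proof (rule R[OF np _ iso _ _ \<Sigma> \<epsilon>])
          note pos = ratio_pos[OF np assms(1)]
          show law: "vec_law p \<mu>" by (rule law_with_density_vec_law[OF dens])
          show "anti_conc p (1 / 12) (1 / 4) \<mu>" by (rule log_concave_anti_conc[OF law iso log])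
          fix x :: real assume x: "0 < x" "x \<le> 1" and Vx: "V \<le> (\<Psi> p)\<^sup>2 * x * real p"
          have \<Psi>p: "0 < \<Psi> p" using \<Psi>(1)[of p] pos(2) by simp
          have "A * (1 / (c\<^sub>0 * \<Psi> p))\<^sup>2 = (7 / 16 * V) / (\<Psi> p)\<^sup>2" by (simp add: V_def power_divide power_mult_distrib)
          also have "\<dots> \<le> 7 / 16 * x * real p" using Vx \<Psi>p by (simp add: pos_divide_le_eq mult_ac)
          finally have "quad_conc p x (2 * exp (- (c\<^sub>0 * \<Psi> p * (x * sqrt (real p) / 4)))) \<mu>"
            unfolding A_def by (rule log_concave_quad_conc[OF lc dens law iso pos(2) log x])
          then show "quad_conc p x (2 * exp (- (c\<^sub>0 / 4) * \<Psi> p * x * sqrt (real p))) \<mu>" by (simp add: mult_ac)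
        qed
        then show ?G using cC pars(5) by blast
      qed
    qed
  next
    fix K C\<^sub>0 :: real assume K: "0 < K" and C0: "0 < C\<^sub>0"
    define A where "A = 4 / (1 - exp (-1/2)) * (2 * exp (1 :: real)) * K\<^sup>2"
    define V where "V = 16 / 7 * A"
    have A: "0 < A" using lam K by (simp add: A_def)
    have V: "0 \<le> V" using A by (simp add: V_def)
    obtain \<kappa>\<^sub>1 where \<kappa>1: "0 < \<kappa>\<^sub>1" and ind_qc: "\<And>p \<mu> C\<^sub>0 x. vec_law p \<mu> \<Longrightarrow> isotropic p \<mu> \<Longrightarrow> 0 < p \<Longrightarrow> IND p K C\<^sub>0 \<mu> \<Longrightarrow> 0 < x \<Longrightarrow> x \<le> 1 \<Longrightarrow>
      quad_conc p x (2 * exp (- \<kappa>\<^sub>1 * x\<^sup>2 * real p)) \<mu>"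
      using IND_gaussian_quad_conc[OF K] by blast
    \<comment> \<open>Minima over the two alternatives, here and for \<open>t\<close> and
      \<open>q\<close>, give constants valid under either hypothesis.\<close>
    define \<kappa> where "\<kappa> = min \<kappa>\<^sub>1 (1 / (64 * K\<^sup>2))"
    have \<kappa>: "0 < \<kappa>" "\<kappa> \<le> \<kappa>\<^sub>1" "\<kappa> \<le> 1 / (64 * K\<^sup>2)" using \<kappa>1 K by (simp_all add: \<kappa>_def)
    define t where "t = min (1 / 2) (1 / (2 * C\<^sub>0))"
    define q where "q = min (exp (- (8 * K\<^sup>2 * sg_const)) / 1024) (1 / 2)"
    have tq: "0 < t" "t \<le> 1 / 2" "t \<le> 1 / (2 * C\<^sub>0)" "0 < q" "q \<le> 1" "q \<le> exp (- (8 * K\<^sup>2 * sg_const)) / 1024" "q \<le> 1 / 2"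
      using C0 by (simp_all add: t_def q_def)
    show "\<exists>c>0. \<exists>C>0. \<exists>\<epsilon>\<^sub>0>0. \<forall>n p \<mu> \<Sigma> \<epsilon>.
          real p / real n = \<gamma> \<longrightarrow> law_with_density p \<mu> \<longrightarrow> isotropic p \<mu> \<longrightarrow>
          IND p K C\<^sub>0 \<mu> \<or> (CCP p K \<mu> \<and> SBP p C\<^sub>0 \<mu>) \<longrightarrow>
          pos_def_mat p \<Sigma> \<longrightarrow> 0 < \<epsilon> \<longrightarrow> \<epsilon> < \<epsilon>\<^sub>0 \<longrightarrow>
          prob_not_E_ME u (1 / d\<^sub>0) n p \<mu> \<Sigma> \<epsilon>
            \<le> ennreal (C * real n ^ 2 * exp (- c * real n * \<epsilon> ^ 2))"
      (is ?G)
    proof (rule maronna_failure_bound[OF assms(1-7,9-12,14) tq(1,4,5)])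
      fix s a c \<epsilon>\<^sub>0 N assume pars: "0 < s" "s \<le> 1" "0 < a" "0 < c" "0 < \<epsilon>\<^sub>0" "\<epsilon>\<^sub>0 \<le> 1" "a * \<epsilon>\<^sub>0 \<le> 1"
        and F: "\<And>n p \<mu> \<Sigma> \<epsilon> r1 r2. N \<le> n \<Longrightarrow> real p / real n = \<gamma> \<Longrightarrow> vec_law p \<mu> \<Longrightarrow> isotropic p \<mu> \<Longrightarrow> anti_conc p t q \<mu> \<Longrightarrow>
         0 \<le> r1 \<Longrightarrow> quad_conc p s r1 \<mu> \<Longrightarrow> 0 \<le> r2 \<Longrightarrow> quad_conc p (a * \<epsilon>) r2 \<mu> \<Longrightarrow>
         pos_def_mat p \<Sigma> \<Longrightarrow> 0 < \<epsilon> \<Longrightarrow> \<epsilon> < \<epsilon>\<^sub>0 \<Longrightarrow> 1 \<le> a * \<epsilon> * real n \<Longrightarrow>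
         prob_not_E_ME u (1 / d\<^sub>0) n p \<mu> \<Sigma> \<epsilon> \<le> ennreal (real n * (real n * r1 + exp (- c * real n) + r2))"
      show ?G
      proof (rule gaussian_rate[where F = "prob_not_E_ME u (1 / d\<^sub>0)", OF assms(1) pars \<kappa>(1) V prob_not_E_ME_le_1 F])
        fix c' C assume cC: "0 < c'" "0 < C" and R: "\<And>n p \<mu> \<Sigma> \<epsilon>. real p / real n = \<gamma> \<Longrightarrow> vec_law p \<mu> \<Longrightarrow> isotropic p \<mu> \<Longrightarrow> anti_conc p t q \<mu> \<Longrightarrow>
           (\<And>x. 0 < x \<Longrightarrow> x \<le> 1 \<Longrightarrow> V \<le> x * real p \<Longrightarrow> quad_conc p x (2 * exp (- \<kappa> * x\<^sup>2 * real p)) \<mu>) \<Longrightarrow>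
           pos_def_mat p \<Sigma> \<Longrightarrow> 0 < \<epsilon> \<Longrightarrow> \<epsilon> < \<epsilon>\<^sub>0 \<Longrightarrow>
           prob_not_E_ME u (1 / d\<^sub>0) n p \<mu> \<Sigma> \<epsilon> \<le> ennreal (C * real n ^ 2 * exp (- c' * real n * \<epsilon> ^ 2))"
        have "prob_not_E_ME u (1 / d\<^sub>0) n p \<mu> \<Sigma> \<epsilon> \<le> ennreal (C * real n ^ 2 * exp (- c' * real n * \<epsilon> ^ 2))"
          if np: "real p / real n = \<gamma>" and dens: "law_with_density p \<mu>" and iso: "isotropic p \<mu>"
            and dist: "IND p K C\<^sub>0 \<mu> \<or> (CCP p K \<mu> \<and> SBP p C\<^sub>0 \<mu>)"
            and \<Sigma>: "pos_def_mat p \<Sigma>" and \<epsilon>: "0 < \<epsilon>" "\<epsilon> < \<epsilon>\<^sub>0" for n p \<mu> \<Sigma> \<epsilon>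
        proof (rule R[OF np _ iso _ _ \<Sigma> \<epsilon>])
          note pos = ratio_pos[OF np assms(1)]
          show law: "vec_law p \<mu>" by (rule law_with_density_vec_law[OF dens])
          show "anti_conc p t q \<mu>" using dist
          proof
            assume "IND p K C\<^sub>0 \<mu>"
            from IND_anti_conc[OF law iso pos(2) this K] show ?thesis by (rule anti_conc_mono[OF law _ tq(2,6)])
          next
            assume "CCP p K \<mu> \<and> SBP p C\<^sub>0 \<mu>"
            then have "SBP p C\<^sub>0 \<mu>" ..
            from SBP_anti_conc[OF law this C0] show ?thesis by (rule anti_conc_mono[OF law _ tq(3,7)])
          qed
          fix x :: real assume x: "0 < x" "x \<le> 1" and Vx: "V \<le> x * real p"
          show "quad_conc p x (2 * exp (- \<kappa> * x\<^sup>2 * real p)) \<mu>" using dist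
          proof
            assume "IND p K C\<^sub>0 \<mu>"
            note qc = ind_qc[OF law iso pos(2) this x]
            have "\<kappa> * (x\<^sup>2 * real p) \<le> \<kappa>\<^sub>1 * (x\<^sup>2 * real p)" using \<kappa> by (intro mult_right_mono) auto
            then have "- \<kappa>\<^sub>1 * x\<^sup>2 * real p \<le> - \<kappa> * x\<^sup>2 * real p" by (simp only: mult.assoc mult_minus_left neg_le_iff_le)
            then show ?thesis by (intro quad_conc_mono[OF law qc]) (simp_all only: mult_le_cancel_left_pos exp_le_cancel_iff zero_less_numeral order_refl)
          next
            assume "CCP p K \<mu> \<and> SBP p C\<^sub>0 \<mu>"
            then have "CCP p K \<mu>" ..
            moreover have "A \<le> 7 / 16 * x * real p" using Vx by (simp add: V_def)
            ultimately have qc: "quad_conc p x (2 * exp (- (x\<^sup>2 * real p / (64 * K\<^sup>2)))) \<mu>"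
              unfolding A_def by (intro CCP_quad_conc[OF law iso pos(2) _ K x])
            have "\<kappa> * (x\<^sup>2 * real p) \<le> 1 / (64 * K\<^sup>2) * (x\<^sup>2 * real p)" using \<kappa> by (intro mult_right_mono) auto
            then have "- (x\<^sup>2 * real p / (64 * K\<^sup>2)) \<le> - \<kappa> * x\<^sup>2 * real p" by simp
            then show ?thesis by (intro quad_conc_mono[OF law qc]) (simp_all only: mult_le_cancel_left_pos exp_le_cancel_iff zero_less_numeral order_refl)
          qed
        qed
        then show ?G using cC pars(5) by blast
      qed
    qed
  }
qed

end
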